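(* Let $k$ be a commutative ring with unit and $A$ a unital associative $k$-algebra with an augmentation $\epsilon:A\to k$ and augmentation ideal $I=\ker\epsilon$. Then $$HS_*(A)\cong H_*(\mathrm{Epi}\Delta S_+,\,B_*^{sym_+}I)=H_*\left(k[N(-\setminus\mathrm{Epi}\Delta S_+)]\otimes_{\mathrm{Epi}\Delta S_+}B_*^{sym_+}I\right).$$
   Context: Category $\Delta S$: objects are the sets $[n]=\{0,1,\dots,n\}$, $n\ge 0$; a morphism $[n]\to[m]$ is a set map $f$ together with a total order on each fibre $f^{-1}(j)$. The composite of $f:[n]\to[m]$ and $g:[m]\to[l]$ has underlying map $g\circ f$, and the fibre over $i$ is ordered by concatenating the ordered fibres $f^{-1}(j)$, with $j$ running over $g^{-1}(i)$ in its given order. $\Delta S_+$ is obtained from $\Delta S$ by adjoining the object $[-1]=\emptyset$ and a unique morphism $\iota_n:[-1]\to[n]$ for each $n\ge -1$. $\mathrm{Epi}\Delta S_+$ is the subcategory of $\Delta S_+$ with all objects and only the epimorphisms (equivalently, the morphisms whose underlying set map is surjective). The symmetric bar construction $B_*^{sym}A:\Delta S\to k\text{-Mod}$ is the covariant functor $[n]\mapsto A^{\otimes(n+1)}$; a morphism $\alpha:[n]\to[m]$ sends $a_0\otimes\cdots\otimes a_n$ to $b_0\otimes\cdots\otimes b_m$, where $b_j$ is the product of the $a_i$, $i\in\alpha^{-1}(j)$, in the given order of the fibre ($b_j=1$ if the fibre is empty). The functor $B_*^{sym_+}I:\mathrm{Epi}\Delta S_+\to k\text{-Mod}$ has $[n]\mapsto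 I^{\otimes(n+1)}$ for $n\ge 0$, $[-1]\mapsto k$, with epimorphisms acting by the same multiplication formula. For a small category $\mathscr C$ and functor $F:\mathscr C\to k\text{-Mod}$, $H_*(\mathscr C,F)=\mathrm{Tor}^{\mathscr C}_*(\underline{k},F)$, i.e. the left derived functors of $\mathrm{colim}_{\mathscr C}$ evaluated at $F$. Symmetric homology is $HS_*(A)=H_*(\Delta S,B_*^{sym}A)$. Here $N$ denotes the nerve, $(X\setminus\mathscr C)$ is the category of objects under $X$, $k[-]$ is the free simplicial $k$-module on a simplicial set, and for $M$ contravariant and $F$ covariant on $\mathscr C$, $M\otimes_{\mathscr C}F$ is the coend $\bigoplus_XM(X)\otimes_kF(X)/\approx$, with $y\otimes f_*(x)\approx f^*(y)\otimes x$. *)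

theory Defs
  imports "HOL-Library.FSet" "HOL-Library.Multiset" "HOL-Algebra.Module" "HOL-Algebra.AbelCoset"
begin

section \<open>Modules: maps, quotients, free modules, direct sums\<close>

definition mod_hom ::
  "('k, 'r) ring_scheme \<Rightarrow> ('k, 'm) module \<Rightarrow> ('k, 'n) module \<Rightarrow> ('m \<Rightarrow> 'n) set" where
  "mod_hom R M N = {h \<in> carrier M \<rightarrow> carrier N.
     (\<forall>x\<in>carrier M. \<forall>y\<in>carrier M. h (x \<oplus>\<^bsub>M\<^esub> y) = h x \<oplus>\<^bsub>N\<^esub> h y) \<and>
     (\<forall>r\<in>carrier R. \<forall>x\<in>carrier M. h (r \<odot>\<^bsub>M\<^esub> x) = r \<odot>\<^bsub>N\<^esub> h x)}"

definition mod_isomorphic ::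
  "('k, 'r) ring_scheme \<Rightarrow> ('k, 'm) module \<Rightarrow> ('k, 'n) module \<Rightarrow> bool" where
  "mod_isomorphic R M N \<longleftrightarrow> (\<exists>h\<in>mod_hom R M N. bij_betw h (carrier M) (carrier N))"

definition span :: "('k, 'r) ring_scheme \<Rightarrow> ('k, 'm) module \<Rightarrow> 'm set \<Rightarrow> 'm set" where
  "span R M S = \<Inter>{H. submodule H R M \<and> S \<subseteq> H}"

definition quot_mod :: "('k, 'm) module \<Rightarrow> 'm set \<Rightarrow> ('k, 'm set) module" where
  "quot_mod M U =
     \<lparr>carrier = a_rcosets\<^bsub>M\<^esub> U, mult = undefined, one = undefined,
      zero = U, add = (\<lambda>K L. K <+>\<^bsub>M\<^esub> L),
      smult = (\<lambda>r K. \<Union>x\<in>K. U +>\<^bsub>M\<^esub> (r \<odot>\<^bsub>M\<^esub> x))\<rparr>"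

(* The map M/U \<rightarrow> N/V induced by h, for h ` U \<subseteq> V: then all members of the union coincide. *)
definition quot_map :: "('k, 'n) module \<Rightarrow> 'n set \<Rightarrow> ('m \<Rightarrow> 'n) \<Rightarrow> 'm set \<Rightarrow> 'n set" where
  "quot_map N V h K = (\<Union>x\<in>K. V +>\<^bsub>N\<^esub> h x)"

definition free_mod :: "('k, 'r) ring_scheme \<Rightarrow> 's set \<Rightarrow> ('k, 's \<Rightarrow> 'k) module" where
  "free_mod R S =
     \<lparr>carrier = {f. (\<forall>s. f s \<in> carrier R) \<and> finite {s. f s \<noteq> \<zero>\<^bsub>R\<^esub>} \<and> {s. f s \<noteq> \<zero>\<^bsub>R\<^esub>} \<subseteq> S},
      mult = undefined, one = undefined,
      zero = (\<lambda>s. \<zero>\<^bsub>R\<^esub>), add = (\<lambda>f g s. f s \<oplus>\<^bsub>R\<^esub> g s),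
      smult = (\<lambda>r f s. r \<otimes>\<^bsub>R\<^esub> f s)\<rparr>"

definition fgen :: "('k, 'r) ring_scheme \<Rightarrow> 's \<Rightarrow> 's \<Rightarrow> 'k" where
  "fgen R s = (\<lambda>t. if t = s then \<one>\<^bsub>R\<^esub> else \<zero>\<^bsub>R\<^esub>)"

definition lin_ext ::
  "('k, 'r) ring_scheme \<Rightarrow> ('k, 'n) module \<Rightarrow> ('s \<Rightarrow> 'n) \<Rightarrow> ('s \<Rightarrow> 'k) \<Rightarrow> 'n" where
  "lin_ext R N g f = (\<Oplus>\<^bsub>N\<^esub>s\<in>{s. f s \<noteq> \<zero>\<^bsub>R\<^esub>}. f s \<odot>\<^bsub>N\<^esub> g s)"

definition dsum :: "'i set \<Rightarrow> ('i \<Rightarrow> ('k, 'm) module) \<Rightarrow> ('k, 'i \<Rightarrow> 'm) module" where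
  "dsum I M =
     \<lparr>carrier = {f \<in> \<Pi>\<^sub>E i\<in>I. carrier (M i). finite {i\<in>I. f i \<noteq> \<zero>\<^bsub>M i\<^esub>}},
      mult = undefined, one = undefined,
      zero = (\<lambda>i\<in>I. \<zero>\<^bsub>M i\<^esub>), add = (\<lambda>f g. \<lambda>i\<in>I. f i \<oplus>\<^bsub>M i\<^esub> g i),
      smult = (\<lambda>r f. \<lambda>i\<in>I. r \<odot>\<^bsub>M i\<^esub> f i)\<rparr>"

definition dsum_in :: "'i set \<Rightarrow> ('i \<Rightarrow> ('k, 'm) module) \<Rightarrow> 'i \<Rightarrow> 'm \<Rightarrow> 'i \<Rightarrow> 'm" where
  "dsum_in I M i x = (\<lambda>j\<in>I. if j = i then x else \<zero>\<^bsub>M j\<^esub>)"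

definition dsum_map :: "'i set \<Rightarrow> ('i \<Rightarrow> 'm \<Rightarrow> 'n) \<Rightarrow> ('i \<Rightarrow> 'm) \<Rightarrow> 'i \<Rightarrow> 'n" where
  "dsum_map I h f = (\<lambda>i\<in>I. h i (f i))"


section \<open>Tensor products\<close>

definition tensor_rels ::
  "('k, 'r) ring_scheme \<Rightarrow> ('k, 'm) module \<Rightarrow> ('k, 'n) module \<Rightarrow> ('m \<times> 'n \<Rightarrow> 'k) set" where
  "tensor_rels R M N =
    (let F = free_mod R (carrier M \<times> carrier N) in span R F
      ({fgen R (x \<oplus>\<^bsub>M\<^esub> x', y) \<ominus>\<^bsub>F\<^esub> (fgen R (x, y) \<oplus>\<^bsub>F\<^esub> fgen R (x', y)) | x x' y.
          x \<in> carrier M \<and> x' \<in> carrier M \<and> y \<in> carrier N} \<union>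
       {fgen R (x, y \<oplus>\<^bsub>N\<^esub> y') \<ominus>\<^bsub>F\<^esub> (fgen R (x, y) \<oplus>\<^bsub>F\<^esub> fgen R (x, y')) | x y y'.
          x \<in> carrier M \<and> y \<in> carrier N \<and> y' \<in> carrier N} \<union>
       {fgen R (r \<odot>\<^bsub>M\<^esub> x, y) \<ominus>\<^bsub>F\<^esub> r \<odot>\<^bsub>F\<^esub> fgen R (x, y) | r x y.
          r \<in> carrier R \<and> x \<in> carrier M \<and> y \<in> carrier N} \<union>
       {fgen R (x, r \<odot>\<^bsub>N\<^esub> y) \<ominus>\<^bsub>F\<^esub> r \<odot>\<^bsub>F\<^esub> fgen R (x, y) | r x y.
          r \<in> carrier R \<and> x \<in> carrier M \<and> y \<in> carrier N}))"

definition tensor ::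
  "('k, 'r) ring_scheme \<Rightarrow> ('k, 'm) module \<Rightarrow> ('k, 'n) module \<Rightarrow> ('k, ('m \<times> 'n \<Rightarrow> 'k) set) module" where
  "tensor R M N = quot_mod (free_mod R (carrier M \<times> carrier N)) (tensor_rels R M N)"

definition pure_tensor ::
  "('k, 'r) ring_scheme \<Rightarrow> ('k, 'm) module \<Rightarrow> ('k, 'n) module \<Rightarrow> 'm \<Rightarrow> 'n \<Rightarrow> ('m \<times> 'n \<Rightarrow> 'k) set" where
  "pure_tensor R M N x y =
     tensor_rels R M N +>\<^bsub>free_mod R (carrier M \<times> carrier N)\<^esub> fgen R (x, y)"

(* The map h \<otimes> id : M \<otimes> N \<rightarrow> M' \<otimes> N; M' is the target module. *)
definition tensor_map ::
  "('k, 'r) ring_scheme \<Rightarrow> ('k, 'm') module \<Rightarrow> ('k, 'n) module \<Rightarrow> ('m \<Rightarrow> 'm') \<Rightarrow>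
   ('m \<times> 'n \<Rightarrow> 'k) set \<Rightarrow> ('m' \<times> 'n \<Rightarrow> 'k) set" where
  "tensor_map R M' N h =
    (let F = free_mod R (carrier M' \<times> carrier N) in
     quot_map F (tensor_rels R M' N) (lin_ext R F (\<lambda>(x, y). fgen R (h x, y))))"

definition tuples :: "('k, 'm) module \<Rightarrow> nat \<Rightarrow> 'm list set" where
  "tuples M n = {xs. length xs = n \<and> set xs \<subseteq> carrier M}"

definition power_rels ::
  "('k, 'r) ring_scheme \<Rightarrow> ('k, 'm) module \<Rightarrow> nat \<Rightarrow> ('m list \<Rightarrow> 'k) set" where
  "power_rels R M n =
    (let F = free_mod R (tuples M n) in span R F
      ({fgen R (us @ (x \<oplus>\<^bsub>M\<^esub> y) # vs) \<ominus>\<^bsub>F\<^esub> (fgen R (us @ x # vs) \<oplus>\<^bsub>F\<^esub> fgen R (us @ y # vs))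
          | us vs x y. us @ x # vs \<in> tuples M n \<and> us @ y # vs \<in> tuples M n} \<union>
       {fgen R (us @ (r \<odot>\<^bsub>M\<^esub> x) # vs) \<ominus>\<^bsub>F\<^esub> r \<odot>\<^bsub>F\<^esub> fgen R (us @ x # vs)
          | us vs r x. r \<in> carrier R \<and> us @ x # vs \<in> tuples M n}))"

(* n-fold tensor power over R. For n = 0 this is the free module on the empty tuple, that is, R. *)
definition tensor_power ::
  "('k, 'r) ring_scheme \<Rightarrow> ('k, 'm) module \<Rightarrow> nat \<Rightarrow> ('k, ('m list \<Rightarrow> 'k) set) module" where
  "tensor_power R M n = quot_mod (free_mod R (tuples M n)) (power_rels R M n)"


section \<open>Categories and functors to modules\<close>

(* cmp C g f is g after f. *)
record ('o, 'a) category =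
  obs :: "'o set"
  arrs :: "'a set"
  src :: "'a \<Rightarrow> 'o"
  trg :: "'a \<Rightarrow> 'o"
  ident :: "'o \<Rightarrow> 'a"
  cmp :: "'a \<Rightarrow> 'a \<Rightarrow> 'a"

definition is_category :: "('o, 'a) category \<Rightarrow> bool" where
  "is_category C \<longleftrightarrow>
     (\<forall>f\<in>arrs C. src C f \<in> obs C \<and> trg C f \<in> obs C) \<and>
     (\<forall>X\<in>obs C. ident C X \<in> arrs C \<and> src C (ident C X) = X \<and> trg C (ident C X) = X) \<and>
     (\<forall>f\<in>arrs C. \<forall>g\<in>arrs C. src C g = trg C f \<longrightarrow>
        cmp C g f \<in> arrs C \<and> src C (cmp C g f) = src C f \<and> trg C (cmp C g f) = trg C g) \<and>
     (\<forall>f\<in>arrs C. cmp C f (ident C (src C f)) = f \<and> cmp C (ident C (trg C f)) f = f) \<and>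
     (\<forall>f\<in>arrs C. \<forall>g\<in>arrs C. \<forall>h\<in>arrs C. src C g = trg C f \<longrightarrow> src C h = trg C g \<longrightarrow>
        cmp C h (cmp C g f) = cmp C (cmp C h g) f)"

definition epi :: "('o, 'a) category \<Rightarrow> 'a \<Rightarrow> bool" where
  "epi C f \<longleftrightarrow> f \<in> arrs C \<and>
     (\<forall>g\<in>arrs C. \<forall>h\<in>arrs C. src C g = trg C f \<longrightarrow> src C h = trg C f \<longrightarrow> trg C g = trg C h \<longrightarrow>
        cmp C g f = cmp C h f \<longrightarrow> g = h)"

record ('o, 'a, 'k, 'm) kfun =
  fob :: "'o \<Rightarrow> ('k, 'm) module"
  far :: "'a \<Rightarrow> 'm \<Rightarrow> 'm"

definition is_kfun ::
  "('k, 'r) ring_scheme \<Rightarrow> ('o, 'a) category \<Rightarrow> ('o, 'a, 'k, 'm) kfun \<Rightarrow> bool" where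
  "is_kfun R C F \<longleftrightarrow>
     (\<forall>X\<in>obs C. module R (fob F X)) \<and>
     (\<forall>f\<in>arrs C. far F f \<in> mod_hom R (fob F (src C f)) (fob F (trg C f))) \<and>
     (\<forall>X\<in>obs C. \<forall>x\<in>carrier (fob F X). far F (ident C X) x = x) \<and>
     (\<forall>f\<in>arrs C. \<forall>g\<in>arrs C. src C g = trg C f \<longrightarrow>
        (\<forall>x\<in>carrier (fob F (src C f)). far F (cmp C g f) x = far F g (far F f x)))"

definition is_nat_trans ::
  "('k, 'r) ring_scheme \<Rightarrow> ('o, 'a) category \<Rightarrow> ('o, 'a, 'k, 'm) kfun \<Rightarrow> ('o, 'a, 'k, 'n) kfun \<Rightarrow>
   ('o \<Rightarrow> 'm \<Rightarrow> 'n) \<Rightarrow> bool" where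
  "is_nat_trans R C F G \<eta> \<longleftrightarrow>
     (\<forall>X\<in>obs C. \<eta> X \<in> mod_hom R (fob F X) (fob G X)) \<and>
     (\<forall>f\<in>arrs C. \<forall>x\<in>carrier (fob F (src C f)).
        \<eta> (trg C f) (far F f x) = far G f (\<eta> (src C f) x))"

definition colim_rels ::
  "('k, 'r) ring_scheme \<Rightarrow> ('o, 'a) category \<Rightarrow> ('o, 'a, 'k, 'm) kfun \<Rightarrow> ('o \<Rightarrow> 'm) set" where
  "colim_rels R C F =
    (let D = dsum (obs C) (fob F); \<iota> = dsum_in (obs C) (fob F) in span R D
      {\<iota> (trg C f) (far F f x) \<ominus>\<^bsub>D\<^esub> \<iota> (src C f) x | f x. f \<in> arrs C \<and> x \<in> carrier (fob F (src C f))})"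

definition colim ::
  "('k, 'r) ring_scheme \<Rightarrow> ('o, 'a) category \<Rightarrow> ('o, 'a, 'k, 'm) kfun \<Rightarrow> ('k, ('o \<Rightarrow> 'm) set) module" where
  "colim R C F = quot_mod (dsum (obs C) (fob F)) (colim_rels R C F)"

definition colim_map ::
  "('k, 'r) ring_scheme \<Rightarrow> ('o, 'a) category \<Rightarrow> ('o, 'a, 'k, 'n) kfun \<Rightarrow> ('o \<Rightarrow> 'm \<Rightarrow> 'n) \<Rightarrow>
   ('o \<Rightarrow> 'm) set \<Rightarrow> ('o \<Rightarrow> 'n) set" where
  "colim_map R C G \<eta> = quot_map (dsum (obs C) (fob G)) (colim_rels R C G) (dsum_map (obs C) \<eta>)"

(* The coend of M and F. Here M is contravariant: far M f maps fob M (trg C f) to fob M (src C f). *)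
definition coend_rels ::
  "('k, 'r) ring_scheme \<Rightarrow> ('o, 'a) category \<Rightarrow> ('o, 'a, 'k, 'm) kfun \<Rightarrow> ('o, 'a, 'k, 'n) kfun \<Rightarrow>
   ('o \<Rightarrow> ('m \<times> 'n \<Rightarrow> 'k) set) set" where
  "coend_rels R C M F =
    (let T = (\<lambda>X. tensor R (fob M X) (fob F X)); D = dsum (obs C) T; \<iota> = dsum_in (obs C) T;
         t = (\<lambda>X. pure_tensor R (fob M X) (fob F X))
     in span R D
      {\<iota> (trg C f) (t (trg C f) y (far F f x)) \<ominus>\<^bsub>D\<^esub> \<iota> (src C f) (t (src C f) (far M f y) x) | f x y.
         f \<in> arrs C \<and> x \<in> carrier (fob F (src C f)) \<and> y \<in> carrier (fob M (trg C f))})"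

definition coend ::
  "('k, 'r) ring_scheme \<Rightarrow> ('o, 'a) category \<Rightarrow> ('o, 'a, 'k, 'm) kfun \<Rightarrow> ('o, 'a, 'k, 'n) kfun \<Rightarrow>
   ('k, ('o \<Rightarrow> ('m \<times> 'n \<Rightarrow> 'k) set) set) module" where
  "coend R C M F =
     quot_mod (dsum (obs C) (\<lambda>X. tensor R (fob M X) (fob F X))) (coend_rels R C M F)"

(* The map of coends induced by a natural transformation \<eta> from a functor to M'. *)
definition coend_map ::
  "('k, 'r) ring_scheme \<Rightarrow> ('o, 'a) category \<Rightarrow> ('o, 'a, 'k, 'm') kfun \<Rightarrow> ('o, 'a, 'k, 'n) kfun \<Rightarrow>
   ('o \<Rightarrow> 'm \<Rightarrow> 'm') \<Rightarrow> ('o \<Rightarrow> ('m \<times> 'n \<Rightarrow> 'k) set) set \<Rightarrow> ('o \<Rightarrow> ('m' \<times> 'n \<Rightarrow> 'k) set) set" where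
  "coend_map R C M' F \<eta> =
     quot_map (dsum (obs C) (\<lambda>X. tensor R (fob M' X) (fob F X))) (coend_rels R C M' F)
       (dsum_map (obs C) (\<lambda>X. tensor_map R (fob M' X) (fob F X) (\<eta> X)))"


section \<open>Homology of functors\<close>

(* d n is the differential from K (Suc n) to K n. *)
definition chain_homology ::
  "(nat \<Rightarrow> ('k, 'm) module) \<Rightarrow> (nat \<Rightarrow> 'm \<Rightarrow> 'm) \<Rightarrow> nat \<Rightarrow> ('k, 'm set) module" where
  "chain_homology K d n =
     quot_mod ((K n)\<lparr>carrier := {x \<in> carrier (K n). \<forall>m. n = Suc m \<longrightarrow> d m x = \<zero>\<^bsub>K m\<^esub>}\<rparr>)
       (d n ` carrier (K (Suc n)))"

(* Homology of a simplicial module, that is, of its alternating face complex;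
   \<delta> n i is the i-th face map from K (Suc n) to K n. *)
definition simplicial_homology ::
  "(nat \<Rightarrow> ('k, 'm) module) \<Rightarrow> (nat \<Rightarrow> nat \<Rightarrow> 'm \<Rightarrow> 'm) \<Rightarrow> nat \<Rightarrow> ('k, 'm set) module" where
  "simplicial_homology K \<delta> =
     chain_homology K
       (\<lambda>n x. \<Oplus>\<^bsub>K n\<^esub>i\<in>{..Suc n}. if even i then \<delta> n i x else \<ominus>\<^bsub>K n\<^esub> \<delta> n i x)"

(* Lifting against epimorphisms E \<rightarrow> G of functors, which are the objectwise surjective
   transformations. A quantifier over the types of the elements of E and G is not available, but the
   two types chosen here suffice: P itself is an instance of G, and the free functor on the elements
   of P is an instance of E, so the condition makes P a retract of a free functor. *)
definition projective ::
  "('k, 'r) ring_scheme \<Rightarrow> ('o, 'a) category \<Rightarrow> ('o, 'a, 'k, 'p) kfun \<Rightarrow> bool" where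
  "projective R C P \<longleftrightarrow> is_kfun R C P \<and>
     (\<forall>(E :: ('o, 'a, 'k, 'a \<times> 'p \<Rightarrow> 'k) kfun) (G :: ('o, 'a, 'k, 'p) kfun) \<pi> \<phi>.
        is_kfun R C E \<longrightarrow> is_kfun R C G \<longrightarrow> is_nat_trans R C E G \<pi> \<longrightarrow>
        (\<forall>X\<in>obs C. \<pi> X ` carrier (fob E X) = carrier (fob G X)) \<longrightarrow>
        is_nat_trans R C P G \<phi> \<longrightarrow>
        (\<exists>\<psi>. is_nat_trans R C P E \<psi> \<and>
           (\<forall>X\<in>obs C. \<forall>x\<in>carrier (fob P X). \<pi> X (\<psi> X x) = \<phi> X x)))"

definition projective_resolution ::
  "('k, 'r) ring_scheme \<Rightarrow> ('o, 'a) category \<Rightarrow> ('o, 'a, 'k, 'm) kfun \<Rightarrow>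
   (nat \<Rightarrow> ('o, 'a, 'k, 'p) kfun) \<Rightarrow> (nat \<Rightarrow> 'o \<Rightarrow> 'p \<Rightarrow> 'p) \<Rightarrow> ('o \<Rightarrow> 'p \<Rightarrow> 'm) \<Rightarrow> bool" where
  "projective_resolution R C F P d e \<longleftrightarrow>
     (\<forall>n. projective R C (P n)) \<and>
     is_nat_trans R C (P 0) F e \<and>
     (\<forall>n. is_nat_trans R C (P (Suc n)) (P n) (d n)) \<and>
     (\<forall>X\<in>obs C. e X ` carrier (fob (P 0) X) = carrier (fob F X)) \<and>
     (\<forall>X\<in>obs C. d 0 X ` carrier (fob (P 1) X) = {x \<in> carrier (fob (P 0) X). e X x = \<zero>\<^bsub>fob F X\<^esub>}) \<and>
     (\<forall>n. \<forall>X\<in>obs C. d (Suc n) X ` carrier (fob (P (Suc (Suc n))) X) =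
        {x \<in> carrier (fob (P (Suc n)) X). d n X x = \<zero>\<^bsub>fob (P n) X\<^esub>})"


subsection \<open>Existence of projective resolutions\<close>

lemma mod_homD:
  assumes "h \<in> mod_hom R M N"
  shows "x \<in> carrier M \<Longrightarrow> h x \<in> carrier N"
    and "x \<in> carrier M \<Longrightarrow> y \<in> carrier M \<Longrightarrow> h (x \<oplus>\<^bsub>M\<^esub> y) = h x \<oplus>\<^bsub>N\<^esub> h y"
    and "r \<in> carrier R \<Longrightarrow> x \<in> carrier M \<Longrightarrow> h (r \<odot>\<^bsub>M\<^esub> x) = r \<odot>\<^bsub>N\<^esub> h x"
  using assms unfolding mod_hom_def by auto

lemma mod_hom_zero:
  assumes "module R M" "module R N" "h \<in> mod_hom R M N"
  shows "h \<zero>\<^bsub>M\<^esub> = \<zero>\<^bsub>N\<^esub>"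
proof -
  interpret M: module R M by fact
  interpret N: module R N by fact
  have "h \<zero>\<^bsub>M\<^esub> = h (\<zero>\<^bsub>R\<^esub> \<odot>\<^bsub>M\<^esub> \<zero>\<^bsub>M\<^esub>)" by simp
  also have "\<dots> = \<zero>\<^bsub>R\<^esub> \<odot>\<^bsub>N\<^esub> h \<zero>\<^bsub>M\<^esub>" by (rule mod_homD(3)[OF assms(3)]) auto
  also have "\<dots> = \<zero>\<^bsub>N\<^esub>" using mod_homD(1)[OF assms(3) M.M.zero_closed] by simp
  finally show ?thesis .
qed

lemma mod_hom_comp:
  "\<lbrakk>h \<in> mod_hom R L M; g \<in> mod_hom R M N\<rbrakk> \<Longrightarrow> (\<lambda>x. g (h x)) \<in> mod_hom R L N"
  unfolding mod_hom_def by (auto simp: Pi_iff)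

lemma free_mod_module:
  fixes R (structure)
  assumes "cring R"
  shows "module R (free_mod R S)"
proof -
  interpret cring R by fact
  have fin: "finite {s. f s \<oplus> g s \<noteq> \<zero>}" "{s. f s \<oplus> g s \<noteq> \<zero>} \<subseteq> S"
    if "finite {s. f s \<noteq> \<zero>}" "finite {s. g s \<noteq> \<zero>}" "{s. f s \<noteq> \<zero>} \<subseteq> S" "{s. g s \<noteq> \<zero>} \<subseteq> S" for f g
  proof -
    have sub: "{s. f s \<oplus> g s \<noteq> \<zero>} \<subseteq> {s. f s \<noteq> \<zero>} \<union> {s. g s \<noteq> \<zero>}" by auto
    show "finite {s. f s \<oplus> g s \<noteq> \<zero>}" using sub that by (meson finite_UnI finite_subset)
    show "{s. f s \<oplus> g s \<noteq> \<zero>} \<subseteq> S" using sub that by auto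
  qed
  have inv: "\<exists>g. ((\<forall>s. g s \<in> carrier R) \<and> finite {s. g s \<noteq> \<zero>} \<and> {s. g s \<noteq> \<zero>} \<subseteq> S) \<and> (\<lambda>s. g s \<oplus> f s) = (\<lambda>s. \<zero>)"
    if f: "\<forall>s. f s \<in> carrier R" "finite {s. f s \<noteq> \<zero>}" "{s. f s \<noteq> \<zero>} \<subseteq> S" for f
  proof -
    have "{s. \<ominus> f s \<noteq> \<zero>} = {s. f s \<noteq> \<zero>}"
      using f by (metis a_inv_closed minus_minus minus_zero)
    then show ?thesis using f by (intro exI[of _ "\<lambda>s. \<ominus> f s"]) (auto simp: l_neg)
  qed
  have fs: "finite {s. r \<otimes> f s \<noteq> \<zero>}" "{s. r \<otimes> f s \<noteq> \<zero>} \<subseteq> S"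
    if "r \<in> carrier R" "finite {s. f s \<noteq> \<zero>}" "{s. f s \<noteq> \<zero>} \<subseteq> S" for f r
  proof -
    have sub: "{s. r \<otimes> f s \<noteq> \<zero>} \<subseteq> {s. f s \<noteq> \<zero>}" using that by auto
    show "finite {s. r \<otimes> f s \<noteq> \<zero>}" using sub that by (meson finite_subset)
    show "{s. r \<otimes> f s \<noteq> \<zero>} \<subseteq> S" using sub that by auto
  qed
  show ?thesis
  proof (rule moduleI)
    show "abelian_group (free_mod R S)"
    proof (rule abelian_groupI)
      fix x assume "x \<in> carrier (free_mod R S)"
      then show "\<exists>y\<in>carrier (free_mod R S). y \<oplus>\<^bsub>free_mod R S\<^esub> x = \<zero>\<^bsub>free_mod R S\<^esub>"
        using inv[of x] by (auto simp: free_mod_def)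
    qed (auto simp: free_mod_def fin a_assoc a_comm a_lcomm dest!: subsetD[OF fin(2), rotated -1])
  qed (auto simp: free_mod_def fin fs l_distr r_distr m_assoc assms dest!: subsetD[OF fs(2), rotated -1])
qed

lemma fgen_carrier:
  assumes "cring R" "s \<in> S"
  shows "fgen R s \<in> carrier (free_mod R S)"
proof -
  interpret cring R by fact
  have "{t. fgen R s t \<noteq> \<zero>\<^bsub>R\<^esub>} \<subseteq> {s}" by (auto simp: fgen_def)
  then show ?thesis using assms(2) by (auto simp: free_mod_def fgen_def intro: finite_subset)
qed

lemma lin_ext_superset:
  assumes "module R N" "g \<in> S \<rightarrow> carrier N" "f \<in> carrier (free_mod R S)"
    and "finite T" "{s. f s \<noteq> \<zero>\<^bsub>R\<^esub>} \<subseteq> T" "T \<subseteq> S"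
  shows "lin_ext R N g f = (\<Oplus>\<^bsub>N\<^esub>s\<in>T. f s \<odot>\<^bsub>N\<^esub> g s)"
proof -
  interpret module R N by fact
  show ?thesis unfolding lin_ext_def
    using assms by (intro M.add.finprod_mono_neutral_cong_left) (auto simp: free_mod_def Pi_iff subset_iff)
qed

lemma lin_ext_hom:
  assumes "module R N" "g \<in> S \<rightarrow> carrier N"
  shows "lin_ext R N g \<in> mod_hom R (free_mod R S) N"
proof -
  interpret module R N by fact
  interpret F: module R "free_mod R S" by (rule free_mod_module) (rule R.cring_axioms)
  have g: "\<And>s. s \<in> S \<Longrightarrow> g s \<in> carrier N" using assms(2) by auto
  have fD: "f s \<in> carrier R" "finite {s. f s \<noteq> \<zero>\<^bsub>R\<^esub>}" "{s. f s \<noteq> \<zero>\<^bsub>R\<^esub>} \<subseteq> S"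
    if "f \<in> carrier (free_mod R S)" for f s using that by (auto simp: free_mod_def)
  note sup = lin_ext_superset[OF assms]
  show ?thesis unfolding mod_hom_def
  proof (intro CollectI conjI ballI Pi_I)
    fix f assume f: "f \<in> carrier (free_mod R S)"
    show "lin_ext R N g f \<in> carrier N"
      unfolding lin_ext_def using fD[OF f] g by (intro M.finsum_closed) auto
    fix h assume h: "h \<in> carrier (free_mod R S)"
    let ?T = "{s. f s \<noteq> \<zero>\<^bsub>R\<^esub>} \<union> {s. h s \<noteq> \<zero>\<^bsub>R\<^esub>}"
    have T: "finite ?T" "?T \<subseteq> S" using fD[OF f] fD[OF h] by auto
    have fh: "(f \<oplus>\<^bsub>free_mod R S\<^esub> h) s = f s \<oplus>\<^bsub>R\<^esub> h s" for s by (simp add: free_mod_def)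
    have "lin_ext R N g (f \<oplus>\<^bsub>free_mod R S\<^esub> h) = (\<Oplus>\<^bsub>N\<^esub>s\<in>?T. (f s \<oplus>\<^bsub>R\<^esub> h s) \<odot>\<^bsub>N\<^esub> g s)"
    proof (subst sup[OF F.M.a_closed[OF f h] T(1) _ T(2)], unfold fh)
      show "{s. f s \<oplus>\<^bsub>R\<^esub> h s \<noteq> \<zero>\<^bsub>R\<^esub>} \<subseteq> ?T" by auto
    qed simp
    also have "\<dots> = (\<Oplus>\<^bsub>N\<^esub>s\<in>?T. f s \<odot>\<^bsub>N\<^esub> g s \<oplus>\<^bsub>N\<^esub> h s \<odot>\<^bsub>N\<^esub> g s)"
      using fD(1)[OF f] fD(1)[OF h] T g by (intro M.finsum_cong') (auto simp: smult_l_distr subset_iff)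
    also have "\<dots> = (\<Oplus>\<^bsub>N\<^esub>s\<in>?T. f s \<odot>\<^bsub>N\<^esub> g s) \<oplus>\<^bsub>N\<^esub> (\<Oplus>\<^bsub>N\<^esub>s\<in>?T. h s \<odot>\<^bsub>N\<^esub> g s)"
      using fD(1)[OF f] fD(1)[OF h] T g by (intro M.finsum_addf) (auto simp: subset_iff)
    also have "\<dots> = lin_ext R N g f \<oplus>\<^bsub>N\<^esub> lin_ext R N g h"
      using sup[OF f T(1) _ T(2)] sup[OF h T(1) _ T(2)] by auto
    finally show "lin_ext R N g (f \<oplus>\<^bsub>free_mod R S\<^esub> h) = lin_ext R N g f \<oplus>\<^bsub>N\<^esub> lin_ext R N g h" .
  next
    fix r f assume r: "r \<in> carrier R" and f: "f \<in> carrier (free_mod R S)"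
    let ?T = "{s. f s \<noteq> \<zero>\<^bsub>R\<^esub>}"
    have T: "finite ?T" "?T \<subseteq> S" using fD[OF f] by auto
    have fh: "(r \<odot>\<^bsub>free_mod R S\<^esub> f) s = r \<otimes>\<^bsub>R\<^esub> f s" for s by (simp add: free_mod_def)
    have "lin_ext R N g (r \<odot>\<^bsub>free_mod R S\<^esub> f) = (\<Oplus>\<^bsub>N\<^esub>s\<in>?T. (r \<otimes>\<^bsub>R\<^esub> f s) \<odot>\<^bsub>N\<^esub> g s)"
    proof (subst sup[OF F.smult_closed[OF r f] T(1) _ T(2)], unfold fh)
      show "{s. r \<otimes>\<^bsub>R\<^esub> f s \<noteq> \<zero>\<^bsub>R\<^esub>} \<subseteq> ?T" using r by auto
    qed simp
    also have "\<dots> = (\<Oplus>\<^bsub>N\<^esub>s\<in>?T. r \<odot>\<^bsub>N\<^esub> (f s \<odot>\<^bsub>N\<^esub> g s))"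
      using fD(1)[OF f] r T g by (intro M.finsum_cong') (auto simp: smult_assoc1 subset_iff)
    also have "\<dots> = r \<odot>\<^bsub>N\<^esub> lin_ext R N g f" unfolding lin_ext_def
      using fD(1)[OF f] r T g by (intro finsum_smult_ldistr[symmetric]) (auto simp: subset_iff)
    finally show "lin_ext R N g (r \<odot>\<^bsub>free_mod R S\<^esub> f) = r \<odot>\<^bsub>N\<^esub> lin_ext R N g f" .
  qed
qed

lemma lin_ext_fgen:
  assumes "module R N" "g \<in> S \<rightarrow> carrier N" "s \<in> S"
  shows "lin_ext R N g (fgen R s) = g s"
proof -
  interpret module R N by fact
  have "lin_ext R N g (fgen R s) = (\<Oplus>\<^bsub>N\<^esub>t\<in>{s}. fgen R s t \<odot>\<^bsub>N\<^esub> g t)"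
    by (rule lin_ext_superset[OF assms(1,2) fgen_carrier[OF R.cring_axioms assms(3)]])
      (use assms(3) in \<open>auto simp: fgen_def\<close>)
  also have "\<dots> = g s" using assms by (auto simp: fgen_def Pi_iff)
  finally show ?thesis .
qed

lemma free_mod_hom_eqI:
  assumes "cring R" "module R N" "h \<in> mod_hom R (free_mod R S) N" "h' \<in> mod_hom R (free_mod R S) N"
    and eq: "\<And>s. s \<in> S \<Longrightarrow> h (fgen R s) = h' (fgen R s)"
    and f: "f \<in> carrier (free_mod R S)"
  shows "h f = h' f"
proof -
  interpret F: module R "free_mod R S" by (rule free_mod_module) fact
  have "h f = h' f" if "finite T" "{s. f s \<noteq> \<zero>\<^bsub>R\<^esub>} \<subseteq> T" "T \<subseteq> S" "f \<in> carrier (free_mod R S)" for T f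
    using that
  proof (induction T arbitrary: f)
    case empty
    then have "f = \<zero>\<^bsub>free_mod R S\<^esub>" by (auto simp: free_mod_def)
    then show ?case using mod_hom_zero[OF F.module_axioms assms(2)] assms(3,4) by metis
  next
    case (insert a T)
    let ?f = "f(a := \<zero>\<^bsub>R\<^esub>)"
    have fa: "f a \<in> carrier R" using insert.prems by (auto simp: free_mod_def)
    have ga: "fgen R a \<in> carrier (free_mod R S)"
      using insert.prems(2) by (intro fgen_carrier[OF assms(1)]) auto
    have "{s. ?f s \<noteq> \<zero>\<^bsub>R\<^esub>} \<subseteq> {s. f s \<noteq> \<zero>\<^bsub>R\<^esub>}" by auto
    then have f': "?f \<in> carrier (free_mod R S)"
      using insert.prems(3) by (auto simp: free_mod_def intro: finite_subset)
    have IH: "h ?f = h' ?f" using insert.prems by (intro insert.IH[OF _ _ f']) auto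
    have split: "f = ?f \<oplus>\<^bsub>free_mod R S\<^esub> (f a \<odot>\<^bsub>free_mod R S\<^esub> fgen R a)"
    proof
      fix s
      have "f s \<in> carrier R" using insert.prems(3) by (auto simp: free_mod_def)
      with fa show "f s = (?f \<oplus>\<^bsub>free_mod R S\<^esub> (f a \<odot>\<^bsub>free_mod R S\<^esub> fgen R a)) s"
        by (auto simp: free_mod_def fgen_def)
    qed
    have "k f = k ?f \<oplus>\<^bsub>N\<^esub> (f a \<odot>\<^bsub>N\<^esub> k (fgen R a))" if "k \<in> mod_hom R (free_mod R S) N" for k
      using split mod_homD(2)[OF that f' F.smult_closed[OF fa ga]] mod_homD(3)[OF that fa ga] by metis
    then show ?case using IH eq[of a] insert.prems assms(3,4) by (metis insert_subset)
  qed
  from this[of "{s. f s \<noteq> \<zero>\<^bsub>R\<^esub>}" f] show ?thesis using f by (auto simp: free_mod_def)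
qed


definition cover_pairs :: "('o, 'a) category \<Rightarrow> ('o \<Rightarrow> 'm set) \<Rightarrow> ('a \<times> 'm) set" where
  "cover_pairs C K = {(f, s). f \<in> arrs C \<and> s \<in> K (src C f)}"

definition cover_gens :: "('o, 'a) category \<Rightarrow> ('o \<Rightarrow> 'm set) \<Rightarrow> ('a \<times> 'm \<Rightarrow> 'g) \<Rightarrow> 'o \<Rightarrow> 'g set" where
  "cover_gens C K lab Y = lab ` {(f, s) \<in> cover_pairs C K. trg C f = Y}"

definition cover_fun ::
  "('k, 'r) ring_scheme \<Rightarrow> ('o, 'a) category \<Rightarrow> ('o \<Rightarrow> 'm set) \<Rightarrow> ('a \<times> 'm \<Rightarrow> 'g) \<Rightarrow>
   ('o, 'a, 'k, 'g \<Rightarrow> 'k) kfun" where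
  "cover_fun R C K lab =
     \<lparr>fob = (\<lambda>Y. free_mod R (cover_gens C K lab Y)),
      far = (\<lambda>h. lin_ext R (free_mod R (cover_gens C K lab (trg C h)))
        (\<lambda>g. case inv_into (cover_pairs C K) lab g of (f, s) \<Rightarrow> fgen R (lab (cmp C h f, s))))\<rparr>"

definition cover_map ::
  "('k, 'r) ring_scheme \<Rightarrow> ('o, 'a) category \<Rightarrow> ('o \<Rightarrow> 'm set) \<Rightarrow> ('a \<times> 'm \<Rightarrow> 'g) \<Rightarrow>
   ('o, 'a, 'k, 'n) kfun \<Rightarrow> ('o \<Rightarrow> 'm \<Rightarrow> 'n) \<Rightarrow> 'o \<Rightarrow> ('g \<Rightarrow> 'k) \<Rightarrow> 'n" where
  "cover_map R C K lab E e Y =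
     lin_ext R (fob E Y) (\<lambda>g. case inv_into (cover_pairs C K) lab g of (f, s) \<Rightarrow> far E f (e (src C f) s))"

lemma is_categoryD:
  assumes "is_category C"
  shows "f \<in> arrs C \<Longrightarrow> src C f \<in> obs C" "f \<in> arrs C \<Longrightarrow> trg C f \<in> obs C"
    "X \<in> obs C \<Longrightarrow> ident C X \<in> arrs C" "X \<in> obs C \<Longrightarrow> src C (ident C X) = X"
    "X \<in> obs C \<Longrightarrow> trg C (ident C X) = X"
    "\<lbrakk>f \<in> arrs C; g \<in> arrs C; src C g = trg C f\<rbrakk> \<Longrightarrow> cmp C g f \<in> arrs C"
    "\<lbrakk>f \<in> arrs C; g \<in> arrs C; src C g = trg C f\<rbrakk> \<Longrightarrow> src C (cmp C g f) = src C f"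
    "\<lbrakk>f \<in> arrs C; g \<in> arrs C; src C g = trg C f\<rbrakk> \<Longrightarrow> trg C (cmp C g f) = trg C g"
    "f \<in> arrs C \<Longrightarrow> cmp C f (ident C (src C f)) = f" "f \<in> arrs C \<Longrightarrow> cmp C (ident C (trg C f)) f = f"
    "\<lbrakk>f \<in> arrs C; g \<in> arrs C; h \<in> arrs C; src C g = trg C f; src C h = trg C g\<rbrakk> \<Longrightarrow>
        cmp C h (cmp C g f) = cmp C (cmp C h g) f"
  using assms unfolding is_category_def by blast+

lemma is_kfunD:
  assumes "is_kfun R C F"
  shows "X \<in> obs C \<Longrightarrow> module R (fob F X)"
    "f \<in> arrs C \<Longrightarrow> far F f \<in> mod_hom R (fob F (src C f)) (fob F (trg C f))"
    "\<lbrakk>X \<in> obs C; x \<in> carrier (fob F X)\<rbrakk> \<Longrightarrow> far F (ident C X) x = x"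
    "\<lbrakk>f \<in> arrs C; g \<in> arrs C; src C g = trg C f; x \<in> carrier (fob F (src C f))\<rbrakk> \<Longrightarrow>
        far F (cmp C g f) x = far F g (far F f x)"
  using assms unfolding is_kfun_def by blast+

lemma is_nat_transD:
  assumes "is_nat_trans R C F G \<eta>"
  shows "X \<in> obs C \<Longrightarrow> \<eta> X \<in> mod_hom R (fob F X) (fob G X)"
    "\<lbrakk>f \<in> arrs C; x \<in> carrier (fob F (src C f))\<rbrakk> \<Longrightarrow> \<eta> (trg C f) (far F f x) = far G f (\<eta> (src C f) x)"
  using assms unfolding is_nat_trans_def by blast+

context
  fixes R :: "('k, 'r) ring_scheme" and C :: "('o, 'a) category"
    and K :: "'o \<Rightarrow> 'm set" and lab :: "'a \<times> 'm \<Rightarrow> 'g"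
  assumes ring: "cring R" and cat: "is_category C" and lab: "inj_on lab (cover_pairs C K)"
begin

abbreviation (input) "FF \<equiv> cover_fun R C K lab"
abbreviation (input) "B \<equiv> cover_gens C K lab"

lemma cover_gen_inv: "\<lbrakk>f \<in> arrs C; s \<in> K (src C f)\<rbrakk> \<Longrightarrow> inv_into (cover_pairs C K) lab (lab (f, s)) = (f, s)"
  by (rule inv_into_f_f[OF lab]) (auto simp: cover_pairs_def)

lemma cover_gensI: "\<lbrakk>f \<in> arrs C; s \<in> K (src C f); trg C f = Y\<rbrakk> \<Longrightarrow> lab (f, s) \<in> B Y"
  by (auto simp: cover_pairs_def cover_gens_def)

lemma cover_gensE: assumes "g \<in> B Y"
  obtains f s where "f \<in> arrs C" "s \<in> K (src C f)" "trg C f = Y" "g = lab (f, s)"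
  using assms by (auto simp: cover_pairs_def cover_gens_def)

lemma cover_fob [simp]: "fob FF Y = free_mod R (B Y)" by (simp add: cover_fun_def)

lemma cover_far_aux:
  assumes "h \<in> arrs C"
  shows "(\<lambda>g. case inv_into (cover_pairs C K) lab g of (f, s) \<Rightarrow> fgen R (lab (cmp C h f, s)))
    \<in> B (src C h) \<rightarrow> carrier (free_mod R (B (trg C h)))"
proof
  fix g assume "g \<in> B (src C h)"
  then obtain f s where g: "f \<in> arrs C" "s \<in> K (src C f)" "trg C f = src C h" "g = lab (f, s)"
    by (rule cover_gensE)
  then show "(case inv_into (cover_pairs C K) lab g of (f, s) \<Rightarrow> fgen R (lab (cmp C h f, s)))
      \<in> carrier (free_mod R (B (trg C h)))"
    using assms by (simp add: cover_gen_inv is_categoryD[OF cat] fgen_carrier[OF ring] cover_gensI)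
qed

lemma cover_far_hom: "h \<in> arrs C \<Longrightarrow> far FF h \<in> mod_hom R (free_mod R (B (src C h))) (free_mod R (B (trg C h)))"
  using lin_ext_hom[OF free_mod_module[OF ring] cover_far_aux] by (simp add: cover_fun_def)

lemma cover_far_gen:
  "\<lbrakk>h \<in> arrs C; f \<in> arrs C; s \<in> K (src C f); trg C f = src C h\<rbrakk> \<Longrightarrow>
    far FF h (fgen R (lab (f, s))) = fgen R (lab (cmp C h f, s))"
  using lin_ext_fgen[OF free_mod_module[OF ring] cover_far_aux, of h "lab (f, s)"] cover_gensI[of f s "src C h"]
  by (simp add: cover_fun_def cover_gen_inv)

lemma cover_kfun: "is_kfun R C FF"
  unfolding is_kfun_def
proof (intro conjI ballI impI)
  fix X assume "X \<in> obs C" show "module R (fob FF X)" by (simp add: free_mod_module ring)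
next
  fix f assume "f \<in> arrs C"
  then show "far FF f \<in> mod_hom R (fob FF (src C f)) (fob FF (trg C f))" by (simp add: cover_far_hom)
next
  fix X x assume X: "X \<in> obs C" and x: "x \<in> carrier (fob FF X)"
  note c = is_categoryD[OF cat]
  show "far FF (ident C X) x = x"
  proof (rule free_mod_hom_eqI[OF ring, where S = "B X"])
    show "module R (free_mod R (B X))" by (rule free_mod_module[OF ring])
    show "far FF (ident C X) \<in> mod_hom R (free_mod R (B X)) (free_mod R (B X))"
      using cover_far_hom[OF c(3)[OF X]] X by (simp add: c)
    show "(\<lambda>x. x) \<in> mod_hom R (free_mod R (B X)) (free_mod R (B X))" by (simp add: mod_hom_def)
    show "x \<in> carrier (free_mod R (B X))" using x by simp
    fix g assume "g \<in> B X"
    then obtain f s where g: "f \<in> arrs C" "s \<in> K (src C f)" "trg C f = X" "g = lab (f, s)"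
      by (rule cover_gensE)
    then show "far FF (ident C X) (fgen R g) = fgen R g"
      using X cover_far_gen[of "ident C X" f s] c(10)[of f] by (simp add: c)
  qed
next
  fix f g x assume f: "f \<in> arrs C" and g: "g \<in> arrs C" and fg: "src C g = trg C f"
    and x: "x \<in> carrier (fob FF (src C f))"
  note c = is_categoryD[OF cat]
  show "far FF (cmp C g f) x = far FF g (far FF f x)"
  proof (rule free_mod_hom_eqI[OF ring, where S = "B (src C f)" and N = "free_mod R (B (trg C g))"
        and h' = "\<lambda>x. far FF g (far FF f x)"])
    show "module R (free_mod R (B (trg C g)))" by (rule free_mod_module[OF ring])
    show "far FF (cmp C g f) \<in> mod_hom R (free_mod R (B (src C f))) (free_mod R (B (trg C g)))"
      using cover_far_hom[OF c(6)[OF f g fg]] by (simp add: c f g fg)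
    show "(\<lambda>x. far FF g (far FF f x)) \<in> mod_hom R (free_mod R (B (src C f))) (free_mod R (B (trg C g)))"
      using cover_far_hom[OF f] cover_far_hom[OF g] unfolding fg by (rule mod_hom_comp)
    show "x \<in> carrier (free_mod R (B (src C f)))" using x by simp
    fix b assume "b \<in> B (src C f)"
    then obtain p s where b: "p \<in> arrs C" "s \<in> K (src C p)" "trg C p = src C f" "b = lab (p, s)"
      by (rule cover_gensE)
    then show "far FF (cmp C g f) (fgen R b) = far FF g (far FF f (fgen R b))"
      using f g fg by (simp add: cover_far_gen c)
  qed
qed

context
  fixes E :: "('o, 'a, 'k, 'n) kfun" and e :: "'o \<Rightarrow> 'm \<Rightarrow> 'n"
  assumes E: "is_kfun R C E" and e: "\<And>X s. \<lbrakk>X \<in> obs C; s \<in> K X\<rbrakk> \<Longrightarrow> e X s \<in> carrier (fob E X)"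
begin

abbreviation (input) "cv \<equiv> cover_map R C K lab E e"

lemma cover_map_aux:
  "(\<lambda>g. case inv_into (cover_pairs C K) lab g of (f, s) \<Rightarrow> far E f (e (src C f) s)) \<in> B Y \<rightarrow> carrier (fob E Y)"
proof
  fix g assume "g \<in> B Y"
  then obtain f s where g: "f \<in> arrs C" "s \<in> K (src C f)" "trg C f = Y" "g = lab (f, s)"
    by (rule cover_gensE)
  then show "(case inv_into (cover_pairs C K) lab g of (f, s) \<Rightarrow> far E f (e (src C f) s)) \<in> carrier (fob E Y)"
    using mod_homD(1)[OF is_kfunD(2)[OF E g(1)] e] by (auto simp: cover_gen_inv is_categoryD[OF cat])
qed

lemma cover_map_hom: "Y \<in> obs C \<Longrightarrow> cv Y \<in> mod_hom R (free_mod R (B Y)) (fob E Y)"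
  using lin_ext_hom[OF is_kfunD(1)[OF E] cover_map_aux] by (simp add: cover_map_def)

lemma cover_map_gen: "\<lbrakk>f \<in> arrs C; s \<in> K (src C f); trg C f = Y\<rbrakk> \<Longrightarrow> cv Y (fgen R (lab (f, s))) = far E f (e (src C f) s)"
  using lin_ext_fgen[OF is_kfunD(1)[OF E] cover_map_aux, of Y "lab (f, s)"] cover_gensI[of f s Y] is_categoryD(2)[OF cat, of f]
  by (auto simp add: cover_map_def cover_gen_inv)

lemma cover_map_nat: "is_nat_trans R C FF E cv"
  unfolding is_nat_trans_def
proof (intro conjI ballI)
  fix X assume "X \<in> obs C" then show "cv X \<in> mod_hom R (fob FF X) (fob E X)" by (simp add: cover_map_hom)
next
  fix h x assume h: "h \<in> arrs C" and x: "x \<in> carrier (fob FF (src C h))"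
  note c = is_categoryD[OF cat]
  show "cv (trg C h) (far FF h x) = far E h (cv (src C h) x)"
  proof (rule free_mod_hom_eqI[OF ring, where S = "B (src C h)" and N = "fob E (trg C h)"])
    show "module R (fob E (trg C h))" using h by (intro is_kfunD(1)[OF E] c)
    show "(\<lambda>x. cv (trg C h) (far FF h x)) \<in> mod_hom R (free_mod R (B (src C h))) (fob E (trg C h))"
      using h by (intro mod_hom_comp[OF cover_far_hom cover_map_hom] c)
    show "(\<lambda>x. far E h (cv (src C h) x)) \<in> mod_hom R (free_mod R (B (src C h))) (fob E (trg C h))"
      using h by (intro mod_hom_comp[OF cover_map_hom is_kfunD(2)[OF E]] c)
    show "x \<in> carrier (free_mod R (B (src C h)))" using x by simp
    fix b assume "b \<in> B (src C h)"
    then obtain f s where b: "f \<in> arrs C" "s \<in> K (src C f)" "trg C f = src C h" "b = lab (f, s)"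
      by (rule cover_gensE)
    then show "cv (trg C h) (far FF h (fgen R b)) = far E h (cv (src C h) (fgen R b))"
      using h e[OF c(1)[OF b(1)] b(2)] is_kfunD(4)[OF E b(1) h] by (simp add: cover_far_gen cover_map_gen c)
  qed
qed

end

lemma cover_projective: "projective R C FF"
  unfolding projective_def
proof (intro conjI cover_kfun allI impI)
  fix E :: "('o, 'a, 'k, 'a \<times> ('g \<Rightarrow> 'k) \<Rightarrow> 'k) kfun" and G :: "('o, 'a, 'k, 'g \<Rightarrow> 'k) kfun" and \<pi> \<phi>
  assume E: "is_kfun R C E" and G: "is_kfun R C G" and \<pi>: "is_nat_trans R C E G \<pi>"
    and surj: "\<forall>X\<in>obs C. \<pi> X ` carrier (fob E X) = carrier (fob G X)"
    and \<phi>: "is_nat_trans R C FF G \<phi>"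
  note c = is_categoryD[OF cat]
  let ?b = "\<lambda>X s. fgen R (lab (ident C X, s))"
  have b: "?b X s \<in> carrier (fob FF X)" if "X \<in> obs C" "s \<in> K X" for X s
    using that by (simp add: fgen_carrier[OF ring] cover_gensI c)
  have "\<exists>x. x \<in> carrier (fob E X) \<and> \<pi> X x = \<phi> X (?b X s)" if "X \<in> obs C" "s \<in> K X" for X s
  proof -
    have "\<phi> X (?b X s) \<in> \<pi> X ` carrier (fob E X)"
      using mod_homD(1)[OF is_nat_transD(1)[OF \<phi> that(1)] b[OF that]] surj that(1) by blast
    then show ?thesis by (auto simp: image_iff)
  qed
  then obtain e where e: "\<And>X s. \<lbrakk>X \<in> obs C; s \<in> K X\<rbrakk> \<Longrightarrow> e X s \<in> carrier (fob E X)"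
    and \<pi>e: "\<And>X s. \<lbrakk>X \<in> obs C; s \<in> K X\<rbrakk> \<Longrightarrow> \<pi> X (e X s) = \<phi> X (?b X s)"
    by metis
  let ?\<psi> = "cover_map R C K lab E e"
  show "\<exists>\<psi>. is_nat_trans R C FF E \<psi> \<and> (\<forall>X\<in>obs C. \<forall>x\<in>carrier (fob FF X). \<pi> X (\<psi> X x) = \<phi> X x)"
  proof (intro exI[of _ ?\<psi>] conjI ballI)
    show "is_nat_trans R C FF E ?\<psi>" by (rule cover_map_nat[OF E e])
    fix X x assume X: "X \<in> obs C" and x: "x \<in> carrier (fob FF X)"
    show "\<pi> X (?\<psi> X x) = \<phi> X x"
    proof (rule free_mod_hom_eqI[OF ring, where S = "B X" and N = "fob G X"
        and h = "\<lambda>x. \<pi> X (?\<psi> X x)"])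
      show "module R (fob G X)" by (rule is_kfunD(1)[OF G X])
      show "(\<lambda>x. \<pi> X (?\<psi> X x)) \<in> mod_hom R (free_mod R (B X)) (fob G X)"
        by (rule mod_hom_comp[OF cover_map_hom[OF E e X] is_nat_transD(1)[OF \<pi> X]])
      show "\<phi> X \<in> mod_hom R (free_mod R (B X)) (fob G X)"
        using is_nat_transD(1)[OF \<phi> X] by simp
      show "x \<in> carrier (free_mod R (B X))" using x by simp
      fix g assume "g \<in> B X"
      then obtain f s where g: "f \<in> arrs C" "s \<in> K (src C f)" "trg C f = X" "g = lab (f, s)"
        by (rule cover_gensE)
      have Y: "src C f \<in> obs C" using g by (simp add: c)
      have "\<pi> X (?\<psi> X (fgen R g)) = \<pi> X (far E f (e (src C f) s))"
        unfolding g(4) using cover_map_gen[OF E e g(1-3)] by simp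
      also have "\<dots> = far G f (\<phi> (src C f) (?b (src C f) s))"
        using is_nat_transD(2)[OF \<pi> g(1) e[OF Y g(2)]] \<pi>e[OF Y g(2)] g(3) by simp
      also have "\<dots> = \<phi> X (far FF f (?b (src C f) s))"
        using is_nat_transD(2)[OF \<phi> g(1) b[OF Y g(2)]] g(3) by simp
      also have "far FF f (?b (src C f) s) = fgen R g"
        using g Y by (simp add: cover_far_gen c)
      finally show "\<pi> X (?\<psi> X (fgen R g)) = \<phi> X (fgen R g)" .
    qed
  qed
qed

(* The image of the cover is the given subfunctor. *)
lemma cover_image:
  fixes G :: "('o, 'a, 'k, 'm) kfun"
  assumes G: "is_kfun R C G" and sub: "\<And>X. X \<in> obs C \<Longrightarrow> submodule (K X) R (fob G X)"
    and stable: "\<And>f s. \<lbrakk>f \<in> arrs C; s \<in> K (src C f)\<rbrakk> \<Longrightarrow> far G f s \<in> K (trg C f)"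
    and X: "X \<in> obs C"
  shows "cover_map R C K lab G (\<lambda>_ s. s) X ` carrier (fob FF X) = K X"
proof -
  note c = is_categoryD[OF cat]
  interpret G: module R "fob G X" by (rule is_kfunD(1)[OF G X])
  have KX: "K Y \<subseteq> carrier (fob G Y)" if "Y \<in> obs C" for Y
    using module.submoduleE(1)[OF is_kfunD(1)[OF G that] sub[OF that]] .
  have e: "\<And>Y s. \<lbrakk>Y \<in> obs C; s \<in> K Y\<rbrakk> \<Longrightarrow> s \<in> carrier (fob G Y)" using KX by auto
  let ?N = "(fob G X)\<lparr>carrier := K X\<rparr>"
  have N: "module R ?N" by (rule submodule.submodule_is_module[OF sub[OF X] G.module_axioms])
  let ?c = "cover_map R C K lab G (\<lambda>_ s. s) X"
  let ?g = "\<lambda>g. case inv_into (cover_pairs C K) lab g of (f, s) \<Rightarrow> far G f s"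
  have gK: "?g \<in> B X \<rightarrow> K X"
  proof
    fix g assume "g \<in> B X"
    then obtain f s where g: "f \<in> arrs C" "s \<in> K (src C f)" "trg C f = X" "g = lab (f, s)"
      by (rule cover_gensE)
    then show "?g g \<in> K X" using stable[OF g(1,2)] by (simp add: cover_gen_inv)
  qed
  have inK: "?c x \<in> K X" if x: "x \<in> carrier (free_mod R (B X))" for x
  proof -
    have "lin_ext R ?N ?g \<in> mod_hom R (free_mod R (B X)) ?N"
      by (rule lin_ext_hom[OF N]) (use gK in simp)
    then have h: "lin_ext R ?N ?g \<in> mod_hom R (free_mod R (B X)) (fob G X)"
      using KX[OF X] by (auto simp: mod_hom_def)
    have "?c x = lin_ext R ?N ?g x"
    proof (rule free_mod_hom_eqI[OF ring G.module_axioms cover_map_hom[OF G e X] h _ x])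
      fix g assume gB: "g \<in> B X"
      then obtain f s where g: "f \<in> arrs C" "s \<in> K (src C f)" "trg C f = X" "g = lab (f, s)"
        by (rule cover_gensE)
      have "lin_ext R ?N ?g (fgen R g) = ?g g"
        by (rule lin_ext_fgen[OF N _ gB]) (use gK in simp)
      then show "?c (fgen R g) = lin_ext R ?N ?g (fgen R g)"
        using cover_map_gen[OF G e g(1-3)] g by (simp add: cover_gen_inv)
    qed
    also have "\<dots> \<in> K X"
      using mod_homD(1)[OF \<open>lin_ext R ?N ?g \<in> mod_hom R (free_mod R (B X)) ?N\<close> x] by simp
    finally show ?thesis .
  qed
  show ?thesis
  proof (intro equalityI subsetI)
    fix y assume "y \<in> ?c ` carrier (fob FF X)" then show "y \<in> K X" using inK by auto
  next
    fix y assume y: "y \<in> K X"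
    have "?c (fgen R (lab (ident C X, y))) = far G (ident C X) y"
      using cover_map_gen[OF G e, where f = "ident C X" and s = y and Y = X] X y by (simp add: c)
    also have "\<dots> = y" using is_kfunD(3)[OF G X] e[OF X y] by simp
    finally have "?c (fgen R (lab (ident C X, y))) = y" .
    moreover have "fgen R (lab (ident C X, y)) \<in> carrier (fob FF X)"
      using X y by (simp add: fgen_carrier[OF ring] cover_gensI c)
    ultimately show "y \<in> ?c ` carrier (fob FF X)" by (metis imageI)
  qed
qed

end


lemma nat_trans_kernel:
  assumes F: "is_kfun R C F" and G: "is_kfun R C G" and \<eta>: "is_nat_trans R C F G \<eta>" and cat: "is_category C"
  defines "K \<equiv> \<lambda>X. {x \<in> carrier (fob F X). \<eta> X x = \<zero>\<^bsub>fob G X\<^esub>}"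
  shows "X \<in> obs C \<Longrightarrow> submodule (K X) R (fob F X)"
    and "\<lbrakk>f \<in> arrs C; s \<in> K (src C f)\<rbrakk> \<Longrightarrow> far F f s \<in> K (trg C f)"
proof -
  assume X: "X \<in> obs C"
  interpret F: module R "fob F X" by (rule is_kfunD(1)[OF F X])
  interpret G: module R "fob G X" by (rule is_kfunD(1)[OF G X])
  note h = mod_homD[OF is_nat_transD(1)[OF \<eta> X]]
  show "submodule (K X) R (fob F X)"
  proof (rule F.submoduleI)
    show "\<zero>\<^bsub>fob F X\<^esub> \<in> K X"
      using mod_hom_zero[OF F.module_axioms G.module_axioms is_nat_transD(1)[OF \<eta> X]] by (simp add: K_def)
    fix x assume x: "x \<in> K X"
    have "\<ominus>\<^bsub>fob F X\<^esub> x = (\<ominus>\<^bsub>R\<^esub> \<one>\<^bsub>R\<^esub>) \<odot>\<^bsub>fob F X\<^esub> x"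
      using x by (simp add: K_def F.smult_l_minus)
    then show "\<ominus>\<^bsub>fob F X\<^esub> x \<in> K X" using x by (auto simp: K_def h)
  qed (auto simp: K_def h)
next
  assume f: "f \<in> arrs C" and s: "s \<in> K (src C f)"
  have o: "src C f \<in> obs C" "trg C f \<in> obs C" using f by (auto simp: is_categoryD[OF cat])
  have "far G f \<zero>\<^bsub>fob G (src C f)\<^esub> = \<zero>\<^bsub>fob G (trg C f)\<^esub>"
    by (rule mod_hom_zero[OF is_kfunD(1)[OF G o(1)] is_kfunD(1)[OF G o(2)] is_kfunD(2)[OF G f]])
  then show "far F f s \<in> K (trg C f)"
    using s is_nat_transD(2)[OF \<eta> f, of s] mod_homD(1)[OF is_kfunD(2)[OF F f]] by (auto simp: K_def)
qed

datatype ('a, 'm, 'k) res_gen = Base 'a 'm | Step 'a "(('a, 'm, 'k) res_gen \<times> 'k) fset"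

definition step_lab ::
  "('k, 'r) ring_scheme \<Rightarrow> 'a \<times> (('a, 'm, 'k) res_gen \<Rightarrow> 'k) \<Rightarrow> ('a, 'm, 'k) res_gen" where
  "step_lab R = (\<lambda>(f, v). Step f (Abs_fset {(g, v g) | g. v g \<noteq> \<zero>\<^bsub>R\<^esub>}))"

lemma inj_step_lab:
  assumes "\<And>X v. \<lbrakk>X \<in> obs C; v \<in> K X\<rbrakk> \<Longrightarrow> finite {g. v g \<noteq> \<zero>\<^bsub>R\<^esub>}" "is_category C"
  shows "inj_on (step_lab R) (cover_pairs C K)"
proof (rule inj_onI, clarify)
  fix f v f' v' assume *: "(f, v) \<in> cover_pairs C K" "(f', v') \<in> cover_pairs C K"
    "step_lab R (f, v) = step_lab R (f', v')"
  let ?G = "\<lambda>v. {(g, v g) | g. v g \<noteq> \<zero>\<^bsub>R\<^esub>}"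
  have img: "?G v = (\<lambda>g. (g, v g)) ` {g. v g \<noteq> \<zero>\<^bsub>R\<^esub>}" for v by auto
  have "finite {g. v g \<noteq> \<zero>\<^bsub>R\<^esub>}" "finite {g. v' g \<noteq> \<zero>\<^bsub>R\<^esub>}"
    using * assms(1) is_categoryD(1)[OF assms(2)] by (auto simp: cover_pairs_def)
  then have "finite (?G v)" "finite (?G v')" unfolding img by auto
  then have "?G v = ?G v'" and f: "f = f'"
    using *(3) by (auto simp: step_lab_def Abs_fset_inject)
  then have G: "(g, c) \<in> ?G v \<longleftrightarrow> (g, c) \<in> ?G v'" for g c by simp
  have "v g = v' g" for g using G[of g "v g"] G[of g "v' g"] by auto
  then show "f = f' \<and> v = v'" using f by auto
qed

primrec free_res ::
  "('k, 'r) ring_scheme \<Rightarrow> ('o, 'a) category \<Rightarrow> ('o, 'a, 'k, 'm) kfun \<Rightarrow> nat \<Rightarrow>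
   ('o, 'a, 'k, ('a, 'm, 'k) res_gen \<Rightarrow> 'k) kfun \<times> ('o \<Rightarrow> (('a, 'm, 'k) res_gen \<Rightarrow> 'k) set)" where
  "free_res R C F 0 =
    (let K = (\<lambda>X. carrier (fob F X)); Q = cover_fun R C K (case_prod Base) in
     (Q, \<lambda>X. {x \<in> carrier (fob Q X). cover_map R C K (case_prod Base) F (\<lambda>_ s. s) X x = \<zero>\<^bsub>fob F X\<^esub>}))"
| "free_res R C F (Suc n) =
    (let (P, K) = free_res R C F n; Q = cover_fun R C K (step_lab R) in
     (Q, \<lambda>X. {x \<in> carrier (fob Q X). cover_map R C K (step_lab R) P (\<lambda>_ s. s) X x = \<zero>\<^bsub>fob P X\<^esub>}))"

theorem projective_resolution_exists:
  fixes F :: "('o, 'a, 'k, 'm) kfun"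
  assumes R: "cring R" and C: "is_category C" and F: "is_kfun R C F"
  shows "\<exists>(P :: nat \<Rightarrow> ('o, 'a, 'k, ('a, 'm, 'k) res_gen \<Rightarrow> 'k) kfun) d e.
    projective_resolution R C F P d e"
proof -
  define P where "P n = fst (free_res R C F n)" for n
  define K where "K n = snd (free_res R C F n)" for n
  define K0 where "K0 X = carrier (fob F X)" for X
  define e :: "'o \<Rightarrow> (('a, 'm, 'k) res_gen \<Rightarrow> 'k) \<Rightarrow> 'm"
    where "e = cover_map R C K0 (case_prod Base) F (\<lambda>_ s. s)"
  define d where "d n = cover_map R C (K n) (step_lab R) (P n) (\<lambda>_ s. s)" for n
  have K0': "K0 = (\<lambda>X. carrier (fob F X))" by (auto simp: K0_def)
  have P0: "P 0 = cover_fun R C K0 (case_prod Base)" by (simp add: P_def K0' Let_def)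
  have k0: "K 0 = (\<lambda>X. {x \<in> carrier (fob (P 0) X). e X x = \<zero>\<^bsub>fob F X\<^esub>})"
    by (simp add: K_def P_def e_def K0' Let_def)
  have PS: "P (Suc n) = cover_fun R C (K n) (step_lab R)" for n
    by (simp add: P_def K_def Let_def split: prod.split)
  have kS: "K (Suc n) = (\<lambda>X. {x \<in> carrier (fob (P (Suc n)) X). d n X x = \<zero>\<^bsub>fob (P n) X\<^esub>})" for n
    by (simp add: P_def K_def d_def Let_def split: prod.split)
  have inj0: "inj_on (case_prod Base :: 'a \<times> 'm \<Rightarrow> ('a, 'm, 'k) res_gen) (cover_pairs C K0)" by (auto simp: inj_on_def)
  have P0f: "is_kfun R C (P 0)" "projective R C (P 0)"
    unfolding P0 using cover_kfun[OF R C inj0] cover_projective[OF R C inj0] by auto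
  have e_nat: "is_nat_trans R C (P 0) F e"
    unfolding P0 e_def by (rule cover_map_nat[OF R C inj0 F]) (auto simp: K0_def)
  have e_im: "e X ` carrier (fob (P 0) X) = carrier (fob F X)" if "X \<in> obs C" for X
    unfolding P0 e_def
    using cover_image[OF R C inj0 F _ _ that] module.carrier_is_submodule[OF is_kfunD(1)[OF F]]
      mod_homD(1)[OF is_kfunD(2)[OF F]]
    by (auto simp: K0_def)
  have inv: "is_kfun R C (P n) \<and> projective R C (P n) \<and>
      (\<forall>X\<in>obs C. submodule (K n X) R (fob (P n) X) \<and> (\<forall>v\<in>K n X. finite {g. v g \<noteq> \<zero>\<^bsub>R\<^esub>})) \<and>
      (\<forall>f\<in>arrs C. \<forall>s\<in>K n (src C f). far (P n) f s \<in> K n (trg C f))" for n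
  proof (induction n)
    case 0
    have "finite {g. v g \<noteq> \<zero>\<^bsub>R\<^esub>}" if "v \<in> K 0 X" for v X
      using that unfolding k0 P0 by (auto simp: cover_fun_def free_mod_def)
    then show ?case using P0f nat_trans_kernel[OF P0f(1) F e_nat C] unfolding k0 by blast
  next
    case (Suc n)
    have inj: "inj_on (step_lab R) (cover_pairs C (K n))"
      by (rule inj_step_lab[OF _ C]) (use Suc in blast)
    have f: "is_kfun R C (P (Suc n))" "projective R C (P (Suc n))"
      unfolding PS using cover_kfun[OF R C inj] cover_projective[OF R C inj] by auto
    have sub: "K n X \<subseteq> carrier (fob (P n) X)" if "X \<in> obs C" for X
      using Suc that module.submoduleE(1) is_kfunD(1) by metis
    have nat: "is_nat_trans R C (P (Suc n)) (P n) (d n)"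
      unfolding PS d_def by (rule cover_map_nat[OF R C inj]) (use Suc sub in auto)
    have "finite {g. v g \<noteq> \<zero>\<^bsub>R\<^esub>}" if "v \<in> K (Suc n) X" for v X
      using that unfolding kS PS by (auto simp: cover_fun_def free_mod_def)
    then show ?case using f nat_trans_kernel[OF f(1) _ nat C] Suc unfolding kS by blast
  qed
  have inj: "inj_on (step_lab R) (cover_pairs C (K n))" for n
    by (rule inj_step_lab[OF _ C]) (use inv in blast)
  have sub: "K n X \<subseteq> carrier (fob (P n) X)" if "X \<in> obs C" for X n
    using inv that module.submoduleE(1) is_kfunD(1) by metis
  have nat: "is_nat_trans R C (P (Suc n)) (P n) (d n)" for n
    unfolding PS d_def by (rule cover_map_nat[OF R C inj]) (use inv sub in blast)+
  have im: "d n X ` carrier (fob (P (Suc n)) X) = K n X" if "X \<in> obs C" for X n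
    unfolding PS d_def by (rule cover_image[OF R C inj _ _ _ that]) (use inv in auto)
  have "projective_resolution R C F P d e"
    unfolding projective_resolution_def
    using inv e_nat nat e_im im[of _ 0] im[of _ "Suc _"] by (auto simp: k0 kS)
  then show ?thesis by blast
qed


subsection \<open>The derived functors of the colimit\<close>

(* Tor^C(k, F) for the constant functor k, as the left derived functors of colim at F. Up to isomorphism
   they do not depend on the chosen resolution. Resolutions are taken with values in functions on
   res_gen; by projective_resolution_exists this type is large enough for every F. *)
definition functor_homology ::
  "('k, 'r) ring_scheme \<Rightarrow> ('o, 'a) category \<Rightarrow> ('o, 'a, 'k, 'm) kfun \<Rightarrow> nat \<Rightarrow>
   ('k, ('o \<Rightarrow> ('a, 'm, 'k) res_gen \<Rightarrow> 'k) set set) module" where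
  "functor_homology R C F =
    (let (P, d, e) = (SOME (P, d, e). projective_resolution R C F P d e) in
     chain_homology (\<lambda>n. colim R C (P n)) (\<lambda>n. colim_map R C (P n) (d n)))"


section \<open>Nerves of under-categories\<close>

definition under :: "('o, 'a) category \<Rightarrow> 'o \<Rightarrow> ('a, 'a \<times> 'a) category" where
  "under C X =
     \<lparr>obs = {f \<in> arrs C. src C f = X},
      arrs = {(f, h). f \<in> arrs C \<and> src C f = X \<and> h \<in> arrs C \<and> src C h = trg C f},
      src = (\<lambda>(f, h). f), trg = (\<lambda>(f, h). cmp C h f),
      ident = (\<lambda>f. (f, ident C (trg C f))),
      cmp = (\<lambda>(g, h') (f, h). (f, cmp C h' h))\<rparr>"

definition order_pairs :: "nat \<Rightarrow> (nat \<times> nat) set" where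
  "order_pairs n = {(i, j). i \<le> j \<and> j \<le> n}"

(* An n-simplex of the nerve is a functor from the poset {0 < ... < n} to C, given by the images
   \<sigma> (i, j) of the arrows i \<le> j. *)
definition nerve :: "('o, 'a) category \<Rightarrow> nat \<Rightarrow> (nat \<times> nat \<Rightarrow> 'a) set" where
  "nerve C n = {\<sigma> \<in> order_pairs n \<rightarrow>\<^sub>E arrs C.
     (\<forall>(i, j)\<in>order_pairs n. src C (\<sigma> (i, j)) = src C (\<sigma> (i, i)) \<and> trg C (\<sigma> (i, j)) = src C (\<sigma> (j, j))) \<and>
     (\<forall>i\<le>n. \<sigma> (i, i) = ident C (src C (\<sigma> (i, i)))) \<and>
     (\<forall>i j l. i \<le> j \<longrightarrow> j \<le> l \<longrightarrow> l \<le> n \<longrightarrow> cmp C (\<sigma> (j, l)) (\<sigma> (i, j)) = \<sigma> (i, l))}"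

definition coface :: "nat \<Rightarrow> nat \<Rightarrow> nat" where
  "coface i j = (if j < i then j else Suc j)"

(* The i-th face of an (n+1)-simplex. *)
definition nerve_face :: "nat \<Rightarrow> nat \<Rightarrow> (nat \<times> nat \<Rightarrow> 'a) \<Rightarrow> nat \<times> nat \<Rightarrow> 'a" where
  "nerve_face n i \<sigma> = (\<lambda>(a, b)\<in>order_pairs n. \<sigma> (coface i a, coface i b))"

(* The contravariant functor X \<mapsto> k[N(X \ C)_n]; an arrow f from X to Y acts by precomposing objects
   under Y with f. *)
definition under_nerve_fun ::
  "('k, 'r) ring_scheme \<Rightarrow> ('o, 'a) category \<Rightarrow> nat \<Rightarrow> ('o, 'a, 'k, (nat \<times> nat \<Rightarrow> 'a \<times> 'a) \<Rightarrow> 'k) kfun" where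
  "under_nerve_fun R C n =
     \<lparr>fob = (\<lambda>X. free_mod R (nerve (under C X) n)),
      far = (\<lambda>f. lin_ext R (free_mod R (nerve (under C (src C f)) n))
        (\<lambda>\<sigma>. fgen R (\<lambda>p\<in>order_pairs n. case \<sigma> p of (g, h) \<Rightarrow> (cmp C g f, h))))\<rparr>"

definition under_nerve_face ::
  "('k, 'r) ring_scheme \<Rightarrow> ('o, 'a) category \<Rightarrow> nat \<Rightarrow> nat \<Rightarrow> 'o \<Rightarrow>
   ((nat \<times> nat \<Rightarrow> 'a \<times> 'a) \<Rightarrow> 'k) \<Rightarrow> (nat \<times> nat \<Rightarrow> 'a \<times> 'a) \<Rightarrow> 'k" where
  "under_nerve_face R C n i X =
     lin_ext R (free_mod R (nerve (under C X) n)) (\<lambda>\<sigma>. fgen R (nerve_face n i \<sigma>))"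

(* Homology of the simplicial module k[N(- \ C)] \<otimes>_C F. *)
definition nerve_tensor_homology ::
  "('k, 'r) ring_scheme \<Rightarrow> ('o, 'a) category \<Rightarrow> ('o, 'a, 'k, 'm) kfun \<Rightarrow> nat \<Rightarrow>
   ('k, ('o \<Rightarrow> (((nat \<times> nat \<Rightarrow> 'a \<times> 'a) \<Rightarrow> 'k) \<times> 'm \<Rightarrow> 'k) set) set set) module" where
  "nerve_tensor_homology R C F =
     simplicial_homology (\<lambda>n. coend R C (under_nerve_fun R C n) F)
       (\<lambda>n i. coend_map R C (under_nerve_fun R C n) F (under_nerve_face R C n i))"


section \<open>The categories \<open>\<Delta>S\<close>, \<open>\<Delta>S\<^sub>+\<close> and \<open>Epi\<Delta>S\<^sub>+\<close>\<close>

(* The object [n] is represented by its cardinality n + 1, so that 0 is [-1].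
   A morphism from [n] to [m] is the list of its m + 1 fibres, each fibre being listed in its order:
   L ! j lists the fibre over j, and every i \<le> n occurs in exactly one fibre, once.
   The only arrow from 0 to m is replicate m [], the added morphism \<iota>. *)
definition fibre_lists :: "nat list list set" where
  "fibre_lists = {L. distinct (concat L) \<and> set (concat L) = {..<length (concat L)}}"

definition underlying_map :: "nat list list \<Rightarrow> nat \<Rightarrow> nat" where
  "underlying_map L i = (THE j. j < length L \<and> i \<in> set (L ! j))"

definition DeltaS_plus :: "(nat, nat list list) category" where
  "DeltaS_plus =
     \<lparr>obs = UNIV, arrs = fibre_lists,
      src = (\<lambda>L. length (concat L)), trg = length,
      ident = (\<lambda>n. map (\<lambda>i. [i]) [0..<n]),
      cmp = (\<lambda>M L. map (\<lambda>fibre. concat (map (\<lambda>j. L ! j) fibre)) M)\<rparr>"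

definition DeltaS :: "(nat, nat list list) category" where
  "DeltaS = DeltaS_plus\<lparr>obs := {n. n \<ge> 1}, arrs := {L \<in> fibre_lists. length (concat L) \<ge> 1}\<rparr>"

definition EpiDeltaS_plus :: "(nat, nat list list) category" where
  "EpiDeltaS_plus = DeltaS_plus\<lparr>arrs := {L. epi DeltaS_plus L}\<rparr>"

lemma DeltaS_plus_simps [simp]:
  "obs DeltaS_plus = UNIV" "arrs DeltaS_plus = fibre_lists"
  "src DeltaS_plus L = length (concat L)" "trg DeltaS_plus L = length L"
  "ident DeltaS_plus n = map (\<lambda>i. [i]) [0..<n]"
  "cmp DeltaS_plus M L = map (\<lambda>fibre. concat (map ((!) L) fibre)) M"
  by (simp_all add: DeltaS_plus_def)

lemma fibre_lists_mset:
  "L \<in> fibre_lists \<longleftrightarrow> mset (concat L) = mset [0..<length (concat L)]"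
proof
  assume "L \<in> fibre_lists"
  then show "mset (concat L) = mset [0..<length (concat L)]"
    by (intro set_eq_iff_mset_eq_distinct[THEN iffD1])
      (auto simp: fibre_lists_def atLeast0LessThan simp del: set_concat)
next
  assume *: "mset (concat L) = mset [0..<length (concat L)]"
  then have "distinct (concat L)" by (metis distinct_upt mset_eq_imp_distinct_iff)
  moreover have "set (concat L) = set [0..<length (concat L)]"
    using * by (metis mset_eq_setD)
  ultimately show "L \<in> fibre_lists"
    by (simp add: fibre_lists_def atLeast0LessThan del: set_concat)
qed

lemma concat_cmp:
  "concat (map (\<lambda>fibre. concat (map ((!) L) fibre)) M) = concat (map ((!) L) (concat M))"
  by (induction M) auto

lemma fibre_less:
  assumes "M \<in> fibre_lists" "fibre \<in> set M" "j \<in> set fibre"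
  shows "j < length (concat M)"
proof -
  have "j \<in> set (concat M)" using assms(2,3) by auto
  then show ?thesis using assms(1) by (simp only: fibre_lists_def) auto
qed

lemma distinct_concat_nth:
  "\<lbrakk>distinct (concat L); i < length L; j < length L; x \<in> set (L ! i); x \<in> set (L ! j)\<rbrakk> \<Longrightarrow> i = j"
proof (induction L arbitrary: i j)
  case (Cons fibre L)
  have "x \<notin> set (L ! m)" if "m < length L" "x \<in> set fibre" for m
  proof
    assume "x \<in> set (L ! m)"
    then have "x \<in> set (concat L)" using nth_mem[OF that(1)] by auto
    then show False using Cons.prems(1) that(2) unfolding concat.simps distinct_append by blast
  qed
  then show ?case using Cons by (cases i; cases j) auto
qed simp

lemma cmp_fibre_lists:
  assumes L: "L \<in> fibre_lists" and M: "M \<in> fibre_lists" and LM: "length (concat M) = length L"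
  defines "K \<equiv> map (\<lambda>fibre. concat (map ((!) L) fibre)) M"
  shows "K \<in> fibre_lists" "length (concat K) = length (concat L)"
proof -
  have c: "mset (concat xss) = (\<Sum>xs\<leftarrow>xss. mset xs)" for xss :: "nat list list"
    by (induction xss) auto
  have "mset (concat K) = (\<Sum>j\<leftarrow>concat M. mset (L ! j))"
    unfolding K_def concat_cmp c by (simp add: o_def)
  also have "\<dots> = (\<Sum>j\<leftarrow>[0..<length L]. mset (L ! j))"
    using M[unfolded fibre_lists_mset LM] by (simp only: sum_mset_sum_list[symmetric] mset_map)
  also have "\<dots> = mset (concat L)"
  proof -
    have "map (\<lambda>j. mset (L ! j)) [0..<length L] = map mset L" by (rule nth_equalityI) simp_all
    then show ?thesis by (simp only: c)
  qed
  finally have *: "mset (concat K) = mset (concat L)" .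
  then show len: "length (concat K) = length (concat L)" by (rule mset_eq_length)
  show "K \<in> fibre_lists" using L unfolding fibre_lists_mset len * .
qed

lemma is_category_DeltaS_plus: "is_category DeltaS_plus"
  unfolding is_category_def
proof (intro conjI ballI impI)
  fix L show "src DeltaS_plus L \<in> obs DeltaS_plus" "trg DeltaS_plus L \<in> obs DeltaS_plus" by simp_all
next
  fix n :: nat
  show "trg DeltaS_plus (ident DeltaS_plus n) = n" by simp
  have "concat (map (\<lambda>i. [i]) [0..<n]) = [0..<n]" by (induction n) auto
  then show "ident DeltaS_plus n \<in> arrs DeltaS_plus" "src DeltaS_plus (ident DeltaS_plus n) = n"
    by (simp_all add: fibre_lists_mset)
next
  fix L M
  show "trg DeltaS_plus (cmp DeltaS_plus M L) = trg DeltaS_plus M" by simp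
  assume "L \<in> arrs DeltaS_plus" "M \<in> arrs DeltaS_plus" "src DeltaS_plus M = trg DeltaS_plus L"
  then show "cmp DeltaS_plus M L \<in> arrs DeltaS_plus"
    "src DeltaS_plus (cmp DeltaS_plus M L) = src DeltaS_plus L"
    using cmp_fibre_lists[of L M] by simp_all
next
  fix L assume L: "L \<in> arrs DeltaS_plus"
  have "concat (map ((!) (map (\<lambda>i. [i]) [0..<length (concat L)])) fibre) = fibre" if "fibre \<in> set L" for fibre
  proof -
    have "map ((!) (map (\<lambda>i. [i]) [0..<length (concat L)])) fibre = map (\<lambda>i. [i]) fibre"
      using fibre_less[OF _ that] L by (intro map_cong) (auto simp del: length_concat)
    then show ?thesis by (simp only: concat_map_singleton list.map_ident)
  qed
  then show "cmp DeltaS_plus L (ident DeltaS_plus (src DeltaS_plus L)) = L"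
    unfolding DeltaS_plus_simps by (rule map_idI)
  have "map (\<lambda>i. L ! i) [0..<length L] = L" by (rule map_nth)
  then show "cmp DeltaS_plus (ident DeltaS_plus (trg DeltaS_plus L)) L = L"
    unfolding DeltaS_plus_simps by (simp add: o_def)
next
  fix L M N assume "L \<in> arrs DeltaS_plus" "M \<in> arrs DeltaS_plus" "N \<in> arrs DeltaS_plus"
    "src DeltaS_plus M = trg DeltaS_plus L" "src DeltaS_plus N = trg DeltaS_plus M"
  then have N: "N \<in> fibre_lists" "length (concat N) = length M" unfolding DeltaS_plus_simps by auto
  let ?f = "\<lambda>fibre. concat (map ((!) L) fibre)"
  have "concat (map ((!) (map ?f M)) fibre) = ?f (concat (map ((!) M) fibre))" if "fibre \<in> set N" for fibre
  proof -
    have "map ((!) (map ?f M)) fibre = map ?f (map ((!) M) fibre)"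
      using fibre_less[OF N(1) that] unfolding N(2) by simp
    then show ?thesis by (simp only: concat_cmp)
  qed
  then show "cmp DeltaS_plus N (cmp DeltaS_plus M L) = cmp DeltaS_plus (cmp DeltaS_plus N M) L"
    unfolding DeltaS_plus_simps by simp
qed

lemma is_category_subcategory:
  assumes C: "is_category C" and "obs D \<subseteq> obs C" "arrs D \<subseteq> arrs C"
    "src D = src C" "trg D = trg C" "ident D = ident C" "cmp D = cmp C"
    and ends: "\<And>f. f \<in> arrs D \<Longrightarrow> src C f \<in> obs D \<and> trg C f \<in> obs D"
    and id: "\<And>X. X \<in> obs D \<Longrightarrow> ident C X \<in> arrs D"
    and comp: "\<And>f g. \<lbrakk>f \<in> arrs D; g \<in> arrs D; src C g = trg C f\<rbrakk> \<Longrightarrow> cmp C g f \<in> arrs D"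
  shows "is_category D"
proof -
  note c = is_categoryD[OF C] and sub = subsetD[OF assms(2)] subsetD[OF assms(3)]
  show ?thesis unfolding is_category_def assms(4-7)
  proof (intro conjI ballI impI)
    fix f assume f: "f \<in> arrs D"
    show "src C f \<in> obs D" "trg C f \<in> obs D" using ends[OF f] by auto
    show "cmp C f (ident C (src C f)) = f" "cmp C (ident C (trg C f)) f = f"
      by (rule c(9,10)[OF sub(2)[OF f]])+
  next
    fix X assume X: "X \<in> obs D"
    show "ident C X \<in> arrs D" by (rule id[OF X])
    show "src C (ident C X) = X" "trg C (ident C X) = X" by (rule c(4,5)[OF sub(1)[OF X]])+
  next
    fix f g assume fg: "f \<in> arrs D" "g \<in> arrs D" "src C g = trg C f"
    show "cmp C g f \<in> arrs D" by (rule comp[OF fg])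
    show "src C (cmp C g f) = src C f" "trg C (cmp C g f) = trg C g"
      by (rule c(7,8)[OF sub(2)[OF fg(1)] sub(2)[OF fg(2)] fg(3)])+
  next
    fix f g h assume "f \<in> arrs D" "g \<in> arrs D" "h \<in> arrs D" and eq: "src C g = trg C f" "src C h = trg C g"
    then have "f \<in> arrs C" "g \<in> arrs C" "h \<in> arrs C" using sub(2) by blast+
    then show "cmp C h (cmp C g f) = cmp C (cmp C h g) f" using eq by (rule c(11))
  qed
qed

lemma is_category_DeltaS: "is_category DeltaS"
proof -
  have "trg DeltaS_plus L \<ge> 1" if "src DeltaS_plus L \<ge> 1" for L
    using that by (cases L) auto
  note pos = this
  note c = is_categoryD[OF is_category_DeltaS_plus]
  have D: "arrs DeltaS = {L \<in> arrs DeltaS_plus. src DeltaS_plus L \<ge> 1}" "obs DeltaS = {n. n \<ge> 1}"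
    by (simp_all add: DeltaS_def)
  show ?thesis
  proof (rule is_category_subcategory[OF is_category_DeltaS_plus])
    fix L assume "L \<in> arrs DeltaS"
    then have "src DeltaS_plus L \<ge> 1" unfolding D(1) by (rule CollectE) (erule conjE)
    then show "src DeltaS_plus L \<in> obs DeltaS \<and> trg DeltaS_plus L \<in> obs DeltaS"
      unfolding D(2) mem_Collect_eq by (intro conjI pos)
  next
    fix n assume "n \<in> obs DeltaS"
    then have "n \<ge> 1" unfolding D(2) mem_Collect_eq .
    then show "ident DeltaS_plus n \<in> arrs DeltaS"
      unfolding D(1) mem_Collect_eq by (simp only: c(3,4) DeltaS_plus_simps(1) UNIV_I)
  next
    fix L M assume "L \<in> arrs DeltaS" "M \<in> arrs DeltaS" and LM: "src DeltaS_plus M = trg DeltaS_plus L"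
    then have "L \<in> arrs DeltaS_plus" "M \<in> arrs DeltaS_plus" "src DeltaS_plus L \<ge> 1"
      unfolding D(1) mem_Collect_eq by blast+
    then show "cmp DeltaS_plus M L \<in> arrs DeltaS"
      unfolding D(1) mem_Collect_eq by (simp only: c(6,7) LM)
  qed (simp_all add: DeltaS_def subset_iff)
qed

text \<open>The epimorphisms are the morphisms with surjective underlying map.\<close>

lemma epi_DeltaS_plus_iff: "epi DeltaS_plus L \<longleftrightarrow> L \<in> fibre_lists \<and> [] \<notin> set L"
proof (intro iffI conjI notI)
  assume e: "epi DeltaS_plus L"
  then show "L \<in> fibre_lists" by (simp add: epi_def)
  assume "[] \<in> set L"
  then obtain j where j: "j < length L" "L ! j = []" by (auto simp: in_set_conv_nth)
  let ?M = "[[0..<length L], []]" and ?N = "[filter (\<lambda>i. i \<noteq> j) [0..<length L], [j]]"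
  have drop: "concat (map ((!) L) (filter (\<lambda>i. i \<noteq> j) xs)) = concat (map ((!) L) xs)" for xs
    using j by (induction xs) auto
  have len: "length (concat ?N) = length L"
    using j sum_length_filter_compl[of "\<lambda>i. i \<noteq> j" "[0..<length L]"]
    by (simp add: distinct_length_filter)
  have set: "set (concat ?N) = {..<length L}" using j by auto
  have N: "?N \<in> fibre_lists"
    unfolding fibre_lists_def mem_Collect_eq len set by auto
  have M: "?M \<in> fibre_lists" by (auto simp: fibre_lists_def)
  have "cmp DeltaS_plus ?M L = cmp DeltaS_plus ?N L"
    unfolding DeltaS_plus_simps list.map drop using j by simp
  moreover have "src DeltaS_plus ?M = trg DeltaS_plus L" "src DeltaS_plus ?N = trg DeltaS_plus L"
    "trg DeltaS_plus ?M = trg DeltaS_plus ?N" using len by simp_all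
  ultimately have "?M = ?N"
    using e[unfolded epi_def, THEN conjunct2, rule_format, of ?M ?N] M N
    unfolding DeltaS_plus_simps(2) by blast
  then show False by simp
next
  assume "L \<in> fibre_lists \<and> [] \<notin> set L"
  then have L: "L \<in> fibre_lists" "[] \<notin> set L" by auto
  have disj: "i = j" if "i < length L" "j < length L" "x \<in> set (L ! i)" "x \<in> set (L ! j)" for i j x
    using distinct_concat_nth[OF _ that] L(1) unfolding fibre_lists_def by blast
  have inj: "xs = ys" if "concat (map ((!) L) xs) = concat (map ((!) L) ys)"
    "set xs \<subseteq> {..<length L}" "set ys \<subseteq> {..<length L}" for xs ys
    using that
  proof (induction xs arbitrary: ys)
    case Nil
    then show ?case using L(2) nth_mem[of "hd ys" L] by (cases ys) auto
  next
    case (Cons a xs)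
    have ne: "L ! i \<noteq> []" if "i < length L" for i using L(2) nth_mem[OF that] by metis
    have a: "a < length L" using Cons.prems(2) by simp
    have "ys \<noteq> []"
    proof
      assume "ys = []"
      then have "L ! a = []" using Cons.prems(1) by simp
      then show False using ne[OF a] by simp
    qed
    then obtain b zs where ys: "ys = b # zs" by (meson neq_Nil_conv)
    have b: "b < length L" using Cons.prems(3) ys by simp
    have app: "L ! a @ concat (map ((!) L) xs) = L ! b @ concat (map ((!) L) zs)"
      using Cons.prems(1) ys by simp
    then have "hd (L ! a) = hd (L ! b)" using ne[OF a] ne[OF b] by (metis hd_append2)
    then have "a = b" using disj[OF a b hd_in_set[OF ne[OF a]]] hd_in_set[OF ne[OF b]] by simp
    moreover have "xs = zs"
      by (rule Cons.IH) (use app \<open>a = b\<close> Cons.prems(2,3) ys in simp_all)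
    ultimately show ?case using ys by simp
  qed
  show "epi DeltaS_plus L" unfolding epi_def DeltaS_plus_simps
  proof (intro conjI L(1) ballI impI)
    fix M N assume M: "M \<in> fibre_lists" "length (concat M) = length L"
      and N: "N \<in> fibre_lists" "length (concat N) = length L" and len: "length M = length N"
      and eq: "map (\<lambda>fibre. concat (map ((!) L) fibre)) M = map (\<lambda>fibre. concat (map ((!) L) fibre)) N"
    show "M = N"
    proof (rule nth_equalityI[OF len])
      fix i assume i: "i < length M"
      then have "concat (map ((!) L) (M ! i)) = concat (map ((!) L) (N ! i))"
        using arg_cong[OF eq, of "\<lambda>xs. xs ! i"] len by simp
      moreover have "set (M ! i) \<subseteq> {..<length L}" "set (N ! i) \<subseteq> {..<length L}"
        using fibre_less[OF M(1) nth_mem, of i] fibre_less[OF N(1) nth_mem, of i] i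
        unfolding M(2) N(2) len by auto
      ultimately show "M ! i = N ! i" by (rule inj)
    qed
  qed
qed

lemma is_category_EpiDeltaS_plus: "is_category EpiDeltaS_plus"
proof -
  have cl: "[] \<notin> set (cmp DeltaS_plus M L)"
    if "[] \<notin> set M" "[] \<notin> set L" "M \<in> fibre_lists" "src DeltaS_plus M = trg DeltaS_plus L" for M L
  proof
    assume "[] \<in> set (cmp DeltaS_plus M L)"
    then obtain fibre where f: "fibre \<in> set M" "concat (map ((!) L) fibre) = []" by auto
    then have "fibre \<noteq> []" using that(1) by auto
    then obtain j where j: "j \<in> set fibre" by (meson hd_in_set)
    then have "j < length L" using fibre_less[OF that(3) f(1) j] that(4) by (simp del: length_concat)
    moreover have "L ! j = []" using f(2) j by auto
    ultimately show False using that(2) by (metis nth_mem)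
  qed
  show ?thesis
  proof (rule is_category_subcategory[OF is_category_DeltaS_plus])
    fix X assume "X \<in> obs EpiDeltaS_plus"
    show "ident DeltaS_plus X \<in> arrs EpiDeltaS_plus"
      using is_categoryD(3)[OF is_category_DeltaS_plus, of X]
      by (auto simp: EpiDeltaS_plus_def epi_DeltaS_plus_iff)
  next
    fix L M assume LM: "L \<in> arrs EpiDeltaS_plus" "M \<in> arrs EpiDeltaS_plus"
      "src DeltaS_plus M = trg DeltaS_plus L"
    then have "cmp DeltaS_plus M L \<in> fibre_lists"
      using is_categoryD(6)[OF is_category_DeltaS_plus, of L M]
      by (simp add: EpiDeltaS_plus_def epi_DeltaS_plus_iff)
    then show "cmp DeltaS_plus M L \<in> arrs EpiDeltaS_plus"
      using cl[of M L] LM by (simp add: EpiDeltaS_plus_def epi_DeltaS_plus_iff del: DeltaS_plus_simps(3-6))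
  qed (auto simp: EpiDeltaS_plus_def epi_DeltaS_plus_iff)
qed

text \<open>Fibre lists and set maps with ordered fibres.\<close>

lemma fibre_unique:
  assumes "L \<in> fibre_lists" "i < length (concat L)"
  shows "\<exists>!j. j < length L \<and> i \<in> set (L ! j)"
proof -
  have d: "distinct (concat L)" and "i \<in> set (concat L)"
    using assms by (auto simp: fibre_lists_def simp del: set_concat length_concat)
  then obtain fibre where "fibre \<in> set L" "i \<in> set fibre" by auto
  then obtain j where "j < length L" "i \<in> set (L ! j)" by (metis in_set_conv_nth)
  moreover have "j = j'" if "j < length L" "i \<in> set (L ! j)" "j' < length L" "i \<in> set (L ! j')" for j j'
    using distinct_concat_nth[OF d] that by blast
  ultimately show ?thesis by blast
qed

lemma underlying_map_eq_iff:
  assumes "L \<in> fibre_lists" "i < length (concat L)" "j < length L"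
  shows "underlying_map L i = j \<longleftrightarrow> i \<in> set (L ! j)"
  using theI'[OF fibre_unique[OF assms(1,2)]] fibre_unique[OF assms(1,2)] assms(3)
  unfolding underlying_map_def by blast

lemma underlying_map_less:
  assumes "L \<in> fibre_lists" "i < length (concat L)"
  shows "underlying_map L i < length L"
  using theI'[OF fibre_unique[OF assms]] unfolding underlying_map_def by blast

lemma underlying_map_cmp:
  assumes L: "L \<in> fibre_lists" and M: "M \<in> fibre_lists" and LM: "length (concat M) = length L"
    and i: "i < length (concat L)"
  shows "underlying_map (cmp DeltaS_plus M L) i = underlying_map M (underlying_map L i)"
proof -
  let ?j = "underlying_map L i" and ?l = "underlying_map M (underlying_map L i)"
  have j: "?j < length L" by (rule underlying_map_less[OF L i])
  have l: "?l < length M" by (rule underlying_map_less[OF M]) (use j LM in simp)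
  have "i \<in> set (L ! ?j)" "?j \<in> set (M ! ?l)"
    using underlying_map_eq_iff[OF L i j] underlying_map_eq_iff[OF M _ l, of ?j] j LM by (auto simp del: length_concat)
  then have "i \<in> set (cmp DeltaS_plus M L ! ?l)" using l by auto
  then show ?thesis
    using underlying_map_eq_iff[of "cmp DeltaS_plus M L" i ?l] cmp_fibre_lists[OF L M LM] i l by simp
qed


section \<open>Augmented algebras and the symmetric bar construction\<close>

locale augmented_algebra = module k A + A: ring A
  for k :: "('k, 'r) ring_scheme" and A :: "('k, 'a) module" +
  fixes \<epsilon> :: "'a \<Rightarrow> 'k"
  assumes smult_mult_left: "\<lbrakk>r \<in> carrier k; x \<in> carrier A; y \<in> carrier A\<rbrakk> \<Longrightarrow>
      (r \<odot>\<^bsub>A\<^esub> x) \<otimes>\<^bsub>A\<^esub> y = r \<odot>\<^bsub>A\<^esub> (x \<otimes>\<^bsub>A\<^esub> y)"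
    and smult_mult_right: "\<lbrakk>r \<in> carrier k; x \<in> carrier A; y \<in> carrier A\<rbrakk> \<Longrightarrow>
      x \<otimes>\<^bsub>A\<^esub> (r \<odot>\<^bsub>A\<^esub> y) = r \<odot>\<^bsub>A\<^esub> (x \<otimes>\<^bsub>A\<^esub> y)"
    and aug_hom: "\<epsilon> \<in> ring_hom A k"
    and aug_linear: "\<lbrakk>r \<in> carrier k; x \<in> carrier A\<rbrakk> \<Longrightarrow> \<epsilon> (r \<odot>\<^bsub>A\<^esub> x) = r \<otimes>\<^bsub>k\<^esub> \<epsilon> x"

(* I = ker \<epsilon> as a non-unital algebra; the unit field still holds the unit of A. *)
definition aug_ideal ::
  "('k, 'r) ring_scheme \<Rightarrow> ('k, 'a) module \<Rightarrow> ('a \<Rightarrow> 'k) \<Rightarrow> ('k, 'a) module" where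
  "aug_ideal k A \<epsilon> = A\<lparr>carrier := a_kernel A k \<epsilon>\<rparr>"

(* On DeltaS and an algebra A this is B^sym A. On EpiDeltaS_plus and the augmentation ideal it is
   B^sym_+ I: all fibres are then non-empty, the products lie in I, and the value at [-1] is k. *)
definition sym_bar ::
  "('k, 'r) ring_scheme \<Rightarrow> ('k, 'a) module \<Rightarrow> (nat, nat list list, 'k, ('a list \<Rightarrow> 'k) set) kfun" where
  "sym_bar k A =
     \<lparr>fob = tensor_power k A,
      far = (\<lambda>L. let F = free_mod k (tuples A (length L)) in
        quot_map F (power_rels k A (length L))
          (lin_ext k F (\<lambda>as. fgen k
            (map (\<lambda>fibre. foldr (\<lambda>i b. as ! i \<otimes>\<^bsub>A\<^esub> b) fibre \<one>\<^bsub>A\<^esub>) L))))\<rparr>"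

definition symmetric_homology ::
  "('k, 'r) ring_scheme \<Rightarrow> ('k, 'a) module \<Rightarrow> nat \<Rightarrow>
   ('k, (nat \<Rightarrow> (nat list list, ('a list \<Rightarrow> 'k) set, 'k) res_gen \<Rightarrow> 'k) set set) module" where
  "symmetric_homology k A = functor_homology k DeltaS (sym_bar k A)"

end

(* For a category C and a functor F let bar C F be the complex that in degree n is the direct sum of
   F (X_0) over the composable chains X_0 -> ... -> X_n of C. It computes the derived functors of the
   colimit: projectives are retracts of free functors, on which the bar complex is acyclic, so the double
   complex bar C P_* of a projective resolution P_* of F has exact rows and columns and its two
   augmentations colim P_* and bar C F have the same homology. The bar complex of F is also the coend
   of k[N(- \ C)] with F, which gives the second isomorphism.

   For the first one, Delta S may be replaced by Delta S_+: adding a point is a functor from Delta S_+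
   to Delta S, and the inclusions n -> n + 1 are a natural transformation from the identity to it, so it
   induces a homotopy inverse on bar complexes. Every morphism of Delta S_+ is uniquely an epimorphism
   followed by an order-preserving injection, so the left Kan extension of B^sym_+ I from Epi Delta S_+
   has at [n] the summand I^(m) for every order-preserving injection with target [n], m being the number
   of points in its source. The splitting A = k 1 + I identifies this sum with the tensor power of A at
   [n], that is, B^sym A is that Kan extension. The extension is exact and preserves colimits and
   projectives, hence preserves the derived functors of the colimit. *)
theory Submission imports Defs
begin

section \<open>Linear maps, generated submodules and quotient modules\<close>

section \<open>Linear maps and quotients\<close>

text \<open>Homology is compared by linear relations rather than by maps. A cycle crosses the double
  complex through successive choices of preimages, so two cycles are called related when a staircase
  joins them. Linearity, totality on both sides and the matching of boundaries make this relation an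
  isomorphism.

  The effect of adding a point on homology is read off from the same double complex: an arrow of the
  category becomes an identity in every colimit, so the induced endomorphism fixes one augmentation
  and, through the staircases, acts trivially on the homology of the other.

  Element types shape the middle part. \<open>functor_homology\<close> fixes the type of its
  resolutions, while extending a resolution along the factorization changes it. The working notion
  is therefore \<open>split_kfun\<close>, a natural section of the canonical free cover, which makes
  sense for every type and passes to the extension; the bar complex is where resolutions of
  different types meet.

  The comparison of the extension with the tensor powers of A is inverted one summand at a
  time.\<close>

lemma mod_homI:
  assumes "\<And>x. x \<in> carrier M \<Longrightarrow> h x \<in> carrier N"
    and "\<And>x y. \<lbrakk>x \<in> carrier M; y \<in> carrier M\<rbrakk> \<Longrightarrow> h (x \<oplus>\<^bsub>M\<^esub> y) = h x \<oplus>\<^bsub>N\<^esub> h y"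
    and "\<And>r x. \<lbrakk>r \<in> carrier R; x \<in> carrier M\<rbrakk> \<Longrightarrow> h (r \<odot>\<^bsub>M\<^esub> x) = r \<odot>\<^bsub>N\<^esub> h x"
  shows "h \<in> mod_hom R M N"
  using assms unfolding mod_hom_def by auto

lemma mod_hom_id: "(\<lambda>x. x) \<in> mod_hom R M M"
  by (rule mod_homI) simp_all

lemma mod_hom_zero_map: "module R N \<Longrightarrow> (\<lambda>x. \<zero>\<^bsub>N\<^esub>) \<in> mod_hom R M N"
proof -
  assume "module R N"
  then interpret N: module R N .
  show ?thesis by (rule mod_homI) simp_all
qed

lemma mod_hom_add:
  assumes "module R N" "f \<in> mod_hom R M N" "g \<in> mod_hom R M N"
  shows "(\<lambda>x. f x \<oplus>\<^bsub>N\<^esub> g x) \<in> mod_hom R M N"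
proof -
  interpret N: module R N by fact
  note f = mod_homD[OF assms(2)] and g = mod_homD[OF assms(3)]
  show ?thesis
    by (rule mod_homI) (simp_all add: f g N.M.a_ac N.smult_r_distr)
qed

lemma mod_hom_smult:
  assumes "module R N" "f \<in> mod_hom R M N" "r \<in> carrier R"
  shows "(\<lambda>x. r \<odot>\<^bsub>N\<^esub> f x) \<in> mod_hom R M N"
proof -
  interpret N: module R N by fact
  note f = mod_homD[OF assms(2)]
  show ?thesis
    by (rule mod_homI)
      (simp_all add: f assms(3) N.smult_r_distr N.smult_assoc1[symmetric] N.R.m_comm)
qed

lemma mod_hom_a_inv:
  assumes "module R M" "module R N" "h \<in> mod_hom R M N" "x \<in> carrier M"
  shows "h (\<ominus>\<^bsub>M\<^esub> x) = \<ominus>\<^bsub>N\<^esub> h x"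
proof -
  interpret M: module R M by fact
  interpret N: module R N by fact
  have "h (\<ominus>\<^bsub>M\<^esub> x) \<oplus>\<^bsub>N\<^esub> h x = h (\<ominus>\<^bsub>M\<^esub> x \<oplus>\<^bsub>M\<^esub> x)"
    using mod_homD(2)[OF assms(3), of "\<ominus>\<^bsub>M\<^esub> x" x] assms(4) by simp
  also have "\<dots> = \<zero>\<^bsub>N\<^esub>"
    using mod_hom_zero[OF assms(1-3)] by (simp add: M.M.l_neg assms(4))
  finally show ?thesis
    using mod_homD(1)[OF assms(3)] assms(4) by (simp add: N.M.minus_equality)
qed

lemma mod_hom_neg:
  assumes "module R M" "module R N" "h \<in> mod_hom R M N"
  shows "(\<lambda>x. \<ominus>\<^bsub>N\<^esub> h x) \<in> mod_hom R M N"
proof -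
  interpret M: module R M by fact
  interpret N: module R N by fact
  note h = mod_homD[OF assms(3)]
  show ?thesis
    by (rule mod_homI) (simp_all add: h N.M.minus_add N.smult_r_minus)
qed

lemma mod_hom_minus:
  assumes "module R M" "module R N" "h \<in> mod_hom R M N" "x \<in> carrier M" "y \<in> carrier M"
  shows "h (x \<ominus>\<^bsub>M\<^esub> y) = h x \<ominus>\<^bsub>N\<^esub> h y"
proof -
  interpret M: module R M by fact
  interpret N: module R N by fact
  show ?thesis
    unfolding a_minus_def using mod_homD(2)[OF assms(3)] mod_hom_a_inv[OF assms(1-3)] assms(4,5) by simp
qed

lemma mod_hom_finsum:
  assumes "module R M" "module R N" "h \<in> mod_hom R M N" "f \<in> A \<rightarrow> carrier M"
  shows "h (\<Oplus>\<^bsub>M\<^esub>i\<in>A. f i) = (\<Oplus>\<^bsub>N\<^esub>i\<in>A. h (f i))"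
proof -
  interpret M: module R M by fact
  interpret N: module R N by fact
  note h = mod_homD[OF assms(3)]
  show ?thesis
  proof (cases "finite A")
    case True
    then show ?thesis using assms(4)
      by (induction A) (auto simp: mod_hom_zero[OF assms(1-3)] h Pi_iff)
  next
    case False
    then show ?thesis by (simp add: mod_hom_zero[OF assms(1-3)])
  qed
qed

lemma mod_hom_finsum_map:
  assumes "module R N" "finite A" "\<And>i. i \<in> A \<Longrightarrow> f i \<in> mod_hom R M N"
  shows "(\<lambda>x. \<Oplus>\<^bsub>N\<^esub>i\<in>A. f i x) \<in> mod_hom R M N"
proof -
  interpret N: module R N by fact
  note f = mod_homD[OF assms(3)]
  show ?thesis
  proof (rule mod_homI)
    fix x assume x: "x \<in> carrier M"
    show "(\<Oplus>\<^bsub>N\<^esub>i\<in>A. f i x) \<in> carrier N"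
      using f x by (intro N.M.finsum_closed) auto
    fix y assume y: "y \<in> carrier M"
    have "(\<Oplus>\<^bsub>N\<^esub>i\<in>A. f i (x \<oplus>\<^bsub>M\<^esub> y)) = (\<Oplus>\<^bsub>N\<^esub>i\<in>A. f i x \<oplus>\<^bsub>N\<^esub> f i y)"
      using f x y by (intro N.M.finsum_cong') auto
    then show "(\<Oplus>\<^bsub>N\<^esub>i\<in>A. f i (x \<oplus>\<^bsub>M\<^esub> y)) = (\<Oplus>\<^bsub>N\<^esub>i\<in>A. f i x) \<oplus>\<^bsub>N\<^esub> (\<Oplus>\<^bsub>N\<^esub>i\<in>A. f i y)"
      using f x y by (subst N.M.finsum_addf[symmetric]) auto
  next
    fix r x assume rx: "r \<in> carrier R" "x \<in> carrier M"
    have "(\<Oplus>\<^bsub>N\<^esub>i\<in>A. f i (r \<odot>\<^bsub>M\<^esub> x)) = (\<Oplus>\<^bsub>N\<^esub>i\<in>A. r \<odot>\<^bsub>N\<^esub> f i x)"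
      using f rx by (intro N.M.finsum_cong') auto
    then show "(\<Oplus>\<^bsub>N\<^esub>i\<in>A. f i (r \<odot>\<^bsub>M\<^esub> x)) = r \<odot>\<^bsub>N\<^esub> (\<Oplus>\<^bsub>N\<^esub>i\<in>A. f i x)"
      using f rx assms(2) by (subst N.finsum_smult_ldistr) auto
  qed
qed

lemma submodule_preimage:
  assumes "module R M" "module R N" "h \<in> mod_hom R M N" "submodule V R N"
  shows "submodule {x \<in> carrier M. h x \<in> V} R M"
proof -
  interpret M: module R M by fact
  interpret N: module R N by fact
  note V = N.submoduleE[OF assms(4)] and h = mod_homD[OF assms(3)]
  have "\<zero>\<^bsub>N\<^esub> \<in> V" using V(1,2,3,5) N.M.r_neg by (metis ex_in_conv subsetD)
  then show ?thesis
    by (intro M.submoduleI)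
      (auto simp: h mod_hom_zero[OF assms(1-3)] mod_hom_a_inv[OF assms(1-3)] V)
qed

lemma submodule_zero:
  assumes "module R M"
  shows "submodule {\<zero>\<^bsub>M\<^esub>} R M"
proof -
  interpret M: module R M by fact
  show ?thesis by (rule M.submoduleI) auto
qed

lemma submodule_kernel:
  assumes "module R M" "module R N" "h \<in> mod_hom R M N"
  shows "submodule {x \<in> carrier M. h x = \<zero>\<^bsub>N\<^esub>} R M"
  using submodule_preimage[OF assms submodule_zero[OF assms(2)]] by simp

lemma submodule_image:
  assumes "module R M" "module R N" "h \<in> mod_hom R M N"
  shows "submodule (h ` carrier M) R N"
proof -
  interpret M: module R M by fact
  interpret N: module R N by fact
  note h = mod_homD[OF assms(3)]
  show ?thesis
  proof (rule N.submoduleI)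
    show "\<zero>\<^bsub>N\<^esub> \<in> h ` carrier M"
      by (rule image_eqI[where x = "\<zero>\<^bsub>M\<^esub>"]) (simp_all add: mod_hom_zero[OF assms])
  next
    fix a assume "a \<in> h ` carrier M"
    then obtain x where "x \<in> carrier M" "a = h x" by auto
    then show "\<ominus>\<^bsub>N\<^esub> a \<in> h ` carrier M"
      by (intro image_eqI[where x = "\<ominus>\<^bsub>M\<^esub> x"]) (simp_all add: mod_hom_a_inv[OF assms])
  next
    fix a b assume "a \<in> h ` carrier M" "b \<in> h ` carrier M"
    then obtain x y where "x \<in> carrier M" "a = h x" "y \<in> carrier M" "b = h y" by auto
    then show "a \<oplus>\<^bsub>N\<^esub> b \<in> h ` carrier M"
      by (intro image_eqI[where x = "x \<oplus>\<^bsub>M\<^esub> y"]) (simp_all add: h)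
  next
    fix r a assume "r \<in> carrier R" "a \<in> h ` carrier M"
    then show "r \<odot>\<^bsub>N\<^esub> a \<in> h ` carrier M" by (auto simp: h(3)[symmetric])
  qed (auto simp: h)
qed

lemma submodule_mem_zero:
  assumes "module R M" "submodule U R M"
  shows "\<zero>\<^bsub>M\<^esub> \<in> U"
proof -
  interpret M: module R M by fact
  note U = M.submoduleE[OF assms(2)]
  show ?thesis using U(1,2,3,5) M.M.r_neg by (metis ex_in_conv subsetD)
qed

lemma submodule_minus:
  assumes "module R M" "submodule U R M" "x \<in> U" "y \<in> U"
  shows "x \<ominus>\<^bsub>M\<^esub> y \<in> U"
proof -
  interpret M: module R M by fact
  show ?thesis using M.submoduleE[OF assms(2)] assms(3,4) by (simp add: a_minus_def)
qed

lemma span_least: "\<lbrakk>submodule H R M; S \<subseteq> H\<rbrakk> \<Longrightarrow> span R M S \<subseteq> H"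
  unfolding span_def by auto

lemma span_incl: "S \<subseteq> span R M S"
  unfolding span_def by auto

lemma span_submodule:
  assumes "module R M" "S \<subseteq> carrier M"
  shows "submodule (span R M S) R M"
proof -
  interpret M: module R M by fact
  have "span R M S \<subseteq> carrier M" by (rule span_least[OF M.carrier_is_submodule assms(2)])
  then show ?thesis
  proof (rule M.submoduleI)
    show "\<zero>\<^bsub>M\<^esub> \<in> span R M S"
      unfolding span_def using submodule_mem_zero[OF M.module_axioms] by auto
  qed (use M.submoduleE(3-5) in \<open>auto simp: span_def\<close>)
qed

text \<open>The kernel is a submodule containing the generators. Maps out of colimits, tensor
  products, coends and tensor powers are shown to be well defined through this rule.\<close>

lemma span_hom_zero:
  assumes "module R M" "module R N" "h \<in> mod_hom R M N" "S \<subseteq> carrier M"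
    "\<And>x. x \<in> S \<Longrightarrow> h x = \<zero>\<^bsub>N\<^esub>" "x \<in> span R M S"
  shows "h x = \<zero>\<^bsub>N\<^esub>"
proof -
  have "span R M S \<subseteq> {x \<in> carrier M. h x = \<zero>\<^bsub>N\<^esub>}"
    by (rule span_least[OF submodule_kernel[OF assms(1-3)]]) (use assms(4,5) in auto)
  then show ?thesis using assms(6) by auto
qed

lemma span_hom_image:
  assumes "module R M" "module R N" "h \<in> mod_hom R M N" "S \<subseteq> carrier M"
    "submodule V R N" "\<And>x. x \<in> S \<Longrightarrow> h x \<in> V" "x \<in> span R M S"
  shows "h x \<in> V"
proof -
  have "span R M S \<subseteq> {x \<in> carrier M. h x \<in> V}"
    by (rule span_least[OF submodule_preimage[OF assms(1-3,5)]]) (use assms(4,6) in auto)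
  then show ?thesis using assms(7) by auto
qed

lemma minus_eq_zero_iff:
  assumes "module R M" "x \<in> carrier M" "y \<in> carrier M"
  shows "x \<ominus>\<^bsub>M\<^esub> y = \<zero>\<^bsub>M\<^esub> \<longleftrightarrow> x = y"
proof -
  interpret M: module R M by fact
  show ?thesis using assms(2,3) by (metis M.M.minus_equality M.M.minus_minus M.M.r_neg M.M.minus_closed
    M.M.a_inv_closed M.M.minus_eq)
qed

context
  fixes R :: "('k, 'r) ring_scheme" and M :: "('k, 'm) module" and U
  assumes M: "module R M" and U: "submodule U R M"
begin

interpretation M: module R M by (rule M)

lemma mem_coset: "x \<in> carrier M \<Longrightarrow> y \<in> U +>\<^bsub>M\<^esub> x \<longleftrightarrow> y \<in> carrier M \<and> y \<ominus>\<^bsub>M\<^esub> x \<in> U"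
proof -
  assume x: "x \<in> carrier M"
  have "y \<ominus>\<^bsub>M\<^esub> x \<in> U \<Longrightarrow> y \<in> carrier M \<Longrightarrow> \<exists>h\<in>U. y = h \<oplus>\<^bsub>M\<^esub> x"
    using x by (intro bexI[of _ "y \<ominus>\<^bsub>M\<^esub> x"]) (simp_all add: a_minus_def M.M.a_assoc M.M.l_neg)
  moreover have "h \<oplus>\<^bsub>M\<^esub> x \<ominus>\<^bsub>M\<^esub> x = h" if "h \<in> U" for h
    using that x M.submoduleE(1)[OF U] by (simp add: a_minus_def M.M.a_assoc M.M.r_neg subset_iff)
  ultimately show ?thesis
    using M.submoduleE(1)[OF U] x by (auto simp: a_r_coset_def' subset_iff)
qed

lemma coset_self: "x \<in> carrier M \<Longrightarrow> x \<in> U +>\<^bsub>M\<^esub> x"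
  by (simp add: mem_coset submodule_mem_zero[OF M U] M.M.r_neg a_minus_def)

lemma coset_eq_iff:
  "\<lbrakk>x \<in> carrier M; y \<in> carrier M\<rbrakk> \<Longrightarrow> U +>\<^bsub>M\<^esub> x = U +>\<^bsub>M\<^esub> y \<longleftrightarrow> x \<ominus>\<^bsub>M\<^esub> y \<in> U"
proof
  assume xy: "x \<in> carrier M" "y \<in> carrier M"
  { assume "U +>\<^bsub>M\<^esub> x = U +>\<^bsub>M\<^esub> y"
    then show "x \<ominus>\<^bsub>M\<^esub> y \<in> U" using coset_self[OF xy(1)] mem_coset[OF xy(2)] by simp }
  assume *: "x \<ominus>\<^bsub>M\<^esub> y \<in> U"
  have "z \<ominus>\<^bsub>M\<^esub> x \<in> U \<longleftrightarrow> z \<ominus>\<^bsub>M\<^esub> y \<in> U" if z: "z \<in> carrier M" for z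
  proof -
    have e: "z \<ominus>\<^bsub>M\<^esub> y = (z \<ominus>\<^bsub>M\<^esub> x) \<oplus>\<^bsub>M\<^esub> (x \<ominus>\<^bsub>M\<^esub> y)"
      using xy z by (simp add: a_minus_def M.M.a_assoc M.M.r_neg1)
    have e': "z \<ominus>\<^bsub>M\<^esub> x = (z \<ominus>\<^bsub>M\<^esub> y) \<oplus>\<^bsub>M\<^esub> \<ominus>\<^bsub>M\<^esub> (x \<ominus>\<^bsub>M\<^esub> y)"
    proof -
      have "\<ominus>\<^bsub>M\<^esub> (x \<ominus>\<^bsub>M\<^esub> y) = y \<ominus>\<^bsub>M\<^esub> x"
        using xy by (simp add: a_minus_def M.M.minus_add M.M.a_comm)
      then show ?thesis using xy z by (simp add: a_minus_def M.M.a_assoc M.M.r_neg1)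
    qed
    show ?thesis
    proof
      assume "z \<ominus>\<^bsub>M\<^esub> x \<in> U" then show "z \<ominus>\<^bsub>M\<^esub> y \<in> U" unfolding e using M.submoduleE(5)[OF U] * by simp
    next
      assume "z \<ominus>\<^bsub>M\<^esub> y \<in> U" then show "z \<ominus>\<^bsub>M\<^esub> x \<in> U" unfolding e' using M.submoduleE(3,5)[OF U] * by simp
    qed
  qed
  then show "U +>\<^bsub>M\<^esub> x = U +>\<^bsub>M\<^esub> y" using mem_coset[OF xy(1)] mem_coset[OF xy(2)] by blast
qed

lemma quot_carrier: "carrier (quot_mod M U) = (\<lambda>x. U +>\<^bsub>M\<^esub> x) ` carrier M"
  by (auto simp: quot_mod_def A_RCOSETS_def RCOSETS_def a_r_coset_def)

lemma quot_coset_closed: "x \<in> carrier M \<Longrightarrow> U +>\<^bsub>M\<^esub> x \<in> carrier (quot_mod M U)"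
  by (simp add: quot_carrier)

lemma quot_cosetE:
  assumes "K \<in> carrier (quot_mod M U)" obtains x where "x \<in> carrier M" "K = U +>\<^bsub>M\<^esub> x"
  using assms by (auto simp: quot_carrier)

text \<open>In \<open>quot_mod\<close> the zero is the submodule itself; written as a coset it fits
  the rules for sums and multiples, which compute on representatives.\<close>

lemma quot_zero: "\<zero>\<^bsub>quot_mod M U\<^esub> = U +>\<^bsub>M\<^esub> \<zero>\<^bsub>M\<^esub>"
proof -
  have "y \<in> U +>\<^bsub>M\<^esub> \<zero>\<^bsub>M\<^esub> \<longleftrightarrow> y \<in> U" for y
    using M.submoduleE(1)[OF U] by (auto simp: mem_coset a_minus_def subset_iff)
  then show ?thesis by (auto simp: quot_mod_def)
qed

lemma quot_add:
  assumes "x \<in> carrier M" "y \<in> carrier M"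
  shows "(U +>\<^bsub>M\<^esub> x) \<oplus>\<^bsub>quot_mod M U\<^esub> (U +>\<^bsub>M\<^esub> y) = U +>\<^bsub>M\<^esub> (x \<oplus>\<^bsub>M\<^esub> y)"
proof -
  have xy: "x \<oplus>\<^bsub>M\<^esub> y \<in> carrier M" using assms by simp
  note UE = M.submoduleE[OF U]
  have "(U +>\<^bsub>M\<^esub> x) <+>\<^bsub>M\<^esub> (U +>\<^bsub>M\<^esub> y) = U +>\<^bsub>M\<^esub> (x \<oplus>\<^bsub>M\<^esub> y)"
  proof (intro equalityI subsetI)
    fix z assume "z \<in> (U +>\<^bsub>M\<^esub> x) <+>\<^bsub>M\<^esub> (U +>\<^bsub>M\<^esub> y)"
    then obtain u v where u: "u \<in> U" "v \<in> U" "z = (u \<oplus>\<^bsub>M\<^esub> x) \<oplus>\<^bsub>M\<^esub> (v \<oplus>\<^bsub>M\<^esub> y)"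
      by (auto simp: set_add_def set_mult_def a_r_coset_def')
    then have "z = (u \<oplus>\<^bsub>M\<^esub> v) \<oplus>\<^bsub>M\<^esub> (x \<oplus>\<^bsub>M\<^esub> y)" "u \<oplus>\<^bsub>M\<^esub> v \<in> U"
      using UE assms by (auto simp: M.M.a_ac subset_iff)
    then show "z \<in> U +>\<^bsub>M\<^esub> (x \<oplus>\<^bsub>M\<^esub> y)" by (auto simp: a_r_coset_def')
  next
    fix z assume "z \<in> U +>\<^bsub>M\<^esub> (x \<oplus>\<^bsub>M\<^esub> y)"
    then obtain u where u: "u \<in> U" "z = u \<oplus>\<^bsub>M\<^esub> (x \<oplus>\<^bsub>M\<^esub> y)" by (auto simp: a_r_coset_def')
    then have "z = (u \<oplus>\<^bsub>M\<^esub> x) \<oplus>\<^bsub>M\<^esub> (\<zero>\<^bsub>M\<^esub> \<oplus>\<^bsub>M\<^esub> y)" "\<zero>\<^bsub>M\<^esub> \<in> U"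
      using UE assms submodule_mem_zero[OF M U] by (auto simp: M.M.a_ac subset_iff)
    then show "z \<in> (U +>\<^bsub>M\<^esub> x) <+>\<^bsub>M\<^esub> (U +>\<^bsub>M\<^esub> y)"
      using u(1) unfolding set_add_def set_mult_def a_r_coset_def' by auto
  qed
  then show ?thesis by (simp add: quot_mod_def)
qed

lemma quot_smult:
  assumes "r \<in> carrier R" "x \<in> carrier M"
  shows "r \<odot>\<^bsub>quot_mod M U\<^esub> (U +>\<^bsub>M\<^esub> x) = U +>\<^bsub>M\<^esub> (r \<odot>\<^bsub>M\<^esub> x)"
proof -
  note UE = M.submoduleE[OF U]
  have "U +>\<^bsub>M\<^esub> (r \<odot>\<^bsub>M\<^esub> y) = U +>\<^bsub>M\<^esub> (r \<odot>\<^bsub>M\<^esub> x)" if y: "y \<in> U +>\<^bsub>M\<^esub> x" for y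
  proof -
    have y': "y \<in> carrier M" "y \<ominus>\<^bsub>M\<^esub> x \<in> U" using y mem_coset[OF assms(2)] by auto
    have "r \<odot>\<^bsub>M\<^esub> y \<ominus>\<^bsub>M\<^esub> r \<odot>\<^bsub>M\<^esub> x = r \<odot>\<^bsub>M\<^esub> (y \<ominus>\<^bsub>M\<^esub> x)"
      using assms y' by (simp add: a_minus_def M.smult_r_distr M.smult_r_minus)
    then show ?thesis using assms y' UE(4) by (simp add: coset_eq_iff)
  qed
  then have "(\<Union>y\<in>U +>\<^bsub>M\<^esub> x. U +>\<^bsub>M\<^esub> (r \<odot>\<^bsub>M\<^esub> y)) = U +>\<^bsub>M\<^esub> (r \<odot>\<^bsub>M\<^esub> x)"
    using coset_self[OF assms(2)] by blast
  then show ?thesis by (simp add: quot_mod_def)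
qed

lemma quot_module: "module R (quot_mod M U)"
proof (rule moduleI)
  show "abelian_group (quot_mod M U)"
  proof (rule abelian_groupI)
    show "\<zero>\<^bsub>quot_mod M U\<^esub> \<in> carrier (quot_mod M U)" by (simp add: quot_zero quot_coset_closed)
  next
    fix x assume "x \<in> carrier (quot_mod M U)"
    then obtain a where a: "a \<in> carrier M" "x = U +>\<^bsub>M\<^esub> a" by (rule quot_cosetE)
    then show "\<exists>y\<in>carrier (quot_mod M U). y \<oplus>\<^bsub>quot_mod M U\<^esub> x = \<zero>\<^bsub>quot_mod M U\<^esub>"
      by (intro bexI[of _ "U +>\<^bsub>M\<^esub> (\<ominus>\<^bsub>M\<^esub> a)"]) (simp_all add: quot_coset_closed quot_add quot_zero M.M.l_neg)
  qed (auto elim!: quot_cosetE simp: quot_add quot_zero quot_coset_closed M.M.a_ac)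
qed (auto elim!: quot_cosetE simp: quot_add quot_smult quot_coset_closed M.smult_r_distr
    M.smult_l_distr M.smult_assoc1 M.R.cring_axioms)

lemma quot_proj_hom: "(\<lambda>x. U +>\<^bsub>M\<^esub> x) \<in> mod_hom R M (quot_mod M U)"
  by (rule mod_homI) (simp_all add: quot_coset_closed quot_add quot_smult)

lemma quot_proj_eq_zero_iff: "x \<in> carrier M \<Longrightarrow> U +>\<^bsub>M\<^esub> x = \<zero>\<^bsub>quot_mod M U\<^esub> \<longleftrightarrow> x \<in> U"
proof -
  assume x: "x \<in> carrier M"
  have "\<ominus>\<^bsub>M\<^esub> \<zero>\<^bsub>M\<^esub> = \<zero>\<^bsub>M\<^esub>" using M.M.l_neg[OF M.M.zero_closed] by simp
  then have "x \<ominus>\<^bsub>M\<^esub> \<zero>\<^bsub>M\<^esub> = x" unfolding a_minus_def using M.M.r_zero[OF x] by (rule ssubst)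
  then show ?thesis using x by (simp add: quot_zero coset_eq_iff)
qed

end

text \<open>The union defining \<open>quot_map\<close> has equal members: two representatives differ
  by an element of \<open>U\<close>, and its image lies in \<open>V\<close>.\<close>

lemma quot_map_coset:
  assumes "module R M" "submodule U R M" "module R N" "submodule V R N" "h \<in> mod_hom R M N"
    "\<And>u. u \<in> U \<Longrightarrow> h u \<in> V" "x \<in> carrier M"
  shows "quot_map N V h (U +>\<^bsub>M\<^esub> x) = V +>\<^bsub>N\<^esub> h x"
proof -
  have "V +>\<^bsub>N\<^esub> h y = V +>\<^bsub>N\<^esub> h x" if y: "y \<in> U +>\<^bsub>M\<^esub> x" for y
  proof -
    have y': "y \<in> carrier M" "y \<ominus>\<^bsub>M\<^esub> x \<in> U" using y mem_coset[OF assms(1,2,7)] by auto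
    have "h y \<ominus>\<^bsub>N\<^esub> h x \<in> V"
      using assms(6)[OF y'(2)] mod_hom_minus[OF assms(1,3,5) y'(1) assms(7)] by simp
    then show ?thesis
      using coset_eq_iff[OF assms(3,4)] mod_homD(1)[OF assms(5)] y'(1) assms(7) by simp
  qed
  then show ?thesis using coset_self[OF assms(1,2,7)] unfolding quot_map_def by blast
qed

lemma quot_map_hom:
  assumes "module R M" "submodule U R M" "module R N" "submodule V R N" "h \<in> mod_hom R M N"
    "\<And>u. u \<in> U \<Longrightarrow> h u \<in> V"
  shows "quot_map N V h \<in> mod_hom R (quot_mod M U) (quot_mod N V)"
proof -
  interpret M: module R M by fact
  note q = quot_map_coset[OF assms] and h = mod_homD[OF assms(5)]
    and M = assms(1,2) and N = assms(3,4)
  show ?thesis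
    by (rule mod_homI)
      (auto elim!: quot_cosetE[OF M] simp: quot_add[OF M] quot_smult[OF M] q h
        quot_add[OF N] quot_smult[OF N] quot_coset_closed[OF N])
qed

text \<open>Evaluates at an arbitrary representative; the value is independent of the choice once
  \<open>h\<close> vanishes on the submodule that was divided out.\<close>

definition quot_lift :: "('m \<Rightarrow> 'n) \<Rightarrow> 'm set \<Rightarrow> 'n" where
  "quot_lift h K = h (SOME x. x \<in> K)"

lemma quot_lift_coset:
  assumes "module R M" "submodule U R M" "module R N" "h \<in> mod_hom R M N"
    "\<And>u. u \<in> U \<Longrightarrow> h u = \<zero>\<^bsub>N\<^esub>" "x \<in> carrier M"
  shows "quot_lift h (U +>\<^bsub>M\<^esub> x) = h x"
proof -
  let ?y = "SOME y. y \<in> U +>\<^bsub>M\<^esub> x"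
  have "?y \<in> U +>\<^bsub>M\<^esub> x" using coset_self[OF assms(1,2,6)] by (rule someI)
  then have y: "?y \<in> carrier M" "?y \<ominus>\<^bsub>M\<^esub> x \<in> U" using mem_coset[OF assms(1,2,6)] by auto
  have "h ?y \<ominus>\<^bsub>N\<^esub> h x = \<zero>\<^bsub>N\<^esub>"
    using assms(5)[OF y(2)] mod_hom_minus[OF assms(1,3,4) y(1) assms(6)] by simp
  then show ?thesis
    unfolding quot_lift_def
    using minus_eq_zero_iff[OF assms(3)] mod_homD(1)[OF assms(4)] y(1) assms(6) by blast
qed

lemma quot_lift_hom:
  assumes "module R M" "submodule U R M" "module R N" "h \<in> mod_hom R M N"
    "\<And>u. u \<in> U \<Longrightarrow> h u = \<zero>\<^bsub>N\<^esub>"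
  shows "quot_lift h \<in> mod_hom R (quot_mod M U) N"
proof -
  interpret M: module R M by fact
  note q = quot_lift_coset[OF assms] and h = mod_homD[OF assms(4)] and M = assms(1,2)
  show ?thesis
    by (rule mod_homI)
      (auto elim!: quot_cosetE[OF M] simp: quot_add[OF M] quot_smult[OF M] q h)
qed

lemma mod_isomorphic_trans:
  "\<lbrakk>mod_isomorphic R L M; mod_isomorphic R M N\<rbrakk> \<Longrightarrow> mod_isomorphic R L N"
  unfolding mod_isomorphic_def by (auto intro: mod_hom_comp bij_betw_trans[unfolded comp_def])

text \<open>Correspondences that arise from choices, such as lifting through a double complex, are
  relations and not maps. Closure under sums and multiples gives closure under differences, and a
  difference lies in \<open>U\<close> exactly when its partner lies in \<open>V\<close>; so cosets
  agree on one side if and only if they agree on the other.\<close>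

lemma quot_iso_rel:
  assumes M: "module R M" and U: "submodule U R M" and N: "module R N" and V: "submodule V R N"
    and r: "r \<subseteq> carrier M \<times> carrier N"
    and r_add: "\<And>a b a' b'. \<lbrakk>(a, b) \<in> r; (a', b') \<in> r\<rbrakk> \<Longrightarrow> (a \<oplus>\<^bsub>M\<^esub> a', b \<oplus>\<^bsub>N\<^esub> b') \<in> r"
    and r_smult: "\<And>c a b. \<lbrakk>c \<in> carrier R; (a, b) \<in> r\<rbrakk> \<Longrightarrow> (c \<odot>\<^bsub>M\<^esub> a, c \<odot>\<^bsub>N\<^esub> b) \<in> r"
    and tot: "\<And>a. a \<in> carrier M \<Longrightarrow> \<exists>b. (a, b) \<in> r" and tot': "\<And>b. b \<in> carrier N \<Longrightarrow> \<exists>a. (a, b) \<in> r"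
    and UV: "\<And>a b. (a, b) \<in> r \<Longrightarrow> a \<in> U \<longleftrightarrow> b \<in> V"
  shows "mod_isomorphic R (quot_mod M U) (quot_mod N V)"
proof -
  interpret M: module R M by fact
  interpret N: module R N by fact
  \<comment> \<open>Negatives are multiples by -1, so closure under scalars provides them.\<close>
  have minus: "(a \<ominus>\<^bsub>M\<^esub> a', b \<ominus>\<^bsub>N\<^esub> b') \<in> r" if "(a, b) \<in> r" "(a', b') \<in> r" for a b a' b'
  proof -
    have "(\<ominus>\<^bsub>M\<^esub> a', \<ominus>\<^bsub>N\<^esub> b') \<in> r"
      using r_smult[OF M.R.a_inv_closed[OF M.R.one_closed] that(2)] r that(2)
      by (auto simp: M.smult_l_minus N.smult_l_minus)
    then show ?thesis using r_add[OF that(1)] by (simp add: a_minus_def)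
  qed
  have eq: "U +>\<^bsub>M\<^esub> a = U +>\<^bsub>M\<^esub> a' \<longleftrightarrow> V +>\<^bsub>N\<^esub> b = V +>\<^bsub>N\<^esub> b'" if "(a, b) \<in> r" "(a', b') \<in> r" for a b a' b'
    using coset_eq_iff[OF M U, of a a'] coset_eq_iff[OF N V, of b b'] UV[OF minus[OF that]] r that by auto
  \<comment> \<open>The value is the coset of any partner of any representative; \<open>eq\<close>
    makes all these choices agree.\<close>
  define h where "h K = (SOME L. \<exists>a b. (a, b) \<in> r \<and> K = U +>\<^bsub>M\<^esub> a \<and> L = V +>\<^bsub>N\<^esub> b)" for K
  have h: "h (U +>\<^bsub>M\<^esub> a) = V +>\<^bsub>N\<^esub> b" if ab: "(a, b) \<in> r" for a b
  proof -
    have "\<exists>L a' b'. (a', b') \<in> r \<and> U +>\<^bsub>M\<^esub> a = U +>\<^bsub>M\<^esub> a' \<and> L = V +>\<^bsub>N\<^esub> b'" using ab by blast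
    then have "\<exists>a' b'. (a', b') \<in> r \<and> U +>\<^bsub>M\<^esub> a = U +>\<^bsub>M\<^esub> a' \<and> h (U +>\<^bsub>M\<^esub> a) = V +>\<^bsub>N\<^esub> b'"
      unfolding h_def by (rule someI_ex)
    then show ?thesis using eq[OF ab] by metis
  qed
  have E: "\<exists>a b. (a, b) \<in> r \<and> K = U +>\<^bsub>M\<^esub> a \<and> a \<in> carrier M \<and> b \<in> carrier N" if "K \<in> carrier (quot_mod M U)" for K
    using that tot r by (auto elim!: quot_cosetE[OF M U]) blast
  have hom: "h \<in> mod_hom R (quot_mod M U) (quot_mod N V)"
  proof (rule mod_homI)
    fix K assume "K \<in> carrier (quot_mod M U)"
    then obtain a b where a: "(a, b) \<in> r" "K = U +>\<^bsub>M\<^esub> a" "a \<in> carrier M" "b \<in> carrier N" using E by blast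
    then show "h K \<in> carrier (quot_mod N V)" by (simp add: h quot_coset_closed[OF N V])
    { fix c assume "c \<in> carrier R"
      then show "h (c \<odot>\<^bsub>quot_mod M U\<^esub> K) = c \<odot>\<^bsub>quot_mod N V\<^esub> h K"
        using a by (simp add: h[OF a(1)] quot_smult[OF M U] quot_smult[OF N V] h[OF r_smult]) }
    fix L assume "L \<in> carrier (quot_mod M U)"
    then obtain a' b' where a': "(a', b') \<in> r" "L = U +>\<^bsub>M\<^esub> a'" "a' \<in> carrier M" "b' \<in> carrier N" using E by blast
    show "h (K \<oplus>\<^bsub>quot_mod M U\<^esub> L) = h K \<oplus>\<^bsub>quot_mod N V\<^esub> h L"
      using a a' by (simp add: h[OF a(1)] h[OF a'(1)] quot_add[OF M U] quot_add[OF N V] h[OF r_add[OF a(1) a'(1)]])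
  qed
  have "bij_betw h (carrier (quot_mod M U)) (carrier (quot_mod N V))"
    unfolding bij_betw_def
  proof
    show "inj_on h (carrier (quot_mod M U))"
    proof (rule inj_onI)
      fix K L assume K: "K \<in> carrier (quot_mod M U)" and L: "L \<in> carrier (quot_mod M U)" and hKL: "h K = h L"
      obtain a b where a: "(a, b) \<in> r" "K = U +>\<^bsub>M\<^esub> a" using E[OF K] by blast
      obtain a' b' where a': "(a', b') \<in> r" "L = U +>\<^bsub>M\<^esub> a'" using E[OF L] by blast
      show "K = L" using hKL eq[OF a(1) a'(1)] h[OF a(1)] h[OF a'(1)] a(2) a'(2) by simp
    qed
    show "h ` carrier (quot_mod M U) = carrier (quot_mod N V)"
    proof (intro equalityI subsetI)
      fix L assume "L \<in> h ` carrier (quot_mod M U)"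
      then show "L \<in> carrier (quot_mod N V)" by (auto simp: mod_homD(1)[OF hom])
    next
      fix L assume "L \<in> carrier (quot_mod N V)"
      then obtain b where b: "b \<in> carrier N" "L = V +>\<^bsub>N\<^esub> b" by (rule quot_cosetE[OF N V])
      then obtain a where a: "(a, b) \<in> r" using tot' by blast
      show "L \<in> h ` carrier (quot_mod M U)"
        by (rule image_eqI[where x = "U +>\<^bsub>M\<^esub> a"]) (use a b r in \<open>auto simp: h[OF a] quot_coset_closed[OF M U]\<close>)
    qed
  qed
  with hom show ?thesis unfolding mod_isomorphic_def by blast
qed

section \<open>Direct sums, their universal property and their exactness\<close>

section \<open>Direct sums\<close>

definition dsum_lift ::
  "'i set \<Rightarrow> ('i \<Rightarrow> ('k, 'm) module) \<Rightarrow> ('k, 'n) module \<Rightarrow> ('i \<Rightarrow> 'm \<Rightarrow> 'n) \<Rightarrow> ('i \<Rightarrow> 'm) \<Rightarrow> 'n" where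
  "dsum_lift I M N h f = (\<Oplus>\<^bsub>N\<^esub>i\<in>{i\<in>I. f i \<noteq> \<zero>\<^bsub>M i\<^esub>}. h i (f i))"

context
  fixes R :: "('k, 'r) ring_scheme" and I :: "'i set" and M :: "'i \<Rightarrow> ('k, 'm) module"
  assumes R: "cring R" and M: "\<And>i. i \<in> I \<Longrightarrow> module R (M i)"
begin

lemma dsum_carrierD:
  assumes "f \<in> carrier (dsum I M)"
  shows "i \<in> I \<Longrightarrow> f i \<in> carrier (M i)" "finite {i\<in>I. f i \<noteq> \<zero>\<^bsub>M i\<^esub>}" "f \<in> extensional I"
  using assms by (auto simp: dsum_def PiE_iff)

lemma dsum_carrierI:
  assumes "\<And>i. i \<in> I \<Longrightarrow> f i \<in> carrier (M i)" "finite T" "\<And>i. \<lbrakk>i \<in> I; i \<notin> T\<rbrakk> \<Longrightarrow> f i = \<zero>\<^bsub>M i\<^esub>" "f \<in> extensional I"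
  shows "f \<in> carrier (dsum I M)"
proof -
  have "finite {i\<in>I. f i \<noteq> \<zero>\<^bsub>M i\<^esub>}" by (rule finite_subset[OF _ assms(2)]) (use assms(3) in auto)
  then show ?thesis using assms(1,4) by (auto simp: dsum_def PiE_iff)
qed

lemma dsum_simps:
  "i \<in> I \<Longrightarrow> (f \<oplus>\<^bsub>dsum I M\<^esub> g) i = f i \<oplus>\<^bsub>M i\<^esub> g i" "i \<in> I \<Longrightarrow> (r \<odot>\<^bsub>dsum I M\<^esub> f) i = r \<odot>\<^bsub>M i\<^esub> f i"
  "i \<in> I \<Longrightarrow> \<zero>\<^bsub>dsum I M\<^esub> i = \<zero>\<^bsub>M i\<^esub>"
  "f \<oplus>\<^bsub>dsum I M\<^esub> g \<in> extensional I" "r \<odot>\<^bsub>dsum I M\<^esub> f \<in> extensional I" "\<zero>\<^bsub>dsum I M\<^esub> \<in> extensional I"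
  by (auto simp: dsum_def)

lemma dsum_eqI:
  "\<lbrakk>f \<in> extensional I; g \<in> extensional I; \<And>i. i \<in> I \<Longrightarrow> f i = g i\<rbrakk> \<Longrightarrow> f = g"
  by (rule extensionalityI)

lemma dsum_add_closed:
  assumes "f \<in> carrier (dsum I M)" "g \<in> carrier (dsum I M)"
  shows "f \<oplus>\<^bsub>dsum I M\<^esub> g \<in> carrier (dsum I M)"
proof (rule dsum_carrierI[where T = "{i\<in>I. f i \<noteq> \<zero>\<^bsub>M i\<^esub>} \<union> {i\<in>I. g i \<noteq> \<zero>\<^bsub>M i\<^esub>}"])
  fix i assume i: "i \<in> I"
  interpret Mi: module R "M i" by (rule M[OF i])
  show "(f \<oplus>\<^bsub>dsum I M\<^esub> g) i \<in> carrier (M i)"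
    using i assms by (simp add: dsum_simps dsum_carrierD)
  show "(f \<oplus>\<^bsub>dsum I M\<^esub> g) i = \<zero>\<^bsub>M i\<^esub>" if "i \<notin> {i\<in>I. f i \<noteq> \<zero>\<^bsub>M i\<^esub>} \<union> {i\<in>I. g i \<noteq> \<zero>\<^bsub>M i\<^esub>}"
    using i that by (simp add: dsum_simps)
qed (use assms in \<open>auto simp: dsum_simps dsum_carrierD\<close>)

lemma dsum_smult_closed:
  assumes "r \<in> carrier R" "f \<in> carrier (dsum I M)"
  shows "r \<odot>\<^bsub>dsum I M\<^esub> f \<in> carrier (dsum I M)"
proof (rule dsum_carrierI[where T = "{i\<in>I. f i \<noteq> \<zero>\<^bsub>M i\<^esub>}"])
  fix i assume i: "i \<in> I"
  interpret Mi: module R "M i" by (rule M[OF i])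
  show "(r \<odot>\<^bsub>dsum I M\<^esub> f) i \<in> carrier (M i)"
    using i assms by (simp add: dsum_simps dsum_carrierD)
  show "(r \<odot>\<^bsub>dsum I M\<^esub> f) i = \<zero>\<^bsub>M i\<^esub>" if "i \<notin> {i\<in>I. f i \<noteq> \<zero>\<^bsub>M i\<^esub>}"
    using i that assms by (simp add: dsum_simps)
qed (use assms in \<open>auto simp: dsum_simps dsum_carrierD\<close>)

lemma dsum_zero_closed: "\<zero>\<^bsub>dsum I M\<^esub> \<in> carrier (dsum I M)"
proof (rule dsum_carrierI[where T = "{}"])
  fix i assume i: "i \<in> I"
  interpret Mi: module R "M i" by (rule M[OF i])
  show "\<zero>\<^bsub>dsum I M\<^esub> i \<in> carrier (M i)" using i by (simp add: dsum_simps)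
qed (auto simp: dsum_simps)

lemma dsum_module: "module R (dsum I M)"
proof -
  interpret R: cring R by (rule R)
  note ext = dsum_simps(4-6)
  show ?thesis
  proof (rule moduleI)
    show "abelian_group (dsum I M)"
    proof (rule abelian_groupI)
      fix f assume f: "f \<in> carrier (dsum I M)"
      show "\<exists>g\<in>carrier (dsum I M). g \<oplus>\<^bsub>dsum I M\<^esub> f = \<zero>\<^bsub>dsum I M\<^esub>"
      proof (intro bexI)
        show "(\<ominus>\<^bsub>R\<^esub> \<one>\<^bsub>R\<^esub>) \<odot>\<^bsub>dsum I M\<^esub> f \<oplus>\<^bsub>dsum I M\<^esub> f = \<zero>\<^bsub>dsum I M\<^esub>"
        proof (rule dsum_eqI[OF ext(1,3)])
          fix i assume i: "i \<in> I"
          interpret Mi: module R "M i" by (rule M[OF i])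
          show "((\<ominus>\<^bsub>R\<^esub> \<one>\<^bsub>R\<^esub>) \<odot>\<^bsub>dsum I M\<^esub> f \<oplus>\<^bsub>dsum I M\<^esub> f) i = \<zero>\<^bsub>dsum I M\<^esub> i"
            using i dsum_carrierD(1)[OF f i] by (simp add: dsum_simps Mi.smult_l_minus Mi.M.l_neg)
        qed
        show "(\<ominus>\<^bsub>R\<^esub> \<one>\<^bsub>R\<^esub>) \<odot>\<^bsub>dsum I M\<^esub> f \<in> carrier (dsum I M)" by (rule dsum_smult_closed[OF _ f]) simp
      qed
      show "\<zero>\<^bsub>dsum I M\<^esub> \<oplus>\<^bsub>dsum I M\<^esub> f = f"
      proof (rule dsum_eqI[OF ext(1) dsum_carrierD(3)[OF f]])
        fix i assume i: "i \<in> I"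
        interpret Mi: module R "M i" by (rule M[OF i])
        show "(\<zero>\<^bsub>dsum I M\<^esub> \<oplus>\<^bsub>dsum I M\<^esub> f) i = f i"
          using i dsum_carrierD(1)[OF f i] by (simp add: dsum_simps)
      qed
      fix g assume g: "g \<in> carrier (dsum I M)"
      show "f \<oplus>\<^bsub>dsum I M\<^esub> g = g \<oplus>\<^bsub>dsum I M\<^esub> f"
      proof (rule dsum_eqI[OF ext(1,1)])
        fix i assume i: "i \<in> I"
        interpret Mi: module R "M i" by (rule M[OF i])
        show "(f \<oplus>\<^bsub>dsum I M\<^esub> g) i = (g \<oplus>\<^bsub>dsum I M\<^esub> f) i"
          using i dsum_carrierD(1)[OF f i] dsum_carrierD(1)[OF g i] by (simp add: dsum_simps Mi.M.a_comm)
      qed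
      fix h assume h: "h \<in> carrier (dsum I M)"
      show "f \<oplus>\<^bsub>dsum I M\<^esub> g \<oplus>\<^bsub>dsum I M\<^esub> h = f \<oplus>\<^bsub>dsum I M\<^esub> (g \<oplus>\<^bsub>dsum I M\<^esub> h)"
      proof (rule dsum_eqI[OF ext(1,1)])
        fix i assume i: "i \<in> I"
        interpret Mi: module R "M i" by (rule M[OF i])
        show "(f \<oplus>\<^bsub>dsum I M\<^esub> g \<oplus>\<^bsub>dsum I M\<^esub> h) i = (f \<oplus>\<^bsub>dsum I M\<^esub> (g \<oplus>\<^bsub>dsum I M\<^esub> h)) i"
          using i dsum_carrierD(1)[OF f i] dsum_carrierD(1)[OF g i] dsum_carrierD(1)[OF h i]
          by (simp add: dsum_simps Mi.M.a_assoc)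
      qed
    qed (auto intro: dsum_add_closed dsum_zero_closed)
  next
    fix r f assume r: "r \<in> carrier R" and f: "f \<in> carrier (dsum I M)"
    show "r \<odot>\<^bsub>dsum I M\<^esub> f \<in> carrier (dsum I M)" by (rule dsum_smult_closed[OF r f])
    fix g assume g: "g \<in> carrier (dsum I M)"
    show "r \<odot>\<^bsub>dsum I M\<^esub> (f \<oplus>\<^bsub>dsum I M\<^esub> g) = r \<odot>\<^bsub>dsum I M\<^esub> f \<oplus>\<^bsub>dsum I M\<^esub> r \<odot>\<^bsub>dsum I M\<^esub> g"
    proof (rule dsum_eqI[OF ext(2,1)])
      fix i assume i: "i \<in> I"
      interpret Mi: module R "M i" by (rule M[OF i])
      show "(r \<odot>\<^bsub>dsum I M\<^esub> (f \<oplus>\<^bsub>dsum I M\<^esub> g)) i = (r \<odot>\<^bsub>dsum I M\<^esub> f \<oplus>\<^bsub>dsum I M\<^esub> r \<odot>\<^bsub>dsum I M\<^esub> g) i"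
        using i r dsum_carrierD(1)[OF f i] dsum_carrierD(1)[OF g i] by (simp add: dsum_simps Mi.smult_r_distr)
    qed
  next
    fix r s f assume rs: "r \<in> carrier R" "s \<in> carrier R" and f: "f \<in> carrier (dsum I M)"
    show "(r \<oplus>\<^bsub>R\<^esub> s) \<odot>\<^bsub>dsum I M\<^esub> f = r \<odot>\<^bsub>dsum I M\<^esub> f \<oplus>\<^bsub>dsum I M\<^esub> s \<odot>\<^bsub>dsum I M\<^esub> f"
    proof (rule dsum_eqI[OF ext(2,1)])
      fix i assume i: "i \<in> I"
      interpret Mi: module R "M i" by (rule M[OF i])
      show "((r \<oplus>\<^bsub>R\<^esub> s) \<odot>\<^bsub>dsum I M\<^esub> f) i = (r \<odot>\<^bsub>dsum I M\<^esub> f \<oplus>\<^bsub>dsum I M\<^esub> s \<odot>\<^bsub>dsum I M\<^esub> f) i"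
        using i rs dsum_carrierD(1)[OF f i] by (simp add: dsum_simps Mi.smult_l_distr)
    qed
    show "(r \<otimes>\<^bsub>R\<^esub> s) \<odot>\<^bsub>dsum I M\<^esub> f = r \<odot>\<^bsub>dsum I M\<^esub> (s \<odot>\<^bsub>dsum I M\<^esub> f)"
    proof (rule dsum_eqI[OF ext(2,2)])
      fix i assume i: "i \<in> I"
      interpret Mi: module R "M i" by (rule M[OF i])
      show "((r \<otimes>\<^bsub>R\<^esub> s) \<odot>\<^bsub>dsum I M\<^esub> f) i = (r \<odot>\<^bsub>dsum I M\<^esub> (s \<odot>\<^bsub>dsum I M\<^esub> f)) i"
        using i rs dsum_carrierD(1)[OF f i] by (simp add: dsum_simps Mi.smult_assoc1)
    qed
  next
    fix f assume f: "f \<in> carrier (dsum I M)"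
    show "\<one>\<^bsub>R\<^esub> \<odot>\<^bsub>dsum I M\<^esub> f = f"
    proof (rule dsum_eqI[OF ext(2) dsum_carrierD(3)[OF f]])
      fix i assume i: "i \<in> I"
      interpret Mi: module R "M i" by (rule M[OF i])
      show "(\<one>\<^bsub>R\<^esub> \<odot>\<^bsub>dsum I M\<^esub> f) i = f i"
        using i dsum_carrierD(1)[OF f i] by (simp add: dsum_simps)
    qed
  qed (rule R)
qed

lemma dsum_in_closed: "\<lbrakk>i \<in> I; x \<in> carrier (M i)\<rbrakk> \<Longrightarrow> dsum_in I M i x \<in> carrier (dsum I M)"
proof (rule dsum_carrierI[where T = "{i}"])
  fix j assume i: "i \<in> I" "x \<in> carrier (M i)" and j: "j \<in> I"
  interpret Mj: module R "M j" by (rule M[OF j])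
  show "dsum_in I M i x j \<in> carrier (M j)" using i j by (simp add: dsum_in_def)
qed (auto simp: dsum_in_def)

lemma dsum_in_hom: "i \<in> I \<Longrightarrow> dsum_in I M i \<in> mod_hom R (M i) (dsum I M)"
proof (rule mod_homI)
  fix x assume i: "i \<in> I" and x: "x \<in> carrier (M i)"
  show "dsum_in I M i x \<in> carrier (dsum I M)" by (rule dsum_in_closed[OF i x])
  { fix y assume y: "y \<in> carrier (M i)"
    show "dsum_in I M i (x \<oplus>\<^bsub>M i\<^esub> y) = dsum_in I M i x \<oplus>\<^bsub>dsum I M\<^esub> dsum_in I M i y"
    proof (rule dsum_eqI[OF _ dsum_simps(4)])
      fix j assume j: "j \<in> I"
      interpret Mj: module R "M j" by (rule M[OF j])
      show "dsum_in I M i (x \<oplus>\<^bsub>M i\<^esub> y) j = (dsum_in I M i x \<oplus>\<^bsub>dsum I M\<^esub> dsum_in I M i y) j"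
        using j by (simp add: dsum_simps) (simp add: dsum_in_def)
    qed (simp add: dsum_in_def) }
  { fix r assume r: "r \<in> carrier R"
    show "dsum_in I M i (r \<odot>\<^bsub>M i\<^esub> x) = r \<odot>\<^bsub>dsum I M\<^esub> dsum_in I M i x"
    proof (rule dsum_eqI[OF _ dsum_simps(5)])
      fix j assume j: "j \<in> I"
      interpret Mj: module R "M j" by (rule M[OF j])
      show "dsum_in I M i (r \<odot>\<^bsub>M i\<^esub> x) j = (r \<odot>\<^bsub>dsum I M\<^esub> dsum_in I M i x) j"
        using j r by (simp add: dsum_simps) (simp add: dsum_in_def)
    qed (simp add: dsum_in_def) }
qed

text \<open>Induction over a finite set \<open>T\<close> that merely contains the support: erasing
  the index j splits f into \<open>f(j := 0)\<close> and a generator at j. An index outside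
  \<open>I\<close> can be discarded from \<open>T\<close>.\<close>

lemma dsum_induct [consumes 1, case_names zero single add]:
  assumes f: "f \<in> carrier (dsum I M)" and z: "P \<zero>\<^bsub>dsum I M\<^esub>"
    and s: "\<And>i x. \<lbrakk>i \<in> I; x \<in> carrier (M i)\<rbrakk> \<Longrightarrow> P (dsum_in I M i x)"
    and a: "\<And>f g. \<lbrakk>f \<in> carrier (dsum I M); g \<in> carrier (dsum I M); P f; P g\<rbrakk> \<Longrightarrow> P (f \<oplus>\<^bsub>dsum I M\<^esub> g)"
  shows "P f"
proof -
  have "P f" if "finite T" "\<And>i. \<lbrakk>i \<in> I; i \<notin> T\<rbrakk> \<Longrightarrow> f i = \<zero>\<^bsub>M i\<^esub>" "f \<in> carrier (dsum I M)" for T f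
    using that
  proof (induction T arbitrary: f)
    case empty
    then have "f = \<zero>\<^bsub>dsum I M\<^esub>" by (intro dsum_eqI) (auto simp: dsum_simps dsum_carrierD)
    then show ?case using z by simp
  next
    case (insert j T)
    note fD = dsum_carrierD[OF insert.prems(2)]
    show ?case
    proof (cases "j \<in> I")
      case True
      interpret Mj: module R "M j" by (rule M[OF True])
      let ?f = "f(j := \<zero>\<^bsub>M j\<^esub>)"
      have f': "?f \<in> carrier (dsum I M)"
        by (rule dsum_carrierI[OF _ fD(2)]) (use fD True in \<open>auto simp: extensional_def\<close>)
      have "P ?f" by (rule insert.IH[OF _ f']) (use insert.prems in auto)
      moreover have "P (dsum_in I M j (f j))" by (rule s[OF True fD(1)[OF True]])
      moreover have "f = ?f \<oplus>\<^bsub>dsum I M\<^esub> dsum_in I M j (f j)"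
      proof (rule dsum_eqI[OF fD(3) dsum_simps(4)])
        fix i assume i: "i \<in> I"
        interpret Mi: module R "M i" by (rule M[OF i])
        show "f i = (?f \<oplus>\<^bsub>dsum I M\<^esub> dsum_in I M j (f j)) i"
          using i True fD(1)[OF i] fD(1)[OF True] by (cases "i = j") (simp_all add: dsum_simps, simp_all add: dsum_in_def)
      qed
      ultimately show ?thesis using a[OF f' dsum_in_closed[OF True fD(1)[OF True]]] by simp
    next
      case False
      show ?thesis by (rule insert.IH) (use insert.prems False in \<open>auto intro: insert.prems\<close>)
    qed
  qed
  from this[OF dsum_carrierD(2)[OF f] _ f] show ?thesis by simp
qed

lemma dsum_hom_eqI:
  assumes N: "module R N" and h: "h \<in> mod_hom R (dsum I M) N" and h': "h' \<in> mod_hom R (dsum I M) N"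
    and eq: "\<And>i x. \<lbrakk>i \<in> I; x \<in> carrier (M i)\<rbrakk> \<Longrightarrow> h (dsum_in I M i x) = h' (dsum_in I M i x)"
    and f: "f \<in> carrier (dsum I M)"
  shows "h f = h' f"
  using f
proof (induction rule: dsum_induct)
  case zero
  then show ?case using mod_hom_zero[OF dsum_module N h] mod_hom_zero[OF dsum_module N h'] by simp
qed (simp_all add: eq mod_homD(2)[OF h] mod_homD(2)[OF h'])

text \<open>Sums over the supports of different elements become comparable once they are all taken
  over a common finite set.\<close>

lemma dsum_lift_superset:
  assumes N: "module R N" and h: "\<And>i. i \<in> I \<Longrightarrow> h i \<in> mod_hom R (M i) N"
    and f: "f \<in> carrier (dsum I M)" and T: "finite T" "T \<subseteq> I" "{i\<in>I. f i \<noteq> \<zero>\<^bsub>M i\<^esub>} \<subseteq> T"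
  shows "dsum_lift I M N h f = (\<Oplus>\<^bsub>N\<^esub>i\<in>T. h i (f i))"
proof -
  interpret N: module R N by fact
  have "h i (f i) = \<zero>\<^bsub>N\<^esub>" if "i \<in> I" "f i = \<zero>\<^bsub>M i\<^esub>" for i
    using mod_hom_zero[OF M[OF that(1)] N h[OF that(1)]] that(2) by simp
  then show ?thesis unfolding dsum_lift_def
    using T mod_homD(1)[OF h] dsum_carrierD(1)[OF f]
    by (intro N.M.add.finprod_mono_neutral_cong_left) (auto simp: subset_iff)
qed

lemma dsum_lift_hom:
  assumes N: "module R N" and h: "\<And>i. i \<in> I \<Longrightarrow> h i \<in> mod_hom R (M i) N"
  shows "dsum_lift I M N h \<in> mod_hom R (dsum I M) N"
proof -
  interpret N: module R N by fact
  note hD = mod_homD[OF h] and sup = dsum_lift_superset[OF N h]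
  show ?thesis
  proof (rule mod_homI)
    fix f assume f: "f \<in> carrier (dsum I M)"
    note fD = dsum_carrierD[OF f]
    show "dsum_lift I M N h f \<in> carrier N" unfolding dsum_lift_def
      using fD hD by (intro N.M.finsum_closed) auto
    { fix r assume r: "r \<in> carrier R"
      have sub: "{i \<in> I. (r \<odot>\<^bsub>dsum I M\<^esub> f) i \<noteq> \<zero>\<^bsub>M i\<^esub>} \<subseteq> {i\<in>I. f i \<noteq> \<zero>\<^bsub>M i\<^esub>}"
        using r by (auto simp: dsum_simps module.smult_r_null[OF M])
      have "dsum_lift I M N h (r \<odot>\<^bsub>dsum I M\<^esub> f) = (\<Oplus>\<^bsub>N\<^esub>i\<in>{i\<in>I. f i \<noteq> \<zero>\<^bsub>M i\<^esub>}. h i ((r \<odot>\<^bsub>dsum I M\<^esub> f) i))"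
        by (rule sup[OF _ dsum_smult_closed[OF r f] fD(2) _ sub]) auto
      also have "\<dots> = (\<Oplus>\<^bsub>N\<^esub>i\<in>{i\<in>I. f i \<noteq> \<zero>\<^bsub>M i\<^esub>}. r \<odot>\<^bsub>N\<^esub> h i (f i))"
        using hD fD r by (intro N.M.finsum_cong') (auto simp: dsum_simps)
      also have "\<dots> = r \<odot>\<^bsub>N\<^esub> dsum_lift I M N h f" unfolding dsum_lift_def
        using hD fD r by (intro N.finsum_smult_ldistr[symmetric]) auto
      finally show "dsum_lift I M N h (r \<odot>\<^bsub>dsum I M\<^esub> f) = r \<odot>\<^bsub>N\<^esub> dsum_lift I M N h f" . }
    fix g assume g: "g \<in> carrier (dsum I M)"
    note gD = dsum_carrierD[OF g]
    let ?T = "{i\<in>I. f i \<noteq> \<zero>\<^bsub>M i\<^esub>} \<union> {i\<in>I. g i \<noteq> \<zero>\<^bsub>M i\<^esub>}"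
    have T: "finite ?T" "?T \<subseteq> I" using fD gD by auto
    have sub: "{i \<in> I. (f \<oplus>\<^bsub>dsum I M\<^esub> g) i \<noteq> \<zero>\<^bsub>M i\<^esub>} \<subseteq> ?T"
    proof
      fix i assume "i \<in> {i \<in> I. (f \<oplus>\<^bsub>dsum I M\<^esub> g) i \<noteq> \<zero>\<^bsub>M i\<^esub>}"
      then have i: "i \<in> I" "f i \<oplus>\<^bsub>M i\<^esub> g i \<noteq> \<zero>\<^bsub>M i\<^esub>" by (auto simp: dsum_simps)
      interpret Mi: module R "M i" by (rule M[OF i(1)])
      show "i \<in> ?T" using i by auto
    qed
    have "dsum_lift I M N h (f \<oplus>\<^bsub>dsum I M\<^esub> g) = (\<Oplus>\<^bsub>N\<^esub>i\<in>?T. h i ((f \<oplus>\<^bsub>dsum I M\<^esub> g) i))"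
      by (rule sup[OF _ dsum_add_closed[OF f g] T sub])
    also have "\<dots> = (\<Oplus>\<^bsub>N\<^esub>i\<in>?T. h i (f i) \<oplus>\<^bsub>N\<^esub> h i (g i))"
      using hD fD gD by (intro N.M.finsum_cong') (auto simp: dsum_simps)
    also have "\<dots> = (\<Oplus>\<^bsub>N\<^esub>i\<in>?T. h i (f i)) \<oplus>\<^bsub>N\<^esub> (\<Oplus>\<^bsub>N\<^esub>i\<in>?T. h i (g i))"
      using hD fD gD by (intro N.M.finsum_addf) auto
    also have "\<dots> = dsum_lift I M N h f \<oplus>\<^bsub>N\<^esub> dsum_lift I M N h g"
      using sup[OF _ f T] sup[OF _ g T] by simp
    finally show "dsum_lift I M N h (f \<oplus>\<^bsub>dsum I M\<^esub> g) = dsum_lift I M N h f \<oplus>\<^bsub>N\<^esub> dsum_lift I M N h g" .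
  qed
qed

lemma dsum_lift_in:
  assumes N: "module R N" and h: "\<And>i. i \<in> I \<Longrightarrow> h i \<in> mod_hom R (M i) N" and i: "i \<in> I" "x \<in> carrier (M i)"
  shows "dsum_lift I M N h (dsum_in I M i x) = h i x"
proof -
  interpret N: module R N by fact
  have "dsum_lift I M N h (dsum_in I M i x) = (\<Oplus>\<^bsub>N\<^esub>j\<in>{i}. h j (dsum_in I M i x j))"
    by (rule dsum_lift_superset[OF N h dsum_in_closed[OF i]]) (use i in \<open>auto simp: dsum_in_def\<close>)
  also have "\<dots> = h i x" using mod_homD(1)[OF h[OF i(1)] i(2)] i(1) by (simp add: dsum_in_def)
  finally show ?thesis .
qed

end

lemma dsum_map_hom:
  assumes R: "cring R" and M: "\<And>i. i \<in> I \<Longrightarrow> module R (M i)" and N: "\<And>i. i \<in> I \<Longrightarrow> module R (N i)"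
    and h: "\<And>i. i \<in> I \<Longrightarrow> h i \<in> mod_hom R (M i) (N i)"
  shows "dsum_map I h \<in> mod_hom R (dsum I M) (dsum I N)"
proof -
  note d = dsum_simps[OF R] and hD = mod_homD[OF h]
  show ?thesis
  proof (rule mod_homI)
    fix f assume f: "f \<in> carrier (dsum I M)"
    note fD = dsum_carrierD[OF R M f]
    show "dsum_map I h f \<in> carrier (dsum I N)"
      by (rule dsum_carrierI[OF R N, where T = "{i\<in>I. f i \<noteq> \<zero>\<^bsub>M i\<^esub>}"])
        (use fD in \<open>auto simp: dsum_map_def hD mod_hom_zero[OF M N h]\<close>)
    { fix g assume g: "g \<in> carrier (dsum I M)"
      note gD = dsum_carrierD[OF R M g]
      show "dsum_map I h (f \<oplus>\<^bsub>dsum I M\<^esub> g) = dsum_map I h f \<oplus>\<^bsub>dsum I N\<^esub> dsum_map I h g"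
        by (rule extensionalityI[of _ I]) (auto simp: d[OF N] d[OF M] dsum_map_def hD fD gD) }
    { fix r assume "r \<in> carrier R"
      then show "dsum_map I h (r \<odot>\<^bsub>dsum I M\<^esub> f) = r \<odot>\<^bsub>dsum I N\<^esub> dsum_map I h f"
        by (intro extensionalityI[of _ I]) (auto simp: d[OF N] d[OF M] dsum_map_def hD fD) }
  qed
qed

lemma dsum_map_in:
  assumes R: "cring R" and M: "\<And>i. i \<in> I \<Longrightarrow> module R (M i)" and N: "\<And>i. i \<in> I \<Longrightarrow> module R (N i)"
    and h: "\<And>i. i \<in> I \<Longrightarrow> h i \<in> mod_hom R (M i) (N i)" and i: "i \<in> I" "x \<in> carrier (M i)"
  shows "dsum_map I h (dsum_in I M i x) = dsum_in I N i (h i x)"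
  using mod_hom_zero[OF M N h] i by (auto simp: dsum_map_def dsum_in_def fun_eq_iff)

text \<open>Direct sums are exact: preimages of the components assemble into a preimage of the
  family. The predicate \<open>Q\<close> is \<open>True\<close> when surjectivity is wanted, and
  membership in the kernel of the next map when exactness is wanted.\<close>

lemma dsum_map_kernel:
  assumes R: "cring R" and L: "\<And>i. i \<in> I \<Longrightarrow> module R (L i)" and M: "\<And>i. i \<in> I \<Longrightarrow> module R (M i)"
    and g: "\<And>i. i \<in> I \<Longrightarrow> g i \<in> mod_hom R (L i) (M i)"
    and ex: "\<And>i x. \<lbrakk>i \<in> I; x \<in> carrier (M i); Q i x\<rbrakk> \<Longrightarrow> \<exists>y\<in>carrier (L i). g i y = x"
    and f: "f \<in> carrier (dsum I M)" "\<And>i. i \<in> I \<Longrightarrow> Q i (f i)"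
  shows "\<exists>y\<in>carrier (dsum I L). dsum_map I g y = f"
proof -
  note fD = dsum_carrierD[OF R M f(1)]
  have "\<forall>i\<in>I. \<exists>y. y \<in> carrier (L i) \<and> g i y = f i" using ex[OF _ fD(1) f(2)] by blast
  then obtain y where y: "\<And>i. i \<in> I \<Longrightarrow> y i \<in> carrier (L i) \<and> g i (y i) = f i" by metis
  \<comment> \<open>A chosen preimage of a zero component could be nonzero; it is replaced by zero
    there to keep the support finite.\<close>
  define y' where "y' = (\<lambda>i\<in>I. if f i = \<zero>\<^bsub>M i\<^esub> then \<zero>\<^bsub>L i\<^esub> else y i)"
  have z: "\<zero>\<^bsub>L i\<^esub> \<in> carrier (L i)" if "i \<in> I" for i
    using submodule_mem_zero[OF L[OF that] module.carrier_is_submodule[OF L[OF that]]] .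
  have "y' \<in> carrier (dsum I L)"
    by (rule dsum_carrierI[OF R L, where T = "{i\<in>I. f i \<noteq> \<zero>\<^bsub>M i\<^esub>}"]) (use fD y z in \<open>auto simp: y'_def\<close>)
  moreover have "dsum_map I g y' = f"
    by (rule extensionalityI[of _ I]) (use y fD in \<open>auto simp: dsum_map_def y'_def mod_hom_zero[OF L M g]\<close>)
  ultimately show ?thesis by blast
qed

section \<open>Homology as cycles modulo boundaries, and criteria for isomorphism\<close>

section \<open>Homology of chain complexes\<close>

definition is_complex :: "('k, 'r) ring_scheme \<Rightarrow> (nat \<Rightarrow> ('k, 'm) module) \<Rightarrow> (nat \<Rightarrow> 'm \<Rightarrow> 'm) \<Rightarrow> bool" where
  "is_complex R K d \<longleftrightarrow> (\<forall>n. module R (K n)) \<and> (\<forall>n. d n \<in> mod_hom R (K (Suc n)) (K n)) \<and>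
     (\<forall>n. \<forall>x\<in>carrier (K (Suc (Suc n))). d n (d (Suc n) x) = \<zero>\<^bsub>K n\<^esub>)"

definition cycles :: "(nat \<Rightarrow> ('k, 'm) module) \<Rightarrow> (nat \<Rightarrow> 'm \<Rightarrow> 'm) \<Rightarrow> nat \<Rightarrow> 'm set" where
  "cycles K d n = {x \<in> carrier (K n). \<forall>m. n = Suc m \<longrightarrow> d m x = \<zero>\<^bsub>K m\<^esub>}"

definition boundaries :: "(nat \<Rightarrow> ('k, 'm) module) \<Rightarrow> (nat \<Rightarrow> 'm \<Rightarrow> 'm) \<Rightarrow> nat \<Rightarrow> 'm set" where
  "boundaries K d n = d n ` carrier (K (Suc n))"

lemma is_complexD:
  assumes "is_complex R K d"
  shows "module R (K n)" "d n \<in> mod_hom R (K (Suc n)) (K n)"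
    "x \<in> carrier (K (Suc (Suc n))) \<Longrightarrow> d n (d (Suc n) x) = \<zero>\<^bsub>K n\<^esub>"
  using assms unfolding is_complex_def by blast+

lemma cycles_submodule:
  assumes "is_complex R K d"
  shows "submodule (cycles K d n) R (K n)"
proof (cases n)
  case 0
  then show ?thesis using module.carrier_is_submodule[OF is_complexD(1)[OF assms]] by (simp add: cycles_def)
next
  case (Suc m)
  then show ?thesis using submodule_kernel[OF is_complexD(1)[OF assms] is_complexD(1)[OF assms] is_complexD(2)[OF assms, of m]]
    by (simp add: cycles_def)
qed

lemma boundaries_submodule:
  assumes "is_complex R K d"
  shows "submodule (boundaries K d n) R (K n)"
  unfolding boundaries_def
  by (rule submodule_image[OF is_complexD(1)[OF assms] is_complexD(1)[OF assms] is_complexD(2)[OF assms]])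

lemma boundaries_subset_cycles:
  assumes "is_complex R K d"
  shows "boundaries K d n \<subseteq> cycles K d n"
  using mod_homD(1)[OF is_complexD(2)[OF assms]] is_complexD(3)[OF assms]
  by (auto simp: boundaries_def cycles_def)

text \<open>\<open>chain_homology\<close> divides the module of cycles by the boundaries, so these
  have to be a submodule of the restricted module and not only of the chains.\<close>

lemma submodule_restrict:
  assumes "module R M" "submodule U R M" "submodule Z R M" "U \<subseteq> Z"
  shows "submodule U R (M\<lparr>carrier := Z\<rparr>)"
proof -
  have Z: "module R (M\<lparr>carrier := Z\<rparr>)" by (rule submodule.submodule_is_module[OF assms(3,1)])
  have "module R (M\<lparr>carrier := U\<rparr>)" by (rule submodule.submodule_is_module[OF assms(2,1)])
  then show ?thesis using module.module_incl_imp_submodule[OF Z, of U] assms(4) by simp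
qed

lemma homology_iso_rel:
  assumes A: "is_complex R A dA" and B: "is_complex R C dB"
    and r: "r \<subseteq> cycles A dA n \<times> cycles C dB n"
    and r_add: "\<And>a b a' b'. \<lbrakk>(a, b) \<in> r; (a', b') \<in> r\<rbrakk> \<Longrightarrow> (a \<oplus>\<^bsub>A n\<^esub> a', b \<oplus>\<^bsub>C n\<^esub> b') \<in> r"
    and r_smult: "\<And>c a b. \<lbrakk>c \<in> carrier R; (a, b) \<in> r\<rbrakk> \<Longrightarrow> (c \<odot>\<^bsub>A n\<^esub> a, c \<odot>\<^bsub>C n\<^esub> b) \<in> r"
    and tot: "\<And>a. a \<in> cycles A dA n \<Longrightarrow> \<exists>b. (a, b) \<in> r" "\<And>b. b \<in> cycles C dB n \<Longrightarrow> \<exists>a. (a, b) \<in> r"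
    and bd: "\<And>a b. (a, b) \<in> r \<Longrightarrow> a \<in> boundaries A dA n \<longleftrightarrow> b \<in> boundaries C dB n"
  shows "mod_isomorphic R (chain_homology A dA n) (chain_homology C dB n)"
proof -
  have sub: "module R ((K n)\<lparr>carrier := cycles K d n\<rparr>)" "submodule (boundaries K d n) R ((K n)\<lparr>carrier := cycles K d n\<rparr>)"
    if "is_complex R K d" for K :: "nat \<Rightarrow> ('a, 'x) module" and d
    using submodule.submodule_is_module[OF cycles_submodule[OF that] is_complexD(1)[OF that]]
      submodule_restrict[OF is_complexD(1)[OF that] boundaries_submodule[OF that] cycles_submodule[OF that]
        boundaries_subset_cycles[OF that]] by auto
  show ?thesis
    unfolding chain_homology_def cycles_def[symmetric] boundaries_def[symmetric]
    by (rule quot_iso_rel[OF sub[OF A] sub[OF B], where r = r]) (use assms in simp_all)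
qed

text \<open>The two maps are asked to be inverse only on cycles and modulo boundaries, which is the
  form in which \<open>bar_map_endofunctor\<close> supplies the information.\<close>

lemma homology_iso_chain_maps:
  assumes A: "is_complex R A dA" and B: "is_complex R C dB"
    and f: "\<And>n. f n \<in> mod_hom R (A n) (C n)" and g: "\<And>n. g n \<in> mod_hom R (C n) (A n)"
    and fd: "\<And>n x. x \<in> carrier (A (Suc n)) \<Longrightarrow> f n (dA n x) = dB n (f (Suc n) x)"
    and gd: "\<And>n x. x \<in> carrier (C (Suc n)) \<Longrightarrow> g n (dB n x) = dA n (g (Suc n) x)"
    and gf: "\<And>x. x \<in> cycles A dA n \<Longrightarrow> x \<ominus>\<^bsub>A n\<^esub> g n (f n x) \<in> boundaries A dA n"
    and fg: "\<And>y. y \<in> cycles C dB n \<Longrightarrow> y \<ominus>\<^bsub>C n\<^esub> f n (g n y) \<in> boundaries C dB n"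
  shows "mod_isomorphic R (chain_homology A dA n) (chain_homology C dB n)"
proof -
  interpret A: module R "A n" by (rule is_complexD(1)[OF A])
  interpret C: module R "C n" by (rule is_complexD(1)[OF B])
  note fD = mod_homD[OF f] and gD = mod_homD[OF g]
  note ZA = A.submoduleE[OF cycles_submodule[OF A]] and ZB = C.submoduleE[OF cycles_submodule[OF B]]
  note UA = A.submoduleE[OF boundaries_submodule[OF A]] and UB = C.submoduleE[OF boundaries_submodule[OF B]]
  have fz: "f n x \<in> cycles C dB n" if "x \<in> cycles A dA n" for x
    using that fD(1) fd[symmetric] mod_hom_zero[OF is_complexD(1)[OF A] is_complexD(1)[OF B] f]
    by (auto simp: cycles_def)
  have gz: "g n x \<in> cycles A dA n" if "x \<in> cycles C dB n" for x
    using that gD(1) gd[symmetric] mod_hom_zero[OF is_complexD(1)[OF B] is_complexD(1)[OF A] g]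
    by (auto simp: cycles_def)
  have fb: "f n x \<in> boundaries C dB n" if "x \<in> boundaries A dA n" for x
    using that by (auto simp: boundaries_def fd fD(1))
  have gb: "g n x \<in> boundaries A dA n" if "x \<in> boundaries C dB n" for x
    using that by (auto simp: boundaries_def gd gD(1))
  have diff: "y \<in> U" if "module R M" "submodule U R M" "x \<ominus>\<^bsub>M\<^esub> y \<in> U" "x \<in> U" "x \<in> carrier M" "y \<in> carrier M"
    for M :: "('a, 'z) module" and U x y
  proof -
    interpret M: module R M by fact
    have "x \<ominus>\<^bsub>M\<^esub> (x \<ominus>\<^bsub>M\<^esub> y) = y"
      using that(5,6) by (simp add: a_minus_def M.M.minus_add M.M.r_neg1 M.M.r_neg2)
    then show ?thesis using submodule_minus[OF that(1,2,4,3)] by simp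
  qed
  have diff': "x \<in> U" if "module R M" "submodule U R M" "x \<ominus>\<^bsub>M\<^esub> y \<in> U" "y \<in> U" "x \<in> carrier M" "y \<in> carrier M"
    for M :: "('a, 'z) module" and U x y
  proof -
    interpret M: module R M by fact
    have "(x \<ominus>\<^bsub>M\<^esub> y) \<oplus>\<^bsub>M\<^esub> y = x"
      using that(5,6) by (simp add: a_minus_def M.M.a_assoc M.M.l_neg)
    then show ?thesis using M.submoduleE(5)[OF that(2,3,4)] by simp
  qed
  \<comment> \<open>The graph of the map that \<open>f\<close> induces on homology classes,
    saturated on the second side by boundaries. Starting from a cycle b, its partner is
    \<open>g n b\<close>, by \<open>fg\<close>.\<close>
  define r where "r = {(a, b). a \<in> cycles A dA n \<and> b \<in> cycles C dB n \<and> b \<ominus>\<^bsub>C n\<^esub> f n a \<in> boundaries C dB n}"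
  show ?thesis
  proof (rule homology_iso_rel[OF A B, where r = r])
    show "r \<subseteq> cycles A dA n \<times> cycles C dB n" by (auto simp: r_def)
  next
    fix a b a' b' assume *: "(a, b) \<in> r" "(a', b') \<in> r"
    then have c: "a \<in> carrier (A n)" "b \<in> carrier (C n)" "a' \<in> carrier (A n)" "b' \<in> carrier (C n)"
      using ZA(1) ZB(1) by (auto simp: r_def)
    have "(b \<oplus>\<^bsub>C n\<^esub> b') \<ominus>\<^bsub>C n\<^esub> f n (a \<oplus>\<^bsub>A n\<^esub> a') = (b \<ominus>\<^bsub>C n\<^esub> f n a) \<oplus>\<^bsub>C n\<^esub> (b' \<ominus>\<^bsub>C n\<^esub> f n a')"
      using c fD by (simp add: a_minus_def C.M.minus_add C.M.a_ac)
    then show "(a \<oplus>\<^bsub>A n\<^esub> a', b \<oplus>\<^bsub>C n\<^esub> b') \<in> r"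
      using * ZA(5) ZB(5) UB(5) by (simp add: r_def)
  next
    fix c a b assume *: "c \<in> carrier R" "(a, b) \<in> r"
    then have ab: "a \<in> carrier (A n)" "b \<in> carrier (C n)"
      using ZA(1) ZB(1) by (auto simp: r_def)
    have "(c \<odot>\<^bsub>C n\<^esub> b) \<ominus>\<^bsub>C n\<^esub> f n (c \<odot>\<^bsub>A n\<^esub> a) = c \<odot>\<^bsub>C n\<^esub> (b \<ominus>\<^bsub>C n\<^esub> f n a)"
      using ab *(1) fD by (simp add: a_minus_def C.smult_r_distr C.smult_r_minus)
    then show "(c \<odot>\<^bsub>A n\<^esub> a, c \<odot>\<^bsub>C n\<^esub> b) \<in> r"
      using * ZA(4) ZB(4) UB(4) by (simp add: r_def)
  next
    fix a assume a: "a \<in> cycles A dA n"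
    have "f n a \<ominus>\<^bsub>C n\<^esub> f n a = \<zero>\<^bsub>C n\<^esub>"
      using a ZA(1) fD(1) minus_eq_zero_iff[OF C.module_axioms] by blast
    then have "(a, f n a) \<in> r"
      using a fz submodule_mem_zero[OF C.module_axioms boundaries_submodule[OF B]] by (simp add: r_def)
    then show "\<exists>b. (a, b) \<in> r" by blast
  next
    fix b assume "b \<in> cycles C dB n"
    then have "(g n b, b) \<in> r" using gz fg by (simp add: r_def)
    then show "\<exists>a. (a, b) \<in> r" by blast
  next
    fix a b assume "(a, b) \<in> r"
    then have a: "a \<in> cycles A dA n" "b \<in> cycles C dB n" "b \<ominus>\<^bsub>C n\<^esub> f n a \<in> boundaries C dB n"
      by (auto simp: r_def)
    then have c: "a \<in> carrier (A n)" "b \<in> carrier (C n)" using ZA(1) ZB(1) by auto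
    show "a \<in> boundaries A dA n \<longleftrightarrow> b \<in> boundaries C dB n"
    proof
      assume "a \<in> boundaries A dA n"
      from diff'[OF C.module_axioms boundaries_submodule[OF B] a(3) fb[OF this]] show "b \<in> boundaries C dB n"
        using c fD(1) by blast
    next
      assume "b \<in> boundaries C dB n"
      from diff[OF C.module_axioms boundaries_submodule[OF B] a(3) this c(2) fD(1)[OF c(1)]]
      have "g n (f n a) \<in> boundaries A dA n" by (rule gb)
      from diff'[OF A.module_axioms boundaries_submodule[OF A] gf[OF a(1)] this c(1)]
      show "a \<in> boundaries A dA n" using c fD(1) gD(1) by blast
    qed
  qed
qed

text \<open>A degreewise inverse of a chain map is itself a chain map, so commutation with the
  differentials is assumed for \<open>f\<close> and deduced for \<open>g\<close>.\<close>

lemma homology_iso_inverse: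
  assumes A: "is_complex R A dA" and B: "is_complex R C dB"
    and f: "\<And>n. f n \<in> mod_hom R (A n) (C n)" and g: "\<And>n. g n \<in> mod_hom R (C n) (A n)"
    and fd: "\<And>n x. x \<in> carrier (A (Suc n)) \<Longrightarrow> f n (dA n x) = dB n (f (Suc n) x)"
    and gf: "\<And>n x. x \<in> carrier (A n) \<Longrightarrow> g n (f n x) = x"
    and fg: "\<And>n y. y \<in> carrier (C n) \<Longrightarrow> f n (g n y) = y"
  shows "mod_isomorphic R (chain_homology A dA n) (chain_homology C dB n)"
proof (rule homology_iso_chain_maps[where f = f and g = g, OF A B f g fd])
  fix n x assume x: "x \<in> carrier (C (Suc n))"
  note dA = mod_homD(1)[OF is_complexD(2)[OF A]] and gD = mod_homD(1)[OF g]
  have "g n (dB n x) = g n (dB n (f (Suc n) (g (Suc n) x)))" using fg x by simp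
  also have "\<dots> = g n (f n (dA n (g (Suc n) x)))" using fd gD x by simp
  also have "\<dots> = dA n (g (Suc n) x)" using gf dA gD x by simp
  finally show "g n (dB n x) = dA n (g (Suc n) x)" .
next
  fix x assume "x \<in> cycles A dA n"
  then have "x \<in> carrier (A n)" by (simp add: cycles_def)
  then have "x \<ominus>\<^bsub>A n\<^esub> g n (f n x) = \<zero>\<^bsub>A n\<^esub>" using gf minus_eq_zero_iff[OF is_complexD(1)[OF A]] by simp
  then show "x \<ominus>\<^bsub>A n\<^esub> g n (f n x) \<in> boundaries A dA n"
    using submodule_mem_zero[OF is_complexD(1)[OF A] boundaries_submodule[OF A]] by simp
next
  fix x assume "x \<in> cycles C dB n"
  then have "x \<in> carrier (C n)" by (simp add: cycles_def)
  then have "x \<ominus>\<^bsub>C n\<^esub> f n (g n x) = \<zero>\<^bsub>C n\<^esub>" using fg minus_eq_zero_iff[OF is_complexD(1)[OF B]] by simp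
  then show "x \<ominus>\<^bsub>C n\<^esub> f n (g n x) \<in> boundaries C dB n"
    using submodule_mem_zero[OF is_complexD(1)[OF B] boundaries_submodule[OF B]] by simp
qed

section \<open>The two augmentations of an exact double complex have the same homology\<close>

section \<open>Double complexes with exact rows and columns\<close>

(* The squares commute, no signs are inserted: the two augmentations are compared by zigzags and not
   through the total complex. *)
locale double_complex =
  fixes R :: "('k, 'r) ring_scheme"
    and X :: "nat \<Rightarrow> nat \<Rightarrow> ('k, 'x) module"
    and A :: "nat \<Rightarrow> ('k, 'a) module" and C :: "nat \<Rightarrow> ('k, 'c) module"
    and dh dv :: "nat \<Rightarrow> nat \<Rightarrow> 'x \<Rightarrow> 'x"
    and eps :: "nat \<Rightarrow> 'x \<Rightarrow> 'a" and eta :: "nat \<Rightarrow> 'x \<Rightarrow> 'c"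
    and dA :: "nat \<Rightarrow> 'a \<Rightarrow> 'a" and dC :: "nat \<Rightarrow> 'c \<Rightarrow> 'c"
  assumes A: "is_complex R A dA" and C: "is_complex R C dC"
    and X: "\<And>p q. module R (X p q)"
    and dh: "\<And>p q. dh p q \<in> mod_hom R (X (Suc p) q) (X p q)"
    and dv: "\<And>p q. dv p q \<in> mod_hom R (X p (Suc q)) (X p q)"
    and eps: "\<And>q. eps q \<in> mod_hom R (X 0 q) (A q)"
    and eta: "\<And>p. eta p \<in> mod_hom R (X p 0) (C p)"
    and comm: "\<And>p q x. x \<in> carrier (X (Suc p) (Suc q)) \<Longrightarrow> dh p q (dv (Suc p) q x) = dv p q (dh p (Suc q) x)"
    and eps_dv: "\<And>q x. x \<in> carrier (X 0 (Suc q)) \<Longrightarrow> eps q (dv 0 q x) = dA q (eps (Suc q) x)"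
    and eta_dh: "\<And>p x. x \<in> carrier (X (Suc p) 0) \<Longrightarrow> eta p (dh p 0 x) = dC p (eta (Suc p) x)"
    and dhdh: "\<And>p q x. x \<in> carrier (X (Suc (Suc p)) q) \<Longrightarrow> dh p q (dh (Suc p) q x) = \<zero>\<^bsub>X p q\<^esub>"
    and dvdv: "\<And>p q x. x \<in> carrier (X p (Suc (Suc q))) \<Longrightarrow> dv p q (dv p (Suc q) x) = \<zero>\<^bsub>X p q\<^esub>"
    and eps_dh: "\<And>q x. x \<in> carrier (X 1 q) \<Longrightarrow> eps q (dh 0 q x) = \<zero>\<^bsub>A q\<^esub>"
    and eta_dv: "\<And>p x. x \<in> carrier (X p 1) \<Longrightarrow> eta p (dv p 0 x) = \<zero>\<^bsub>C p\<^esub>"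
    and eps_surj: "\<And>q a. a \<in> carrier (A q) \<Longrightarrow> \<exists>x\<in>carrier (X 0 q). eps q x = a"
    and eta_surj: "\<And>p c. c \<in> carrier (C p) \<Longrightarrow> \<exists>x\<in>carrier (X p 0). eta p x = c"
    and eps_exact: "\<And>q x. \<lbrakk>x \<in> carrier (X 0 q); eps q x = \<zero>\<^bsub>A q\<^esub>\<rbrakk> \<Longrightarrow> \<exists>y\<in>carrier (X 1 q). dh 0 q y = x"
    and eta_exact: "\<And>p x. \<lbrakk>x \<in> carrier (X p 0); eta p x = \<zero>\<^bsub>C p\<^esub>\<rbrakk> \<Longrightarrow> \<exists>y\<in>carrier (X p 1). dv p 0 y = x"
    and dh_exact: "\<And>p q x. \<lbrakk>x \<in> carrier (X (Suc p) q); dh p q x = \<zero>\<^bsub>X p q\<^esub>\<rbrakk> \<Longrightarrow>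
      \<exists>y\<in>carrier (X (Suc (Suc p)) q). dh (Suc p) q y = x"
    and dv_exact: "\<And>p q x. \<lbrakk>x \<in> carrier (X p (Suc q)); dv p q x = \<zero>\<^bsub>X p q\<^esub>\<rbrakk> \<Longrightarrow>
      \<exists>y\<in>carrier (X p (Suc (Suc q))). dv p (Suc q) y = x"
begin

text \<open>The axioms are symmetric under transposition, so each statement about passing from one
  augmentation to the other gives its converse.\<close>

lemma double_complex_swap:
  "double_complex R (\<lambda>p q. X q p) C A (\<lambda>p q. dv q p) (\<lambda>p q. dh q p) eta eps dC dA"
  by (rule double_complex.intro)
    (use A C X dh dv eps eta comm eps_dv eta_dh dhdh dvdv eps_dh eta_dv eps_surj eta_surj
      eps_exact eta_exact dh_exact dv_exact in simp_all)

text \<open>A staircase along the antidiagonal of total degree n, ending in a on one side and in c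
  on the other. Up to signs it is a cycle of the total complex.\<close>

definition zigzag :: "nat \<Rightarrow> 'a \<Rightarrow> 'c \<Rightarrow> (nat \<Rightarrow> 'x) \<Rightarrow> bool" where
  "zigzag n a c x \<longleftrightarrow> (\<forall>p\<le>n. x p \<in> carrier (X p (n - p))) \<and> eps n (x 0) = a \<and> eta n (x n) = c \<and>
     (\<forall>p<n. dv p (n - Suc p) (x p) = dh p (n - Suc p) (x (Suc p)))"

lemma zigzagD:
  assumes "zigzag n a c x"
  shows "p \<le> n \<Longrightarrow> x p \<in> carrier (X p (n - p))" "eps n (x 0) = a" "eta n (x n) = c"
    "p < n \<Longrightarrow> dv p (n - Suc p) (x p) = dh p (n - Suc p) (x (Suc p))"
  using assms unfolding zigzag_def by blast+

lemma zigzag_swap: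
  assumes "zigzag n a c x"
  shows "double_complex.zigzag (\<lambda>p q. X q p) (\<lambda>p q. dv q p) (\<lambda>p q. dh q p) eta eps n c a (\<lambda>p. x (n - p))"
proof -
  have eq: "dh (n - Suc p) p (x (n - p)) = dv (n - Suc p) p (x (n - Suc p))" if "p < n" for p
  proof -
    have "n - Suc p < n" "n - Suc (n - Suc p) = p" "Suc (n - Suc p) = n - p" using that by auto
    then show ?thesis using assms unfolding zigzag_def by metis
  qed
  have c: "x (n - p) \<in> carrier (X (n - p) p)" if "p \<le> n" for p
    using assms that unfolding zigzag_def by (metis diff_diff_cancel diff_le_self)
  show ?thesis
    unfolding double_complex.zigzag_def[OF double_complex_swap]
    using assms eq c by (auto simp: zigzag_def)
qed

text \<open>The staircase is built by lifting along the exact rows. The vertical image of the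
  current element is killed by the next horizontal map: at the start because a is a cycle, later
  because the horizontal image of the current element is itself a vertical image, and
  \<open>dv\<close> squares to zero.\<close>

lemma zigzag_total:
  assumes a: "a \<in> cycles A dA n"
  shows "\<exists>c x. zigzag n a c x"
proof -
  have ac: "a \<in> carrier (A n)" using a by (simp add: cycles_def)
  have "\<exists>x. (\<forall>p\<le>m. x p \<in> carrier (X p (n - p))) \<and> eps n (x 0) = a \<and>
      (\<forall>p<m. dv p (n - Suc p) (x p) = dh p (n - Suc p) (x (Suc p)))" if "m \<le> n" for m
    using that
  proof (induction m)
    case 0
    obtain x0 where "x0 \<in> carrier (X 0 n)" "eps n x0 = a" using eps_surj[OF ac] by blast
    then show ?case by (intro exI[of _ "\<lambda>_. x0"]) auto
  next
    case (Suc m)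
    then obtain x where x: "\<And>p. p \<le> m \<Longrightarrow> x p \<in> carrier (X p (n - p))" "eps n (x 0) = a"
      "\<And>p. p < m \<Longrightarrow> dv p (n - Suc p) (x p) = dh p (n - Suc p) (x (Suc p))" by auto
    \<comment> \<open>The vertical degree of the element to be constructed, one less than that of
      \<open>x m\<close>.\<close>
    define q where "q = n - Suc m"
    have nm: "n - m = Suc q" using Suc.prems by (simp add: q_def)
    have xm: "x m \<in> carrier (X m (Suc q))" using x(1)[of m] nm by simp
    have dxm: "dv m q (x m) \<in> carrier (X m q)" by (rule mod_homD(1)[OF dv xm])
    have "\<exists>y\<in>carrier (X (Suc m) q). dh m q y = dv m q (x m)"
    proof (cases m)
      case 0
      then have n: "n = Suc q" using nm by simp
      have "eps q (dv 0 q (x 0)) = dA q (eps (Suc q) (x 0))" using eps_dv xm 0 by simp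
      also have "\<dots> = \<zero>\<^bsub>A q\<^esub>" using a x(2) n by (simp add: cycles_def)
      finally show ?thesis using eps_exact[of "dv 0 q (x 0)" q] dxm 0 by simp
    next
      case (Suc m')
      have nm': "n - m' = Suc (Suc q)" "n - Suc m' = Suc q" using nm Suc by simp_all
      have xm': "x m' \<in> carrier (X m' (Suc (Suc q)))" using x(1)[of m'] Suc nm' by simp
      have "dh m' q (dv (Suc m') q (x m)) = dv m' q (dh m' (Suc q) (x m))" using comm xm Suc by simp
      also have "dh m' (Suc q) (x m) = dv m' (Suc q) (x m')" using x(3)[of m'] Suc nm' by simp
      also have "dv m' q (dv m' (Suc q) (x m')) = \<zero>\<^bsub>X m' q\<^esub>" by (rule dvdv[OF xm'])
      finally show ?thesis using dh_exact[of "dv m q (x m)" m' q] dxm Suc by simp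
    qed
    then obtain y where y: "y \<in> carrier (X (Suc m) q)" "dh m q y = dv m q (x m)" by blast
    show ?case
    proof (intro exI[of _ "x(Suc m := y)"] conjI allI impI)
      fix p assume "p \<le> Suc m" then show "(x(Suc m := y)) p \<in> carrier (X p (n - p))"
        using x(1)[of p] y(1) by (auto simp: q_def le_Suc_eq)
    next
      fix p assume "p < Suc m"
      then show "dv p (n - Suc p) ((x(Suc m := y)) p) = dh p (n - Suc p) ((x(Suc m := y)) (Suc p))"
        using x(3)[of p] y(2) by (auto simp: q_def less_Suc_eq)
    qed (use x(2) in simp)
  qed
  from this[of n] show ?thesis unfolding zigzag_def by blast
qed

text \<open>The last step of the staircase rewrites the horizontal image of \<open>x n\<close> as a
  vertical image, which \<open>eta\<close> kills.\<close>

lemma zigzag_cycle: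
  assumes "zigzag n a c x"
  shows "c \<in> cycles C dC n"
proof -
  have x: "\<And>p. p \<le> n \<Longrightarrow> x p \<in> carrier (X p (n - p))" "eta n (x n) = c"
    "\<And>p. p < n \<Longrightarrow> dv p (n - Suc p) (x p) = dh p (n - Suc p) (x (Suc p))"
    using assms by (auto simp: zigzag_def)
  have "dC m c = \<zero>\<^bsub>C m\<^esub>" if n: "n = Suc m" for m
  proof -
    have "dC m c = eta m (dh m 0 (x n))" using eta_dh[of "x n" m] x(1)[of n] x(2) n by simp
    also have "dh m 0 (x n) = dv m 0 (x m)" using x(3)[of m] n by simp
    also have "eta m (dv m 0 (x m)) = \<zero>\<^bsub>C m\<^esub>" using eta_dv[of "x m" m] x(1)[of m] n by simp
    finally show ?thesis .
  qed
  moreover have "c \<in> carrier (C n)" using mod_homD(1)[OF eta, of "x n" n] x(1)[of n] x(2) by simp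
  ultimately show ?thesis by (simp add: cycles_def)
qed

text \<open>A second staircase y of total degree n + 1 starts over a preimage of a and fills the
  first one: each \<open>x p\<close> is the vertical image of \<open>y p\<close> plus the horizontal
  image of \<open>y (Suc p)\<close>. At the end \<open>eta\<close> kills the vertical part, and the
  horizontal part becomes a boundary.\<close>

lemma zigzag_boundary:
  assumes "zigzag n a c x" "a \<in> boundaries A dA n"
  shows "c \<in> boundaries C dC n"
proof -
  note x = zigzagD[OF assms(1)]
  obtain a' where a': "a' \<in> carrier (A (Suc n))" "a = dA n a'" using assms(2) by (auto simp: boundaries_def)
  have "\<exists>y. (\<forall>p\<le>m. y p \<in> carrier (X p (Suc n - p))) \<and> eps (Suc n) (y 0) = a' \<and>
      (\<forall>p<m. x p \<ominus>\<^bsub>X p (n - p)\<^esub> dv p (n - p) (y p) = dh p (n - p) (y (Suc p)))" if "m \<le> Suc n" for m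
    using that
  proof (induction m)
    case 0
    obtain y0 where "y0 \<in> carrier (X 0 (Suc n))" "eps (Suc n) y0 = a'" using eps_surj[OF a'(1)] by blast
    then show ?case by (intro exI[of _ "\<lambda>_. y0"]) auto
  next
    case (Suc m)
    then obtain y where y: "\<And>p. p \<le> m \<Longrightarrow> y p \<in> carrier (X p (Suc n - p))" "eps (Suc n) (y 0) = a'"
      "\<And>p. p < m \<Longrightarrow> x p \<ominus>\<^bsub>X p (n - p)\<^esub> dv p (n - p) (y p) = dh p (n - p) (y (Suc p))" by auto
    define q where "q = n - m"
    have nm: "Suc n - m = Suc q" using Suc.prems by (simp add: q_def)
    have ym: "y m \<in> carrier (X m (Suc q))" using y(1)[of m] nm by simp
    have xm: "x m \<in> carrier (X m q)" using x(1)[of m] Suc.prems by (simp add: q_def)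
    have dym: "dv m q (y m) \<in> carrier (X m q)" by (rule mod_homD(1)[OF dv ym])
    \<comment> \<open>The part of \<open>x m\<close> not yet filled by \<open>y m\<close>. The next
      horizontal map kills it, by the choice of a' at the start and by the previous equation of the
      staircase afterwards, so exactness provides \<open>y (Suc m)\<close>.\<close>
    define z where "z = x m \<ominus>\<^bsub>X m q\<^esub> dv m q (y m)"
    interpret Xm: module R "X m q" by (rule X)
    have z: "z \<in> carrier (X m q)" using xm dym by (simp add: z_def)
    have "\<exists>w\<in>carrier (X (Suc m) q). dh m q w = z"
    proof (cases m)
      case 0
      then have n: "n = q" using q_def by simp
      have "eps q z = eps q (x 0) \<ominus>\<^bsub>A q\<^esub> eps q (dv 0 q (y 0))"
        unfolding z_def using mod_hom_minus[OF X is_complexD(1)[OF A] eps] xm dym 0 by simp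
      also have "eps q (dv 0 q (y 0)) = a" using eps_dv[of "y 0" q] ym 0 y(2) n a'(2) by simp
      also have "eps q (x 0) \<ominus>\<^bsub>A q\<^esub> a = \<zero>\<^bsub>A q\<^esub>"
        using x(2) n mod_homD(1)[OF eps, of "x 0" q] xm 0 minus_eq_zero_iff[OF is_complexD(1)[OF A]] by auto
      finally show ?thesis using eps_exact[of z q] z 0 by simp
    next
      case (Suc m')
      have nm': "n - m' = Suc q" "n - Suc m' = q" "Suc n - m' = Suc (Suc q)" using Suc q_def nm by simp_all
      have ym': "y m' \<in> carrier (X m' (Suc (Suc q)))" using y(1)[of m'] Suc nm' by simp
      have xm': "x m' \<in> carrier (X m' (Suc q))" using x(1)[of m'] Suc nm' \<open>Suc m \<le> Suc n\<close> by simp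
      have "dh m' q z = dh m' q (x m) \<ominus>\<^bsub>X m' q\<^esub> dh m' q (dv m q (y m))"
        unfolding z_def using mod_hom_minus[OF X X dh] xm dym Suc by simp
      also have "dh m' q (dv m q (y m)) = dv m' q (dh m' (Suc q) (y m))" using comm ym Suc by simp
      also have "dh m' (Suc q) (y m) = x m' \<ominus>\<^bsub>X m' (Suc q)\<^esub> dv m' (Suc q) (y m')" using y(3)[of m'] Suc nm' by simp
      also have "dv m' q \<dots> = dv m' q (x m') \<ominus>\<^bsub>X m' q\<^esub> dv m' q (dv m' (Suc q) (y m'))"
        using mod_hom_minus[OF X X dv] xm' mod_homD(1)[OF dv ym'] by simp
      also have "dv m' q (dv m' (Suc q) (y m')) = \<zero>\<^bsub>X m' q\<^esub>" by (rule dvdv[OF ym'])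
      also have "dv m' q (x m') = dh m' q (x m)" using x(4)[of m'] Suc nm' \<open>Suc m \<le> Suc n\<close> by simp
      finally have e: "dh m' q z = dh m' q (x m) \<ominus>\<^bsub>X m' q\<^esub> (dh m' q (x m) \<ominus>\<^bsub>X m' q\<^esub> \<zero>\<^bsub>X m' q\<^esub>)" .
      interpret Xm': module R "X m' q" by (rule X)
      have c: "dh m' q (x m) \<in> carrier (X m' q)" using mod_homD(1)[OF dh] xm Suc by simp
      have "\<ominus>\<^bsub>X m' q\<^esub> \<zero>\<^bsub>X m' q\<^esub> = \<zero>\<^bsub>X m' q\<^esub>"
        using mod_hom_a_inv[OF X X mod_hom_zero_map[OF X] Xm'.M.zero_closed, of m' q] Xm'.M.l_neg[OF Xm'.M.zero_closed] by simp
      then have "dh m' q (x m) \<ominus>\<^bsub>X m' q\<^esub> \<zero>\<^bsub>X m' q\<^esub> = dh m' q (x m)" unfolding a_minus_def using Xm'.M.r_zero[OF c] by (rule ssubst)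
      then have "dh m' q z = \<zero>\<^bsub>X m' q\<^esub>" unfolding e using minus_eq_zero_iff[OF X] c by simp
      then show ?thesis using dh_exact[of z m' q] z Suc by simp
    qed
    then obtain w where w: "w \<in> carrier (X (Suc m) q)" "dh m q w = z" by blast
    show ?case
    proof (intro exI[of _ "y(Suc m := w)"] conjI allI impI)
      fix p assume "p \<le> Suc m" then show "(y(Suc m := w)) p \<in> carrier (X p (Suc n - p))"
        using y(1)[of p] w(1) by (auto simp: q_def le_Suc_eq)
    next
      fix p assume "p < Suc m"
      then show "x p \<ominus>\<^bsub>X p (n - p)\<^esub> dv p (n - p) ((y(Suc m := w)) p) = dh p (n - p) ((y(Suc m := w)) (Suc p))"
        using y(3)[of p] w(2) by (auto simp: q_def z_def less_Suc_eq)
    qed (use y(2) in simp)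
  qed
  from this[of "Suc n"] obtain y where y: "\<And>p. p \<le> Suc n \<Longrightarrow> y p \<in> carrier (X p (Suc n - p))"
    "x n \<ominus>\<^bsub>X n 0\<^esub> dv n 0 (y n) = dh n 0 (y (Suc n))"
    by (metis (no_types, lifting) diff_self_eq_0 le_refl lessI)
  have yn: "y n \<in> carrier (X n 1)" "y (Suc n) \<in> carrier (X (Suc n) 0)" "x n \<in> carrier (X n 0)"
    using y(1)[of n] y(1)[of "Suc n"] x(1)[of n] by (simp_all add: Suc_diff_le)
  interpret Xn: module R "X n 0" by (rule X)
  interpret Cn: module R "C n" by (rule is_complexD(1)[OF C])
  have dyn: "dv n 0 (y n) \<in> carrier (X n 0)" using mod_homD(1)[OF dv] yn by simp
  \<comment> \<open>Written this way, \<open>x n\<close> is a horizontal image plus a vertical one,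
    and only the horizontal one survives \<open>eta\<close>.\<close>
  have "x n = (x n \<ominus>\<^bsub>X n 0\<^esub> dv n 0 (y n)) \<oplus>\<^bsub>X n 0\<^esub> dv n 0 (y n)"
    using yn dyn by (simp add: a_minus_def Xn.M.a_assoc Xn.M.l_neg)
  then have "eta n (x n) = eta n (dh n 0 (y (Suc n)) \<oplus>\<^bsub>X n 0\<^esub> dv n 0 (y n))" using y(2) by simp
  also have "\<dots> = eta n (dh n 0 (y (Suc n))) \<oplus>\<^bsub>C n\<^esub> eta n (dv n 0 (y n))"
    using mod_homD(2)[OF eta mod_homD(1)[OF dh yn(2)] dyn] by simp
  also have "\<dots> = dC n (eta (Suc n) (y (Suc n)))"
    using eta_dh[OF yn(2)] eta_dv[OF yn(1)] mod_homD(1)[OF is_complexD(2)[OF C] mod_homD(1)[OF eta yn(2)]] by simp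
  finally show ?thesis using x(3) mod_homD(1)[OF eta yn(2)] by (auto simp: boundaries_def)
qed

lemma zigzag_add:
  assumes "zigzag n a c x" "zigzag n a' c' x'"
  shows "zigzag n (a \<oplus>\<^bsub>A n\<^esub> a') (c \<oplus>\<^bsub>C n\<^esub> c') (\<lambda>p. x p \<oplus>\<^bsub>X p (n - p)\<^esub> x' p)"
  unfolding zigzag_def
proof (intro conjI allI impI)
  note x = zigzagD[OF assms(1)] and x' = zigzagD[OF assms(2)]
  { fix p assume "p \<le> n"
    then show "x p \<oplus>\<^bsub>X p (n - p)\<^esub> x' p \<in> carrier (X p (n - p))"
      using mod_homD(2)[OF mod_hom_id] abelian_monoid.a_closed x(1) x'(1) X
      by (metis abelian_group.axioms(1) module.axioms(2)) }
  show "eps n (x 0 \<oplus>\<^bsub>X 0 (n - 0)\<^esub> x' 0) = a \<oplus>\<^bsub>A n\<^esub> a'"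
    using x(1)[of 0] x'(1)[of 0] by (simp add: mod_homD(2)[OF eps] x(2) x'(2))
  show "eta n (x n \<oplus>\<^bsub>X n (n - n)\<^esub> x' n) = c \<oplus>\<^bsub>C n\<^esub> c'"
    using x(1)[of n] x'(1)[of n] by (simp add: mod_homD(2)[OF eta] x(3) x'(3))
  fix p assume p: "p < n"
  define q where "q = n - Suc p"
  have q: "n - Suc p = q" "n - p = Suc q" using p by (simp_all add: q_def)
  show "dv p (n - Suc p) (x p \<oplus>\<^bsub>X p (n - p)\<^esub> x' p) =
      dh p (n - Suc p) (x (Suc p) \<oplus>\<^bsub>X (Suc p) (n - Suc p)\<^esub> x' (Suc p))"
    using x(1)[of p] x'(1)[of p] x(1)[of "Suc p"] x'(1)[of "Suc p"] x(4)[of p] x'(4)[of p] p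
    unfolding q by (simp add: mod_homD(2)[OF dv] mod_homD(2)[OF dh])
qed

lemma zigzag_smult:
  assumes "zigzag n a c x" "r \<in> carrier R"
  shows "zigzag n (r \<odot>\<^bsub>A n\<^esub> a) (r \<odot>\<^bsub>C n\<^esub> c) (\<lambda>p. r \<odot>\<^bsub>X p (n - p)\<^esub> x p)"
  unfolding zigzag_def
proof (intro conjI allI impI)
  note x = zigzagD[OF assms(1)]
  { fix p assume "p \<le> n"
    then show "r \<odot>\<^bsub>X p (n - p)\<^esub> x p \<in> carrier (X p (n - p))"
      using module.smult_closed[OF X assms(2)] x(1) by blast }
  show "eps n (r \<odot>\<^bsub>X 0 (n - 0)\<^esub> x 0) = r \<odot>\<^bsub>A n\<^esub> a"
    using x(1)[of 0] by (simp add: mod_homD(3)[OF eps assms(2)] x(2))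
  show "eta n (r \<odot>\<^bsub>X n (n - n)\<^esub> x n) = r \<odot>\<^bsub>C n\<^esub> c"
    using x(1)[of n] by (simp add: mod_homD(3)[OF eta assms(2)] x(3))
  fix p assume p: "p < n"
  define q where "q = n - Suc p"
  have q: "n - Suc p = q" "n - p = Suc q" using p by (simp_all add: q_def)
  show "dv p (n - Suc p) (r \<odot>\<^bsub>X p (n - p)\<^esub> x p) = dh p (n - Suc p) (r \<odot>\<^bsub>X (Suc p) (n - Suc p)\<^esub> x (Suc p))"
    using x(1)[of p] x(1)[of "Suc p"] x(4)[of p] p
    unfolding q by (simp add: mod_homD(3)[OF dv assms(2)] mod_homD(3)[OF dh assms(2)])
qed

lemma zigzag_boundary_iff:
  assumes "zigzag n a c x"
  shows "a \<in> boundaries A dA n \<longleftrightarrow> c \<in> boundaries C dC n"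
  using zigzag_boundary[OF assms] double_complex.zigzag_boundary[OF double_complex_swap zigzag_swap[OF assms]] by blast

text \<open>Being joined by a staircase is linear, total in both directions, and respects boundaries
  in both directions; the second direction is in each case the transposed statement.\<close>

theorem double_complex_homology_iso: "mod_isomorphic R (chain_homology A dA n) (chain_homology C dC n)"
proof (rule homology_iso_rel[OF A C, where r = "{(a, c). \<exists>x. zigzag n a c x}"])
  show "{(a, c). \<exists>x. zigzag n a c x} \<subseteq> cycles A dA n \<times> cycles C dC n"
    using zigzag_cycle double_complex.zigzag_cycle[OF double_complex_swap zigzag_swap] by blast
next
  fix a assume "a \<in> cycles A dA n"
  then show "\<exists>c. (a, c) \<in> {(a, c). \<exists>x. zigzag n a c x}" using zigzag_total by blast
next
  fix c assume "c \<in> cycles C dC n"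
  then obtain a x where "double_complex.zigzag (\<lambda>p q. X q p) (\<lambda>p q. dv q p) (\<lambda>p q. dh q p) eta eps n c a x"
    using double_complex.zigzag_total[OF double_complex_swap] by blast
  from double_complex.zigzag_swap[OF double_complex_swap this]
  show "\<exists>a. (a, c) \<in> {(a, c). \<exists>x. zigzag n a c x}" by auto
next
  fix a c assume "(a, c) \<in> {(a, c). \<exists>x. zigzag n a c x}"
  then show "a \<in> boundaries A dA n \<longleftrightarrow> c \<in> boundaries C dC n" using zigzag_boundary_iff by blast
qed (use zigzag_add zigzag_smult in blast)+

(* Such an endomorphism induces the identity on the first augmentation, hence on the homology of the
   second one. *)
lemma double_complex_endomorphism:
  assumes tX: "\<And>p q x. x \<in> carrier (X p q) \<Longrightarrow> tau p q x \<in> carrier (X p q)"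
    and tdh: "\<And>p q x. x \<in> carrier (X (Suc p) q) \<Longrightarrow> dh p q (tau (Suc p) q x) = tau p q (dh p q x)"
    and tdv: "\<And>p q x. x \<in> carrier (X p (Suc q)) \<Longrightarrow> dv p q (tau p (Suc q) x) = tau p q (dv p q x)"
    and teps: "\<And>q x. x \<in> carrier (X 0 q) \<Longrightarrow> eps q (tau 0 q x) = eps q x"
    and teta: "\<And>p x. x \<in> carrier (X p 0) \<Longrightarrow> eta p (tau p 0 x) = tC p (eta p x)"
    and c: "c \<in> cycles C dC n"
  shows "c \<ominus>\<^bsub>C n\<^esub> tC n c \<in> boundaries C dC n"
proof -
  interpret R: cring R using module.axioms(1)[OF X] .
  obtain a y where "double_complex.zigzag (\<lambda>p q. X q p) (\<lambda>p q. dv q p) (\<lambda>p q. dh q p) eta eps n c a y"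
    using double_complex.zigzag_total[OF double_complex_swap c] by blast
  from double_complex.zigzag_swap[OF double_complex_swap this]
  obtain x where z: "zigzag n a c x" by blast
  note x = zigzagD[OF z]
  \<comment> \<open>The image of the staircase under the endomorphism still starts at a, since
    \<open>tau\<close> does not change \<open>eps\<close>, but ends at
    \<open>tC n c\<close>.\<close>
  have "zigzag n a (tC n c) (\<lambda>p. tau p (n - p) (x p))"
    unfolding zigzag_def
  proof (intro conjI allI impI)
    fix p assume p: "p < n"
    then have np: "n - p = Suc (n - Suc p)" by simp
    show "dv p (n - Suc p) (tau p (n - p) (x p)) = dh p (n - Suc p) (tau (Suc p) (n - Suc p) (x (Suc p)))"
      using tdv[of "x p" p "n - Suc p"] tdh[of "x (Suc p)" p "n - Suc p"] x(1)[of p] x(1)[of "Suc p"] x(4)[of p] p np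
      by simp
  next
    show "eps n (tau 0 (n - 0) (x 0)) = a" using teps[of "x 0" n] x(1)[of 0] x(2) by simp
    show "eta n (tau n (n - n) (x n)) = tC n c" using teta[of "x n" n] x(1)[of n] x(3) by simp
  qed (use tX x in auto)
  \<comment> \<open>The difference of the two staircases runs from zero, which is a boundary, to
    \<open>c\<close> minus \<open>tC n c\<close>. Subtraction is addition of the multiple by
    -1.\<close>
  from zigzag_add[OF z zigzag_smult[OF this R.a_inv_closed[OF R.one_closed]]]
  have *: "zigzag n (a \<oplus>\<^bsub>A n\<^esub> (\<ominus>\<^bsub>R\<^esub> \<one>\<^bsub>R\<^esub>) \<odot>\<^bsub>A n\<^esub> a) (c \<oplus>\<^bsub>C n\<^esub> (\<ominus>\<^bsub>R\<^esub> \<one>\<^bsub>R\<^esub>) \<odot>\<^bsub>C n\<^esub> tC n c)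
    (\<lambda>p. x p \<oplus>\<^bsub>X p (n - p)\<^esub> (\<ominus>\<^bsub>R\<^esub> \<one>\<^bsub>R\<^esub>) \<odot>\<^bsub>X p (n - p)\<^esub> tau p (n - p) (x p))" .
  interpret A: module R "A n" by (rule is_complexD(1)[OF A])
  interpret C: module R "C n" by (rule is_complexD(1)[OF C])
  have a: "a \<in> carrier (A n)" using mod_homD(1)[OF eps, of "x 0" n] x(1)[of 0] x(2) by simp
  have "tC n c \<in> carrier (C n)"
    using teta[of "x n" n] x(1)[of n] x(3) mod_homD(1)[OF eta tX, of "x n" n] by simp
  then have "zigzag n \<zero>\<^bsub>A n\<^esub> (c \<ominus>\<^bsub>C n\<^esub> tC n c)
    (\<lambda>p. x p \<oplus>\<^bsub>X p (n - p)\<^esub> (\<ominus>\<^bsub>R\<^esub> \<one>\<^bsub>R\<^esub>) \<odot>\<^bsub>X p (n - p)\<^esub> tau p (n - p) (x p))"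
    using * a by (simp add: A.smult_l_minus C.smult_l_minus A.M.r_neg a_minus_def)
  from zigzag_boundary[OF this submodule_mem_zero[OF is_complexD(1)[OF A] boundaries_submodule[OF A]]]
  show ?thesis .
qed

end

section \<open>Alternating sums of face maps\<close>

section \<open>Alternating sums\<close>

definition altsum :: "('k, 'm) module \<Rightarrow> nat \<Rightarrow> (nat \<Rightarrow> 'm) \<Rightarrow> 'm" where
  "altsum M m f = (\<Oplus>\<^bsub>M\<^esub>i\<in>{..m}. if even i then f i else \<ominus>\<^bsub>M\<^esub> f i)"

context
  fixes R :: "('k, 'r) ring_scheme" and M :: "('k, 'm) module"
  assumes M: "module R M"
begin

interpretation M: module R M by (rule M)

lemma altsum_closed: "(\<And>i. i \<le> m \<Longrightarrow> f i \<in> carrier M) \<Longrightarrow> altsum M m f \<in> carrier M"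
  unfolding altsum_def by (rule M.M.finsum_closed) auto

lemma altsum_cong:
  assumes "\<And>i. i \<le> m \<Longrightarrow> f i = g i" "\<And>i. i \<le> m \<Longrightarrow> g i \<in> carrier M"
  shows "altsum M m f = altsum M m g"
  unfolding altsum_def using assms by (intro M.M.finsum_cong') auto

lemma altsum_0: "f 0 \<in> carrier M \<Longrightarrow> altsum M 0 f = f 0"
  unfolding altsum_def by simp

text \<open>With the index 0 split off, the tail carries the opposite sign as a whole. Inductions on
  the number of terms use this recursion in place of the parity test.\<close>

lemma altsum_Suc:
  assumes "\<And>i. i \<le> Suc m \<Longrightarrow> f i \<in> carrier M"
  shows "altsum M (Suc m) f = f 0 \<ominus>\<^bsub>M\<^esub> altsum M m (\<lambda>i. f (Suc i))"
proof -
  let ?g = "\<lambda>i. if even i then f i else \<ominus>\<^bsub>M\<^esub> f i" and ?h = "\<lambda>i. if even i then f (Suc i) else \<ominus>\<^bsub>M\<^esub> f (Suc i)"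
  have "altsum M (Suc m) f = (\<Oplus>\<^bsub>M\<^esub>i\<in>{..m}. ?g (Suc i)) \<oplus>\<^bsub>M\<^esub> ?g 0"
    unfolding altsum_def using assms by (intro M.M.finsum_Suc2) auto
  also have "(\<Oplus>\<^bsub>M\<^esub>i\<in>{..m}. ?g (Suc i)) = (\<Oplus>\<^bsub>M\<^esub>i\<in>{..m}. \<ominus>\<^bsub>M\<^esub> ?h i)"
    using assms by (intro M.M.finsum_cong') auto
  also have "\<dots> = \<ominus>\<^bsub>M\<^esub> (\<Oplus>\<^bsub>M\<^esub>i\<in>{..m}. ?h i)"
    using mod_hom_finsum[OF M M mod_hom_neg[OF M M mod_hom_id], of ?h "{..m}"] assms by auto
  finally show ?thesis
    using assms[of 0] altsum_closed[of m "\<lambda>i. f (Suc i)"] assms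
    by (simp add: altsum_def[symmetric] a_minus_def M.M.a_comm)
qed

lemma altsum_hom:
  assumes N: "module R N" and h: "h \<in> mod_hom R M N" and f: "\<And>i. i \<le> m \<Longrightarrow> f i \<in> carrier M"
  shows "h (altsum M m f) = altsum N m (\<lambda>i. h (f i))"
proof -
  interpret N: module R N by (rule N)
  have "h (altsum M m f) = (\<Oplus>\<^bsub>N\<^esub>i\<in>{..m}. h (if even i then f i else \<ominus>\<^bsub>M\<^esub> f i))"
    unfolding altsum_def using f by (intro mod_hom_finsum[OF M N h]) auto
  also have "\<dots> = altsum N m (\<lambda>i. h (f i))"
    unfolding altsum_def using f mod_homD(1)[OF h] mod_hom_a_inv[OF M N h]
    by (intro N.M.finsum_cong') auto
  finally show ?thesis .
qed

lemma altsum_map_hom: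
  assumes "\<And>i. i \<le> m \<Longrightarrow> f i \<in> mod_hom R L M" "module R L"
  shows "(\<lambda>x. altsum M m (\<lambda>i. f i x)) \<in> mod_hom R L M"
  unfolding altsum_def
proof (rule mod_hom_finsum_map[OF M])
  fix i assume "i \<in> {..m}"
  then have "i \<le> m" by simp
  from mod_hom_neg[OF assms(2) M assms(1)[OF this]] assms(1)[OF this]
  show "(\<lambda>x. if even i then f i x else \<ominus>\<^bsub>M\<^esub> f i x) \<in> mod_hom R L M" by (cases "even i") simp_all
qed simp

end

text \<open>Write the inner sum as f_0 - f' and the outer one as g_0 - g', where f' and g' are the
  sums of the shifted families. The face identities with i = 0 turn g_0 f' into the whole outer sum
  applied to f_0, that is g_0 f_0 - g' f_0, while g' f' vanishes by induction. The four terms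
  cancel.\<close>

lemma altsum_altsum_zero:
  assumes L: "module R L" and M: "module R M" and N: "module R N"
    and f: "\<And>j. j \<le> Suc m \<Longrightarrow> f j \<in> mod_hom R L M" and g: "\<And>i. i \<le> m \<Longrightarrow> g i \<in> mod_hom R M N"
    and fg: "\<And>i j y. \<lbrakk>i \<le> j; j \<le> m; y \<in> carrier L\<rbrakk> \<Longrightarrow> g i (f (Suc j) y) = g j (f i y)"
    and x: "x \<in> carrier L"
  shows "altsum N m (\<lambda>i. g i (altsum M (Suc m) (\<lambda>j. f j x))) = \<zero>\<^bsub>N\<^esub>"
  using f g fg
proof (induction m arbitrary: f g)
  case 0
  interpret M: module R M by (rule M)
  interpret N: module R N by (rule N)
  have fx: "f 0 x \<in> carrier M" "f (Suc 0) x \<in> carrier M" using mod_homD(1)[OF 0(1)] x by auto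
  have d: "altsum M (Suc 0) (\<lambda>j. f j x) = f 0 x \<ominus>\<^bsub>M\<^esub> f (Suc 0) x"
    using fx by (subst altsum_Suc[OF M]) (auto simp: le_Suc_eq altsum_0[OF M])
  have "g 0 (f 0 x \<ominus>\<^bsub>M\<^esub> f (Suc 0) x) = g 0 (f 0 x) \<ominus>\<^bsub>N\<^esub> g 0 (f (Suc 0) x)"
    using mod_hom_minus[OF M N 0(2)[of 0]] fx by simp
  also have "\<dots> = \<zero>\<^bsub>N\<^esub>"
    using 0(3)[of 0 0 x] x mod_homD(1)[OF 0(2)[of 0]] fx minus_eq_zero_iff[OF N] by simp
  finally show ?case using d by (simp add: altsum_0[OF N])
next
  case (Suc m)
  interpret M: module R M by (rule M)
  interpret N: module R N by (rule N)
  note fD = mod_homD[OF Suc.prems(1)] and gD = mod_homD[OF Suc.prems(2)]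
  let ?df = "altsum M (Suc (Suc m)) (\<lambda>j. f j x)" and ?df' = "altsum M (Suc m) (\<lambda>j. f (Suc j) x)"
  let ?dg = "\<lambda>y. altsum N (Suc m) (\<lambda>i. g i y)" and ?dg' = "\<lambda>y. altsum N m (\<lambda>i. g (Suc i) y)"
  have df: "?df = f 0 x \<ominus>\<^bsub>M\<^esub> ?df'" by (rule altsum_Suc[OF M]) (use fD x in auto)
  have dg: "?dg y = g 0 y \<ominus>\<^bsub>N\<^esub> ?dg' y" if "y \<in> carrier M" for y
    by (rule altsum_Suc[OF N]) (use gD that in auto)
  have df'c: "?df' \<in> carrier M" by (rule altsum_closed[OF M]) (use fD x in auto)
  have dfc: "?df \<in> carrier M" by (rule altsum_closed[OF M]) (use fD x in auto)
  have f0: "f 0 x \<in> carrier M" using fD x by auto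
  have dg'hom: "?dg' \<in> mod_hom R M N" by (rule altsum_map_hom[OF N _ M]) (use Suc.prems(2) in auto)
  note dg'D = mod_homD[OF dg'hom]
  have "g 0 ?df' = altsum N (Suc m) (\<lambda>j. g 0 (f (Suc j) x))"
    by (rule altsum_hom[OF M N Suc.prems(2)]) (use fD x in auto)
  also have "\<dots> = ?dg (f 0 x)"
    by (rule altsum_cong[OF N]) (use Suc.prems(3)[of 0] x gD f0 in auto)
  also have "\<dots> = g 0 (f 0 x) \<ominus>\<^bsub>N\<^esub> ?dg' (f 0 x)" by (rule dg[OF f0])
  finally have g0: "g 0 ?df' = g 0 (f 0 x) \<ominus>\<^bsub>N\<^esub> ?dg' (f 0 x)" .
  have IH: "?dg' ?df' = \<zero>\<^bsub>N\<^esub>"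
    by (rule Suc.IH) (use Suc.prems in auto)
  have "?dg ?df = g 0 ?df \<ominus>\<^bsub>N\<^esub> ?dg' ?df" by (rule dg[OF dfc])
  also have "g 0 ?df = g 0 (f 0 x) \<ominus>\<^bsub>N\<^esub> g 0 ?df'"
    unfolding df using mod_hom_minus[OF M N Suc.prems(2)[of 0] f0 df'c] by simp
  also have "?dg' ?df = ?dg' (f 0 x) \<ominus>\<^bsub>N\<^esub> ?dg' ?df'"
    unfolding df by (rule mod_hom_minus[OF M N dg'hom f0 df'c])
  finally have "?dg ?df = g 0 (f 0 x) \<ominus>\<^bsub>N\<^esub> (g 0 (f 0 x) \<ominus>\<^bsub>N\<^esub> ?dg' (f 0 x)) \<ominus>\<^bsub>N\<^esub> (?dg' (f 0 x) \<ominus>\<^bsub>N\<^esub> \<zero>\<^bsub>N\<^esub>)"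
    unfolding IH g0 .
  moreover have "g 0 (f 0 x) \<in> carrier N" "?dg' (f 0 x) \<in> carrier N" using gD f0 dg'D by auto
  moreover have "u \<ominus>\<^bsub>N\<^esub> (u \<ominus>\<^bsub>N\<^esub> v) \<ominus>\<^bsub>N\<^esub> (v \<ominus>\<^bsub>N\<^esub> \<zero>\<^bsub>N\<^esub>) = \<zero>\<^bsub>N\<^esub>" if "u \<in> carrier N" "v \<in> carrier N" for u v
  proof -
    have "v \<ominus>\<^bsub>N\<^esub> \<zero>\<^bsub>N\<^esub> = v \<ominus>\<^bsub>N\<^esub> (v \<ominus>\<^bsub>N\<^esub> v)" using minus_eq_zero_iff[OF N that(2,2)] by simp
    also have "\<dots> = v" using that by (simp add: a_minus_def N.M.minus_add N.M.r_neg1 N.M.r_neg2)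
    also have "u \<ominus>\<^bsub>N\<^esub> (u \<ominus>\<^bsub>N\<^esub> v) = v" using that by (simp add: a_minus_def N.M.minus_add N.M.r_neg1 N.M.r_neg2)
    ultimately show ?thesis using minus_eq_zero_iff[OF N that(2,2)] by simp
  qed
  ultimately show ?case by simp
qed

text \<open>Read \<open>f i\<close> as the i-th face d_i x of a cycle x and \<open>g i\<close> as
  d_i (s x). From d_0 s = 1 and d_{i+1} s = s d_i follows d s x = x - s d x, and d x is
  zero.\<close>

lemma altsum_extra_degeneracy:
  assumes L: "module R L" and M: "module R M" and s: "s \<in> mod_hom R L M"
    and f: "\<And>i. i \<le> m \<Longrightarrow> f i \<in> carrier L"
    and g0: "g 0 = x" and gS: "\<And>i. i \<le> m \<Longrightarrow> g (Suc i) = s (f i)"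
    and x: "x \<in> carrier M" and z: "altsum L m f = \<zero>\<^bsub>L\<^esub>"
  shows "altsum M (Suc m) g = x"
proof -
  interpret M: module R M by (rule M)
  have "altsum M (Suc m) g = g 0 \<ominus>\<^bsub>M\<^esub> altsum M m (\<lambda>i. g (Suc i))"
  proof (rule altsum_Suc[OF M])
    fix i assume "i \<le> Suc m"
    then show "g i \<in> carrier M" using g0 gS x f mod_homD(1)[OF s] by (cases i) auto
  qed
  also have "altsum M m (\<lambda>i. g (Suc i)) = altsum M m (\<lambda>i. s (f i))"
    by (rule altsum_cong[OF M]) (use gS f mod_homD(1)[OF s] in auto)
  also have "\<dots> = s (altsum L m f)" by (rule altsum_hom[OF L M s f, symmetric])
  also have "\<dots> = x \<ominus>\<^bsub>M\<^esub> x" using z mod_hom_zero[OF L M s] minus_eq_zero_iff[OF M x x] by simp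
  also have "g 0 \<ominus>\<^bsub>M\<^esub> (x \<ominus>\<^bsub>M\<^esub> x) = x"
    using x g0 by (simp add: a_minus_def M.M.minus_add M.M.r_neg1 M.M.r_neg2)
  finally show ?thesis .
qed

section \<open>Colimits by generators and relations, and their functoriality\<close>

section \<open>Colimits\<close>

abbreviation (input) elts :: "('o, 'a, 'k, 'm) kfun \<Rightarrow> 'o \<Rightarrow> 'm set" where
  "elts F X \<equiv> carrier (fob F X)"

definition colim_in ::
  "('k, 'r) ring_scheme \<Rightarrow> ('o, 'a) category \<Rightarrow> ('o, 'a, 'k, 'm) kfun \<Rightarrow> 'o \<Rightarrow> 'm \<Rightarrow> ('o \<Rightarrow> 'm) set" where
  "colim_in R C F X x = colim_rels R C F +>\<^bsub>dsum (obs C) (fob F)\<^esub> dsum_in (obs C) (fob F) X x"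

definition colim_lift ::
  "('o, 'a) category \<Rightarrow> ('o, 'a, 'k, 'm) kfun \<Rightarrow> ('k, 'n) module \<Rightarrow> ('o \<Rightarrow> 'm \<Rightarrow> 'n) \<Rightarrow> ('o \<Rightarrow> 'm) set \<Rightarrow> 'n" where
  "colim_lift C F N h = quot_lift (dsum_lift (obs C) (fob F) N h)"

context
  fixes R :: "('k, 'r) ring_scheme" and C :: "('o, 'a) category" and F :: "('o, 'a, 'k, 'm) kfun"
  assumes R: "cring R" and C: "is_category C" and F: "is_kfun R C F"
begin

lemma kfun_dsum_module: "module R (dsum (obs C) (fob F))"
  by (rule dsum_module[OF R is_kfunD(1)[OF F]])

lemma kfun_in_closed:
  "\<lbrakk>X \<in> obs C; x \<in> elts F X\<rbrakk> \<Longrightarrow> dsum_in (obs C) (fob F) X x \<in> carrier (dsum (obs C) (fob F))"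
  by (rule dsum_in_closed[OF R is_kfunD(1)[OF F]])

lemma kfun_lift_hom:
  "\<lbrakk>module R N; \<And>X. X \<in> obs C \<Longrightarrow> h X \<in> mod_hom R (fob F X) N\<rbrakk> \<Longrightarrow>
    dsum_lift (obs C) (fob F) N h \<in> mod_hom R (dsum (obs C) (fob F)) N"
  by (rule dsum_lift_hom[OF R is_kfunD(1)[OF F]])

lemma kfun_lift_in:
  "\<lbrakk>module R N; \<And>X. X \<in> obs C \<Longrightarrow> h X \<in> mod_hom R (fob F X) N; X \<in> obs C; x \<in> elts F X\<rbrakk> \<Longrightarrow>
    dsum_lift (obs C) (fob F) N h (dsum_in (obs C) (fob F) X x) = h X x"
  by (rule dsum_lift_in[OF R is_kfunD(1)[OF F]])

lemma colim_gens:
  "{dsum_in (obs C) (fob F) (trg C f) (far F f x) \<ominus>\<^bsub>dsum (obs C) (fob F)\<^esub> dsum_in (obs C) (fob F) (src C f) x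
     | f x. f \<in> arrs C \<and> x \<in> elts F (src C f)} \<subseteq> carrier (dsum (obs C) (fob F))"
proof -
  interpret D: module R "dsum (obs C) (fob F)" by (rule kfun_dsum_module)
  show ?thesis
    using kfun_in_closed is_categoryD(1,2)[OF C] mod_homD(1)[OF is_kfunD(2)[OF F]]
    by (auto intro!: D.M.minus_closed)
qed

lemma colim_rels_submodule: "submodule (colim_rels R C F) R (dsum (obs C) (fob F))"
  unfolding colim_rels_def Let_def by (rule span_submodule[OF kfun_dsum_module colim_gens])

lemma colim_module: "module R (colim R C F)"
  unfolding colim_def by (rule quot_module[OF kfun_dsum_module colim_rels_submodule])

lemma colim_proj_hom:
  "(\<lambda>x. colim_rels R C F +>\<^bsub>dsum (obs C) (fob F)\<^esub> x) \<in> mod_hom R (dsum (obs C) (fob F)) (colim R C F)"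
  unfolding colim_def by (rule quot_proj_hom[OF kfun_dsum_module colim_rels_submodule])

lemma colim_in_hom: "X \<in> obs C \<Longrightarrow> colim_in R C F X \<in> mod_hom R (fob F X) (colim R C F)"
  using mod_hom_comp[OF dsum_in_hom[OF R is_kfunD(1)[OF F]] colim_proj_hom]
  by (simp add: colim_in_def[abs_def])

lemma colim_in_far:
  assumes f: "f \<in> arrs C" and x: "x \<in> elts F (src C f)"
  shows "colim_in R C F (trg C f) (far F f x) = colim_in R C F (src C f) x"
proof -
  have "dsum_in (obs C) (fob F) (trg C f) (far F f x) \<ominus>\<^bsub>dsum (obs C) (fob F)\<^esub> dsum_in (obs C) (fob F) (src C f) x
      \<in> colim_rels R C F"
    unfolding colim_rels_def Let_def by (rule subsetD[OF span_incl]) (use f x in blast)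
  moreover have "dsum_in (obs C) (fob F) (trg C f) (far F f x) \<in> carrier (dsum (obs C) (fob F))"
    "dsum_in (obs C) (fob F) (src C f) x \<in> carrier (dsum (obs C) (fob F))"
    using kfun_in_closed is_categoryD(1,2)[OF C f] mod_homD(1)[OF is_kfunD(2)[OF F f] x] x by auto
  ultimately show ?thesis
    unfolding colim_in_def using coset_eq_iff[OF kfun_dsum_module colim_rels_submodule] by blast
qed

lemma colim_hom_eqI:
  assumes N: "module R N" and h: "h \<in> mod_hom R (colim R C F) N" and h': "h' \<in> mod_hom R (colim R C F) N"
    and eq: "\<And>X x. \<lbrakk>X \<in> obs C; x \<in> elts F X\<rbrakk> \<Longrightarrow> h (colim_in R C F X x) = h' (colim_in R C F X x)"
    and z: "z \<in> carrier (colim R C F)"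
  shows "h z = h' z"
proof -
  obtain y where y: "y \<in> carrier (dsum (obs C) (fob F))" "z = colim_rels R C F +>\<^bsub>dsum (obs C) (fob F)\<^esub> y"
    using z unfolding colim_def by (rule quot_cosetE[OF kfun_dsum_module colim_rels_submodule])
  show ?thesis unfolding y(2)
    by (rule dsum_hom_eqI[OF R is_kfunD(1)[OF F] N mod_hom_comp[OF colim_proj_hom h]
          mod_hom_comp[OF colim_proj_hom h'] _ y(1)])
      (use eq in \<open>auto simp: colim_in_def\<close>)
qed

context
  fixes N :: "('k, 'n) module" and h :: "'o \<Rightarrow> 'm \<Rightarrow> 'n"
  assumes N: "module R N" and h: "\<And>X. X \<in> obs C \<Longrightarrow> h X \<in> mod_hom R (fob F X) N"
    and compat: "\<And>f x. \<lbrakk>f \<in> arrs C; x \<in> elts F (src C f)\<rbrakk> \<Longrightarrow> h (trg C f) (far F f x) = h (src C f) x"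
begin

lemma colim_lift_aux:
  assumes "u \<in> colim_rels R C F"
  shows "dsum_lift (obs C) (fob F) N h u = \<zero>\<^bsub>N\<^esub>"
proof (rule span_hom_zero[OF kfun_dsum_module N kfun_lift_hom[OF N h] colim_gens])
  show "u \<in> span R (dsum (obs C) (fob F))
    {dsum_in (obs C) (fob F) (trg C f) (far F f x) \<ominus>\<^bsub>dsum (obs C) (fob F)\<^esub> dsum_in (obs C) (fob F) (src C f) x
     | f x. f \<in> arrs C \<and> x \<in> elts F (src C f)}"
    using assms unfolding colim_rels_def Let_def .
next
  let ?l = "dsum_lift (obs C) (fob F) N h" and ?D = "dsum (obs C) (fob F)" and ?i = "dsum_in (obs C) (fob F)"
  fix z assume "z \<in> {?i (trg C f) (far F f x) \<ominus>\<^bsub>?D\<^esub> ?i (src C f) x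
     | f x. f \<in> arrs C \<and> x \<in> elts F (src C f)}"
  then obtain f x where z: "z = ?i (trg C f) (far F f x) \<ominus>\<^bsub>?D\<^esub> ?i (src C f) x"
    and f: "f \<in> arrs C" and x: "x \<in> elts F (src C f)" by blast
  have o: "src C f \<in> obs C" "trg C f \<in> obs C" by (rule is_categoryD(1,2)[OF C f])+
  have fx: "far F f x \<in> elts F (trg C f)" by (rule mod_homD(1)[OF is_kfunD(2)[OF F f] x])
  have "?l z = h (trg C f) (far F f x) \<ominus>\<^bsub>N\<^esub> h (src C f) x"
    unfolding z
    using mod_hom_minus[OF kfun_dsum_module N kfun_lift_hom[OF N h]]
      kfun_in_closed kfun_lift_in[OF N h] o fx x by simp
  then show "?l z = \<zero>\<^bsub>N\<^esub>"
    using compat[OF f x] mod_homD(1)[OF h[OF o(1)] x] minus_eq_zero_iff[OF N] by simp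
qed

lemma colim_lift_hom: "colim_lift C F N h \<in> mod_hom R (colim R C F) N"
  unfolding colim_lift_def colim_def
  by (rule quot_lift_hom[OF kfun_dsum_module colim_rels_submodule N kfun_lift_hom[OF N h] colim_lift_aux])

lemma colim_lift_in:
  assumes "X \<in> obs C" "x \<in> elts F X"
  shows "colim_lift C F N h (colim_in R C F X x) = h X x"
  unfolding colim_lift_def colim_in_def
  using quot_lift_coset[OF kfun_dsum_module colim_rels_submodule N kfun_lift_hom[OF N h] colim_lift_aux]
    kfun_in_closed kfun_lift_in[OF N h] assms
  by simp

end

end

context
  fixes R :: "('k, 'r) ring_scheme" and C :: "('o, 'a) category"
    and F :: "('o, 'a, 'k, 'm) kfun" and G :: "('o, 'a, 'k, 'n) kfun" and \<eta> :: "'o \<Rightarrow> 'm \<Rightarrow> 'n"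
  assumes R: "cring R" and C: "is_category C" and F: "is_kfun R C F" and G: "is_kfun R C G"
    and \<eta>: "is_nat_trans R C F G \<eta>"
begin

lemma kfun_dsum_map_hom:
  "dsum_map (obs C) \<eta> \<in> mod_hom R (dsum (obs C) (fob F)) (dsum (obs C) (fob G))"
  by (rule dsum_map_hom[OF R is_kfunD(1)[OF F] is_kfunD(1)[OF G] is_nat_transD(1)[OF \<eta>]])

lemma kfun_map_in:
  "\<lbrakk>X \<in> obs C; x \<in> elts F X\<rbrakk> \<Longrightarrow>
    dsum_map (obs C) \<eta> (dsum_in (obs C) (fob F) X x) = dsum_in (obs C) (fob G) X (\<eta> X x)"
  by (rule dsum_map_in[OF R is_kfunD(1)[OF F] is_kfunD(1)[OF G] is_nat_transD(1)[OF \<eta>]])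

lemma colim_map_aux:
  assumes "u \<in> colim_rels R C F"
  shows "dsum_map (obs C) \<eta> u \<in> colim_rels R C G"
proof (rule span_hom_image[OF kfun_dsum_module[OF R C F] kfun_dsum_module[OF R C G] kfun_dsum_map_hom
      colim_gens[OF R C F] colim_rels_submodule[OF R C G]])
  show "u \<in> span R (dsum (obs C) (fob F))
    {dsum_in (obs C) (fob F) (trg C f) (far F f x) \<ominus>\<^bsub>dsum (obs C) (fob F)\<^esub> dsum_in (obs C) (fob F) (src C f) x
     | f x. f \<in> arrs C \<and> x \<in> elts F (src C f)}"
    using assms unfolding colim_rels_def Let_def .
next
  let ?D = "dsum (obs C) (fob F)" and ?i = "dsum_in (obs C) (fob F)"
  fix z assume "z \<in> {?i (trg C f) (far F f x) \<ominus>\<^bsub>?D\<^esub> ?i (src C f) x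
     | f x. f \<in> arrs C \<and> x \<in> elts F (src C f)}"
  then obtain f x where z: "z = ?i (trg C f) (far F f x) \<ominus>\<^bsub>?D\<^esub> ?i (src C f) x"
    and f: "f \<in> arrs C" and x: "x \<in> elts F (src C f)" by blast
  have o: "src C f \<in> obs C" "trg C f \<in> obs C" by (rule is_categoryD(1,2)[OF C f])+
  have fx: "far F f x \<in> elts F (trg C f)" by (rule mod_homD(1)[OF is_kfunD(2)[OF F f] x])
  have "dsum_map (obs C) \<eta> z = dsum_in (obs C) (fob G) (trg C f) (far G f (\<eta> (src C f) x))
      \<ominus>\<^bsub>dsum (obs C) (fob G)\<^esub> dsum_in (obs C) (fob G) (src C f) (\<eta> (src C f) x)"
    unfolding z
    using mod_hom_minus[OF kfun_dsum_module[OF R C F] kfun_dsum_module[OF R C G] kfun_dsum_map_hom]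
      kfun_in_closed[OF R C F] kfun_map_in is_nat_transD(2)[OF \<eta> f x] o fx x by simp
  then show "dsum_map (obs C) \<eta> z \<in> colim_rels R C G"
    unfolding colim_rels_def Let_def
    using f mod_homD(1)[OF is_nat_transD(1)[OF \<eta> o(1)] x] by (intro subsetD[OF span_incl]) blast
qed

lemma colim_map_hom: "colim_map R C G \<eta> \<in> mod_hom R (colim R C F) (colim R C G)"
  unfolding colim_map_def colim_def
  by (rule quot_map_hom[OF kfun_dsum_module[OF R C F] colim_rels_submodule[OF R C F]
        kfun_dsum_module[OF R C G] colim_rels_submodule[OF R C G] kfun_dsum_map_hom colim_map_aux])

lemma colim_map_in:
  assumes "X \<in> obs C" "x \<in> elts F X"
  shows "colim_map R C G \<eta> (colim_in R C F X x) = colim_in R C G X (\<eta> X x)"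
  unfolding colim_map_def colim_in_def
  using quot_map_coset[OF kfun_dsum_module[OF R C F] colim_rels_submodule[OF R C F]
        kfun_dsum_module[OF R C G] colim_rels_submodule[OF R C G] kfun_dsum_map_hom colim_map_aux]
    kfun_map_in kfun_in_closed[OF R C F] assms by simp

end

lemma colim_complex:
  assumes R: "cring R" and C: "is_category C" and P: "\<And>n. is_kfun R C (P n)"
    and d: "\<And>n. is_nat_trans R C (P (Suc n)) (P n) (d n)"
    and dd: "\<And>n X x. \<lbrakk>X \<in> obs C; x \<in> elts (P (Suc (Suc n))) X\<rbrakk> \<Longrightarrow> d n X (d (Suc n) X x) = \<zero>\<^bsub>fob (P n) X\<^esub>"
  shows "is_complex R (\<lambda>n. colim R C (P n)) (\<lambda>n. colim_map R C (P n) (d n))"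
  unfolding is_complex_def
proof (intro conjI allI ballI)
  fix n
  show "module R (colim R C (P n))" by (rule colim_module[OF R C P])
  show "colim_map R C (P n) (d n) \<in> mod_hom R (colim R C (P (Suc n))) (colim R C (P n))"
    by (rule colim_map_hom[OF R C P P d])
  fix x assume x: "x \<in> carrier (colim R C (P (Suc (Suc n))))"
  show "colim_map R C (P n) (d n) (colim_map R C (P (Suc n)) (d (Suc n)) x) = \<zero>\<^bsub>colim R C (P n)\<^esub>"
  proof (rule colim_hom_eqI[OF R C P colim_module[OF R C P]
        mod_hom_comp[OF colim_map_hom[OF R C P P d] colim_map_hom[OF R C P P d]]
        mod_hom_zero_map[OF colim_module[OF R C P]] _ x])
    fix X y assume X: "X \<in> obs C" and y: "y \<in> elts (P (Suc (Suc n))) X"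
    show "colim_map R C (P n) (d n) (colim_map R C (P (Suc n)) (d (Suc n)) (colim_in R C (P (Suc (Suc n))) X y))
        = \<zero>\<^bsub>colim R C (P n)\<^esub>"
      using X y by (simp add: colim_map_in[OF R C P P d] mod_homD(1)[OF is_nat_transD(1)[OF d]] dd
          mod_hom_zero[OF is_kfunD(1)[OF P] colim_module[OF R C P] colim_in_hom[OF R C P]])
  qed
qed

section \<open>Simplicial operators on nerves and on the bar construction\<close>

section \<open>The bar complex of a functor\<close>

type_synonym 'a simplex = "nat \<times> nat \<Rightarrow> 'a"

text \<open>Vertices are not recorded in a simplex; X_0 is recovered from the identity arrow
  \<open>\<sigma> (0, 0)\<close>. The coefficients of the bar complex sit at this vertex.\<close>

abbreviation (input) origin :: "('o, 'a) category \<Rightarrow> 'a simplex \<Rightarrow> 'o" where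
  "origin C \<sigma> \<equiv> src C (\<sigma> (0, 0))"

lemma nerveD:
  assumes "\<sigma> \<in> nerve C n"
  shows "\<lbrakk>i \<le> j; j \<le> n\<rbrakk> \<Longrightarrow> \<sigma> (i, j) \<in> arrs C" "\<lbrakk>i \<le> j; j \<le> n\<rbrakk> \<Longrightarrow> src C (\<sigma> (i, j)) = src C (\<sigma> (i, i))"
    "\<lbrakk>i \<le> j; j \<le> n\<rbrakk> \<Longrightarrow> trg C (\<sigma> (i, j)) = src C (\<sigma> (j, j))"
    "i \<le> n \<Longrightarrow> \<sigma> (i, i) = ident C (src C (\<sigma> (i, i)))"
    "\<lbrakk>i \<le> j; j \<le> l; l \<le> n\<rbrakk> \<Longrightarrow> cmp C (\<sigma> (j, l)) (\<sigma> (i, j)) = \<sigma> (i, l)"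
    "\<sigma> \<in> extensional (order_pairs n)"
proof -
  have s: "\<sigma> \<in> order_pairs n \<rightarrow>\<^sub>E arrs C"
    "\<forall>(i, j)\<in>order_pairs n. src C (\<sigma> (i, j)) = src C (\<sigma> (i, i)) \<and> trg C (\<sigma> (i, j)) = src C (\<sigma> (j, j))"
    "\<forall>i\<le>n. \<sigma> (i, i) = ident C (src C (\<sigma> (i, i)))"
    "\<forall>i j l. i \<le> j \<longrightarrow> j \<le> l \<longrightarrow> l \<le> n \<longrightarrow> cmp C (\<sigma> (j, l)) (\<sigma> (i, j)) = \<sigma> (i, l)"
    using assms unfolding nerve_def mem_Collect_eq by blast+
  show "\<sigma> \<in> extensional (order_pairs n)" using s(1) by (simp add: PiE_iff)
  show "i \<le> n \<Longrightarrow> \<sigma> (i, i) = ident C (src C (\<sigma> (i, i)))" using s(3) by blast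
  show "\<lbrakk>i \<le> j; j \<le> l; l \<le> n\<rbrakk> \<Longrightarrow> cmp C (\<sigma> (j, l)) (\<sigma> (i, j)) = \<sigma> (i, l)" using s(4) by blast
  { assume "i \<le> j" "j \<le> n"
    then have m: "(i, j) \<in> order_pairs n" by (simp add: order_pairs_def)
    show "\<sigma> (i, j) \<in> arrs C" by (rule PiE_mem[OF s(1) m])
    show "src C (\<sigma> (i, j)) = src C (\<sigma> (i, i))" "trg C (\<sigma> (i, j)) = src C (\<sigma> (j, j))"
      using bspec[OF s(2) m] by simp_all }
qed

lemma nerveI:
  assumes "\<And>i j. \<lbrakk>i \<le> j; j \<le> n\<rbrakk> \<Longrightarrow> \<sigma> (i, j) \<in> arrs C"
    "\<And>i j. \<lbrakk>i \<le> j; j \<le> n\<rbrakk> \<Longrightarrow> src C (\<sigma> (i, j)) = X i" "\<And>i j. \<lbrakk>i \<le> j; j \<le> n\<rbrakk> \<Longrightarrow> trg C (\<sigma> (i, j)) = X j"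
    "\<And>i. i \<le> n \<Longrightarrow> \<sigma> (i, i) = ident C (X i)"
    "\<And>i j l. \<lbrakk>i \<le> j; j \<le> l; l \<le> n\<rbrakk> \<Longrightarrow> cmp C (\<sigma> (j, l)) (\<sigma> (i, j)) = \<sigma> (i, l)"
    "\<sigma> \<in> extensional (order_pairs n)"
  shows "\<sigma> \<in> nerve C n"
proof -
  have "\<sigma> \<in> order_pairs n \<rightarrow>\<^sub>E arrs C"
    unfolding PiE_iff using assms(1,6) by (auto simp: order_pairs_def)
  moreover have "\<forall>(i, j)\<in>order_pairs n. src C (\<sigma> (i, j)) = src C (\<sigma> (i, i)) \<and> trg C (\<sigma> (i, j)) = src C (\<sigma> (j, j))"
    using assms(2,3) by (auto simp: order_pairs_def)
  moreover have "\<forall>i\<le>n. \<sigma> (i, i) = ident C (src C (\<sigma> (i, i)))" by (metis assms(2,4) le_refl)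
  ultimately show ?thesis unfolding nerve_def mem_Collect_eq using assms(5) by blast
qed

lemma order_pairs_iff [simp]: "(i, j) \<in> order_pairs n \<longleftrightarrow> i \<le> j \<and> j \<le> n"
  by (simp add: order_pairs_def)

lemma nerve_vertex: "\<lbrakk>is_category C; \<sigma> \<in> nerve C n; i \<le> n\<rbrakk> \<Longrightarrow> src C (\<sigma> (i, i)) \<in> obs C"
  by (rule is_categoryD(1)[OF _ nerveD(1)]) auto

lemma ident_ident: "\<lbrakk>is_category C; X \<in> obs C\<rbrakk> \<Longrightarrow> cmp C (ident C X) (ident C X) = ident C X"
  by (metis is_categoryD(3,4,9))

text \<open>Faces are treated as instances of general simplicial operators, so that the simplicial
  identities reduce to equalities between composites of monotone maps.\<close>

definition mono_map :: "nat \<Rightarrow> nat \<Rightarrow> (nat \<Rightarrow> nat) \<Rightarrow> bool" where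
  "mono_map m n \<theta> \<longleftrightarrow> (\<forall>i j. i \<le> j \<longrightarrow> j \<le> m \<longrightarrow> \<theta> i \<le> \<theta> j \<and> \<theta> j \<le> n)"

definition nerve_act :: "nat \<Rightarrow> (nat \<Rightarrow> nat) \<Rightarrow> 'a simplex \<Rightarrow> nat \<times> nat \<Rightarrow> 'a" where
  "nerve_act m \<theta> \<sigma> = (\<lambda>(a, b)\<in>order_pairs m. \<sigma> (\<theta> a, \<theta> b))"

lemma mono_mapD: "\<lbrakk>mono_map m n \<theta>; i \<le> j; j \<le> m\<rbrakk> \<Longrightarrow> \<theta> i \<le> \<theta> j" "\<lbrakk>mono_map m n \<theta>; j \<le> m\<rbrakk> \<Longrightarrow> \<theta> j \<le> n"
  by (auto simp: mono_map_def)

lemma mono_map_coface: "i \<le> Suc n \<Longrightarrow> mono_map n (Suc n) (coface i)"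
  by (auto simp: mono_map_def coface_def)

lemma nerve_act_apply [simp]: "\<lbrakk>i \<le> j; j \<le> m\<rbrakk> \<Longrightarrow> nerve_act m \<theta> \<sigma> (i, j) = \<sigma> (\<theta> i, \<theta> j)"
  by (simp add: nerve_act_def)

lemma nerve_act_closed:
  assumes "\<sigma> \<in> nerve C n" "mono_map m n \<theta>"
  shows "nerve_act m \<theta> \<sigma> \<in> nerve C m"
proof (rule nerveI[where X = "\<lambda>i. src C (\<sigma> (\<theta> i, \<theta> i))"])
  note m = mono_mapD[OF assms(2)] and s = nerveD[OF assms(1)]
  fix i j assume ij: "i \<le> j" "j \<le> m"
  show "nerve_act m \<theta> \<sigma> (i, j) \<in> arrs C" using ij s(1) m by simp
  show "src C (nerve_act m \<theta> \<sigma> (i, j)) = src C (\<sigma> (\<theta> i, \<theta> i))" using ij s(2)[of "\<theta> i" "\<theta> j"] m by simp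
  show "trg C (nerve_act m \<theta> \<sigma> (i, j)) = src C (\<sigma> (\<theta> j, \<theta> j))" using ij s(3)[of "\<theta> i" "\<theta> j"] m by simp
next
  fix i j l assume ij: "i \<le> j" "j \<le> l" "l \<le> m"
  then show "cmp C (nerve_act m \<theta> \<sigma> (j, l)) (nerve_act m \<theta> \<sigma> (i, j)) = nerve_act m \<theta> \<sigma> (i, l)"
    using nerveD(5)[OF assms(1), of "\<theta> i" "\<theta> j" "\<theta> l"] mono_mapD[OF assms(2)] by simp
next
  fix i assume "i \<le> m"
  then show "nerve_act m \<theta> \<sigma> (i, i) = ident C (src C (\<sigma> (\<theta> i, \<theta> i)))"
    using nerveD(4)[OF assms(1)] mono_mapD[OF assms(2)] by simp
qed (simp add: nerve_act_def)

lemma nerve_act_comp: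
  assumes "mono_map l m \<phi>" "\<And>i. i \<le> l \<Longrightarrow> \<psi> i = \<theta> (\<phi> i)"
  shows "nerve_act l \<phi> (nerve_act m \<theta> \<sigma>) = nerve_act l \<psi> \<sigma>"
  using mono_mapD[OF assms(1)] assms(2)
  by (intro extensionalityI[of _ "order_pairs l"]) (auto simp: nerve_act_def)

definition bar_mod :: "('o, 'a) category \<Rightarrow> ('o, 'a, 'k, 'm) kfun \<Rightarrow> nat \<Rightarrow> ('k, 'a simplex \<Rightarrow> 'm) module" where
  "bar_mod C F n = dsum (nerve C n) (\<lambda>\<sigma>. fob F (origin C \<sigma>))"

definition bar_in ::
  "('o, 'a) category \<Rightarrow> ('o, 'a, 'k, 'm) kfun \<Rightarrow> nat \<Rightarrow> 'a simplex \<Rightarrow> 'm \<Rightarrow> 'a simplex \<Rightarrow> 'm" where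
  "bar_in C F n = dsum_in (nerve C n) (\<lambda>\<sigma>. fob F (origin C \<sigma>))"

definition bar_lift ::
  "('o, 'a) category \<Rightarrow> ('o, 'a, 'k, 'm) kfun \<Rightarrow> nat \<Rightarrow> ('k, 'n) module \<Rightarrow>
   ('a simplex \<Rightarrow> 'm \<Rightarrow> 'n) \<Rightarrow> ('a simplex \<Rightarrow> 'm) \<Rightarrow> 'n" where
  "bar_lift C F n = dsum_lift (nerve C n) (\<lambda>\<sigma>. fob F (origin C \<sigma>))"

text \<open>The first vertex of the new chain is vertex \<open>\<theta> 0\<close> of the old one, so
  the coefficient is moved along \<open>\<sigma> (0, \<theta> 0)\<close>. Among the faces only the
  one with index 0 uses an arrow other than an identity of the chain.\<close>

definition bar_act ::
  "('o, 'a) category \<Rightarrow> ('o, 'a, 'k, 'm) kfun \<Rightarrow> nat \<Rightarrow> nat \<Rightarrow> (nat \<Rightarrow> nat) \<Rightarrow>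
   ('a simplex \<Rightarrow> 'm) \<Rightarrow> 'a simplex \<Rightarrow> 'm" where
  "bar_act C F n m \<theta> =
     bar_lift C F n (bar_mod C F m) (\<lambda>\<sigma> x. bar_in C F m (nerve_act m \<theta> \<sigma>) (far F (\<sigma> (0, \<theta> 0)) x))"

abbreviation bar_face ::
  "('o, 'a) category \<Rightarrow> ('o, 'a, 'k, 'm) kfun \<Rightarrow> nat \<Rightarrow> nat \<Rightarrow>
   ('a simplex \<Rightarrow> 'm) \<Rightarrow> 'a simplex \<Rightarrow> 'm" where
  "bar_face C F n i \<equiv> bar_act C F (Suc n) n (coface i)"

definition bar_diff ::
  "('o, 'a) category \<Rightarrow> ('o, 'a, 'k, 'm) kfun \<Rightarrow> nat \<Rightarrow>
   ('a simplex \<Rightarrow> 'm) \<Rightarrow> 'a simplex \<Rightarrow> 'm" where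
  "bar_diff C F n x = altsum (bar_mod C F n) (Suc n) (\<lambda>i. bar_face C F n i x)"

abbreviation (input) "bar_homology C F \<equiv> chain_homology (bar_mod C F) (bar_diff C F)"

definition bar_eps ::
  "('k, 'r) ring_scheme \<Rightarrow> ('o, 'a) category \<Rightarrow> ('o, 'a, 'k, 'm) kfun \<Rightarrow>
   ('a simplex \<Rightarrow> 'm) \<Rightarrow> ('o \<Rightarrow> 'm) set" where
  "bar_eps R C F = bar_lift C F 0 (colim R C F) (\<lambda>\<sigma>. colim_in R C F (origin C \<sigma>))"

context
  fixes R :: "('k, 'r) ring_scheme" and C :: "('o, 'a) category" and F :: "('o, 'a, 'k, 'm) kfun"
  assumes R: "cring R" and C: "is_category C" and F: "is_kfun R C F"
begin

lemma bar_summand: "\<sigma> \<in> nerve C n \<Longrightarrow> module R (fob F (origin C \<sigma>))"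
  by (rule is_kfunD(1)[OF F nerve_vertex[OF C]]) auto

lemma bar_module: "module R (bar_mod C F n)"
  unfolding bar_mod_def by (rule dsum_module[OF R bar_summand])

lemma bar_in_hom: "\<sigma> \<in> nerve C n \<Longrightarrow> bar_in C F n \<sigma> \<in> mod_hom R (fob F (origin C \<sigma>)) (bar_mod C F n)"
  unfolding bar_mod_def bar_in_def by (rule dsum_in_hom[OF R bar_summand])

lemmas bar_in_closed = mod_homD(1)[OF bar_in_hom]

lemma bar_hom_eqI:
  assumes "module R N" "h \<in> mod_hom R (bar_mod C F n) N" "h' \<in> mod_hom R (bar_mod C F n) N"
    and "\<And>\<sigma> x. \<lbrakk>\<sigma> \<in> nerve C n; x \<in> elts F (origin C \<sigma>)\<rbrakk> \<Longrightarrow> h (bar_in C F n \<sigma> x) = h' (bar_in C F n \<sigma> x)"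
    and "z \<in> carrier (bar_mod C F n)"
  shows "h z = h' z"
  by (rule dsum_hom_eqI[where I = "nerve C n" and M = "\<lambda>\<sigma>. fob F (origin C \<sigma>)" and R = R and N = N])
    (use R bar_summand assms in \<open>simp_all add: bar_mod_def bar_in_def\<close>)

lemma bar_lift_hom:
  "\<lbrakk>module R N; \<And>\<sigma>. \<sigma> \<in> nerve C n \<Longrightarrow> h \<sigma> \<in> mod_hom R (fob F (origin C \<sigma>)) N\<rbrakk> \<Longrightarrow>
    bar_lift C F n N h \<in> mod_hom R (bar_mod C F n) N"
  unfolding bar_mod_def bar_lift_def by (rule dsum_lift_hom[OF R bar_summand])

lemma bar_lift_in:
  "\<lbrakk>module R N; \<And>\<sigma>. \<sigma> \<in> nerve C n \<Longrightarrow> h \<sigma> \<in> mod_hom R (fob F (origin C \<sigma>)) N; \<sigma> \<in> nerve C n;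
    x \<in> elts F (origin C \<sigma>)\<rbrakk> \<Longrightarrow> bar_lift C F n N h (bar_in C F n \<sigma> x) = h \<sigma> x"
  unfolding bar_in_def bar_lift_def by (rule dsum_lift_in[OF R bar_summand])

lemma nerve_far:
  assumes "\<sigma> \<in> nerve C n" "i \<le> j" "j \<le> n"
  shows "far F (\<sigma> (i, j)) \<in> mod_hom R (fob F (src C (\<sigma> (i, i)))) (fob F (src C (\<sigma> (j, j))))"
  using is_kfunD(2)[OF F nerveD(1)[OF assms]] nerveD(2,3)[OF assms] by simp

lemma nerve_far_comp:
  assumes s: "\<sigma> \<in> nerve C n" and ij: "i \<le> j" "j \<le> l" "l \<le> n" and x: "x \<in> elts F (src C (\<sigma> (i, i)))"
  shows "far F (\<sigma> (j, l)) (far F (\<sigma> (i, j)) x) = far F (\<sigma> (i, l)) x"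
proof -
  note D = nerveD[OF s]
  have jn: "j \<le> n" using ij by simp
  show ?thesis
    using is_kfunD(4)[OF F D(1)[OF ij(1) jn] D(1)[OF ij(2,3)]] D(2)[OF ij(1) jn] D(2)[OF ij(2,3)]
      D(3)[OF ij(1) jn] D(5)[OF ij] x by simp
qed

lemma nerve_far_ident:
  "\<lbrakk>\<sigma> \<in> nerve C n; i \<le> n; x \<in> elts F (src C (\<sigma> (i, i)))\<rbrakk> \<Longrightarrow> far F (\<sigma> (i, i)) x = x"
  using is_kfunD(3)[OF F nerve_vertex[OF C]] nerveD(4) by metis

context
  fixes n m \<theta> assumes \<theta>: "mono_map m n \<theta>"
begin

lemma bar_act_aux:
  assumes \<sigma>: "\<sigma> \<in> nerve C n"
  shows "(\<lambda>x. bar_in C F m (nerve_act m \<theta> \<sigma>) (far F (\<sigma> (0, \<theta> 0)) x))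
    \<in> mod_hom R (fob F (origin C \<sigma>)) (bar_mod C F m)"
proof (rule mod_hom_comp)
  show "far F (\<sigma> (0, \<theta> 0)) \<in> mod_hom R (fob F (origin C \<sigma>)) (fob F (src C (nerve_act m \<theta> \<sigma> (0, 0))))"
    using nerve_far[OF \<sigma>, of 0 "\<theta> 0"] mono_mapD(2)[OF \<theta>, of 0] by simp
qed (rule bar_in_hom[OF nerve_act_closed[OF \<sigma> \<theta>]])

lemma bar_act_hom: "bar_act C F n m \<theta> \<in> mod_hom R (bar_mod C F n) (bar_mod C F m)"
  unfolding bar_act_def by (rule bar_lift_hom[OF bar_module]) (rule bar_act_aux)

lemma bar_act_in:
  "\<lbrakk>\<sigma> \<in> nerve C n; x \<in> elts F (origin C \<sigma>)\<rbrakk> \<Longrightarrow>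
    bar_act C F n m \<theta> (bar_in C F n \<sigma> x) = bar_in C F m (nerve_act m \<theta> \<sigma>) (far F (\<sigma> (0, \<theta> 0)) x)"
  unfolding bar_act_def by (rule bar_lift_in[OF bar_module]) (rule bar_act_aux)

end

text \<open>The coefficient moves from vertex 0 to \<open>\<theta> 0\<close> and then to
  \<open>\<theta> (\<phi> 0)\<close>; functoriality merges the two arrows. The composite is a
  separate parameter \<psi>, known only on the vertices up to l, so that one operator can stand for
  two different composites.\<close>

lemma bar_act_comp:
  assumes \<theta>: "mono_map m n \<theta>" and \<phi>: "mono_map l m \<phi>" and \<psi>: "mono_map l n \<psi>"
    and eq: "\<And>i. i \<le> l \<Longrightarrow> \<psi> i = \<theta> (\<phi> i)" and z: "z \<in> carrier (bar_mod C F n)"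
  shows "bar_act C F m l \<phi> (bar_act C F n m \<theta> z) = bar_act C F n l \<psi> z"
proof (rule bar_hom_eqI[OF bar_module mod_hom_comp[OF bar_act_hom[OF \<theta>] bar_act_hom[OF \<phi>]] bar_act_hom[OF \<psi>] _ z])
  fix \<sigma> x assume \<sigma>: "\<sigma> \<in> nerve C n" and x: "x \<in> elts F (origin C \<sigma>)"
  have b: "\<theta> 0 \<le> n" "\<phi> 0 \<le> m" "\<theta> (\<phi> 0) \<le> n" "\<theta> 0 \<le> \<theta> (\<phi> 0)"
    using mono_mapD[OF \<theta>] mono_mapD[OF \<phi>] by simp_all
  have y: "far F (\<sigma> (0, \<theta> 0)) x \<in> elts F (src C (nerve_act m \<theta> \<sigma> (0, 0)))"
    using mod_homD(1)[OF nerve_far[OF \<sigma>] x] b by simp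
  show "bar_act C F m l \<phi> (bar_act C F n m \<theta> (bar_in C F n \<sigma> x)) = bar_act C F n l \<psi> (bar_in C F n \<sigma> x)"
    using bar_act_in[OF \<theta> \<sigma> x] bar_act_in[OF \<phi> nerve_act_closed[OF \<sigma> \<theta>] y] bar_act_in[OF \<psi> \<sigma> x]
      nerve_act_comp[where \<psi> = \<psi> and \<theta> = \<theta> and \<sigma> = \<sigma>, OF \<phi> eq] nerve_far_comp[OF \<sigma> _ b(4,3) x] b eq[of 0] by simp
qed

lemma bar_face_hom: "i \<le> Suc n \<Longrightarrow> bar_face C F n i \<in> mod_hom R (bar_mod C F (Suc n)) (bar_mod C F n)"
  by (rule bar_act_hom[OF mono_map_coface])

lemma bar_diff_hom: "bar_diff C F n \<in> mod_hom R (bar_mod C F (Suc n)) (bar_mod C F n)"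
  unfolding bar_diff_def[abs_def] by (rule altsum_map_hom[OF bar_module bar_face_hom bar_module])

text \<open>Both sides are the action of one operator, because \<open>coface (Suc j)\<close> after
  \<open>coface i\<close> equals \<open>coface i\<close> after \<open>coface j\<close> for i \<le>
  j.\<close>

lemma bar_face_face:
  assumes "i \<le> j" "j \<le> Suc n" "z \<in> carrier (bar_mod C F (Suc (Suc n)))"
  shows "bar_face C F n i (bar_face C F (Suc n) (Suc j) z) = bar_face C F n j (bar_face C F (Suc n) i z)"
proof -
  let ?\<psi> = "\<lambda>a. coface (Suc j) (coface i a)"
  have \<psi>: "mono_map n (Suc (Suc n)) ?\<psi>" by (auto simp: mono_map_def coface_def)
  have "bar_face C F n i (bar_face C F (Suc n) (Suc j) z) = bar_act C F (Suc (Suc n)) n ?\<psi> z"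
    by (rule bar_act_comp[OF mono_map_coface mono_map_coface \<psi> _ assms(3)]) (use assms in auto)
  also have "\<dots> = bar_face C F n j (bar_face C F (Suc n) i z)"
    by (rule bar_act_comp[OF mono_map_coface mono_map_coface \<psi> _ assms(3), symmetric])
      (use assms in \<open>auto simp: coface_def\<close>)
  finally show ?thesis .
qed

lemma bar_complex: "is_complex R (bar_mod C F) (bar_diff C F)"
  unfolding is_complex_def
proof (intro conjI allI ballI)
  fix n x assume x: "x \<in> carrier (bar_mod C F (Suc (Suc n)))"
  show "bar_diff C F n (bar_diff C F (Suc n) x) = \<zero>\<^bsub>bar_mod C F n\<^esub>"
    unfolding bar_diff_def
    by (rule altsum_altsum_zero[OF bar_module bar_module bar_module _ _ _ x])
      (use bar_face_hom bar_face_face in auto)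
qed (auto intro: bar_module bar_diff_hom)

section \<open>The augmentation to the colimit and exactness in degree zero\<close>

lemma bar_eps_aux:
  "\<sigma> \<in> nerve C 0 \<Longrightarrow> colim_in R C F (origin C \<sigma>) \<in> mod_hom R (fob F (origin C \<sigma>)) (colim R C F)"
  by (rule colim_in_hom[OF R C F nerve_vertex[OF C]]) auto

lemma bar_eps_hom: "bar_eps R C F \<in> mod_hom R (bar_mod C F 0) (colim R C F)"
  unfolding bar_eps_def by (rule bar_lift_hom[OF colim_module[OF R C F]]) (rule bar_eps_aux)

lemma bar_eps_in:
  "\<lbrakk>\<sigma> \<in> nerve C 0; x \<in> elts F (origin C \<sigma>)\<rbrakk> \<Longrightarrow>
    bar_eps R C F (bar_in C F 0 \<sigma> x) = colim_in R C F (origin C \<sigma>) x"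
  unfolding bar_eps_def by (rule bar_lift_in[OF colim_module[OF R C F]]) (rule bar_eps_aux)

definition vertex_simplex :: "'o \<Rightarrow> nat \<times> nat \<Rightarrow> 'a" where
  "vertex_simplex X = (\<lambda>_\<in>order_pairs 0. ident C X)"

lemma vertex_simplex_apply [simp]: "vertex_simplex X (0, 0) = ident C X"
  by (simp add: vertex_simplex_def)

lemma vertex_simplex_closed: "X \<in> obs C \<Longrightarrow> vertex_simplex X \<in> nerve C 0"
  using is_categoryD(3-5)[OF C] ident_ident[OF C] by (intro nerveI[where X = "\<lambda>_. X"]) (auto simp: vertex_simplex_def)

text \<open>A simplex of dimension 0 is a single identity, so degree 0 of the bar complex is the
  direct sum from which the colimit is formed.\<close>

lemma vertex_simplex_eq: "\<sigma> \<in> nerve C 0 \<Longrightarrow> vertex_simplex (origin C \<sigma>) = \<sigma>"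
  using nerveD(4,6)[of \<sigma> C 0] by (intro extensionalityI[of _ "order_pairs 0"]) (auto simp: vertex_simplex_def order_pairs_def)

definition edge_simplex :: "'a \<Rightarrow> nat \<times> nat \<Rightarrow> 'a" where
  "edge_simplex f = (\<lambda>(i, j)\<in>order_pairs 1. if j = 0 then ident C (src C f) else if i = 0 then f else ident C (trg C f))"

lemma edge_simplex_apply [simp]: "edge_simplex f (0, 0) = ident C (src C f)" "edge_simplex f (0, Suc 0) = f"
  "edge_simplex f (Suc 0, Suc 0) = ident C (trg C f)"
  by (simp_all add: edge_simplex_def)

lemma edge_simplex_closed:
  assumes "f \<in> arrs C"
  shows "edge_simplex f \<in> nerve C 1"
proof -
  note c = is_categoryD[OF C] and o = is_categoryD(1,2)[OF C assms]
  show ?thesis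
    by (rule nerveI[where X = "\<lambda>i. if i = 0 then src C f else trg C f"])
      (use assms c(3-5,9,10) o ident_ident[OF C] in \<open>auto simp: edge_simplex_def le_Suc_eq\<close>)
qed

lemma edge_simplex_faces:
  assumes "f \<in> arrs C"
  shows "nerve_act 0 (coface 0) (edge_simplex f) = vertex_simplex (trg C f)"
    "nerve_act 0 (coface (Suc 0)) (edge_simplex f) = vertex_simplex (src C f)"
  by (rule extensionalityI[of _ "order_pairs 0"]; auto simp: nerve_act_def vertex_simplex_def coface_def order_pairs_def)+

text \<open>Face 0 of a 1-simplex carries the pushed forward coefficient at the target, face 1 the
  coefficient itself at the source; the colimit identifies the two.\<close>

lemma bar_eps_diff:
  assumes "z \<in> carrier (bar_mod C F 1)"
  shows "bar_eps R C F (bar_diff C F 0 z) = \<zero>\<^bsub>colim R C F\<^esub>"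
proof (rule bar_hom_eqI[OF colim_module[OF R C F] mod_hom_comp[OF _ bar_eps_hom]
      mod_hom_zero_map[OF colim_module[OF R C F]] _ assms])
  show "bar_diff C F 0 \<in> mod_hom R (bar_mod C F 1) (bar_mod C F 0)" using bar_diff_hom[of 0] by simp
  fix \<sigma> x assume \<sigma>: "\<sigma> \<in> nerve C 1" and x: "x \<in> elts F (origin C \<sigma>)"
  then have \<sigma>': "\<sigma> \<in> nerve C (Suc 0)" by simp
  note c = mono_map_coface[of _ 0, simplified]
  have b: "bar_in C F 1 \<sigma> x \<in> carrier (bar_mod C F (Suc 0))" using bar_in_closed[OF \<sigma> x] by simp
  note D = nerveD[OF \<sigma>]
  have y: "far F (\<sigma> (0, 1)) x \<in> elts F (src C (\<sigma> (1, 1)))" using mod_homD(1)[OF nerve_far[OF \<sigma>] x] by simp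
  have f: "bar_face C F 0 0 (bar_in C F 1 \<sigma> x) = bar_in C F 0 (nerve_act 0 (coface 0) \<sigma>) (far F (\<sigma> (0, 1)) x)"
    "bar_face C F 0 (Suc 0) (bar_in C F 1 \<sigma> x) = bar_in C F 0 (nerve_act 0 (coface (Suc 0)) \<sigma>) x"
    using bar_act_in[OF c \<sigma>' x] nerve_far_ident[OF \<sigma> _ x] by (simp_all add: coface_def)
  have n: "nerve_act 0 (coface 0) \<sigma> \<in> nerve C 0" "nerve_act 0 (coface (Suc 0)) \<sigma> \<in> nerve C 0"
    by (rule nerve_act_closed[OF \<sigma>' c]; simp)+
  have v: "nerve_act 0 (coface 0) \<sigma> (0, 0) = \<sigma> (1, 1)" "nerve_act 0 (coface (Suc 0)) \<sigma> (0, 0) = \<sigma> (0, 0)"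
    by (simp_all add: coface_def)
  have "bar_eps R C F (bar_diff C F 0 (bar_in C F 1 \<sigma> x)) =
      altsum (colim R C F) (Suc 0) (\<lambda>i. bar_eps R C F (bar_face C F 0 i (bar_in C F 1 \<sigma> x)))"
    unfolding bar_diff_def
    by (rule altsum_hom[OF bar_module colim_module[OF R C F] bar_eps_hom]) (use mod_homD(1)[OF bar_face_hom b] in simp)
  also have "\<dots> = bar_eps R C F (bar_face C F 0 0 (bar_in C F 1 \<sigma> x)) \<ominus>\<^bsub>colim R C F\<^esub>
      altsum (colim R C F) 0 (\<lambda>i. bar_eps R C F (bar_face C F 0 (Suc i) (bar_in C F 1 \<sigma> x)))"
    by (rule altsum_Suc[OF colim_module[OF R C F]]) (use mod_homD(1)[OF bar_face_hom b] mod_homD(1)[OF bar_eps_hom] in simp)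
  also have "\<dots> = colim_in R C F (src C (\<sigma> (1, 1))) (far F (\<sigma> (0, 1)) x) \<ominus>\<^bsub>colim R C F\<^esub> colim_in R C F (origin C \<sigma>) x"
  proof -
    have e0: "bar_eps R C F (bar_face C F 0 0 (bar_in C F 1 \<sigma> x)) = colim_in R C F (src C (\<sigma> (1, 1))) (far F (\<sigma> (0, 1)) x)"
      unfolding f using bar_eps_in[OF n(1)] y unfolding v by blast
    have e1: "bar_eps R C F (bar_face C F 0 (Suc 0) (bar_in C F 1 \<sigma> x)) = colim_in R C F (origin C \<sigma>) x"
      unfolding f using bar_eps_in[OF n(2)] x unfolding v by blast
    have "colim_in R C F (origin C \<sigma>) x \<in> carrier (colim R C F)"
      using mod_homD(1)[OF colim_in_hom[OF R C F nerve_vertex[OF C \<sigma>, of 0]] x] by simp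
    then show ?thesis unfolding e0 using e1 by (subst altsum_0[OF colim_module[OF R C F]]) simp_all
  qed
  also have "\<dots> = \<zero>\<^bsub>colim R C F\<^esub>"
    using colim_in_far[OF R C F D(1)[of 0 1]] D(2,3)[of 0 1] x
      mod_homD(1)[OF colim_in_hom[OF R C F nerve_vertex[OF C \<sigma>, of 0]] x] minus_eq_zero_iff[OF colim_module[OF R C F]] by simp
  finally show "bar_eps R C F (bar_diff C F 0 (bar_in C F 1 \<sigma> x)) = \<zero>\<^bsub>colim R C F\<^esub>" .
qed

text \<open>Boundaries of edges are the defining relations of the colimit, transported to degree 0
  of the bar complex.\<close>

lemma bar_diff_edge:
  assumes f: "f \<in> arrs C" and x: "x \<in> elts F (src C f)"
  shows "bar_diff C F 0 (bar_in C F 1 (edge_simplex f) x) =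
    bar_in C F 0 (vertex_simplex (trg C f)) (far F f x) \<ominus>\<^bsub>bar_mod C F 0\<^esub> bar_in C F 0 (vertex_simplex (src C f)) x"
proof -
  have \<sigma>: "edge_simplex f \<in> nerve C (Suc 0)" using edge_simplex_closed[OF f] by simp
  note c = mono_map_coface[of _ 0, simplified] and o = is_categoryD(1,2)[OF C f]
  have x': "x \<in> elts F (src C (edge_simplex f (0, 0)))" using x o is_categoryD(4)[OF C] by simp
  have b: "bar_in C F 1 (edge_simplex f) x \<in> carrier (bar_mod C F (Suc 0))" using bar_in_closed[OF \<sigma> x'] by simp
  have f0: "bar_face C F 0 0 (bar_in C F 1 (edge_simplex f) x) = bar_in C F 0 (vertex_simplex (trg C f)) (far F f x)"
    using bar_act_in[OF c \<sigma> x', of 0] edge_simplex_faces[OF f] by (simp add: coface_def)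
  have f1: "bar_face C F 0 (Suc 0) (bar_in C F 1 (edge_simplex f) x) = bar_in C F 0 (vertex_simplex (src C f)) x"
    using bar_act_in[OF c \<sigma> x', of "Suc 0"] edge_simplex_faces[OF f] is_kfunD(3)[OF F o(1) x] by (simp add: coface_def)
  have "bar_diff C F 0 (bar_in C F 1 (edge_simplex f) x) = bar_face C F 0 0 (bar_in C F 1 (edge_simplex f) x)
      \<ominus>\<^bsub>bar_mod C F 0\<^esub> altsum (bar_mod C F 0) 0 (\<lambda>i. bar_face C F 0 (Suc i) (bar_in C F 1 (edge_simplex f) x))"
    unfolding bar_diff_def by (rule altsum_Suc[OF bar_module]) (use mod_homD(1)[OF bar_face_hom b] in simp)
  also have "altsum (bar_mod C F 0) 0 (\<lambda>i. bar_face C F 0 (Suc i) (bar_in C F 1 (edge_simplex f) x)) =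
      bar_in C F 0 (vertex_simplex (src C f)) x"
    using mod_homD(1)[OF bar_face_hom b, of "Suc 0"] by (subst altsum_0[OF bar_module]) (simp_all only: f1 le_refl)
  finally show ?thesis unfolding f0 .
qed

lemma bar_eps_surj:
  assumes "a \<in> carrier (colim R C F)"
  shows "\<exists>x\<in>carrier (bar_mod C F 0). bar_eps R C F x = a"
proof -
  obtain y where y: "y \<in> carrier (dsum (obs C) (fob F))" "a = colim_rels R C F +>\<^bsub>dsum (obs C) (fob F)\<^esub> y"
    using assms unfolding colim_def by (rule quot_cosetE[OF kfun_dsum_module[OF R C F] colim_rels_submodule[OF R C F]])
  let ?k = "dsum_lift (obs C) (fob F) (bar_mod C F 0) (\<lambda>X. bar_in C F 0 (vertex_simplex X))"
  have k: "bar_in C F 0 (vertex_simplex X) \<in> mod_hom R (fob F X) (bar_mod C F 0)" if "X \<in> obs C" for X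
    using bar_in_hom[OF vertex_simplex_closed[OF that]] is_categoryD(4)[OF C that] by simp
  have hom: "?k \<in> mod_hom R (dsum (obs C) (fob F)) (bar_mod C F 0)"
    by (rule kfun_lift_hom[OF R C F bar_module]) (rule k)
  have ki: "?k (dsum_in (obs C) (fob F) X y) = bar_in C F 0 (vertex_simplex X) y"
    if "X \<in> obs C" "y \<in> elts F X" for X y
    by (rule kfun_lift_in[OF R C F bar_module _ that]) (rule k)
  have "bar_eps R C F (?k y) = a"
    unfolding y(2)
    by (rule dsum_hom_eqI[OF R is_kfunD(1)[OF F] colim_module[OF R C F] mod_hom_comp[OF hom bar_eps_hom]
          colim_proj_hom[OF R C F] _ y(1)])
      (use vertex_simplex_closed is_categoryD(4)[OF C] in
        \<open>simp_all add: ki bar_eps_in colim_in_def[symmetric]\<close>)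
  then show ?thesis using mod_homD(1)[OF hom y(1)] by blast
qed

text \<open>The maps l and k translate between degree 0 of the bar complex and the direct sum over
  objects, with k (l x) = x; under l the augmentation becomes the projection to the quotient. So l x
  lies in the span of the colimit relations, and k sends every generating relation to the boundary
  of an edge.\<close>

lemma bar_eps_exact:
  assumes x: "x \<in> carrier (bar_mod C F 0)" and z: "bar_eps R C F x = \<zero>\<^bsub>colim R C F\<^esub>"
  shows "\<exists>y\<in>carrier (bar_mod C F 1). bar_diff C F 0 y = x"
proof -
  let ?D = "dsum (obs C) (fob F)" and ?i = "dsum_in (obs C) (fob F)"
  let ?l = "bar_lift C F 0 ?D (\<lambda>\<sigma>. ?i (origin C \<sigma>))"
  let ?k = "dsum_lift (obs C) (fob F) (bar_mod C F 0) (\<lambda>X. bar_in C F 0 (vertex_simplex X))"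
  note DM = kfun_dsum_module[OF R C F] and fm = is_kfunD(1)[OF F]
  have laux: "?i (origin C \<sigma>) \<in> mod_hom R (fob F (origin C \<sigma>)) ?D" if "\<sigma> \<in> nerve C 0" for \<sigma>
    by (rule dsum_in_hom[OF R fm nerve_vertex[OF C that]]) simp_all
  have lh: "?l \<in> mod_hom R (bar_mod C F 0) ?D" by (rule bar_lift_hom[OF DM]) (rule laux)
  have li: "?l (bar_in C F 0 \<sigma> y) = ?i (origin C \<sigma>) y"
    if "\<sigma> \<in> nerve C 0" "y \<in> elts F (origin C \<sigma>)" for \<sigma> y
    by (rule bar_lift_in[OF DM _ that]) (rule laux)
  have kaux: "bar_in C F 0 (vertex_simplex X) \<in> mod_hom R (fob F X) (bar_mod C F 0)" if "X \<in> obs C" for X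
    using bar_in_hom[OF vertex_simplex_closed[OF that]] is_categoryD(4)[OF C that] by simp
  have kh: "?k \<in> mod_hom R ?D (bar_mod C F 0)" by (rule kfun_lift_hom[OF R C F bar_module]) (rule kaux)
  have ki: "?k (?i X y) = bar_in C F 0 (vertex_simplex X) y" if "X \<in> obs C" "y \<in> elts F X" for X y
    by (rule kfun_lift_in[OF R C F bar_module _ that]) (rule kaux)
  have kl: "?k (?l x) = x"
    by (rule bar_hom_eqI[OF bar_module mod_hom_comp[OF lh kh] mod_hom_id _ x])
      (simp_all add: li ki nerve_vertex[OF C] vertex_simplex_eq)
  have "bar_eps R C F x = colim_rels R C F +>\<^bsub>?D\<^esub> ?l x"
    by (rule bar_hom_eqI[OF colim_module[OF R C F] bar_eps_hom mod_hom_comp[OF lh colim_proj_hom[OF R C F]] _ x])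
      (simp_all add: li bar_eps_in colim_in_def)
  then have "?l x \<in> colim_rels R C F"
    using z quot_proj_eq_zero_iff[OF DM colim_rels_submodule[OF R C F] mod_homD(1)[OF lh x]] unfolding colim_def by simp
  then have "?k (?l x) \<in> bar_diff C F 0 ` carrier (bar_mod C F 1)"
    unfolding colim_rels_def Let_def
  proof (rule span_hom_image[OF DM bar_module kh colim_gens[OF R C F], rotated 2])
    show "submodule (bar_diff C F 0 ` carrier (bar_mod C F 1)) R (bar_mod C F 0)"
      using submodule_image[OF bar_module bar_module bar_diff_hom[of 0]] by simp
    fix z assume "z \<in> {?i (trg C f) (far F f x) \<ominus>\<^bsub>?D\<^esub> ?i (src C f) x | f x. f \<in> arrs C \<and> x \<in> elts F (src C f)}"
    then obtain f y where z: "z = ?i (trg C f) (far F f y) \<ominus>\<^bsub>?D\<^esub> ?i (src C f) y"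
      and f: "f \<in> arrs C" and y: "y \<in> elts F (src C f)" by blast
    note o = is_categoryD(1,2)[OF C f] and fy = mod_homD(1)[OF is_kfunD(2)[OF F f] y]
    have "?k z = bar_in C F 0 (vertex_simplex (trg C f)) (far F f y) \<ominus>\<^bsub>bar_mod C F 0\<^esub> bar_in C F 0 (vertex_simplex (src C f)) y"
      unfolding z using mod_hom_minus[OF DM bar_module kh] kfun_in_closed[OF R C F] ki o fy y by simp
    also have "\<dots> = bar_diff C F 0 (bar_in C F 1 (edge_simplex f) y)" using bar_diff_edge[OF f y] by simp
    finally show "?k z \<in> bar_diff C F 0 ` carrier (bar_mod C F 1)"
      using bar_in_closed[OF edge_simplex_closed[OF f], of y] y o is_categoryD(4)[OF C] by auto
  qed
  then show ?thesis unfolding kl by auto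
qed

end

section \<open>Maps of bar complexes induced by functors and natural transformations\<close>

subsection \<open>Functoriality of the bar complex\<close>

definition is_functor :: "('o, 'a) category \<Rightarrow> ('p, 'b) category \<Rightarrow> ('o \<Rightarrow> 'p) \<Rightarrow> ('a \<Rightarrow> 'b) \<Rightarrow> bool" where
  "is_functor C D \<phi> \<Phi> \<longleftrightarrow>
     (\<forall>X\<in>obs C. \<phi> X \<in> obs D \<and> \<Phi> (ident C X) = ident D (\<phi> X)) \<and>
     (\<forall>f\<in>arrs C. \<Phi> f \<in> arrs D \<and> src D (\<Phi> f) = \<phi> (src C f) \<and> trg D (\<Phi> f) = \<phi> (trg C f)) \<and>
     (\<forall>f\<in>arrs C. \<forall>g\<in>arrs C. src C g = trg C f \<longrightarrow> \<Phi> (cmp C g f) = cmp D (\<Phi> g) (\<Phi> f))"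

lemma is_functorD:
  assumes "is_functor C D \<phi> \<Phi>"
  shows "X \<in> obs C \<Longrightarrow> \<phi> X \<in> obs D" "X \<in> obs C \<Longrightarrow> \<Phi> (ident C X) = ident D (\<phi> X)"
    "f \<in> arrs C \<Longrightarrow> \<Phi> f \<in> arrs D" "f \<in> arrs C \<Longrightarrow> src D (\<Phi> f) = \<phi> (src C f)"
    "f \<in> arrs C \<Longrightarrow> trg D (\<Phi> f) = \<phi> (trg C f)"
    "\<lbrakk>f \<in> arrs C; g \<in> arrs C; src C g = trg C f\<rbrakk> \<Longrightarrow> \<Phi> (cmp C g f) = cmp D (\<Phi> g) (\<Phi> f)"
  using assms unfolding is_functor_def by blast+

lemma is_functor_id: "is_functor C C (\<lambda>X. X) (\<lambda>f. f)"
  by (simp add: is_functor_def)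

definition nerve_map :: "nat \<Rightarrow> ('a \<Rightarrow> 'b) \<Rightarrow> 'a simplex \<Rightarrow> nat \<times> nat \<Rightarrow> 'b" where
  "nerve_map n \<Phi> \<sigma> = (\<lambda>p\<in>order_pairs n. \<Phi> (\<sigma> p))"

lemma nerve_map_apply [simp]: "\<lbrakk>i \<le> j; j \<le> n\<rbrakk> \<Longrightarrow> nerve_map n \<Phi> \<sigma> (i, j) = \<Phi> (\<sigma> (i, j))"
  by (simp add: nerve_map_def)

lemma nerve_map_id: "\<sigma> \<in> nerve C n \<Longrightarrow> nerve_map n (\<lambda>f. f) \<sigma> = \<sigma>"
  using nerveD(6) by (intro extensionalityI[of _ "order_pairs n"]) (auto simp: nerve_map_def)

lemma nerve_map_closed:
  assumes C: "is_category C" and \<Phi>: "is_functor C D \<phi> \<Phi>" and \<sigma>: "\<sigma> \<in> nerve C n"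
  shows "nerve_map n \<Phi> \<sigma> \<in> nerve D n"
proof (rule nerveI[where X = "\<lambda>i. \<phi> (src C (\<sigma> (i, i)))"])
  note f = is_functorD[OF \<Phi>] and s = nerveD[OF \<sigma>]
  fix i j assume ij: "i \<le> j" "j \<le> n"
  show "nerve_map n \<Phi> \<sigma> (i, j) \<in> arrs D" using f(3)[OF s(1)[OF ij]] ij by simp
  show "src D (nerve_map n \<Phi> \<sigma> (i, j)) = \<phi> (src C (\<sigma> (i, i)))" using f(4)[OF s(1)[OF ij]] s(2)[OF ij] ij by simp
  show "trg D (nerve_map n \<Phi> \<sigma> (i, j)) = \<phi> (src C (\<sigma> (j, j)))" using f(5)[OF s(1)[OF ij]] s(3)[OF ij] ij by simp
next
  fix i j l assume ij: "i \<le> j" "j \<le> l" "l \<le> n"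
  note s = nerveD[OF \<sigma>]
  show "cmp D (nerve_map n \<Phi> \<sigma> (j, l)) (nerve_map n \<Phi> \<sigma> (i, j)) = nerve_map n \<Phi> \<sigma> (i, l)"
    using is_functorD(6)[OF \<Phi> s(1)[of i j] s(1)[of j l]] s(2)[of j l] s(3)[of i j] s(5)[OF ij] ij by simp
next
  fix i assume i: "i \<le> n"
  have "\<Phi> (\<sigma> (i, i)) = \<Phi> (ident C (src C (\<sigma> (i, i))))" using nerveD(4)[OF \<sigma> i] by simp
  then show "nerve_map n \<Phi> \<sigma> (i, i) = ident D (\<phi> (src C (\<sigma> (i, i))))"
    using is_functorD(2)[OF \<Phi> nerve_vertex[OF C \<sigma> i]] i by simp
qed (simp add: nerve_map_def)

lemma nerve_act_map:
  "mono_map m n \<theta> \<Longrightarrow> nerve_act m \<theta> (nerve_map n \<Phi> \<sigma>) = nerve_map m \<Phi> (nerve_act m \<theta> \<sigma>)"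
  using mono_mapD by (intro extensionalityI[of _ "order_pairs m"]) (fastforce simp: nerve_act_def nerve_map_def)+

text \<open>Induced by a functor \<Phi> of the index categories together with a natural map \<gamma>
  from F to the restriction of G along \<Phi>.\<close>

definition bar_map ::
  "('o, 'a) category \<Rightarrow> ('o, 'a, 'k, 'm) kfun \<Rightarrow> ('p, 'b) category \<Rightarrow> ('p, 'b, 'k, 'n) kfun \<Rightarrow>
   ('a \<Rightarrow> 'b) \<Rightarrow> ('o \<Rightarrow> 'm \<Rightarrow> 'n) \<Rightarrow> nat \<Rightarrow> ('a simplex \<Rightarrow> 'm) \<Rightarrow> 'b simplex \<Rightarrow> 'n" where
  "bar_map C F D G \<Phi> \<gamma> n =
     bar_lift C F n (bar_mod D G n) (\<lambda>\<sigma> x. bar_in D G n (nerve_map n \<Phi> \<sigma>) (\<gamma> (origin C \<sigma>) x))"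

text \<open>Corresponds to \<open>bar_map\<close> along the identity functor, but in the form of a
  map of direct sums, so that exactness passes through \<open>dsum_map_kernel\<close>.\<close>

definition bar_nat ::
  "('o, 'a) category \<Rightarrow> ('o \<Rightarrow> 'm \<Rightarrow> 'n) \<Rightarrow> nat \<Rightarrow> ('a simplex \<Rightarrow> 'm) \<Rightarrow> 'a simplex \<Rightarrow> 'n" where
  "bar_nat C \<eta> n = dsum_map (nerve C n) (\<lambda>\<sigma>. \<eta> (origin C \<sigma>))"

lemma bar_nat_hom:
  assumes R: "cring R" and C: "is_category C" and F: "is_kfun R C F" and G: "is_kfun R C G"
    and \<eta>: "is_nat_trans R C F G \<eta>"
  shows "bar_nat C \<eta> n \<in> mod_hom R (bar_mod C F n) (bar_mod C G n)"
  unfolding bar_nat_def bar_mod_def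
  by (rule dsum_map_hom[OF R bar_summand[OF R C F] bar_summand[OF R C G]])
    (auto intro: is_nat_transD(1)[OF \<eta>] nerve_vertex[OF C])

lemma bar_nat_in:
  assumes R: "cring R" and C: "is_category C" and F: "is_kfun R C F" and G: "is_kfun R C G"
    and \<eta>: "is_nat_trans R C F G \<eta>" and \<sigma>: "\<sigma> \<in> nerve C n" and x: "x \<in> elts F (origin C \<sigma>)"
  shows "bar_nat C \<eta> n (bar_in C F n \<sigma> x) = bar_in C G n \<sigma> (\<eta> (origin C \<sigma>) x)"
  unfolding bar_nat_def bar_in_def
  by (rule dsum_map_in[where h = "\<lambda>\<sigma>. \<eta> (origin C \<sigma>)" and M = "\<lambda>\<sigma>. fob F (origin C \<sigma>)"
        and N = "\<lambda>\<sigma>. fob G (origin C \<sigma>)" and I = "nerve C n" and R = R])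
    (use \<sigma> x in \<open>auto intro: R bar_summand[OF R C F] bar_summand[OF R C G] is_nat_transD(1)[OF \<eta>] nerve_vertex[OF C]\<close>)

context
  fixes R :: "('k, 'r) ring_scheme" and C :: "('o, 'a) category" and D :: "('p, 'b) category"
    and F :: "('o, 'a, 'k, 'm) kfun" and G :: "('p, 'b, 'k, 'n) kfun" and \<phi> \<Phi> \<gamma>
  assumes R: "cring R" and C: "is_category C" and D: "is_category D"
    and F: "is_kfun R C F" and G: "is_kfun R D G" and \<Phi>: "is_functor C D \<phi> \<Phi>"
    and \<gamma>: "\<And>X. X \<in> obs C \<Longrightarrow> \<gamma> X \<in> mod_hom R (fob F X) (fob G (\<phi> X))"
    and nat: "\<And>f x. \<lbrakk>f \<in> arrs C; x \<in> elts F (src C f)\<rbrakk> \<Longrightarrow> \<gamma> (trg C f) (far F f x) = far G (\<Phi> f) (\<gamma> (src C f) x)"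
begin

lemma nerve_map_vertex:
  assumes "\<sigma> \<in> nerve C n"
  shows "src D (nerve_map n \<Phi> \<sigma> (0, 0)) = \<phi> (origin C \<sigma>)"
  using is_functorD(4)[OF \<Phi> nerveD(1)[OF assms]] by simp

lemma bar_map_aux:
  assumes \<sigma>: "\<sigma> \<in> nerve C n"
  shows "(\<lambda>x. bar_in D G n (nerve_map n \<Phi> \<sigma>) (\<gamma> (origin C \<sigma>) x)) \<in> mod_hom R (fob F (origin C \<sigma>)) (bar_mod D G n)"
proof (rule mod_hom_comp)
  show "\<gamma> (origin C \<sigma>) \<in> mod_hom R (fob F (origin C \<sigma>)) (fob G (src D (nerve_map n \<Phi> \<sigma> (0, 0))))"
    unfolding nerve_map_vertex[OF \<sigma>] by (rule \<gamma>[OF nerve_vertex[OF C \<sigma>]]) simp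
qed (rule bar_in_hom[OF R D G nerve_map_closed[OF C \<Phi> \<sigma>]])

lemma bar_map_hom: "bar_map C F D G \<Phi> \<gamma> n \<in> mod_hom R (bar_mod C F n) (bar_mod D G n)"
  unfolding bar_map_def by (rule bar_lift_hom[OF R C F bar_module[OF R D G]]) (rule bar_map_aux)

lemma bar_map_in:
  "\<lbrakk>\<sigma> \<in> nerve C n; x \<in> elts F (origin C \<sigma>)\<rbrakk> \<Longrightarrow>
    bar_map C F D G \<Phi> \<gamma> n (bar_in C F n \<sigma> x) = bar_in D G n (nerve_map n \<Phi> \<sigma>) (\<gamma> (origin C \<sigma>) x)"
  unfolding bar_map_def by (rule bar_lift_in[OF R C F bar_module[OF R D G]]) (rule bar_map_aux)

text \<open>Only the values on generators enter, so one argument covers \<open>bar_map\<close> and,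
  over the identity functor, \<open>bar_nat\<close>. It rests on naturality of \<gamma> along
  \<open>\<sigma> (0, \<theta> 0)\<close>.\<close>

lemma chain_map_act:
  assumes t: "\<And>n. t n \<in> mod_hom R (bar_mod C F n) (bar_mod D G n)"
    and tin: "\<And>n \<sigma> x. \<lbrakk>\<sigma> \<in> nerve C n; x \<in> elts F (origin C \<sigma>)\<rbrakk> \<Longrightarrow>
      t n (bar_in C F n \<sigma> x) = bar_in D G n (nerve_map n \<Phi> \<sigma>) (\<gamma> (origin C \<sigma>) x)"
    and \<theta>: "mono_map m n \<theta>" and z: "z \<in> carrier (bar_mod C F n)"
  shows "t m (bar_act C F n m \<theta> z) = bar_act D G n m \<theta> (t n z)"
proof (rule bar_hom_eqI[OF R C F bar_module[OF R D G] mod_hom_comp[OF bar_act_hom[OF R C F \<theta>] t]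
      mod_hom_comp[OF t bar_act_hom[OF R D G \<theta>]] _ z])
  fix \<sigma> x assume \<sigma>: "\<sigma> \<in> nerve C n" and x: "x \<in> elts F (origin C \<sigma>)"
  have b: "\<theta> 0 \<le> n" using mono_mapD(2)[OF \<theta>, of 0] by simp
  note s = nerveD[OF \<sigma>]
  have fx: "far F (\<sigma> (0, \<theta> 0)) x \<in> elts F (src C (nerve_act m \<theta> \<sigma> (0, 0)))"
    using mod_homD(1)[OF nerve_far[OF R C F \<sigma>] x] b by simp
  have gx: "\<gamma> (origin C \<sigma>) x \<in> elts G (src D (nerve_map n \<Phi> \<sigma> (0, 0)))"
    unfolding nerve_map_vertex[OF \<sigma>] by (rule mod_homD(1)[OF \<gamma>[OF nerve_vertex[OF C \<sigma>]] x]) simp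
  have "\<gamma> (src C (nerve_act m \<theta> \<sigma> (0, 0))) (far F (\<sigma> (0, \<theta> 0)) x)
      = far G (nerve_map n \<Phi> \<sigma> (0, \<theta> 0)) (\<gamma> (origin C \<sigma>) x)"
    using nat[OF s(1)[of 0 "\<theta> 0"], of x] s(2,3)[of 0 "\<theta> 0"] b x by simp
  then show "t m (bar_act C F n m \<theta> (bar_in C F n \<sigma> x)) = bar_act D G n m \<theta> (t n (bar_in C F n \<sigma> x))"
    using bar_act_in[OF R C F \<theta> \<sigma> x] tin[OF nerve_act_closed[OF \<sigma> \<theta>] fx] tin[OF \<sigma> x]
      bar_act_in[OF R D G \<theta> nerve_map_closed[OF C \<Phi> \<sigma>] gx] nerve_act_map[where \<Phi> = \<Phi> and \<sigma> = \<sigma>, OF \<theta>] by simp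
qed

lemma chain_map_diff:
  assumes t: "\<And>n. t n \<in> mod_hom R (bar_mod C F n) (bar_mod D G n)"
    and tin: "\<And>n \<sigma> x. \<lbrakk>\<sigma> \<in> nerve C n; x \<in> elts F (origin C \<sigma>)\<rbrakk> \<Longrightarrow>
      t n (bar_in C F n \<sigma> x) = bar_in D G n (nerve_map n \<Phi> \<sigma>) (\<gamma> (origin C \<sigma>) x)"
    and z: "z \<in> carrier (bar_mod C F (Suc n))"
  shows "t n (bar_diff C F n z) = bar_diff D G n (t (Suc n) z)"
proof -
  note h = mod_homD(1)[OF bar_face_hom[OF R C F] z]
  have "t n (bar_diff C F n z) = altsum (bar_mod D G n) (Suc n) (\<lambda>i. t n (bar_face C F n i z))"
    unfolding bar_diff_def by (rule altsum_hom[OF bar_module[OF R C F] bar_module[OF R D G] t]) (rule h)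
  also have "\<dots> = bar_diff D G n (t (Suc n) z)"
    unfolding bar_diff_def
    by (rule altsum_cong[OF bar_module[OF R D G]])
      (use chain_map_act[of t, OF t tin mono_map_coface z] mod_homD(1)[OF bar_face_hom[OF R D G] mod_homD(1)[OF t z]] in auto)
  finally show ?thesis .
qed

lemma bar_map_diff:
  "z \<in> carrier (bar_mod C F (Suc n)) \<Longrightarrow>
    bar_map C F D G \<Phi> \<gamma> n (bar_diff C F n z) = bar_diff D G n (bar_map C F D G \<Phi> \<gamma> (Suc n) z)"
  by (rule chain_map_diff[where t = "bar_map C F D G \<Phi> \<gamma>", OF bar_map_hom bar_map_in])

end

lemma bar_nat_diff:
  assumes R: "cring R" and C: "is_category C" and F: "is_kfun R C F" and G: "is_kfun R C G"
    and \<eta>: "is_nat_trans R C F G \<eta>" and z: "z \<in> carrier (bar_mod C F (Suc n))"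
  shows "bar_nat C \<eta> n (bar_diff C F n z) = bar_diff C G n (bar_nat C \<eta> (Suc n) z)"
proof (rule chain_map_diff[where t = "bar_nat C \<eta>" and \<gamma> = \<eta>, OF R C C F G is_functor_id _ _ _ _ z])
  fix n \<sigma> x assume *: "\<sigma> \<in> nerve C n" "x \<in> elts F (origin C \<sigma>)"
  show "bar_nat C \<eta> n (bar_in C F n \<sigma> x) = bar_in C G n (nerve_map n (\<lambda>f. f) \<sigma>) (\<eta> (origin C \<sigma>) x)"
    unfolding nerve_map_id[OF *(1)] by (rule bar_nat_in[OF R C F G \<eta> *])
qed (use is_nat_transD[OF \<eta>] bar_nat_hom[OF R C F G \<eta>] in auto)

lemma bar_nat_eps:
  assumes R: "cring R" and C: "is_category C" and F: "is_kfun R C F" and G: "is_kfun R C G"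
    and \<eta>: "is_nat_trans R C F G \<eta>" and z: "z \<in> carrier (bar_mod C F 0)"
  shows "bar_eps R C G (bar_nat C \<eta> 0 z) = colim_map R C G \<eta> (bar_eps R C F z)"
proof (rule bar_hom_eqI[OF R C F colim_module[OF R C G] mod_hom_comp[OF bar_nat_hom[OF R C F G \<eta>] bar_eps_hom[OF R C G]]
      mod_hom_comp[OF bar_eps_hom[OF R C F] colim_map_hom[OF R C F G \<eta>]] _ z])
  fix \<sigma> x assume *: "\<sigma> \<in> nerve C 0" "x \<in> elts F (origin C \<sigma>)"
  have v: "origin C \<sigma> \<in> obs C" by (rule nerve_vertex[OF C *(1)]) simp
  show "bar_eps R C G (bar_nat C \<eta> 0 (bar_in C F 0 \<sigma> x)) = colim_map R C G \<eta> (bar_eps R C F (bar_in C F 0 \<sigma> x))"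
    using bar_nat_in[OF R C F G \<eta> *] bar_eps_in[OF R C F *] bar_eps_in[OF R C G *(1)]
      colim_map_in[OF R C F G \<eta> v *(2)] mod_homD(1)[OF is_nat_transD(1)[OF \<eta> v] *(2)] by simp
qed

text \<open>In each degree the bar construction is a direct sum of values of the functor, hence
  exact in it.\<close>

lemma bar_nat_exact:
  assumes R: "cring R" and C: "is_category C" and F: "is_kfun R C F" and G: "is_kfun R C G"
    and \<eta>: "is_nat_trans R C F G \<eta>"
    and ex: "\<And>X x. \<lbrakk>X \<in> obs C; x \<in> elts G X; Q X x\<rbrakk> \<Longrightarrow> \<exists>y\<in>elts F X. \<eta> X y = x"
    and z: "z \<in> carrier (bar_mod C G n)" "\<And>\<sigma>. \<sigma> \<in> nerve C n \<Longrightarrow> Q (origin C \<sigma>) (z \<sigma>)"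
  shows "\<exists>y\<in>carrier (bar_mod C F n). bar_nat C \<eta> n y = z"
  unfolding bar_mod_def bar_nat_def
proof (rule dsum_map_kernel[where Q = "\<lambda>\<sigma>. Q (origin C \<sigma>)" and M = "\<lambda>\<sigma>. fob G (origin C \<sigma>)" and R = R])
  have v: "origin C \<sigma> \<in> obs C" if "\<sigma> \<in> nerve C n" for \<sigma> by (rule nerve_vertex[OF C that]) simp
  show "\<And>\<sigma>. \<sigma> \<in> nerve C n \<Longrightarrow> \<eta> (origin C \<sigma>) \<in> mod_hom R (fob F (origin C \<sigma>)) (fob G (origin C \<sigma>))"
    by (rule is_nat_transD(1)[OF \<eta> v])
  show "\<And>\<sigma> x. \<lbrakk>\<sigma> \<in> nerve C n; x \<in> elts G (origin C \<sigma>); Q (origin C \<sigma>) x\<rbrakk> \<Longrightarrow>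
      \<exists>y\<in>elts F (origin C \<sigma>). \<eta> (origin C \<sigma>) y = x" by (rule ex[OF v])
  show "z \<in> carrier (dsum (nerve C n) (\<lambda>\<sigma>. fob G (origin C \<sigma>)))" using z(1) by (simp add: bar_mod_def)
qed (use R z(2) bar_summand[OF R C F] bar_summand[OF R C G] in auto)

lemma bar_nat_comp_zero:
  assumes R: "cring R" and C: "is_category C" and F: "is_kfun R C F" and G: "is_kfun R C G" and H: "is_kfun R C H"
    and \<eta>: "is_nat_trans R C F G \<eta>" and \<zeta>: "is_nat_trans R C G H \<zeta>"
    and z: "\<And>X x. \<lbrakk>X \<in> obs C; x \<in> elts F X\<rbrakk> \<Longrightarrow> \<zeta> X (\<eta> X x) = \<zero>\<^bsub>fob H X\<^esub>"
    and x: "x \<in> carrier (bar_mod C F n)"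
  shows "bar_nat C \<zeta> n (bar_nat C \<eta> n x) = \<zero>\<^bsub>bar_mod C H n\<^esub>"
proof (rule bar_hom_eqI[OF R C F bar_module[OF R C H] mod_hom_comp[OF bar_nat_hom[OF R C F G \<eta>] bar_nat_hom[OF R C G H \<zeta>]]
      mod_hom_zero_map[OF bar_module[OF R C H]] _ x])
  fix \<sigma> x assume *: "\<sigma> \<in> nerve C n" "x \<in> elts F (origin C \<sigma>)"
  have v: "origin C \<sigma> \<in> obs C" by (rule nerve_vertex[OF C *(1)]) simp
  show "bar_nat C \<zeta> n (bar_nat C \<eta> n (bar_in C F n \<sigma> x)) = \<zero>\<^bsub>bar_mod C H n\<^esub>"
    using bar_nat_in[OF R C F G \<eta> *] bar_nat_in[OF R C G H \<zeta> *(1) mod_homD(1)[OF is_nat_transD(1)[OF \<eta> v] *(2)]] z[OF v *(2)]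
      mod_hom_zero[OF is_kfunD(1)[OF H v] bar_module[OF R C H] bar_in_hom[OF R C H *(1)]] by simp
qed

lemma bar_nat_zeroD:
  assumes "cring R" "is_category C" "is_kfun R C G" "bar_nat C \<eta> n x = \<zero>\<^bsub>bar_mod C G n\<^esub>" "\<sigma> \<in> nerve C n"
  shows "\<eta> (origin C \<sigma>) (x \<sigma>) = \<zero>\<^bsub>fob G (origin C \<sigma>)\<^esub>"
proof -
  have "bar_nat C \<eta> n x \<sigma> = \<zero>\<^bsub>bar_mod C G n\<^esub> \<sigma>" using assms(4) by simp
  then show ?thesis
    using assms(5) unfolding bar_nat_def bar_mod_def by (simp add: dsum_map_def) (simp add: dsum_def)
qed

section \<open>Contracting the bar complex of a retract of a free functor\<close>

section \<open>Retracts of free functors are acyclic\<close>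

text \<open>Projectivity as it is used here: the canonical cover of P, free on all elements of P,
  has a natural section. Unlike \<open>projective\<close>, it quantifies over no functors of
  prescribed element types, so it can be carried to the extensions.\<close>

definition split_kfun :: "('k, 'r) ring_scheme \<Rightarrow> ('o, 'a) category \<Rightarrow> ('o, 'a, 'k, 'm) kfun \<Rightarrow> bool" where
  "split_kfun R C P \<longleftrightarrow> is_kfun R C P \<and>
     (\<exists>\<rho>. is_nat_trans R C P (cover_fun R C (elts P) (\<lambda>p. p)) \<rho> \<and>
       (\<forall>X\<in>obs C. \<forall>x\<in>elts P X.
         cover_map R C (elts P) (\<lambda>p. p) P (\<lambda>_ s. s) X (\<rho> X x) = x))"

text \<open>The identity of P is lifted against the free cover on the elements of P. With generators
  labelled by themselves, this cover has exactly the element type over which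
  \<open>projective\<close> allows lifting.\<close>

lemma projective_split:
  assumes R: "cring R" and C: "is_category C" and P: "projective R C P"
  shows "split_kfun R C P"
proof -
  let ?K = "\<lambda>X. elts P X"
  let ?E = "cover_fun R C ?K (\<lambda>p. p)" and ?p = "cover_map R C ?K (\<lambda>p. p) P (\<lambda>_ s. s)"
  have PF: "is_kfun R C P" using P by (simp add: projective_def)
  have inj: "inj_on (\<lambda>p. p) (cover_pairs C ?K)" by simp
  have E: "is_kfun R C ?E" by (rule cover_kfun[OF R C inj])
  have p: "is_nat_trans R C ?E P ?p" by (rule cover_map_nat[OF R C inj PF])
  have surj: "\<forall>X\<in>obs C. ?p X ` elts ?E X = elts P X"
    using cover_image[OF R C inj PF] module.carrier_is_submodule[OF is_kfunD(1)[OF PF]] mod_homD(1)[OF is_kfunD(2)[OF PF]]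
    by blast
  have "is_nat_trans R C P P (\<lambda>X x. x)" by (simp add: is_nat_trans_def mod_hom_id)
  then show ?thesis
    using P E PF p surj unfolding split_kfun_def projective_def by blast
qed

definition nerve_cons :: "('o, 'a) category \<Rightarrow> nat \<Rightarrow> 'a \<Rightarrow> 'a simplex \<Rightarrow> nat \<times> nat \<Rightarrow> 'a" where
  "nerve_cons C n f \<sigma> = (\<lambda>(a, b)\<in>order_pairs (Suc n).
     if b = 0 then ident C (src C f) else if a = 0 then cmp C (\<sigma> (0, b - 1)) f else \<sigma> (a - 1, b - 1))"

lemma nerve_cons_apply [simp]:
  "nerve_cons C n f \<sigma> (0, 0) = ident C (src C f)"
  "b \<le> n \<Longrightarrow> nerve_cons C n f \<sigma> (0, Suc b) = cmp C (\<sigma> (0, b)) f"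
  "\<lbrakk>a \<le> b; b \<le> n\<rbrakk> \<Longrightarrow> nerve_cons C n f \<sigma> (Suc a, Suc b) = \<sigma> (a, b)"
  by (simp_all add: nerve_cons_def)

lemma nerve_cons_closed:
  assumes C: "is_category C" and \<sigma>: "\<sigma> \<in> nerve C n" and f: "f \<in> arrs C" "trg C f = origin C \<sigma>"
  shows "nerve_cons C n f \<sigma> \<in> nerve C (Suc n)"
proof (rule nerveI[where X = "\<lambda>i. case i of 0 \<Rightarrow> src C f | Suc i \<Rightarrow> src C (\<sigma> (i, i))"])
  note c = is_categoryD[OF C] and s = nerveD[OF \<sigma>]
  have o: "src C f \<in> obs C" using c(1)[OF f(1)] .
  have comp: "cmp C (\<sigma> (0, b)) f \<in> arrs C" "src C (cmp C (\<sigma> (0, b)) f) = src C f"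
    "trg C (cmp C (\<sigma> (0, b)) f) = src C (\<sigma> (b, b))" if "b \<le> n" for b
    using c(6-8)[OF f(1) s(1)[of 0 b]] s(2,3)[of 0 b] f(2) that by auto
  { fix i j assume ij: "i \<le> j" "j \<le> Suc n"
    show "nerve_cons C n f \<sigma> (i, j) \<in> arrs C"
      "src C (nerve_cons C n f \<sigma> (i, j)) = (case i of 0 \<Rightarrow> src C f | Suc i \<Rightarrow> src C (\<sigma> (i, i)))"
      "trg C (nerve_cons C n f \<sigma> (i, j)) = (case j of 0 \<Rightarrow> src C f | Suc i \<Rightarrow> src C (\<sigma> (i, i)))"
      using ij c(3-5)[OF o] comp s(1)[of "i - 1" "j - 1"] s(2)[of "i - 1" "j - 1"] s(3)[of "i - 1" "j - 1"] by (cases i; cases j; simp)+ }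
  { fix i assume i: "i \<le> Suc n"
    show "nerve_cons C n f \<sigma> (i, i) = ident C (case i of 0 \<Rightarrow> src C f | Suc i \<Rightarrow> src C (\<sigma> (i, i)))"
      using i s(4)[of "i - 1"] by (cases i) simp_all }
  fix i j l assume ij: "i \<le> j" "j \<le> l" "l \<le> Suc n"
  show "cmp C (nerve_cons C n f \<sigma> (j, l)) (nerve_cons C n f \<sigma> (i, j)) = nerve_cons C n f \<sigma> (i, l)"
  proof (cases i)
    case (Suc i')
    then obtain j' l' where "j = Suc j'" "l = Suc l'" using ij by (cases j; cases l) auto
    then show ?thesis using s(5)[of i' j' l'] ij Suc by simp
  next
    case i: 0
    show ?thesis
    proof (cases j)
      case j: 0
      show ?thesis
      proof (cases l)
        case 0
        then show ?thesis using i j ident_ident[OF C o] by simp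
      next
        case (Suc l')
        then show ?thesis using i j ij c(9)[OF comp(1)[of l']] comp(2)[of l'] by simp
      qed
    next
      case (Suc j')
      then obtain l' where l: "l = Suc l'" using ij by (cases l) auto
      then have l': "j' \<le> l'" "l' \<le> n" using Suc ij by auto
      then have "cmp C (\<sigma> (j', l')) (cmp C (\<sigma> (0, j')) f) = cmp C (\<sigma> (0, l')) f"
        using c(11)[OF f(1) s(1)[of 0 j'] s(1)[of j' l']] s(2)[of 0 j'] s(2)[of j' l'] s(3)[of 0 j'] s(5)[of 0 j' l'] f(2) by simp
      then show ?thesis using i Suc l l' by simp
    qed
  qed
qed (simp add: nerve_cons_def)

lemma nerve_cons_face_0:
  assumes "\<sigma> \<in> nerve C n"
  shows "nerve_act n (coface 0) (nerve_cons C n f \<sigma>) = \<sigma>"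
  using nerveD(6)[OF assms]
  by (intro extensionalityI[of _ "order_pairs n"]) (auto simp: nerve_act_def coface_def)

text \<open>Face i + 1 deletes vertex i of \<sigma>. For i = 0 the arrow in front is extended by the
  first arrow of \<sigma>; for i > 0 it is composed with the identity
  \<open>\<sigma> (0, 0)\<close>. The value \<open>coface i 0\<close> puts both cases into one
  formula.\<close>

lemma nerve_cons_face_Suc:
  assumes C: "is_category C" and \<sigma>: "\<sigma> \<in> nerve C (Suc n)" and f: "f \<in> arrs C" "trg C f = origin C \<sigma>"
    and i: "i \<le> Suc n"
  shows "nerve_act (Suc n) (coface (Suc i)) (nerve_cons C (Suc n) f \<sigma>) =
    nerve_cons C n (cmp C (\<sigma> (0, coface i 0)) f) (nerve_act n (coface i) \<sigma>)"
proof (rule extensionalityI[of _ "order_pairs (Suc n)"])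
  note s = nerveD[OF \<sigma>] and c = is_categoryD[OF C]
  have m: "mono_map n (Suc n) (coface i)" by (rule mono_map_coface[OF i])
  have i0: "coface i 0 \<le> Suc n" by (simp add: coface_def)
  fix p assume "p \<in> order_pairs (Suc n)"
  then obtain a b where p: "p = (a, b)" "a \<le> b" "b \<le> Suc n" by (auto simp: order_pairs_def)
  have cf: "coface (Suc i) 0 = 0" "\<And>b. coface (Suc i) (Suc b) = Suc (coface i b)" by (auto simp: coface_def)
  show "nerve_act (Suc n) (coface (Suc i)) (nerve_cons C (Suc n) f \<sigma>) p =
      nerve_cons C n (cmp C (\<sigma> (0, coface i 0)) f) (nerve_act n (coface i) \<sigma>) p"
  proof (cases b)
    case 0
    then show ?thesis using p c(7)[OF f(1) s(1)[OF le0 i0]] s(2)[OF le0 i0] f(2) by (simp add: cf)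
  next
    case (Suc b')
    have b': "b' \<le> n" "coface i b' \<le> Suc n" "coface i 0 \<le> coface i b'"
      using Suc p mono_mapD[OF m] by auto
    show ?thesis
    proof (cases a)
      case 0
      have "cmp C (\<sigma> (coface i 0, coface i b')) (cmp C (\<sigma> (0, coface i 0)) f) = cmp C (\<sigma> (0, coface i b')) f"
        using c(11)[OF f(1) s(1)[OF le0 i0] s(1)[OF b'(3,2)]] s(2,3)[OF le0 i0] s(2)[OF b'(3,2)] s(5)[OF le0 b'(3,2)] f(2)
        by simp
      then show ?thesis using 0 Suc p b' by (simp add: cf)
    next
      case (Suc a')
      then show ?thesis using \<open>b = Suc b'\<close> p b' mono_mapD(1)[OF m, of a' b'] by (simp add: cf)
    qed
  qed
qed (simp_all add: nerve_act_def nerve_cons_def)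

context
  fixes R :: "('k, 'r) ring_scheme" and C :: "('o, 'a) category" and P :: "('o, 'a, 'k, 'm) kfun" and \<rho>
  assumes R: "cring R" and C: "is_category C" and P: "is_kfun R C P"
    and \<rho>: "is_nat_trans R C P (cover_fun R C (elts P) (\<lambda>p. p)) \<rho>"
    and sect: "\<And>X x. \<lbrakk>X \<in> obs C; x \<in> elts P X\<rbrakk> \<Longrightarrow>
      cover_map R C (elts P) (\<lambda>p. p) P (\<lambda>_ s. s) X (\<rho> X x) = x"
begin

text \<open>On a generator (f, s) of the free cover at the first vertex: f is put in front of the
  chain, and s, which lives at the source of f, becomes the coefficient.\<close>

definition cons_lift :: "nat \<Rightarrow> 'a simplex \<Rightarrow> ('a \<times> 'm \<Rightarrow> 'k) \<Rightarrow> 'a simplex \<Rightarrow> 'm" where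
  "cons_lift n \<sigma> = lin_ext R (bar_mod C P (Suc n)) (\<lambda>(f, s). bar_in C P (Suc n) (nerve_cons C n f \<sigma>) s)"

text \<open>A coefficient at X_0 does not by itself come from an earlier object; the section \<rho>
  writes it as a combination of generators (f, s), and each f is an arrow that can be
  prefixed.\<close>

definition extra_degeneracy :: "nat \<Rightarrow> ('a simplex \<Rightarrow> 'm) \<Rightarrow> 'a simplex \<Rightarrow> 'm" where
  "extra_degeneracy n = bar_lift C P n (bar_mod C P (Suc n)) (\<lambda>\<sigma> x. cons_lift n \<sigma> (\<rho> (origin C \<sigma>) x))"

abbreviation (input) "gens \<equiv> cover_gens C (elts P) (\<lambda>p. p)"

lemma gens_iff: "(f, s) \<in> gens Y \<longleftrightarrow> f \<in> arrs C \<and> s \<in> elts P (src C f) \<and> trg C f = Y"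
  by (auto simp: cover_gens_def cover_pairs_def)

lemma inj_id: "inj_on (\<lambda>p. p) (cover_pairs C (elts P))" by simp

lemma cons_closed:
  assumes "\<sigma> \<in> nerve C n" "f \<in> arrs C" "trg C f = origin C \<sigma>" "s \<in> elts P (src C f)"
  shows "s \<in> elts P (src C (nerve_cons C n f \<sigma> (0, 0)))"
  using assms is_categoryD(1,4)[OF C] by simp

lemma cons_lift_aux:
  assumes "\<sigma> \<in> nerve C n"
  shows "(\<lambda>(f, s). bar_in C P (Suc n) (nerve_cons C n f \<sigma>) s) \<in> gens (origin C \<sigma>) \<rightarrow> carrier (bar_mod C P (Suc n))"
  using bar_in_closed[OF R C P nerve_cons_closed[OF C assms] cons_closed[OF assms]] by (auto simp: gens_iff)

lemma cons_lift_hom: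
  "\<sigma> \<in> nerve C n \<Longrightarrow> cons_lift n \<sigma> \<in> mod_hom R (free_mod R (gens (origin C \<sigma>))) (bar_mod C P (Suc n))"
  unfolding cons_lift_def by (rule lin_ext_hom[OF bar_module[OF R C P] cons_lift_aux])

lemma cons_lift_gen:
  assumes "\<sigma> \<in> nerve C n" "(f, s) \<in> gens (origin C \<sigma>)"
  shows "cons_lift n \<sigma> (fgen R (f, s)) = bar_in C P (Suc n) (nerve_cons C n f \<sigma>) s"
  unfolding cons_lift_def using lin_ext_fgen[OF bar_module[OF R C P] cons_lift_aux[OF assms(1)] assms(2)] by simp

lemma rho_hom:
  assumes "\<sigma> \<in> nerve C n"
  shows "\<rho> (origin C \<sigma>) \<in> mod_hom R (fob P (origin C \<sigma>)) (free_mod R (gens (origin C \<sigma>)))"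
  using is_nat_transD(1)[OF \<rho> nerve_vertex[OF C assms, of 0]] by (simp add: cover_fun_def)

lemma extra_degeneracy_aux:
  "\<sigma> \<in> nerve C n \<Longrightarrow> (\<lambda>x. cons_lift n \<sigma> (\<rho> (origin C \<sigma>) x)) \<in> mod_hom R (fob P (origin C \<sigma>)) (bar_mod C P (Suc n))"
  by (rule mod_hom_comp[OF rho_hom cons_lift_hom])

lemma extra_degeneracy_hom: "extra_degeneracy n \<in> mod_hom R (bar_mod C P n) (bar_mod C P (Suc n))"
  unfolding extra_degeneracy_def by (rule bar_lift_hom[OF R C P bar_module[OF R C P]]) (rule extra_degeneracy_aux)

lemma extra_degeneracy_in:
  "\<lbrakk>\<sigma> \<in> nerve C n; x \<in> elts P (origin C \<sigma>)\<rbrakk> \<Longrightarrow>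
    extra_degeneracy n (bar_in C P n \<sigma> x) = cons_lift n \<sigma> (\<rho> (origin C \<sigma>) x)"
  unfolding extra_degeneracy_def by (rule bar_lift_in[OF R C P bar_module[OF R C P]]) (rule extra_degeneracy_aux)

text \<open>Deleting the prefixed vertex pushes s along f, which is how the free cover is evaluated
  in P. After \<rho> this evaluation returns the coefficient, so face 0 undoes the extra
  degeneracy.\<close>

lemma cons_lift_face_0:
  assumes \<sigma>: "\<sigma> \<in> nerve C n" and u: "u \<in> carrier (free_mod R (gens (origin C \<sigma>)))"
  shows "bar_face C P n 0 (cons_lift n \<sigma> u) =
    bar_in C P n \<sigma> (cover_map R C (elts P) (\<lambda>p. p) P (\<lambda>_ s. s) (origin C \<sigma>) u)"
proof (rule free_mod_hom_eqI[OF R bar_module[OF R C P] mod_hom_comp[OF cons_lift_hom[OF \<sigma>] bar_face_hom[OF R C P]] _ _ u])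
  have v: "origin C \<sigma> \<in> obs C" by (rule nerve_vertex[OF C \<sigma>]) simp
  have cm: "cover_map R C (elts P) (\<lambda>p. p) P (\<lambda>_ s. s) (origin C \<sigma>)
      \<in> mod_hom R (free_mod R (gens (origin C \<sigma>))) (fob P (origin C \<sigma>))"
    by (rule cover_map_hom[OF R C inj_id P _ v])
  show "(\<lambda>u. bar_in C P n \<sigma> (cover_map R C (elts P) (\<lambda>p. p) P (\<lambda>_ s. s) (origin C \<sigma>) u))
      \<in> mod_hom R (free_mod R (gens (origin C \<sigma>))) (bar_mod C P n)"
    by (rule mod_hom_comp[OF cm bar_in_hom[OF R C P \<sigma>]])
  fix g assume "g \<in> gens (origin C \<sigma>)"
  then obtain f s where g: "g = (f, s)" "(f, s) \<in> gens (origin C \<sigma>)" by (cases g) auto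
  then have fs: "f \<in> arrs C" "s \<in> elts P (src C f)" "trg C f = origin C \<sigma>" by (auto simp: gens_iff)
  note nc = nerve_cons_closed[OF C \<sigma> fs(1,3)]
  have "cmp C (\<sigma> (0, 0)) f = f" using nerveD(4)[OF \<sigma>, of 0] is_categoryD(10)[OF C fs(1)] fs(3) by simp
  then have "bar_face C P n 0 (cons_lift n \<sigma> (fgen R g)) = bar_in C P n \<sigma> (far P f s)"
    unfolding g(1) cons_lift_gen[OF \<sigma> g(2)]
    using bar_act_in[OF R C P mono_map_coface[of 0 n] nc cons_closed[OF \<sigma> fs(1,3,2)]] nerve_cons_face_0[OF \<sigma>]
    by (simp add: coface_def)
  then show "bar_face C P n 0 (cons_lift n \<sigma> (fgen R g)) =
      bar_in C P n \<sigma> (cover_map R C (elts P) (\<lambda>p. p) P (\<lambda>_ s. s) (origin C \<sigma>) (fgen R g))"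
    using cover_map_gen[OF R C inj_id P _ fs] g(1) by simp
qed simp

text \<open>The arrow in front is composed with \<open>\<sigma> (0, coface i 0)\<close>, and
  composition is the action of that arrow on the generators of the free cover. Naturality of \<rho>
  then exchanges the remaining faces with the extra degeneracy.\<close>

lemma cons_lift_face_Suc:
  assumes \<sigma>: "\<sigma> \<in> nerve C (Suc n)" and u: "u \<in> carrier (free_mod R (gens (origin C \<sigma>)))" and i: "i \<le> Suc n"
  shows "bar_face C P (Suc n) (Suc i) (cons_lift (Suc n) \<sigma> u) =
    cons_lift n (nerve_act n (coface i) \<sigma>) (far (cover_fun R C (elts P) (\<lambda>p. p)) (\<sigma> (0, coface i 0)) u)"
proof (rule free_mod_hom_eqI[OF R bar_module[OF R C P] mod_hom_comp[OF cons_lift_hom[OF \<sigma>] bar_face_hom[OF R C P]] _ _ u])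
  have m: "mono_map n (Suc n) (coface i)" by (rule mono_map_coface[OF i])
  have i0: "coface i 0 \<le> Suc n" by (simp add: coface_def)
  note s = nerveD[OF \<sigma>] and na = nerve_act_closed[OF \<sigma> m] and c = is_categoryD[OF C]
  let ?h = "\<sigma> (0, coface i 0)"
  have h: "?h \<in> arrs C" "src C ?h = origin C \<sigma>" "trg C ?h = src C (nerve_act n (coface i) \<sigma> (0, 0))"
    using s(1-3)[OF le0 i0] by simp_all
  have "far (cover_fun R C (elts P) (\<lambda>p. p)) ?h
      \<in> mod_hom R (free_mod R (gens (origin C \<sigma>))) (free_mod R (gens (src C (nerve_act n (coface i) \<sigma> (0, 0)))))"
    using cover_far_hom[OF R C inj_id h(1)] unfolding h .
  from mod_hom_comp[OF this cons_lift_hom[OF na]]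
  show "(\<lambda>u. cons_lift n (nerve_act n (coface i) \<sigma>) (far (cover_fun R C (elts P) (\<lambda>p. p)) ?h u))
      \<in> mod_hom R (free_mod R (gens (origin C \<sigma>))) (bar_mod C P (Suc n))" .
  fix g assume "g \<in> gens (origin C \<sigma>)"
  then obtain f s where g: "g = (f, s)" "(f, s) \<in> gens (origin C \<sigma>)" by (cases g) auto
  then have fs: "f \<in> arrs C" "s \<in> elts P (src C f)" "trg C f = origin C \<sigma>" by (auto simp: gens_iff)
  note nc = nerve_cons_closed[OF C \<sigma> fs(1,3)]
  have hf: "cmp C ?h f \<in> arrs C" "src C (cmp C ?h f) = src C f" "trg C (cmp C ?h f) = trg C ?h"
    using c(6-8)[OF fs(1) h(1)] h(2) fs(3) by simp_all
  have g': "(cmp C ?h f, s) \<in> gens (src C (nerve_act n (coface i) \<sigma> (0, 0)))"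
    using hf fs h by (simp add: gens_iff)
  have c0: "coface (Suc i) 0 = 0" by (simp add: coface_def)
  have "bar_face C P (Suc n) (Suc i) (cons_lift (Suc n) \<sigma> (fgen R g)) =
      bar_in C P (Suc n) (nerve_cons C n (cmp C ?h f) (nerve_act n (coface i) \<sigma>)) s"
    unfolding g(1) cons_lift_gen[OF \<sigma> g(2)]
    using bar_act_in[OF R C P mono_map_coface[of "Suc i" "Suc n"] nc cons_closed[OF \<sigma> fs(1,3,2)]] i
      nerve_cons_face_Suc[OF C \<sigma> fs(1,3) i] c0 is_kfunD(3)[OF P c(1)[OF fs(1)] fs(2)] by simp
  also have "\<dots> = cons_lift n (nerve_act n (coface i) \<sigma>) (fgen R (cmp C ?h f, s))"
    by (rule cons_lift_gen[OF na g', symmetric])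
  also have "fgen R (cmp C ?h f, s) = far (cover_fun R C (elts P) (\<lambda>p. p)) ?h (fgen R g)"
    unfolding g(1) using cover_far_gen[OF R C inj_id h(1) fs(1,2)] h(2) fs(3) by simp
  finally show "bar_face C P (Suc n) (Suc i) (cons_lift (Suc n) \<sigma> (fgen R g)) =
      cons_lift n (nerve_act n (coface i) \<sigma>) (far (cover_fun R C (elts P) (\<lambda>p. p)) ?h (fgen R g))" .
qed (use i in simp)

lemma extra_degeneracy_face_0:
  assumes z: "z \<in> carrier (bar_mod C P n)"
  shows "bar_face C P n 0 (extra_degeneracy n z) = z"
proof (rule bar_hom_eqI[OF R C P bar_module[OF R C P] mod_hom_comp[OF extra_degeneracy_hom bar_face_hom[OF R C P]] mod_hom_id _ z])
  fix \<sigma> x assume *: "\<sigma> \<in> nerve C n" "x \<in> elts P (origin C \<sigma>)"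
  show "bar_face C P n 0 (extra_degeneracy n (bar_in C P n \<sigma> x)) = bar_in C P n \<sigma> x"
    using extra_degeneracy_in[OF *] cons_lift_face_0[OF *(1) mod_homD(1)[OF rho_hom[OF *(1)] *(2)]]
      sect[OF nerve_vertex[OF C *(1)] *(2)] by simp
qed simp

lemma extra_degeneracy_face_Suc:
  assumes z: "z \<in> carrier (bar_mod C P (Suc n))" and i: "i \<le> Suc n"
  shows "bar_face C P (Suc n) (Suc i) (extra_degeneracy (Suc n) z) = extra_degeneracy n (bar_face C P n i z)"
proof (rule bar_hom_eqI[OF R C P bar_module[OF R C P] mod_hom_comp[OF extra_degeneracy_hom bar_face_hom[OF R C P]]
      mod_hom_comp[OF bar_face_hom[OF R C P] extra_degeneracy_hom] _ z])
  fix \<sigma> x assume \<sigma>: "\<sigma> \<in> nerve C (Suc n)" and x: "x \<in> elts P (origin C \<sigma>)"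
  have m: "mono_map n (Suc n) (coface i)" by (rule mono_map_coface[OF i])
  have i0: "coface i 0 \<le> Suc n" by (simp add: coface_def)
  note s = nerveD[OF \<sigma>]
  let ?h = "\<sigma> (0, coface i 0)"
  have h: "?h \<in> arrs C" "src C ?h = origin C \<sigma>" "trg C ?h = src C (nerve_act n (coface i) \<sigma> (0, 0))"
    using s(1-3)[OF le0 i0] by simp_all
  have hx: "far P ?h x \<in> elts P (src C (nerve_act n (coface i) \<sigma> (0, 0)))"
    using mod_homD(1)[OF is_kfunD(2)[OF P h(1)], of x] x unfolding h by simp
  have "\<rho> (src C (nerve_act n (coface i) \<sigma> (0, 0))) (far P ?h x) =
      far (cover_fun R C (elts P) (\<lambda>p. p)) ?h (\<rho> (origin C \<sigma>) x)"
    using is_nat_transD(2)[OF \<rho> h(1), of x] x unfolding h by simp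
  then show "bar_face C P (Suc n) (Suc i) (extra_degeneracy (Suc n) (bar_in C P (Suc n) \<sigma> x)) =
      extra_degeneracy n (bar_face C P n i (bar_in C P (Suc n) \<sigma> x))"
    using extra_degeneracy_in[OF \<sigma> x] cons_lift_face_Suc[OF \<sigma> mod_homD(1)[OF rho_hom[OF \<sigma>] x] i]
      bar_act_in[OF R C P m \<sigma> x] extra_degeneracy_in[OF nerve_act_closed[OF \<sigma> m] hx] by simp
qed (use i in simp_all)

text \<open>The extra degeneracy contracts the complex on cycles of positive degree. Degree 0 is
  \<open>bar_eps_exact\<close>, which holds for all coefficients.\<close>

lemma bar_exact_retract:
  assumes x: "x \<in> carrier (bar_mod C P (Suc n))" and z: "bar_diff C P n x = \<zero>\<^bsub>bar_mod C P n\<^esub>"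
  shows "\<exists>y\<in>carrier (bar_mod C P (Suc (Suc n))). bar_diff C P (Suc n) y = x"
proof
  show "extra_degeneracy (Suc n) x \<in> carrier (bar_mod C P (Suc (Suc n)))" by (rule mod_homD(1)[OF extra_degeneracy_hom x])
  show "bar_diff C P (Suc n) (extra_degeneracy (Suc n) x) = x"
    unfolding bar_diff_def
  proof (rule altsum_extra_degeneracy[OF bar_module[OF R C P] bar_module[OF R C P] extra_degeneracy_hom])
    show "altsum (bar_mod C P n) (Suc n) (\<lambda>i. bar_face C P n i x) = \<zero>\<^bsub>bar_mod C P n\<^esub>"
      using z by (simp add: bar_diff_def)
  qed (use mod_homD(1)[OF bar_face_hom[OF R C P] x] extra_degeneracy_face_0[OF x] extra_degeneracy_face_Suc[OF x] x in simp_all)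
qed

end

lemma bar_exact_split:
  assumes "cring R" "is_category C" "split_kfun R C P" "x \<in> carrier (bar_mod C P (Suc n))" "bar_diff C P n x = \<zero>\<^bsub>bar_mod C P n\<^esub>"
  shows "\<exists>y\<in>carrier (bar_mod C P (Suc (Suc n))). bar_diff C P (Suc n) y = x"
  using assms(3) bar_exact_retract[OF assms(1,2) _ _ _ assms(4,5)] unfolding split_kfun_def by blast

section \<open>Resolutions, bar homology and derived functors of the colimit\<close>

section \<open>The bar complex computes the derived functors of the colimit\<close>

text \<open>The notion of resolution that survives a change of element type: projectivity is
  replaced by the splitting of the canonical cover, and the exactness conditions are those of
  \<open>projective_resolution\<close>.\<close>

definition split_resolution ::
  "('k, 'r) ring_scheme \<Rightarrow> ('o, 'a) category \<Rightarrow> ('o, 'a, 'k, 'm) kfun \<Rightarrow>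
   (nat \<Rightarrow> ('o, 'a, 'k, 'p) kfun) \<Rightarrow> (nat \<Rightarrow> 'o \<Rightarrow> 'p \<Rightarrow> 'p) \<Rightarrow> ('o \<Rightarrow> 'p \<Rightarrow> 'm) \<Rightarrow> bool" where
  "split_resolution R C F P d e \<longleftrightarrow>
     (\<forall>n. split_kfun R C (P n)) \<and>
     is_nat_trans R C (P 0) F e \<and>
     (\<forall>n. is_nat_trans R C (P (Suc n)) (P n) (d n)) \<and>
     (\<forall>X\<in>obs C. e X ` elts (P 0) X = elts F X) \<and>
     (\<forall>X\<in>obs C. d 0 X ` elts (P 1) X = {x \<in> elts (P 0) X. e X x = \<zero>\<^bsub>fob F X\<^esub>}) \<and>
     (\<forall>n. \<forall>X\<in>obs C. d (Suc n) X ` elts (P (Suc (Suc n))) X =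
        {x \<in> elts (P (Suc n)) X. d n X x = \<zero>\<^bsub>fob (P n) X\<^esub>})"

lemma split_resolutionI:
  assumes "cring R" "is_category C" "projective_resolution R C F P d e"
  shows "split_resolution R C F P d e"
proof -
  note u = assms(3)[unfolded projective_resolution_def]
  show ?thesis
    unfolding split_resolution_def
    by (rule conjI[OF allI conjunct2[OF u]]) (rule projective_split[OF assms(1,2) spec[OF conjunct1[OF u]]])
qed

context
  fixes R :: "('k, 'r) ring_scheme" and C :: "('o, 'a) category" and F :: "('o, 'a, 'k, 'm) kfun"
    and P :: "nat \<Rightarrow> ('o, 'a, 'k, 'p) kfun" and d :: "nat \<Rightarrow> 'o \<Rightarrow> 'p \<Rightarrow> 'p" and e :: "'o \<Rightarrow> 'p \<Rightarrow> 'm"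
  assumes R: "cring R" and C: "is_category C" and F: "is_kfun R C F" and res: "split_resolution R C F P d e"
begin

lemma split_resolution_facts:
  shows "split_kfun R C (P n)" "is_kfun R C (P n)" "is_nat_trans R C (P 0) F e"
    "is_nat_trans R C (P (Suc n)) (P n) (d n)"
    "\<lbrakk>X \<in> obs C; x \<in> elts F X\<rbrakk> \<Longrightarrow> \<exists>y\<in>elts (P 0) X. e X y = x"
    "\<lbrakk>X \<in> obs C; y \<in> elts (P 0) X; e X y = \<zero>\<^bsub>fob F X\<^esub>\<rbrakk> \<Longrightarrow> \<exists>z\<in>elts (P 1) X. d 0 X z = y"
    "\<lbrakk>X \<in> obs C; z \<in> elts (P 1) X\<rbrakk> \<Longrightarrow> e X (d 0 X z) = \<zero>\<^bsub>fob F X\<^esub>"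
    "\<lbrakk>X \<in> obs C; w \<in> elts (P (Suc n)) X; d n X w = \<zero>\<^bsub>fob (P n) X\<^esub>\<rbrakk> \<Longrightarrow>
      \<exists>z\<in>elts (P (Suc (Suc n))) X. d (Suc n) X z = w"
    "\<lbrakk>X \<in> obs C; v \<in> elts (P (Suc (Suc n))) X\<rbrakk> \<Longrightarrow> d n X (d (Suc n) X v) = \<zero>\<^bsub>fob (P n) X\<^esub>"
proof -
  note u1 = res[unfolded split_resolution_def]
  note u2 = conjunct2[OF u1] note u3 = conjunct2[OF u2] note u4 = conjunct2[OF u3]
  note u5 = conjunct2[OF u4] note u6 = conjunct2[OF u5]
  have s: "split_kfun R C (P n)" for n by (rule spec[OF conjunct1[OF u1]])
  then show "split_kfun R C (P n)" "is_kfun R C (P n)" by (simp_all add: split_kfun_def)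
  show "is_nat_trans R C (P 0) F e" by (rule conjunct1[OF u2])
  show "is_nat_trans R C (P (Suc n)) (P n) (d n)" by (rule spec[OF conjunct1[OF u3]])
  assume X: "X \<in> obs C"
  have e: "e X ` elts (P 0) X = elts F X"
    by (rule bspec[OF conjunct1[OF u4] X])
  have d0: "d 0 X ` elts (P 1) X = {x \<in> elts (P 0) X. e X x = \<zero>\<^bsub>fob F X\<^esub>}"
    by (rule bspec[OF conjunct1[OF u5] X])
  have dS: "d (Suc n) X ` elts (P (Suc (Suc n))) X =
        {x \<in> elts (P (Suc n)) X. d n X x = \<zero>\<^bsub>fob (P n) X\<^esub>}" for n
    by (rule bspec[OF spec[OF u6] X])
  have w: "\<exists>y\<in>S. g y = x" if "g ` S = T" "x \<in> T" for g :: "'x \<Rightarrow> 'y" and S T x using that by auto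
  have v: "g y \<in> T" if "g ` S = T" "y \<in> S" for g :: "'x \<Rightarrow> 'y" and S T y using that by auto
  show "x \<in> elts F X \<Longrightarrow> \<exists>y\<in>elts (P 0) X. e X y = x" by (rule w[OF e])
  show "\<lbrakk>y \<in> elts (P 0) X; e X y = \<zero>\<^bsub>fob F X\<^esub>\<rbrakk> \<Longrightarrow> \<exists>z\<in>elts (P 1) X. d 0 X z = y"
    by (rule w[OF d0]) simp
  show "z \<in> elts (P 1) X \<Longrightarrow> e X (d 0 X z) = \<zero>\<^bsub>fob F X\<^esub>" using v[OF d0] by simp
  show "\<lbrakk>w \<in> elts (P (Suc n)) X; d n X w = \<zero>\<^bsub>fob (P n) X\<^esub>\<rbrakk> \<Longrightarrow>
      \<exists>z\<in>elts (P (Suc (Suc n))) X. d (Suc n) X z = w" by (rule w[OF dS]) simp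
  show "v \<in> elts (P (Suc (Suc n))) X \<Longrightarrow> d n X (d (Suc n) X v) = \<zero>\<^bsub>fob (P n) X\<^esub>" using v[OF dS] by simp
qed

text \<open>The first index p is the bar degree, the second index q the place in the resolution. For
  fixed q exactness comes from the extra degeneracy of \<open>P q\<close> together with
  \<open>bar_eps_exact\<close>; for fixed p the terms are direct sums of values of the resolution
  and inherit its exactness.\<close>

lemma bar_double_complex:
  "double_complex R (\<lambda>p q. bar_mod C (P q) p) (\<lambda>q. colim R C (P q)) (bar_mod C F)
    (\<lambda>p q. bar_diff C (P q) p) (\<lambda>p q. bar_nat C (d q) p) (\<lambda>q. bar_eps R C (P q)) (bar_nat C e)
    (\<lambda>q. colim_map R C (P q) (d q)) (bar_diff C F)"
proof -
  note r = split_resolution_facts and Pf = split_resolution_facts(2) and dn = split_resolution_facts(4)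
    and en = split_resolution_facts(3)
  show ?thesis
  proof (rule double_complex.intro)
    show "is_complex R (\<lambda>q. colim R C (P q)) (\<lambda>q. colim_map R C (P q) (d q))"
      by (rule colim_complex[where P = P and d = d, OF R C]) (rule Pf dn r(9); assumption)+
    show "is_complex R (bar_mod C F) (bar_diff C F)" by (rule bar_complex[OF R C F])
    fix p q
    show "module R (bar_mod C (P q) p)" by (rule bar_module[OF R C Pf])
    show "bar_diff C (P q) p \<in> mod_hom R (bar_mod C (P q) (Suc p)) (bar_mod C (P q) p)" by (rule bar_diff_hom[OF R C Pf])
    show "bar_nat C (d q) p \<in> mod_hom R (bar_mod C (P (Suc q)) p) (bar_mod C (P q) p)" by (rule bar_nat_hom[OF R C Pf Pf dn])
    show "bar_eps R C (P q) \<in> mod_hom R (bar_mod C (P q) 0) (colim R C (P q))" by (rule bar_eps_hom[OF R C Pf])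
    show "bar_nat C e p \<in> mod_hom R (bar_mod C (P 0) p) (bar_mod C F p)" by (rule bar_nat_hom[OF R C Pf F en])
    { fix x assume "x \<in> carrier (bar_mod C (P (Suc q)) (Suc p))"
      then show "bar_diff C (P q) p (bar_nat C (d q) (Suc p) x) = bar_nat C (d q) p (bar_diff C (P (Suc q)) p x)"
        by (rule bar_nat_diff[OF R C Pf Pf dn, symmetric]) }
    { fix x assume "x \<in> carrier (bar_mod C (P (Suc q)) 0)"
      then show "bar_eps R C (P q) (bar_nat C (d q) 0 x) = colim_map R C (P q) (d q) (bar_eps R C (P (Suc q)) x)"
        by (rule bar_nat_eps[OF R C Pf Pf dn]) }
    { fix x assume "x \<in> carrier (bar_mod C (P 0) (Suc p))"
      then show "bar_nat C e p (bar_diff C (P 0) p x) = bar_diff C F p (bar_nat C e (Suc p) x)"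
        by (rule bar_nat_diff[OF R C Pf F en]) }
    { fix x assume "x \<in> carrier (bar_mod C (P q) (Suc (Suc p)))"
      then show "bar_diff C (P q) p (bar_diff C (P q) (Suc p) x) = \<zero>\<^bsub>bar_mod C (P q) p\<^esub>"
        by (rule is_complexD(3)[OF bar_complex[OF R C Pf]]) }
    { fix x assume x: "x \<in> carrier (bar_mod C (P (Suc (Suc q))) p)"
      show "bar_nat C (d q) p (bar_nat C (d (Suc q)) p x) = \<zero>\<^bsub>bar_mod C (P q) p\<^esub>"
        by (rule bar_nat_comp_zero[OF R C Pf Pf Pf dn dn _ x]) (rule r(9)) }
    { fix x assume "x \<in> carrier (bar_mod C (P q) 1)"
      then show "bar_eps R C (P q) (bar_diff C (P q) 0 x) = \<zero>\<^bsub>colim R C (P q)\<^esub>" by (rule bar_eps_diff[OF R C Pf]) }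
    { fix x assume x: "x \<in> carrier (bar_mod C (P 1) p)"
      have d0: "is_nat_trans R C (P 1) (P 0) (d 0)" using dn[of 0] by simp
      show "bar_nat C e p (bar_nat C (d 0) p x) = \<zero>\<^bsub>bar_mod C F p\<^esub>"
        by (rule bar_nat_comp_zero[OF R C Pf Pf F d0 en _ x]) (rule r(7)) }
    { fix a assume "a \<in> carrier (colim R C (P q))"
      then show "\<exists>x\<in>carrier (bar_mod C (P q) 0). bar_eps R C (P q) x = a" by (rule bar_eps_surj[OF R C Pf]) }
    { fix c assume c: "c \<in> carrier (bar_mod C F p)"
      show "\<exists>x\<in>carrier (bar_mod C (P 0) p). bar_nat C e p x = c"
        by (rule bar_nat_exact[OF R C Pf F en _ c, where Q = "\<lambda>_ _. True"]) (use r(5) in auto) }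
    { fix x assume "x \<in> carrier (bar_mod C (P q) 0)" "bar_eps R C (P q) x = \<zero>\<^bsub>colim R C (P q)\<^esub>"
      then show "\<exists>y\<in>carrier (bar_mod C (P q) 1). bar_diff C (P q) 0 y = x" by (rule bar_eps_exact[OF R C Pf]) }
    { fix x assume x: "x \<in> carrier (bar_mod C (P 0) p)" "bar_nat C e p x = \<zero>\<^bsub>bar_mod C F p\<^esub>"
      have d0: "is_nat_trans R C (P 1) (P 0) (d 0)" using dn[of 0] by simp
      show "\<exists>y\<in>carrier (bar_mod C (P 1) p). bar_nat C (d 0) p y = x"
        by (rule bar_nat_exact[OF R C Pf Pf d0 _ x(1), where Q = "\<lambda>X y. e X y = \<zero>\<^bsub>fob F X\<^esub>"])
          (use r(6) bar_nat_zeroD[OF R C F x(2)] in auto) }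
    { fix x assume "x \<in> carrier (bar_mod C (P q) (Suc p))" "bar_diff C (P q) p x = \<zero>\<^bsub>bar_mod C (P q) p\<^esub>"
      then show "\<exists>y\<in>carrier (bar_mod C (P q) (Suc (Suc p))). bar_diff C (P q) (Suc p) y = x"
        by (rule bar_exact_split[OF R C r(1)]) }
    { fix x assume x: "x \<in> carrier (bar_mod C (P (Suc q)) p)" "bar_nat C (d q) p x = \<zero>\<^bsub>bar_mod C (P q) p\<^esub>"
      show "\<exists>y\<in>carrier (bar_mod C (P (Suc (Suc q))) p). bar_nat C (d (Suc q)) p y = x"
        by (rule bar_nat_exact[OF R C Pf Pf dn _ x(1), where Q = "\<lambda>X y. d q X y = \<zero>\<^bsub>fob (P q) X\<^esub>"])
          (use r(8) bar_nat_zeroD[OF R C Pf x(2)] in auto) }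
  qed
qed

lemma colim_bar_homology:
  "mod_isomorphic R (chain_homology (\<lambda>q. colim R C (P q)) (\<lambda>q. colim_map R C (P q) (d q)) n)
    (bar_homology C F n)"
  by (rule double_complex.double_complex_homology_iso[OF bar_double_complex])

lemma bar_colim_homology:
  "mod_isomorphic R (bar_homology C F n)
    (chain_homology (\<lambda>q. colim R C (P q)) (\<lambda>q. colim_map R C (P q) (d q)) n)"
  by (rule double_complex.double_complex_homology_iso[OF double_complex.double_complex_swap[OF bar_double_complex]])

text \<open>The functor T acts on the bar complex of every \<open>P q\<close>, with coefficients
  moved along \<alpha>, and commutes with both differentials. It fixes the augmentation to the
  colimits, so \<open>double_complex_endomorphism\<close> makes it trivial on the bar homology of
  F.\<close>

lemma bar_map_endofunctor_resolved:
  assumes T: "is_functor C C \<phi> T" and \<alpha>: "\<And>X. X \<in> obs C \<Longrightarrow> \<alpha> X \<in> arrs C \<and> src C (\<alpha> X) = X \<and> trg C (\<alpha> X) = \<phi> X"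
    and nat: "\<And>f. f \<in> arrs C \<Longrightarrow> cmp C (\<alpha> (trg C f)) f = cmp C (T f) (\<alpha> (src C f))"
    and z: "z \<in> cycles (bar_mod C F) (bar_diff C F) n"
  shows "z \<ominus>\<^bsub>bar_mod C F n\<^esub> bar_map C F C F T (\<lambda>X. far F (\<alpha> X)) n z \<in> boundaries (bar_mod C F) (bar_diff C F) n"
proof -
  note r = split_resolution_facts and Pf = split_resolution_facts(2) and dn = split_resolution_facts(4)
    and en = split_resolution_facts(3) and c = is_categoryD[OF C]
  have \<gamma>: "far G (\<alpha> X) \<in> mod_hom R (fob G X) (fob G (\<phi> X))" if "is_kfun R C G" "X \<in> obs C"
    for G :: "('o, 'a, 'k, 'y) kfun" and X
    using is_kfunD(2)[OF that(1), of "\<alpha> X"] \<alpha>[OF that(2)] by simp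
  have \<gamma>n: "far G (\<alpha> (trg C f)) (far G f x) = far G (T f) (far G (\<alpha> (src C f)) x)"
    if G: "is_kfun R C G" and f: "f \<in> arrs C" and x: "x \<in> elts G (src C f)" for G :: "('o, 'a, 'k, 'y) kfun" and f x
  proof -
    have "far G (\<alpha> (trg C f)) (far G f x) = far G (cmp C (\<alpha> (trg C f)) f) x"
      using is_kfunD(4)[OF G f _ _ x] \<alpha>[OF c(2)[OF f]] by simp
    also have "\<dots> = far G (T f) (far G (\<alpha> (src C f)) x)"
      unfolding nat[OF f]
      using is_kfunD(4)[OF G _ is_functorD(3)[OF T f], of "\<alpha> (src C f)" x] \<alpha>[OF c(1)[OF f]] is_functorD(4)[OF T f] x by simp
    finally show ?thesis .
  qed
  let ?t = "\<lambda>G. bar_map C G C G T (\<lambda>X. far G (\<alpha> X))"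
  have hom: "bar_map C G C G T (\<lambda>X. far G (\<alpha> X)) p \<in> mod_hom R (bar_mod C G p) (bar_mod C G p)"
    if "is_kfun R C G" for G :: "('o, 'a, 'k, 'y) kfun" and p
    by (rule bar_map_hom[OF R C C that that T \<gamma>[OF that] \<gamma>n[OF that]])
  have val: "bar_map C G C G T (\<lambda>X. far G (\<alpha> X)) p (bar_in C G p \<sigma> x) = bar_in C G p (nerve_map p T \<sigma>) (far G (\<alpha> (origin C \<sigma>)) x)"
    if "is_kfun R C G" "\<sigma> \<in> nerve C p" "x \<in> elts G (origin C \<sigma>)" for G :: "('o, 'a, 'k, 'y) kfun" and p \<sigma> x
    by (rule bar_map_in[OF R C C that(1) that(1) T \<gamma>[OF that(1)] \<gamma>n[OF that(1)] that(2,3)])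
  \<comment> \<open>The endomorphism is natural in the coefficient functor, which makes it commute
    with the differentials of the resolution and with its augmentation to F.\<close>
  have nt: "bar_nat C \<eta> p (bar_map C G C G T (\<lambda>X. far G (\<alpha> X)) p x) = bar_map C H C H T (\<lambda>X. far H (\<alpha> X)) p (bar_nat C \<eta> p x)"
    if G: "is_kfun R C G" and H: "is_kfun R C H" and \<eta>: "is_nat_trans R C G H \<eta>" and x: "x \<in> carrier (bar_mod C G p)"
    for G :: "('o, 'a, 'k, 'y) kfun" and H :: "('o, 'a, 'k, 'z) kfun" and \<eta> p x
  proof (rule bar_hom_eqI[OF R C G bar_module[OF R C H] mod_hom_comp[OF hom[OF G] bar_nat_hom[OF R C G H \<eta>]]
        mod_hom_comp[OF bar_nat_hom[OF R C G H \<eta>] hom[OF H]] _ x])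
    fix \<sigma> y assume s: "\<sigma> \<in> nerve C p" "y \<in> elts G (origin C \<sigma>)"
    have v: "origin C \<sigma> \<in> obs C" by (rule nerve_vertex[OF C s(1)]) simp
    have Tv: "src C (nerve_map p T \<sigma> (0, 0)) = \<phi> (origin C \<sigma>)"
      using is_functorD(4)[OF T nerveD(1)[OF s(1)]] by simp
    have e: "\<eta> (\<phi> (origin C \<sigma>)) (far G (\<alpha> (origin C \<sigma>)) y) = far H (\<alpha> (origin C \<sigma>)) (\<eta> (origin C \<sigma>) y)"
      using is_nat_transD(2)[OF \<eta>, of "\<alpha> (origin C \<sigma>)" y] \<alpha>[OF v] s(2) by simp
    have gy: "far G (\<alpha> (origin C \<sigma>)) y \<in> elts G (src C (nerve_map p T \<sigma> (0, 0)))"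
      unfolding Tv by (rule mod_homD(1)[OF \<gamma>[OF G v] s(2)])
    show "bar_nat C \<eta> p (?t G p (bar_in C G p \<sigma> y)) = bar_map C H C H T (\<lambda>X. far H (\<alpha> X)) p (bar_nat C \<eta> p (bar_in C G p \<sigma> y))"
      using val[OF G s] bar_nat_in[OF R C G H \<eta> nerve_map_closed[OF C T s(1)] gy] bar_nat_in[OF R C G H \<eta> s]
        val[OF H s(1) mod_homD(1)[OF is_nat_transD(1)[OF \<eta> v] s(2)]] e Tv by simp
  qed
  show ?thesis
  proof (rule double_complex.double_complex_endomorphism[OF bar_double_complex,
        where tau = "\<lambda>p q. bar_map C (P q) C (P q) T (\<lambda>X. far (P q) (\<alpha> X)) p", OF _ _ _ _ _ z])
    fix p q x
    show "x \<in> carrier (bar_mod C (P q) p) \<Longrightarrow> ?t (P q) p x \<in> carrier (bar_mod C (P q) p)"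
      by (rule mod_homD(1)[OF hom[OF Pf]])
    show "x \<in> carrier (bar_mod C (P q) (Suc p)) \<Longrightarrow> bar_diff C (P q) p (?t (P q) (Suc p) x) = ?t (P q) p (bar_diff C (P q) p x)"
      by (rule bar_map_diff[OF R C C Pf Pf T \<gamma>[OF Pf] \<gamma>n[OF Pf], symmetric])
    show "x \<in> carrier (bar_mod C (P (Suc q)) p) \<Longrightarrow> bar_nat C (d q) p (?t (P (Suc q)) p x) = ?t (P q) p (bar_nat C (d q) p x)"
      by (rule nt[OF Pf Pf dn])
    show "x \<in> carrier (bar_mod C (P 0) p) \<Longrightarrow> bar_nat C e p (?t (P 0) p x) = bar_map C F C F T (\<lambda>X. far F (\<alpha> X)) p (bar_nat C e p x)"
      by (rule nt[OF Pf F en])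
    assume x: "x \<in> carrier (bar_mod C (P q) 0)"
    \<comment> \<open>Here \<alpha> disappears: it is an arrow of C, so an element and its image
      under \<alpha> have the same class in the colimit.\<close>
    show "bar_eps R C (P q) (?t (P q) 0 x) = bar_eps R C (P q) x"
    proof (rule bar_hom_eqI[OF R C Pf colim_module[OF R C Pf] mod_hom_comp[OF hom[OF Pf] bar_eps_hom[OF R C Pf]] bar_eps_hom[OF R C Pf] _ x])
      fix \<sigma> y assume s: "\<sigma> \<in> nerve C 0" "y \<in> elts (P q) (origin C \<sigma>)"
      have v: "origin C \<sigma> \<in> obs C" by (rule nerve_vertex[OF C s(1)]) simp
      have Tv: "src C (nerve_map 0 T \<sigma> (0, 0)) = \<phi> (origin C \<sigma>)"
        using is_functorD(4)[OF T nerveD(1)[OF s(1)]] by simp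
      have gy: "far (P q) (\<alpha> (origin C \<sigma>)) y \<in> elts (P q) (src C (nerve_map 0 T \<sigma> (0, 0)))"
        unfolding Tv by (rule mod_homD(1)[OF \<gamma>[OF Pf v] s(2)])
      show "bar_eps R C (P q) (?t (P q) 0 (bar_in C (P q) 0 \<sigma> y)) = bar_eps R C (P q) (bar_in C (P q) 0 \<sigma> y)"
        using val[OF Pf s] bar_eps_in[OF R C Pf nerve_map_closed[OF C T s(1)] gy] bar_eps_in[OF R C Pf s]
          colim_in_far[OF R C Pf, of "\<alpha> (origin C \<sigma>)" y] \<alpha>[OF v] s(2) Tv by simp
    qed
  qed
qed

end

text \<open>The resolution serves only as an auxiliary witness, so an arbitrary one from
  \<open>projective_resolution_exists\<close> is inserted.\<close>

lemma bar_map_endofunctor: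
  fixes F :: "('o, 'a, 'k, 'm) kfun"
  assumes R: "cring R" and C: "is_category C" and F: "is_kfun R C F" and T: "is_functor C C \<phi> T"
    and \<alpha>: "\<And>X. X \<in> obs C \<Longrightarrow> \<alpha> X \<in> arrs C \<and> src C (\<alpha> X) = X \<and> trg C (\<alpha> X) = \<phi> X"
    and nat: "\<And>f. f \<in> arrs C \<Longrightarrow> cmp C (\<alpha> (trg C f)) f = cmp C (T f) (\<alpha> (src C f))"
    and z: "z \<in> cycles (bar_mod C F) (bar_diff C F) n"
  shows "z \<ominus>\<^bsub>bar_mod C F n\<^esub> bar_map C F C F T (\<lambda>X. far F (\<alpha> X)) n z \<in> boundaries (bar_mod C F) (bar_diff C F) n"
proof -
  obtain P :: "nat \<Rightarrow> ('o, 'a, 'k, ('a, 'm, 'k) res_gen \<Rightarrow> 'k) kfun" and d e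
    where "projective_resolution R C F P d e"
    using projective_resolution_exists[OF R C F] by blast
  from bar_map_endofunctor_resolved[OF R C F split_resolutionI[OF R C this] T \<alpha> nat z] show ?thesis .
qed

text \<open>The existence theorem produces a resolution of exactly the element type over which the
  choice in \<open>functor_homology\<close> ranges, so the chosen triple is a projective
  resolution.\<close>

lemma functor_homology_resolved:
  fixes F :: "('o, 'a, 'k, 'm) kfun"
  assumes "cring R" "is_category C" "is_kfun R C F"
  obtains P :: "nat \<Rightarrow> ('o, 'a, 'k, ('a, 'm, 'k) res_gen \<Rightarrow> 'k) kfun" and d e
  where "split_resolution R C F P d e"
    "functor_homology R C F = chain_homology (\<lambda>n. colim R C (P n)) (\<lambda>n. colim_map R C (P n) (d n))"
proof -
  obtain P :: "nat \<Rightarrow> ('o, 'a, 'k, ('a, 'm, 'k) res_gen \<Rightarrow> 'k) kfun" and d e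
    where Pde: "(SOME (P :: nat \<Rightarrow> ('o, 'a, 'k, ('a, 'm, 'k) res_gen \<Rightarrow> 'k) kfun, d, e). projective_resolution R C F P d e) = (P, d, e)"
    by (metis prod_cases3)
  have "\<exists>x :: (nat \<Rightarrow> ('o, 'a, 'k, ('a, 'm, 'k) res_gen \<Rightarrow> 'k) kfun) \<times> _ \<times> _. case x of (P, d, e) \<Rightarrow> projective_resolution R C F P d e"
    using projective_resolution_exists[OF assms] by auto
  from someI_ex[OF this] have "projective_resolution R C F P d e" unfolding Pde by simp
  then show ?thesis
    using that[OF split_resolutionI[OF assms(1,2)]] Pde by (simp add: functor_homology_def)
qed

section \<open>Tensor products and coends through their universal properties\<close>

section \<open>Tensor products and coends\<close>

abbreviation (input) "pair_mod R M N \<equiv> free_mod R (carrier M \<times> carrier N)"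

definition bilinear_map ::
  "('k, 'r) ring_scheme \<Rightarrow> ('k, 'm) module \<Rightarrow> ('k, 'n) module \<Rightarrow> ('k, 'l) module \<Rightarrow> ('m \<Rightarrow> 'n \<Rightarrow> 'l) \<Rightarrow> bool" where
  "bilinear_map R M N L b \<longleftrightarrow> (\<forall>x\<in>carrier M. b x \<in> mod_hom R N L) \<and> (\<forall>y\<in>carrier N. (\<lambda>x. b x y) \<in> mod_hom R M L)"

lemma bilinear_mapD:
  assumes "bilinear_map R M N L b"
  shows "x \<in> carrier M \<Longrightarrow> b x \<in> mod_hom R N L" "y \<in> carrier N \<Longrightarrow> (\<lambda>x. b x y) \<in> mod_hom R M L"
  using assms unfolding bilinear_map_def by blast+

lemma bilinear_map_comp:
  assumes "bilinear_map R M N L b" "h \<in> mod_hom R L L'"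
  shows "bilinear_map R M N L' (\<lambda>x y. h (b x y))"
  unfolding bilinear_map_def
proof (intro conjI ballI)
  fix x assume "x \<in> carrier M"
  then show "(\<lambda>y. h (b x y)) \<in> mod_hom R N L'" by (rule mod_hom_comp[OF bilinear_mapD(1)[OF assms(1)] assms(2)])
next
  fix y assume "y \<in> carrier N"
  then show "(\<lambda>x. h (b x y)) \<in> mod_hom R M L'" by (rule mod_hom_comp[OF bilinear_mapD(2)[OF assms(1)] assms(2)])
qed

lemma bilinear_map_closed:
  "\<lbrakk>bilinear_map R M N L b; x \<in> carrier M; y \<in> carrier N\<rbrakk> \<Longrightarrow> b x y \<in> carrier L"
  by (rule mod_homD(1)[OF bilinear_mapD(1)])

definition tensor_gens ::
  "('k, 'r) ring_scheme \<Rightarrow> ('k, 'm) module \<Rightarrow> ('k, 'n) module \<Rightarrow> ('m \<times> 'n \<Rightarrow> 'k) set" where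
  "tensor_gens R M N =
    (let F = pair_mod R M N in
      {fgen R (x \<oplus>\<^bsub>M\<^esub> x', y) \<ominus>\<^bsub>F\<^esub> (fgen R (x, y) \<oplus>\<^bsub>F\<^esub> fgen R (x', y)) | x x' y.
          x \<in> carrier M \<and> x' \<in> carrier M \<and> y \<in> carrier N} \<union>
       {fgen R (x, y \<oplus>\<^bsub>N\<^esub> y') \<ominus>\<^bsub>F\<^esub> (fgen R (x, y) \<oplus>\<^bsub>F\<^esub> fgen R (x, y')) | x y y'.
          x \<in> carrier M \<and> y \<in> carrier N \<and> y' \<in> carrier N} \<union>
       {fgen R (r \<odot>\<^bsub>M\<^esub> x, y) \<ominus>\<^bsub>F\<^esub> r \<odot>\<^bsub>F\<^esub> fgen R (x, y) | r x y.
          r \<in> carrier R \<and> x \<in> carrier M \<and> y \<in> carrier N} \<union>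
       {fgen R (x, r \<odot>\<^bsub>N\<^esub> y) \<ominus>\<^bsub>F\<^esub> r \<odot>\<^bsub>F\<^esub> fgen R (x, y) | r x y.
          r \<in> carrier R \<and> x \<in> carrier M \<and> y \<in> carrier N})"

lemma tensor_rels_span: "tensor_rels R M N = span R (pair_mod R M N) (tensor_gens R M N)"
  by (simp add: tensor_rels_def tensor_gens_def Let_def)

lemma tensor_gens_cases:
  assumes "g \<in> tensor_gens R M N"
  obtains (add_l) x x' y where "x \<in> carrier M" "x' \<in> carrier M" "y \<in> carrier N"
      "g = fgen R (x \<oplus>\<^bsub>M\<^esub> x', y) \<ominus>\<^bsub>pair_mod R M N\<^esub>
        (fgen R (x, y) \<oplus>\<^bsub>pair_mod R M N\<^esub> fgen R (x', y))"
  | (add_r) x y y' where "x \<in> carrier M" "y \<in> carrier N" "y' \<in> carrier N"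
      "g = fgen R (x, y \<oplus>\<^bsub>N\<^esub> y') \<ominus>\<^bsub>pair_mod R M N\<^esub>
        (fgen R (x, y) \<oplus>\<^bsub>pair_mod R M N\<^esub> fgen R (x, y'))"
  | (smult_l) r x y where "r \<in> carrier R" "x \<in> carrier M" "y \<in> carrier N"
      "g = fgen R (r \<odot>\<^bsub>M\<^esub> x, y) \<ominus>\<^bsub>pair_mod R M N\<^esub>
        r \<odot>\<^bsub>pair_mod R M N\<^esub> fgen R (x, y)"
  | (smult_r) r x y where "r \<in> carrier R" "x \<in> carrier M" "y \<in> carrier N"
      "g = fgen R (x, r \<odot>\<^bsub>N\<^esub> y) \<ominus>\<^bsub>pair_mod R M N\<^esub>
        r \<odot>\<^bsub>pair_mod R M N\<^esub> fgen R (x, y)"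
  using assms unfolding tensor_gens_def Let_def by blast

lemma tensor_gensI:
  "\<lbrakk>x \<in> carrier M; x' \<in> carrier M; y \<in> carrier N\<rbrakk> \<Longrightarrow> fgen R (x \<oplus>\<^bsub>M\<^esub> x', y) \<ominus>\<^bsub>pair_mod R M N\<^esub> (fgen R (x, y) \<oplus>\<^bsub>pair_mod R M N\<^esub> fgen R (x', y)) \<in> tensor_gens R M N"
  "\<lbrakk>x \<in> carrier M; y \<in> carrier N; y' \<in> carrier N\<rbrakk> \<Longrightarrow> fgen R (x, y \<oplus>\<^bsub>N\<^esub> y') \<ominus>\<^bsub>pair_mod R M N\<^esub> (fgen R (x, y) \<oplus>\<^bsub>pair_mod R M N\<^esub> fgen R (x, y')) \<in> tensor_gens R M N"
  "\<lbrakk>r \<in> carrier R; x \<in> carrier M; y \<in> carrier N\<rbrakk> \<Longrightarrow> fgen R (r \<odot>\<^bsub>M\<^esub> x, y) \<ominus>\<^bsub>pair_mod R M N\<^esub> r \<odot>\<^bsub>pair_mod R M N\<^esub> fgen R (x, y) \<in> tensor_gens R M N"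
  "\<lbrakk>r \<in> carrier R; x \<in> carrier M; y \<in> carrier N\<rbrakk> \<Longrightarrow> fgen R (x, r \<odot>\<^bsub>N\<^esub> y) \<ominus>\<^bsub>pair_mod R M N\<^esub> r \<odot>\<^bsub>pair_mod R M N\<^esub> fgen R (x, y) \<in> tensor_gens R M N"
  unfolding tensor_gens_def Let_def by blast+

context
  fixes R :: "('k, 'r) ring_scheme" and M :: "('k, 'm) module" and N :: "('k, 'n) module"
  assumes M: "module R M" and N: "module R N"
begin

interpretation M: module R M by (rule M)
interpretation N: module R N by (rule N)
interpretation F: module R "pair_mod R M N" by (rule free_mod_module[OF M.R.cring_axioms])

lemma tensor_fgen: "\<lbrakk>x \<in> carrier M; y \<in> carrier N\<rbrakk> \<Longrightarrow> fgen R (x, y) \<in> carrier (pair_mod R M N)"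
  by (rule fgen_carrier[OF M.R.cring_axioms]) simp

lemma tensor_gens_carrier: "tensor_gens R M N \<subseteq> carrier (pair_mod R M N)"
proof
  fix g assume "g \<in> tensor_gens R M N"
  then show "g \<in> carrier (pair_mod R M N)"
    by (cases rule: tensor_gens_cases) (simp_all add: tensor_fgen)
qed

lemma tensor_rels_submodule: "submodule (tensor_rels R M N) R (pair_mod R M N)"
  unfolding tensor_rels_span by (rule span_submodule[OF F.module_axioms tensor_gens_carrier])

lemma tensor_module: "module R (tensor R M N)"
  unfolding tensor_def by (rule quot_module[OF F.module_axioms tensor_rels_submodule])

lemma tensor_proj_hom:
  "(\<lambda>u. tensor_rels R M N +>\<^bsub>pair_mod R M N\<^esub> u)
    \<in> mod_hom R (pair_mod R M N) (tensor R M N)"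
  unfolding tensor_def by (rule quot_proj_hom[OF F.module_axioms tensor_rels_submodule])

lemma tensor_coset_eqI:
  assumes "u \<ominus>\<^bsub>pair_mod R M N\<^esub> v \<in> tensor_gens R M N"
    "u \<in> carrier (pair_mod R M N)" "v \<in> carrier (pair_mod R M N)"
  shows "tensor_rels R M N +>\<^bsub>pair_mod R M N\<^esub> u = tensor_rels R M N +>\<^bsub>pair_mod R M N\<^esub> v"
proof (rule coset_eq_iff[OF F.module_axioms tensor_rels_submodule assms(2,3), THEN iffD2])
  show "u \<ominus>\<^bsub>pair_mod R M N\<^esub> v \<in> tensor_rels R M N"
    unfolding tensor_rels_span by (rule subsetD[OF span_incl assms(1)])
qed

lemma pure_tensor_bilinear: "bilinear_map R M N (tensor R M N) (pure_tensor R M N)"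
  unfolding bilinear_map_def
proof (intro conjI ballI)
  note p = mod_homD[OF tensor_proj_hom]
  fix x assume x: "x \<in> carrier M"
  show "pure_tensor R M N x \<in> mod_hom R N (tensor R M N)"
  proof (rule mod_homI)
    fix y assume y: "y \<in> carrier N"
    show "pure_tensor R M N x y \<in> carrier (tensor R M N)"
      unfolding pure_tensor_def by (rule p(1)[OF tensor_fgen[OF x y]])
    { fix y' assume y': "y' \<in> carrier N"
      show "pure_tensor R M N x (y \<oplus>\<^bsub>N\<^esub> y') = pure_tensor R M N x y \<oplus>\<^bsub>tensor R M N\<^esub> pure_tensor R M N x y'"
        unfolding pure_tensor_def p(2)[OF tensor_fgen[OF x y] tensor_fgen[OF x y'], symmetric]
        by (rule tensor_coset_eqI[OF tensor_gensI(2)]) (use x y y' in \<open>auto intro: tensor_fgen\<close>) }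
    { fix r assume r: "r \<in> carrier R"
      show "pure_tensor R M N x (r \<odot>\<^bsub>N\<^esub> y) = r \<odot>\<^bsub>tensor R M N\<^esub> pure_tensor R M N x y"
        unfolding pure_tensor_def p(3)[OF r tensor_fgen[OF x y], symmetric]
        by (rule tensor_coset_eqI[OF tensor_gensI(4)]) (use x y r in \<open>auto intro: tensor_fgen\<close>) }
  qed
next
  note p = mod_homD[OF tensor_proj_hom]
  fix y assume y: "y \<in> carrier N"
  show "(\<lambda>x. pure_tensor R M N x y) \<in> mod_hom R M (tensor R M N)"
  proof (rule mod_homI)
    fix x assume x: "x \<in> carrier M"
    show "pure_tensor R M N x y \<in> carrier (tensor R M N)"
      unfolding pure_tensor_def by (rule p(1)[OF tensor_fgen[OF x y]])
    { fix x' assume x': "x' \<in> carrier M"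
      show "pure_tensor R M N (x \<oplus>\<^bsub>M\<^esub> x') y = pure_tensor R M N x y \<oplus>\<^bsub>tensor R M N\<^esub> pure_tensor R M N x' y"
        unfolding pure_tensor_def p(2)[OF tensor_fgen[OF x y] tensor_fgen[OF x' y], symmetric]
        by (rule tensor_coset_eqI[OF tensor_gensI(1)]) (use x y x' in \<open>auto intro: tensor_fgen\<close>) }
    { fix r assume r: "r \<in> carrier R"
      show "pure_tensor R M N (r \<odot>\<^bsub>M\<^esub> x) y = r \<odot>\<^bsub>tensor R M N\<^esub> pure_tensor R M N x y"
        unfolding pure_tensor_def p(3)[OF r tensor_fgen[OF x y], symmetric]
        by (rule tensor_coset_eqI[OF tensor_gensI(3)]) (use x y r in \<open>auto intro: tensor_fgen\<close>) }
  qed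
qed

lemma tensor_hom_eqI:
  assumes L: "module R L" and h: "h \<in> mod_hom R (tensor R M N) L" and h': "h' \<in> mod_hom R (tensor R M N) L"
    and eq: "\<And>x y. \<lbrakk>x \<in> carrier M; y \<in> carrier N\<rbrakk> \<Longrightarrow> h (pure_tensor R M N x y) = h' (pure_tensor R M N x y)"
    and z: "z \<in> carrier (tensor R M N)"
  shows "h z = h' z"
proof -
  obtain u where u: "u \<in> carrier (pair_mod R M N)"
    "z = tensor_rels R M N +>\<^bsub>pair_mod R M N\<^esub> u"
    using z unfolding tensor_def by (rule quot_cosetE[OF F.module_axioms tensor_rels_submodule])
  show ?thesis unfolding u(2)
    by (rule free_mod_hom_eqI[OF M.R.cring_axioms L mod_hom_comp[OF tensor_proj_hom h] mod_hom_comp[OF tensor_proj_hom h'] _ u(1)])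
      (use eq in \<open>auto simp: pure_tensor_def\<close>)
qed

context
  fixes L :: "('k, 'l) module" and b
  assumes L: "module R L" and b: "bilinear_map R M N L b"
begin

interpretation L: module R L by (rule L)

lemma bilinear_lin_ext:
  "lin_ext R L (\<lambda>(x, y). b x y) \<in> mod_hom R (pair_mod R M N) L"
  "\<lbrakk>x \<in> carrier M; y \<in> carrier N\<rbrakk> \<Longrightarrow> lin_ext R L (\<lambda>(x, y). b x y) (fgen R (x, y)) = b x y"
proof -
  have a: "(\<lambda>(x, y). b x y) \<in> carrier M \<times> carrier N \<rightarrow> carrier L"
    using mod_homD(1)[OF bilinear_mapD(1)[OF b]] by auto
  show "lin_ext R L (\<lambda>(x, y). b x y) \<in> mod_hom R (pair_mod R M N) L"
    by (rule lin_ext_hom[OF L a])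
  show "\<lbrakk>x \<in> carrier M; y \<in> carrier N\<rbrakk> \<Longrightarrow> lin_ext R L (\<lambda>(x, y). b x y) (fgen R (x, y)) = b x y"
    using lin_ext_fgen[OF L a, of "(x, y)"] by simp
qed

lemma bilinear_lin_ext_rels:
  assumes "u \<in> tensor_rels R M N"
  shows "lin_ext R L (\<lambda>(x, y). b x y) u = \<zero>\<^bsub>L\<^esub>"
proof (rule span_hom_zero[OF F.module_axioms L bilinear_lin_ext(1) tensor_gens_carrier _ assms[unfolded tensor_rels_span]])
  fix g assume "g \<in> tensor_gens R M N"
  note hm = mod_hom_minus[OF F.module_axioms L bilinear_lin_ext(1)] and h = mod_homD[OF bilinear_lin_ext(1)]
    and v = bilinear_lin_ext(2) and b1 = mod_homD[OF bilinear_mapD(1)[OF b]] and b2 = mod_homD[OF bilinear_mapD(2)[OF b]]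
  from \<open>g \<in> tensor_gens R M N\<close> show "lin_ext R L (\<lambda>(x, y). b x y) g = \<zero>\<^bsub>L\<^esub>"
  proof (cases rule: tensor_gens_cases)
    case (add_l x x' y)
    then show ?thesis by (simp add: hm h v tensor_fgen b2 b1(1) minus_eq_zero_iff[OF L])
  next
    case (add_r x y y')
    then show ?thesis by (simp add: hm h v tensor_fgen b1 minus_eq_zero_iff[OF L])
  next
    case (smult_l r x y)
    then show ?thesis by (simp add: hm h v tensor_fgen b2 b1(1) minus_eq_zero_iff[OF L])
  next
    case (smult_r r x y)
    then show ?thesis by (simp add: hm h v tensor_fgen b1 minus_eq_zero_iff[OF L])
  qed
qed

definition tensor_lift :: "('m \<times> 'n \<Rightarrow> 'k) set \<Rightarrow> 'l" where
  "tensor_lift = quot_lift (lin_ext R L (\<lambda>(x, y). b x y))"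

lemma tensor_lift_hom: "tensor_lift \<in> mod_hom R (tensor R M N) L"
  unfolding tensor_lift_def tensor_def
  by (rule quot_lift_hom[OF F.module_axioms tensor_rels_submodule L bilinear_lin_ext(1) bilinear_lin_ext_rels])

lemma tensor_lift_pure: "\<lbrakk>x \<in> carrier M; y \<in> carrier N\<rbrakk> \<Longrightarrow> tensor_lift (pure_tensor R M N x y) = b x y"
  unfolding tensor_lift_def pure_tensor_def
  using quot_lift_coset[OF F.module_axioms tensor_rels_submodule L bilinear_lin_ext(1) bilinear_lin_ext_rels tensor_fgen]
    bilinear_lin_ext(2) by simp

end

end

lemma tensor_map_props:
  assumes M: "module R M" and M': "module R M'" and N: "module R N" and h: "h \<in> mod_hom R M M'"
  shows "tensor_map R M' N h \<in> mod_hom R (tensor R M N) (tensor R M' N)" (is ?hom)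
    and "\<lbrakk>x \<in> carrier M; y \<in> carrier N\<rbrakk> \<Longrightarrow> tensor_map R M' N h (pure_tensor R M N x y) = pure_tensor R M' N (h x) y"
      (is "_ \<Longrightarrow> _ \<Longrightarrow> ?pure")
proof -
  interpret M: module R M by fact
  let ?F = "pair_mod R M N" and ?F' = "pair_mod R M' N"
  interpret F: module R ?F by (rule free_mod_module[OF M.R.cring_axioms])
  interpret F': module R ?F' by (rule free_mod_module[OF M.R.cring_axioms])
  let ?l = "lin_ext R ?F' (\<lambda>(x, y). fgen R (h x, y))"
  have a: "(\<lambda>(x, y). fgen R (h x, y)) \<in> carrier M \<times> carrier N \<rightarrow> carrier ?F'"
    using mod_homD(1)[OF h] tensor_fgen[OF M' N] by auto
  have l: "?l \<in> mod_hom R ?F ?F'" by (rule lin_ext_hom[OF F'.module_axioms a])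
  have lv: "?l (fgen R (x, y)) = fgen R (h x, y)" if "x \<in> carrier M" "y \<in> carrier N" for x y
    using lin_ext_fgen[OF F'.module_axioms a, of "(x, y)"] that by simp
  have sub: "?l u \<in> tensor_rels R M' N" if "u \<in> tensor_rels R M N" for u
    using that unfolding tensor_rels_span[of R M]
  proof (rule span_hom_image[OF F.module_axioms F'.module_axioms l tensor_gens_carrier[OF M N] tensor_rels_submodule[OF M' N], rotated])
    fix g assume "g \<in> tensor_gens R M N"
    note hm = mod_hom_minus[OF F.module_axioms F'.module_axioms l] and lh = mod_homD[OF l] and hD = mod_homD[OF h]
    have "?l g \<in> tensor_gens R M' N" using \<open>g \<in> tensor_gens R M N\<close>
    proof (cases rule: tensor_gens_cases)
      case (add_l x x' y)
      then have "?l g = fgen R (h x \<oplus>\<^bsub>M'\<^esub> h x', y) \<ominus>\<^bsub>?F'\<^esub> (fgen R (h x, y) \<oplus>\<^bsub>?F'\<^esub> fgen R (h x', y))"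
        by (simp add: hm lh lv tensor_fgen[OF M N] hD)
      then show ?thesis using add_l hD by (simp add: tensor_gensI)
    next
      case (add_r x y y')
      interpret N: module R N by (rule N)
      from add_r have "?l g = fgen R (h x, y \<oplus>\<^bsub>N\<^esub> y') \<ominus>\<^bsub>?F'\<^esub> (fgen R (h x, y) \<oplus>\<^bsub>?F'\<^esub> fgen R (h x, y'))"
        by (simp add: hm lh lv tensor_fgen[OF M N] hD)
      then show ?thesis using add_r hD by (simp add: tensor_gensI)
    next
      case (smult_l r x y)
      then have "?l g = fgen R (r \<odot>\<^bsub>M'\<^esub> h x, y) \<ominus>\<^bsub>?F'\<^esub> r \<odot>\<^bsub>?F'\<^esub> fgen R (h x, y)"
        by (simp add: hm lh lv tensor_fgen[OF M N] hD)
      then show ?thesis using smult_l hD by (simp add: tensor_gensI)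
    next
      case (smult_r r x y)
      interpret N: module R N by (rule N)
      from smult_r have "?l g = fgen R (h x, r \<odot>\<^bsub>N\<^esub> y) \<ominus>\<^bsub>?F'\<^esub> r \<odot>\<^bsub>?F'\<^esub> fgen R (h x, y)"
        by (simp add: hm lh lv tensor_fgen[OF M N] hD)
      then show ?thesis using smult_r hD by (simp add: tensor_gensI)
    qed
    then show "?l g \<in> tensor_rels R M' N" unfolding tensor_rels_span by (rule subsetD[OF span_incl])
  qed
  note U = F.module_axioms tensor_rels_submodule[OF M N] F'.module_axioms tensor_rels_submodule[OF M' N]
  show ?hom unfolding tensor_map_def tensor_def Let_def by (rule quot_map_hom[OF U l sub])
  assume "x \<in> carrier M" "y \<in> carrier N"
  then show ?pure unfolding tensor_map_def pure_tensor_def Let_def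
    using quot_map_coset[OF U l sub tensor_fgen[OF M N]] lv by simp
qed

(* The part of the contravariant functor laws that makes coends well defined. *)
definition contra_fun :: "('k, 'r) ring_scheme \<Rightarrow> ('o, 'a) category \<Rightarrow> ('o, 'a, 'k, 'm) kfun \<Rightarrow> bool" where
  "contra_fun R C M \<longleftrightarrow> (\<forall>X\<in>obs C. module R (fob M X)) \<and>
     (\<forall>f\<in>arrs C. far M f \<in> mod_hom R (fob M (trg C f)) (fob M (src C f)))"

lemma contra_funD:
  assumes "contra_fun R C M"
  shows "X \<in> obs C \<Longrightarrow> module R (fob M X)"
    "f \<in> arrs C \<Longrightarrow> far M f \<in> mod_hom R (fob M (trg C f)) (fob M (src C f))"
  using assms unfolding contra_fun_def by blast+

definition coend_in ::
  "('k, 'r) ring_scheme \<Rightarrow> ('o, 'a) category \<Rightarrow> ('o, 'a, 'k, 'm) kfun \<Rightarrow> ('o, 'a, 'k, 'n) kfun \<Rightarrow>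
   'o \<Rightarrow> 'm \<Rightarrow> 'n \<Rightarrow> ('o \<Rightarrow> ('m \<times> 'n \<Rightarrow> 'k) set) set" where
  "coend_in R C M F X y x = coend_rels R C M F +>\<^bsub>dsum (obs C) (\<lambda>X. tensor R (fob M X) (fob F X))\<^esub>
     dsum_in (obs C) (\<lambda>X. tensor R (fob M X) (fob F X)) X (pure_tensor R (fob M X) (fob F X) y x)"

definition coend_gens ::
  "('k, 'r) ring_scheme \<Rightarrow> ('o, 'a) category \<Rightarrow> ('o, 'a, 'k, 'm) kfun \<Rightarrow> ('o, 'a, 'k, 'n) kfun \<Rightarrow>
   ('o \<Rightarrow> ('m \<times> 'n \<Rightarrow> 'k) set) set" where
  "coend_gens R C M F =
    (let T = (\<lambda>X. tensor R (fob M X) (fob F X)); D = dsum (obs C) T; \<iota> = dsum_in (obs C) T;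
         t = (\<lambda>X. pure_tensor R (fob M X) (fob F X))
     in {\<iota> (trg C f) (t (trg C f) y (far F f x)) \<ominus>\<^bsub>D\<^esub> \<iota> (src C f) (t (src C f) (far M f y) x) | f x y.
         f \<in> arrs C \<and> x \<in> elts F (src C f) \<and> y \<in> elts M (trg C f)})"

lemma coend_rels_span:
  "coend_rels R C M F = span R (dsum (obs C) (\<lambda>X. tensor R (fob M X) (fob F X))) (coend_gens R C M F)"
  by (simp add: coend_rels_def coend_gens_def Let_def)

context
  fixes R :: "('k, 'r) ring_scheme" and C :: "('o, 'a) category"
    and M :: "('o, 'a, 'k, 'm) kfun" and F :: "('o, 'a, 'k, 'n) kfun"
  assumes R: "cring R" and C: "is_category C" and M: "contra_fun R C M" and F: "is_kfun R C F"
begin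

abbreviation (input) "coend_tensor \<equiv> (\<lambda>X. tensor R (fob M X) (fob F X))"
abbreviation (input) "coend_dsum \<equiv> dsum (obs C) (\<lambda>X. tensor R (fob M X) (fob F X))"
abbreviation (input) "coend_pure \<equiv> (\<lambda>X y x. dsum_in (obs C) (\<lambda>X. tensor R (fob M X) (fob F X)) X (pure_tensor R (fob M X) (fob F X) y x))"

lemma coend_tensor_module: "X \<in> obs C \<Longrightarrow> module R (tensor R (fob M X) (fob F X))"
  by (rule tensor_module[OF contra_funD(1)[OF M] is_kfunD(1)[OF F]])

lemma coend_dsum_module: "module R coend_dsum"
  by (rule dsum_module[OF R]) (rule coend_tensor_module)

lemma coend_dsum_in_hom: "X \<in> obs C \<Longrightarrow> dsum_in (obs C) coend_tensor X \<in> mod_hom R (tensor R (fob M X) (fob F X)) coend_dsum"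
  by (rule dsum_in_hom[where M = coend_tensor, OF R]) (rule coend_tensor_module)

lemma coend_pure_bilinear:
  assumes "X \<in> obs C"
  shows "bilinear_map R (fob M X) (fob F X) coend_dsum (coend_pure X)"
  by (rule bilinear_map_comp[OF pure_tensor_bilinear[OF contra_funD(1)[OF M assms] is_kfunD(1)[OF F assms]]
        coend_dsum_in_hom[OF assms]])

lemma coend_pure_closed:
  "\<lbrakk>X \<in> obs C; y \<in> elts M X; x \<in> elts F X\<rbrakk> \<Longrightarrow> coend_pure X y x \<in> carrier coend_dsum"
  by (rule bilinear_map_closed[OF coend_pure_bilinear])

lemma coend_gen_parts:
  assumes f: "f \<in> arrs C" and x: "x \<in> elts F (src C f)" and y: "y \<in> elts M (trg C f)"
  shows "coend_pure (trg C f) y (far F f x) \<in> carrier coend_dsum" "coend_pure (src C f) (far M f y) x \<in> carrier coend_dsum"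
  using coend_pure_closed is_categoryD(1,2)[OF C f] x y mod_homD(1)[OF is_kfunD(2)[OF F f] x]
    mod_homD(1)[OF contra_funD(2)[OF M f] y] by auto

lemma coend_gens_carrier: "coend_gens R C M F \<subseteq> carrier coend_dsum"
proof -
  interpret D: module R coend_dsum by (rule coend_dsum_module)
  show ?thesis unfolding coend_gens_def Let_def using coend_gen_parts by (auto intro!: D.M.minus_closed)
qed

lemma coend_rels_submodule: "submodule (coend_rels R C M F) R coend_dsum"
  unfolding coend_rels_span by (rule span_submodule[OF coend_dsum_module coend_gens_carrier])

lemma coend_module: "module R (coend R C M F)"
  unfolding coend_def by (rule quot_module[OF coend_dsum_module coend_rels_submodule])

lemma coend_proj_hom: "(\<lambda>u. coend_rels R C M F +>\<^bsub>coend_dsum\<^esub> u) \<in> mod_hom R coend_dsum (coend R C M F)"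
  unfolding coend_def by (rule quot_proj_hom[OF coend_dsum_module coend_rels_submodule])

lemma coend_in_bilinear:
  assumes "X \<in> obs C"
  shows "bilinear_map R (fob M X) (fob F X) (coend R C M F) (coend_in R C M F X)"
  unfolding coend_in_def[abs_def] by (rule bilinear_map_comp[OF coend_pure_bilinear[OF assms] coend_proj_hom])

lemma coend_in_rel:
  assumes f: "f \<in> arrs C" and x: "x \<in> elts F (src C f)" and y: "y \<in> elts M (trg C f)"
  shows "coend_in R C M F (trg C f) y (far F f x) = coend_in R C M F (src C f) (far M f y) x"
proof -
  have "coend_pure (trg C f) y (far F f x) \<ominus>\<^bsub>coend_dsum\<^esub> coend_pure (src C f) (far M f y) x \<in> coend_gens R C M F"
    unfolding coend_gens_def Let_def using f x y by blast
  then have "coend_pure (trg C f) y (far F f x) \<ominus>\<^bsub>coend_dsum\<^esub> coend_pure (src C f) (far M f y) x \<in> coend_rels R C M F"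
    unfolding coend_rels_span by (rule subsetD[OF span_incl])
  then show ?thesis
    unfolding coend_in_def coset_eq_iff[OF coend_dsum_module coend_rels_submodule coend_gen_parts[OF f x y]] .
qed

lemma coend_hom_eqI:
  assumes L: "module R L" and h: "h \<in> mod_hom R (coend R C M F) L" and h': "h' \<in> mod_hom R (coend R C M F) L"
    and eq: "\<And>X y x. \<lbrakk>X \<in> obs C; y \<in> elts M X; x \<in> elts F X\<rbrakk> \<Longrightarrow>
      h (coend_in R C M F X y x) = h' (coend_in R C M F X y x)"
    and z: "z \<in> carrier (coend R C M F)"
  shows "h z = h' z"
proof -
  obtain u where u: "u \<in> carrier coend_dsum" "z = coend_rels R C M F +>\<^bsub>coend_dsum\<^esub> u"
    using z unfolding coend_def by (rule quot_cosetE[OF coend_dsum_module coend_rels_submodule])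
  note ph = mod_hom_comp[OF coend_proj_hom h] and ph' = mod_hom_comp[OF coend_proj_hom h']
  show ?thesis unfolding u(2)
  proof (rule dsum_hom_eqI[where M = coend_tensor, OF R _ L ph ph' _ u(1)])
    fix X t assume X: "X \<in> obs C" and t: "t \<in> carrier (tensor R (fob M X) (fob F X))"
    show "h (coend_rels R C M F +>\<^bsub>coend_dsum\<^esub> dsum_in (obs C) coend_tensor X t) =
        h' (coend_rels R C M F +>\<^bsub>coend_dsum\<^esub> dsum_in (obs C) coend_tensor X t)"
      by (rule tensor_hom_eqI[OF contra_funD(1)[OF M X] is_kfunD(1)[OF F X] L
            mod_hom_comp[OF coend_dsum_in_hom[OF X] ph] mod_hom_comp[OF coend_dsum_in_hom[OF X] ph'] _ t])
        (use eq[OF X] in \<open>simp add: coend_in_def\<close>)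
  qed (rule coend_tensor_module)
qed

context
  fixes L :: "('k, 'l) module" and b
  assumes L: "module R L" and b: "\<And>X. X \<in> obs C \<Longrightarrow> bilinear_map R (fob M X) (fob F X) L (b X)"
    and compat: "\<And>f x y. \<lbrakk>f \<in> arrs C; x \<in> elts F (src C f); y \<in> elts M (trg C f)\<rbrakk> \<Longrightarrow>
      b (trg C f) y (far F f x) = b (src C f) (far M f y) x"
begin

definition coend_lift :: "('o \<Rightarrow> ('m \<times> 'n \<Rightarrow> 'k) set) set \<Rightarrow> 'l" where
  "coend_lift = quot_lift (dsum_lift (obs C) coend_tensor L (\<lambda>X. tensor_lift R L (b X)))"

lemma coend_dsum_lift:
  shows "dsum_lift (obs C) coend_tensor L (\<lambda>X. tensor_lift R L (b X)) \<in> mod_hom R coend_dsum L"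
    and "\<lbrakk>X \<in> obs C; y \<in> elts M X; x \<in> elts F X\<rbrakk> \<Longrightarrow>
      dsum_lift (obs C) coend_tensor L (\<lambda>X. tensor_lift R L (b X)) (coend_pure X y x) = b X y x"
proof -
  have t: "tensor_lift R L (b X) \<in> mod_hom R (tensor R (fob M X) (fob F X)) L" if "X \<in> obs C" for X
    by (rule tensor_lift_hom[OF contra_funD(1)[OF M that] is_kfunD(1)[OF F that] L b[OF that]])
  show "dsum_lift (obs C) coend_tensor L (\<lambda>X. tensor_lift R L (b X)) \<in> mod_hom R coend_dsum L"
    by (rule dsum_lift_hom[OF R _ L]) (rule coend_tensor_module t; assumption)+
  assume X: "X \<in> obs C" and y: "y \<in> elts M X" and x: "x \<in> elts F X"
  have p: "pure_tensor R (fob M X) (fob F X) y x \<in> carrier (tensor R (fob M X) (fob F X))"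
    using mod_homD(1)[OF bilinear_mapD(1)[OF pure_tensor_bilinear[OF contra_funD(1)[OF M X] is_kfunD(1)[OF F X]] y] x] .
  have "dsum_lift (obs C) coend_tensor L (\<lambda>X. tensor_lift R L (b X)) (coend_pure X y x) =
      tensor_lift R L (b X) (pure_tensor R (fob M X) (fob F X) y x)"
    by (rule dsum_lift_in[where M = coend_tensor, OF R _ L _ X p]) (rule coend_tensor_module t; assumption)+
  also have "\<dots> = b X y x"
    by (rule tensor_lift_pure[OF contra_funD(1)[OF M X] is_kfunD(1)[OF F X] L b[OF X] y x])
  finally show "dsum_lift (obs C) coend_tensor L (\<lambda>X. tensor_lift R L (b X)) (coend_pure X y x) = b X y x" .
qed

lemma coend_lift_rels:
  assumes "u \<in> coend_rels R C M F"
  shows "dsum_lift (obs C) coend_tensor L (\<lambda>X. tensor_lift R L (b X)) u = \<zero>\<^bsub>L\<^esub>"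
proof (rule span_hom_zero[OF coend_dsum_module L coend_dsum_lift(1) coend_gens_carrier _ assms[unfolded coend_rels_span]])
  fix g assume "g \<in> coend_gens R C M F"
  then obtain f x y where g: "g = coend_pure (trg C f) y (far F f x) \<ominus>\<^bsub>coend_dsum\<^esub> coend_pure (src C f) (far M f y) x"
    and f: "f \<in> arrs C" and x: "x \<in> elts F (src C f)" and y: "y \<in> elts M (trg C f)"
    unfolding coend_gens_def Let_def by blast
  note o = is_categoryD(1,2)[OF C f]
  have fx: "far F f x \<in> elts F (trg C f)" by (rule mod_homD(1)[OF is_kfunD(2)[OF F f] x])
  have fy: "far M f y \<in> elts M (src C f)" by (rule mod_homD(1)[OF contra_funD(2)[OF M f] y])
  have "dsum_lift (obs C) coend_tensor L (\<lambda>X. tensor_lift R L (b X)) g =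
      b (trg C f) y (far F f x) \<ominus>\<^bsub>L\<^esub> b (src C f) (far M f y) x"
    unfolding g mod_hom_minus[OF coend_dsum_module L coend_dsum_lift(1) coend_gen_parts[OF f x y]]
      coend_dsum_lift(2)[OF o(2) y fx] coend_dsum_lift(2)[OF o(1) fy x] ..
  then show "dsum_lift (obs C) coend_tensor L (\<lambda>X. tensor_lift R L (b X)) g = \<zero>\<^bsub>L\<^esub>"
    using compat[OF f x y] minus_eq_zero_iff[OF L] mod_homD(1)[OF bilinear_mapD(1)[OF b[OF o(1)] fy] x] by simp
qed

lemma coend_lift_hom: "coend_lift \<in> mod_hom R (coend R C M F) L"
  unfolding coend_lift_def coend_def
  by (rule quot_lift_hom[OF coend_dsum_module coend_rels_submodule L coend_dsum_lift(1) coend_lift_rels])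

lemma coend_lift_in:
  assumes "X \<in> obs C" "y \<in> elts M X" "x \<in> elts F X"
  shows "coend_lift (coend_in R C M F X y x) = b X y x"
  unfolding coend_lift_def coend_in_def
  using quot_lift_coset[OF coend_dsum_module coend_rels_submodule L coend_dsum_lift(1) coend_lift_rels coend_pure_closed[OF assms]]
    coend_dsum_lift(2)[OF assms] by simp

end

end

text \<open>Naturality of \<eta> takes the coend relation for an arrow f and elements y, x to the
  relation for f and \<eta> y, x.\<close>

lemma coend_map_props:
  assumes R: "cring R" and C: "is_category C" and M: "contra_fun R C M" and M': "contra_fun R C M'" and F: "is_kfun R C F"
    and h: "\<And>X. X \<in> obs C \<Longrightarrow> \<eta> X \<in> mod_hom R (fob M X) (fob M' X)"
    and nat: "\<And>f y. \<lbrakk>f \<in> arrs C; y \<in> elts M (trg C f)\<rbrakk> \<Longrightarrow> \<eta> (src C f) (far M f y) = far M' f (\<eta> (trg C f) y)"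
  shows "coend_map R C M' F \<eta> \<in> mod_hom R (coend R C M F) (coend R C M' F)" (is ?hom)
    and "\<lbrakk>X \<in> obs C; y \<in> elts M X; x \<in> elts F X\<rbrakk> \<Longrightarrow>
      coend_map R C M' F \<eta> (coend_in R C M F X y x) = coend_in R C M' F X (\<eta> X y) x" (is "_ \<Longrightarrow> _ \<Longrightarrow> _ \<Longrightarrow> ?val")
proof -
  let ?D = "dsum (obs C) (\<lambda>X. tensor R (fob M X) (fob F X))" and ?D' = "dsum (obs C) (\<lambda>X. tensor R (fob M' X) (fob F X))"
  let ?l = "dsum_map (obs C) (\<lambda>X. tensor_map R (fob M' X) (fob F X) (\<eta> X))"
  note DM = coend_dsum_module[OF R C M F] and DM' = coend_dsum_module[OF R C M' F]
  let ?i = "\<lambda>X y x. dsum_in (obs C) (\<lambda>X. tensor R (fob M X) (fob F X)) X (pure_tensor R (fob M X) (fob F X) y x)"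
  let ?i' = "\<lambda>X y x. dsum_in (obs C) (\<lambda>X. tensor R (fob M' X) (fob F X)) X (pure_tensor R (fob M' X) (fob F X) y x)"
  note t = tensor_map_props[OF contra_funD(1)[OF M] contra_funD(1)[OF M'] is_kfunD(1)[OF F] h]
  have l: "?l \<in> mod_hom R ?D ?D'"
    by (rule dsum_map_hom[OF R]) (rule coend_tensor_module[OF R C M F] coend_tensor_module[OF R C M' F] t(1); assumption)+
  have lv: "?l (?i X y x) = ?i' X (\<eta> X y) x" if "X \<in> obs C" "y \<in> elts M X" "x \<in> elts F X" for X y x
  proof -
    have p: "pure_tensor R (fob M X) (fob F X) y x \<in> carrier (tensor R (fob M X) (fob F X))"
      using mod_homD(1)[OF bilinear_mapD(1)[OF pure_tensor_bilinear[OF contra_funD(1)[OF M that(1)] is_kfunD(1)[OF F that(1)]] that(2)] that(3)] .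
    have "?l (?i X y x) = dsum_in (obs C) (\<lambda>X. tensor R (fob M' X) (fob F X)) X (tensor_map R (fob M' X) (fob F X) (\<eta> X) (pure_tensor R (fob M X) (fob F X) y x))"
      by (rule dsum_map_in[where h = "\<lambda>X. tensor_map R (fob M' X) (fob F X) (\<eta> X)" and M = "\<lambda>X. tensor R (fob M X) (fob F X)"
            and N = "\<lambda>X. tensor R (fob M' X) (fob F X)", OF R _ _ _ that(1) p])
        (rule coend_tensor_module[OF R C M F] coend_tensor_module[OF R C M' F] t(1); assumption)+
    then show ?thesis using t(2)[OF that(1,1,1,1,2,3)] by simp
  qed
  have sub: "?l u \<in> coend_rels R C M' F" if "u \<in> coend_rels R C M F" for u
    using that unfolding coend_rels_span[of R C M]
  proof (rule span_hom_image[OF DM DM' l coend_gens_carrier[OF R C M F] coend_rels_submodule[OF R C M' F], rotated])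
    fix g assume "g \<in> coend_gens R C M F"
    then obtain f x y where g: "g = ?i (trg C f) y (far F f x) \<ominus>\<^bsub>?D\<^esub> ?i (src C f) (far M f y) x"
      and f: "f \<in> arrs C" and x: "x \<in> elts F (src C f)" and y: "y \<in> elts M (trg C f)"
      unfolding coend_gens_def Let_def by blast
    note o = is_categoryD(1,2)[OF C f]
    have fx: "far F f x \<in> elts F (trg C f)" by (rule mod_homD(1)[OF is_kfunD(2)[OF F f] x])
    have fy: "far M f y \<in> elts M (src C f)" by (rule mod_homD(1)[OF contra_funD(2)[OF M f] y])
    have "?l g = ?i' (trg C f) (\<eta> (trg C f) y) (far F f x) \<ominus>\<^bsub>?D'\<^esub> ?i' (src C f) (far M' f (\<eta> (trg C f) y)) x"
      unfolding g mod_hom_minus[OF DM DM' l coend_gen_parts[OF R C M F f x y]] lv[OF o(2) y fx] lv[OF o(1) fy x] nat[OF f y] ..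
    then have "?l g \<in> coend_gens R C M' F"
      unfolding coend_gens_def Let_def using f x mod_homD(1)[OF h[OF o(2)] y] by blast
    then show "?l g \<in> coend_rels R C M' F" unfolding coend_rels_span by (rule subsetD[OF span_incl])
  qed
  note U = DM coend_rels_submodule[OF R C M F] DM' coend_rels_submodule[OF R C M' F]
  show ?hom unfolding coend_map_def coend_def by (rule quot_map_hom[OF U l sub])
  assume "X \<in> obs C" "y \<in> elts M X" "x \<in> elts F X"
  then show ?val unfolding coend_map_def coend_in_def
    using quot_map_coset[OF U l sub coend_pure_closed[OF R C M F]] lv by simp
qed

section \<open>The bar complex as a coend with nerves of under-categories\<close>

section \<open>Nerves of under-categories\<close>

lemma under_simps:
  "obs (under C X) = {f \<in> arrs C. src C f = X}"
  "p \<in> arrs (under C X) \<longleftrightarrow> fst p \<in> arrs C \<and> src C (fst p) = X \<and> snd p \<in> arrs C \<and> src C (snd p) = trg C (fst p)"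
  "src (under C X) p = fst p" "trg (under C X) p = cmp C (snd p) (fst p)"
  "ident (under C X) f = (f, ident C (trg C f))" "cmp (under C X) q p = (fst p, cmp C (snd q) (snd p))"
  by (cases p; cases q; simp add: under_def)+

text \<open>The chain \<sigma> seen as a simplex under its own first vertex, with
  \<open>\<sigma> (0, i)\<close> as structure arrow to vertex i. These canonical lifts represent all
  generators of the coend.\<close>

definition under_lift :: "nat \<Rightarrow> 'a simplex \<Rightarrow> nat \<times> nat \<Rightarrow> 'a \<times> 'a" where
  "under_lift n \<sigma> = (\<lambda>(i, j)\<in>order_pairs n. (\<sigma> (0, i), \<sigma> (i, j)))"

definition under_precomp :: "('o, 'a) category \<Rightarrow> nat \<Rightarrow> 'a \<Rightarrow> (nat \<times> nat \<Rightarrow> 'a \<times> 'a) \<Rightarrow> nat \<times> nat \<Rightarrow> 'a \<times> 'a" where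
  "under_precomp C n f \<sigma> = (\<lambda>p\<in>order_pairs n. case \<sigma> p of (g, h) \<Rightarrow> (cmp C g f, h))"

context
  fixes C :: "('o, 'a) category"
  assumes C: "is_category C"
begin

lemma under_nerveD:
  assumes \<sigma>: "\<sigma> \<in> nerve (under C X) n" and ij: "i \<le> j" "j \<le> n"
  shows "fst (\<sigma> (i, j)) = fst (\<sigma> (i, i))" "fst (\<sigma> (i, i)) \<in> arrs C" "src C (fst (\<sigma> (i, i))) = X"
    "snd (\<sigma> (i, j)) \<in> arrs C" "src C (snd (\<sigma> (i, j))) = trg C (fst (\<sigma> (i, i)))"
    "trg C (snd (\<sigma> (i, j))) = trg C (fst (\<sigma> (j, j)))"
    "cmp C (snd (\<sigma> (i, j))) (fst (\<sigma> (i, i))) = fst (\<sigma> (j, j))"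
    "snd (\<sigma> (i, i)) = ident C (trg C (fst (\<sigma> (i, i))))"
proof -
  note s = nerveD[OF \<sigma>] and c = is_categoryD[OF C]
  have u: "fst (\<sigma> (i, j)) \<in> arrs C" "src C (fst (\<sigma> (i, j))) = X" "snd (\<sigma> (i, j)) \<in> arrs C"
    "src C (snd (\<sigma> (i, j))) = trg C (fst (\<sigma> (i, j)))" if "i \<le> j" "j \<le> n" for i j
    using s(1)[OF that] unfolding under_simps by blast+
  have f: "fst (\<sigma> (i, j)) = fst (\<sigma> (i, i))" if "i \<le> j" "j \<le> n" for i j
    using s(2)[OF that] unfolding under_simps .
  show "fst (\<sigma> (i, j)) = fst (\<sigma> (i, i))" by (rule f[OF ij])
  show u': "fst (\<sigma> (i, i)) \<in> arrs C" "src C (fst (\<sigma> (i, i))) = X" using u[of i i] ij by auto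
  show v: "snd (\<sigma> (i, j)) \<in> arrs C" "src C (snd (\<sigma> (i, j))) = trg C (fst (\<sigma> (i, i)))"
    using u(3,4)[OF ij] unfolding f[OF ij] .
  show w: "cmp C (snd (\<sigma> (i, j))) (fst (\<sigma> (i, i))) = fst (\<sigma> (j, j))"
    using s(3)[OF ij] unfolding under_simps f[OF ij] .
  show "trg C (snd (\<sigma> (i, j))) = trg C (fst (\<sigma> (j, j)))"
    using c(8)[OF u'(1) v] unfolding w by simp
  have "i \<le> n" using ij by simp
  from arg_cong[OF s(4)[OF this], of snd]
  show "snd (\<sigma> (i, i)) = ident C (trg C (fst (\<sigma> (i, i))))" unfolding under_simps snd_conv .
qed

lemma under_nerve_cmp:
  assumes \<sigma>: "\<sigma> \<in> nerve (under C X) n" and ij: "i \<le> j" "j \<le> l" "l \<le> n"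
  shows "cmp C (snd (\<sigma> (j, l))) (snd (\<sigma> (i, j))) = snd (\<sigma> (i, l))"
  using arg_cong[OF nerveD(5)[OF \<sigma> ij], of snd] unfolding under_simps snd_conv .

lemma under_nerveI:
  assumes g: "\<And>i. i \<le> n \<Longrightarrow> g i \<in> arrs C \<and> src C (g i) = X"
    and h: "\<And>i j. \<lbrakk>i \<le> j; j \<le> n\<rbrakk> \<Longrightarrow> h i j \<in> arrs C \<and> src C (h i j) = trg C (g i) \<and> cmp C (h i j) (g i) = g j"
    and id: "\<And>i. i \<le> n \<Longrightarrow> h i i = ident C (trg C (g i))"
    and hh: "\<And>i j l. \<lbrakk>i \<le> j; j \<le> l; l \<le> n\<rbrakk> \<Longrightarrow> cmp C (h j l) (h i j) = h i l"
  shows "(\<lambda>(i, j)\<in>order_pairs n. (g i, h i j)) \<in> nerve (under C X) n"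
proof (rule nerveI[where X = g])
  fix i j assume "i \<le> j" "j \<le> n"
  moreover have "i \<le> n" using calculation by simp
  ultimately show "(\<lambda>(i, j)\<in>order_pairs n. (g i, h i j)) (i, j) \<in> arrs (under C X)"
    "src (under C X) ((\<lambda>(i, j)\<in>order_pairs n. (g i, h i j)) (i, j)) = g i"
    "trg (under C X) ((\<lambda>(i, j)\<in>order_pairs n. (g i, h i j)) (i, j)) = g j"
    using g[of i] h[of i j] by (simp_all add: under_simps)
next
  fix i j l assume "i \<le> j" "j \<le> l" "l \<le> n"
  then show "cmp (under C X) ((\<lambda>(i, j)\<in>order_pairs n. (g i, h i j)) (j, l)) ((\<lambda>(i, j)\<in>order_pairs n. (g i, h i j)) (i, j)) =
      (\<lambda>(i, j)\<in>order_pairs n. (g i, h i j)) (i, l)"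
    using hh[of i j l] by (simp add: under_simps)
qed (use id in \<open>simp_all add: under_simps\<close>)

lemma under_lift_closed:
  assumes \<sigma>: "\<sigma> \<in> nerve C n"
  shows "under_lift n \<sigma> \<in> nerve (under C (origin C \<sigma>)) n"
  unfolding under_lift_def
proof (rule under_nerveI)
  note s = nerveD[OF \<sigma>]
  show "\<And>i. i \<le> n \<Longrightarrow> \<sigma> (0, i) \<in> arrs C \<and> src C (\<sigma> (0, i)) = origin C \<sigma>" using s(1,2) by blast
  show "\<And>i j. \<lbrakk>i \<le> j; j \<le> n\<rbrakk> \<Longrightarrow> \<sigma> (i, j) \<in> arrs C \<and> src C (\<sigma> (i, j)) = trg C (\<sigma> (0, i)) \<and> cmp C (\<sigma> (i, j)) (\<sigma> (0, i)) = \<sigma> (0, j)"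
    using s(1)[OF _ _] s(2)[OF _ _] s(3)[of 0] s(5)[of 0] by (metis le0 le_trans)
  show "\<And>i. i \<le> n \<Longrightarrow> \<sigma> (i, i) = ident C (trg C (\<sigma> (0, i)))" using s(3,4) by (metis le0)
qed (rule nerveD(5)[OF \<sigma>])

lemma under_precomp_closed:
  assumes \<sigma>: "\<sigma> \<in> nerve (under C (trg C f)) n" and f: "f \<in> arrs C"
  shows "under_precomp C n f \<sigma> \<in> nerve (under C (src C f)) n"
proof -
  note u = under_nerveD[OF \<sigma>] and c = is_categoryD[OF C]
  have "under_precomp C n f \<sigma> = (\<lambda>(i, j)\<in>order_pairs n. (cmp C (fst (\<sigma> (i, i))) f, snd (\<sigma> (i, j))))"
  proof (rule extensionalityI[of _ "order_pairs n"])
    fix p assume "p \<in> order_pairs n"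
    then obtain i j where p: "p = (i, j)" "i \<le> j" "j \<le> n" by (auto simp: order_pairs_def)
    then show "under_precomp C n f \<sigma> p = (\<lambda>(i, j)\<in>order_pairs n. (cmp C (fst (\<sigma> (i, i))) f, snd (\<sigma> (i, j)))) p"
      using u(1)[OF p(2,3)] by (simp add: under_precomp_def case_prod_beta)
  qed (simp_all add: under_precomp_def)
  also have "\<dots> \<in> nerve (under C (src C f)) n"
  proof (rule under_nerveI)
    fix i assume "i \<le> n"
    then show "cmp C (fst (\<sigma> (i, i))) f \<in> arrs C \<and> src C (cmp C (fst (\<sigma> (i, i))) f) = src C f"
      using c(6,7)[OF f u(2)[of i i] u(3)[of i i]] by auto
    show "snd (\<sigma> (i, i)) = ident C (trg C (cmp C (fst (\<sigma> (i, i))) f))"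
      using c(8)[OF f u(2)[of i i] u(3)[of i i]] u(8)[of i i] \<open>i \<le> n\<close> by auto
  next
    fix i j assume ij: "i \<le> j" "j \<le> n"
    then have i: "i \<le> i" "i \<le> n" by auto
    show "snd (\<sigma> (i, j)) \<in> arrs C \<and> src C (snd (\<sigma> (i, j))) = trg C (cmp C (fst (\<sigma> (i, i))) f) \<and>
        cmp C (snd (\<sigma> (i, j))) (cmp C (fst (\<sigma> (i, i))) f) = cmp C (fst (\<sigma> (j, j))) f"
      using u(4,5,7)[OF ij] c(8)[OF f u(2,3)[OF i]] c(11)[OF f u(2)[OF i] u(4)[OF ij] u(3)[OF i] u(5)[OF ij]] by simp
  qed (rule under_nerve_cmp[OF \<sigma>])
  finally show ?thesis .
qed

lemma under_snd_closed:
  assumes \<sigma>: "\<sigma> \<in> nerve (under C X) n"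
  shows "nerve_map n snd \<sigma> \<in> nerve C n" "src C (nerve_map n snd \<sigma> (0, 0)) = trg C (fst (\<sigma> (0, 0)))"
proof -
  note u = under_nerveD[OF \<sigma>]
  show "nerve_map n snd \<sigma> \<in> nerve C n"
  proof (rule nerveI[where X = "\<lambda>i. trg C (fst (\<sigma> (i, i)))"])
    fix i j assume ij: "i \<le> j" "j \<le> n"
    show "nerve_map n snd \<sigma> (i, j) \<in> arrs C" "src C (nerve_map n snd \<sigma> (i, j)) = trg C (fst (\<sigma> (i, i)))"
      "trg C (nerve_map n snd \<sigma> (i, j)) = trg C (fst (\<sigma> (j, j)))" using ij u(4-6)[OF ij] by simp_all
  next
    fix i assume "i \<le> n"
    then show "nerve_map n snd \<sigma> (i, i) = ident C (trg C (fst (\<sigma> (i, i))))" using u(8)[of i i] by simp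
  next
    fix i j l assume ij: "i \<le> j" "j \<le> l" "l \<le> n"
    then show "cmp C (nerve_map n snd \<sigma> (j, l)) (nerve_map n snd \<sigma> (i, j)) = nerve_map n snd \<sigma> (i, l)"
      using under_nerve_cmp[OF \<sigma> ij] by simp
  qed (simp add: nerve_map_def)
  show "src C (nerve_map n snd \<sigma> (0, 0)) = trg C (fst (\<sigma> (0, 0)))" using u(5)[of 0 0] by simp
qed

text \<open>A simplex under X is the canonical lift of its own chain, pulled back along the first
  structure arrow. In the coend every generator can therefore be moved to the first vertex of its
  chain.\<close>

lemma under_precomp_lift:
  assumes \<sigma>: "\<sigma> \<in> nerve (under C X) n"
  shows "under_precomp C n (fst (\<sigma> (0, 0))) (under_lift n (nerve_map n snd \<sigma>)) = \<sigma>"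
proof (rule extensionalityI[of _ "order_pairs n"])
  show "\<sigma> \<in> extensional (order_pairs n)" by (rule nerveD(6)[OF \<sigma>])
  fix p assume "p \<in> order_pairs n"
  then obtain i j where p: "p = (i, j)" "i \<le> j" "j \<le> n" by (auto simp: order_pairs_def)
  note u = under_nerveD[OF \<sigma>]
  have "cmp C (snd (\<sigma> (0, i))) (fst (\<sigma> (0, 0))) = fst (\<sigma> (i, j))" using u(7)[of 0 i] u(1)[of i j] p by simp
  then show "under_precomp C n (fst (\<sigma> (0, 0))) (under_lift n (nerve_map n snd \<sigma>)) p = \<sigma> p"
    using p by (simp add: under_precomp_def under_lift_def)
qed (simp add: under_precomp_def)

lemma under_snd_lift: "\<sigma> \<in> nerve C n \<Longrightarrow> nerve_map n snd (under_lift n \<sigma>) = \<sigma>"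
  using nerveD(6) by (intro extensionalityI[of _ "order_pairs n"]) (auto simp: nerve_map_def under_lift_def)

text \<open>A simplicial operator may change the first vertex to \<open>\<theta> 0\<close>. The
  canonical lift of the new chain is based there and becomes a simplex under X_0 after pulling back
  along \<open>\<sigma> (0, \<theta> 0)\<close>.\<close>

lemma under_lift_act:
  assumes \<sigma>: "\<sigma> \<in> nerve C n" and \<theta>: "mono_map m n \<theta>"
  shows "under_precomp C m (\<sigma> (0, \<theta> 0)) (under_lift m (nerve_act m \<theta> \<sigma>)) = nerve_act m \<theta> (under_lift n \<sigma>)"
proof (rule extensionalityI[of _ "order_pairs m"])
  fix p assume "p \<in> order_pairs m"
  then obtain i j where p: "p = (i, j)" "i \<le> j" "j \<le> m" by (auto simp: order_pairs_def)
  have t: "\<theta> 0 \<le> \<theta> i" "\<theta> i \<le> \<theta> j" "\<theta> j \<le> n" using mono_mapD[OF \<theta>] p by auto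
  then show "under_precomp C m (\<sigma> (0, \<theta> 0)) (under_lift m (nerve_act m \<theta> \<sigma>)) p = nerve_act m \<theta> (under_lift n \<sigma>) p"
    using p nerveD(5)[OF \<sigma>, of 0 "\<theta> 0" "\<theta> i"] by (simp add: under_precomp_def under_lift_def)
qed (simp_all add: under_precomp_def nerve_act_def)

lemma nerve_face_act: "nerve_face n i = nerve_act n (coface i)"
  by (simp add: nerve_face_def nerve_act_def fun_eq_iff)

lemma under_precomp_act:
  assumes "mono_map m n \<theta>"
  shows "under_precomp C m f (nerve_act m \<theta> \<sigma>) = nerve_act m \<theta> (under_precomp C n f \<sigma>)"
proof (rule extensionalityI[of _ "order_pairs m"])
  fix p assume "p \<in> order_pairs m"
  then obtain i j where p: "p = (i, j)" "i \<le> j" "j \<le> m" by (auto simp: order_pairs_def)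
  then show "under_precomp C m f (nerve_act m \<theta> \<sigma>) p = nerve_act m \<theta> (under_precomp C n f \<sigma>) p"
    using mono_mapD[OF assms] by (simp add: under_precomp_def)
qed (simp_all add: under_precomp_def nerve_act_def)

end

context
  fixes R :: "('k, 'r) ring_scheme" and C :: "('o, 'a) category" and F :: "('o, 'a, 'k, 'm) kfun"
  assumes R: "cring R" and C: "is_category C" and F: "is_kfun R C F"
begin

abbreviation (input) "NU \<equiv> under_nerve_fun R C"

lemma under_nerve_fob [simp]: "fob (NU n) X = free_mod R (nerve (under C X) n)"
  by (simp add: under_nerve_fun_def)

lemma under_nerve_far_aux:
  "f \<in> arrs C \<Longrightarrow> (\<lambda>\<sigma>. fgen R (under_precomp C n f \<sigma>)) \<in> nerve (under C (trg C f)) n \<rightarrow> carrier (free_mod R (nerve (under C (src C f)) n))"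
  using fgen_carrier[OF R under_precomp_closed[OF C]] by auto

lemma under_nerve_far:
  "far (NU n) f = lin_ext R (free_mod R (nerve (under C (src C f)) n)) (\<lambda>\<sigma>. fgen R (under_precomp C n f \<sigma>))"
  by (simp add: under_nerve_fun_def under_precomp_def)

lemma under_nerve_far_hom:
  "f \<in> arrs C \<Longrightarrow> far (NU n) f \<in> mod_hom R (free_mod R (nerve (under C (trg C f)) n)) (free_mod R (nerve (under C (src C f)) n))"
  unfolding under_nerve_far by (rule lin_ext_hom[OF free_mod_module[OF R] under_nerve_far_aux])

lemma under_nerve_far_gen:
  "\<lbrakk>f \<in> arrs C; \<sigma> \<in> nerve (under C (trg C f)) n\<rbrakk> \<Longrightarrow> far (NU n) f (fgen R \<sigma>) = fgen R (under_precomp C n f \<sigma>)"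
  unfolding under_nerve_far by (rule lin_ext_fgen[OF free_mod_module[OF R] under_nerve_far_aux])

lemma under_nerve_contra: "contra_fun R C (NU n)"
  unfolding contra_fun_def by (simp add: under_nerve_far_hom free_mod_module[OF R])

lemma under_face_aux:
  "i \<le> Suc n \<Longrightarrow> (\<lambda>\<sigma>. fgen R (nerve_act n (coface i) \<sigma>)) \<in> nerve (under C X) (Suc n) \<rightarrow> carrier (free_mod R (nerve (under C X) n))"
  using fgen_carrier[OF R nerve_act_closed[OF _ mono_map_coface]] by auto

lemma under_face_hom:
  "i \<le> Suc n \<Longrightarrow> under_nerve_face R C n i X \<in> mod_hom R (free_mod R (nerve (under C X) (Suc n))) (free_mod R (nerve (under C X) n))"
  unfolding under_nerve_face_def nerve_face_act[OF C] by (rule lin_ext_hom[OF free_mod_module[OF R] under_face_aux])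

lemma under_face_gen:
  "\<lbrakk>i \<le> Suc n; \<sigma> \<in> nerve (under C X) (Suc n)\<rbrakk> \<Longrightarrow> under_nerve_face R C n i X (fgen R \<sigma>) = fgen R (nerve_act n (coface i) \<sigma>)"
  unfolding under_nerve_face_def nerve_face_act[OF C] by (rule lin_ext_fgen[OF free_mod_module[OF R] under_face_aux])

lemma under_face_nat:
  assumes f: "f \<in> arrs C" and y: "y \<in> elts (NU (Suc n)) (trg C f)" and i: "i \<le> Suc n"
  shows "under_nerve_face R C n i (src C f) (far (NU (Suc n)) f y) = far (NU n) f (under_nerve_face R C n i (trg C f) y)"
proof (rule free_mod_hom_eqI[OF R free_mod_module[OF R] mod_hom_comp[OF under_nerve_far_hom[OF f] under_face_hom[OF i]]
      mod_hom_comp[OF under_face_hom[OF i] under_nerve_far_hom[OF f]] _ y[simplified]])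
  fix \<sigma> assume \<sigma>: "\<sigma> \<in> nerve (under C (trg C f)) (Suc n)"
  note m = mono_map_coface[OF i]
  show "under_nerve_face R C n i (src C f) (far (NU (Suc n)) f (fgen R \<sigma>)) =
      far (NU n) f (under_nerve_face R C n i (trg C f) (fgen R \<sigma>))"
    by (simp add: under_nerve_far_gen f \<sigma> under_face_gen i under_precomp_closed[OF C \<sigma> f] nerve_act_closed[OF \<sigma> m]
        under_precomp_act[OF C m])
qed

lemmas coend_face =
  coend_map_props[where M = "NU (Suc n)" and M' = "NU n" and \<eta> = "under_nerve_face R C n i", OF R C under_nerve_contra under_nerve_contra F] for n i

lemma coend_face_hom:
  "i \<le> Suc n \<Longrightarrow> coend_map R C (NU n) F (under_nerve_face R C n i) \<in> mod_hom R (coend R C (NU (Suc n)) F) (coend R C (NU n) F)"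
  by (rule coend_face(1)) (simp_all add: under_face_hom under_face_nat)

lemma coend_face_in:
  assumes "i \<le> Suc n" "X \<in> obs C" "\<sigma> \<in> nerve (under C X) (Suc n)" "x \<in> elts F X"
  shows "coend_map R C (NU n) F (under_nerve_face R C n i) (coend_in R C (NU (Suc n)) F X (fgen R \<sigma>) x) =
    coend_in R C (NU n) F X (fgen R (nerve_act n (coface i) \<sigma>)) x"
  using coend_face(2)[of n i X "fgen R \<sigma>" x] assms
  by (simp add: under_face_hom under_face_nat under_face_gen fgen_carrier[OF R])

definition bar_to_coend :: "nat \<Rightarrow> ('a simplex \<Rightarrow> 'm) \<Rightarrow> ('o \<Rightarrow> (((nat \<times> nat \<Rightarrow> 'a \<times> 'a) \<Rightarrow> 'k) \<times> 'm \<Rightarrow> 'k) set) set" where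
  "bar_to_coend n = bar_lift C F n (coend R C (NU n) F)
     (\<lambda>\<sigma>. coend_in R C (NU n) F (origin C \<sigma>) (fgen R (under_lift n \<sigma>)))"

lemma bar_to_coend_aux:
  assumes "\<sigma> \<in> nerve C n"
  shows "coend_in R C (NU n) F (origin C \<sigma>) (fgen R (under_lift n \<sigma>)) \<in> mod_hom R (fob F (origin C \<sigma>)) (coend R C (NU n) F)"
  by (rule bilinear_mapD(1)[OF coend_in_bilinear[OF R C under_nerve_contra F nerve_vertex[OF C assms]]])
    (simp_all add: fgen_carrier[OF R under_lift_closed[OF C assms]])

lemma bar_to_coend_hom: "bar_to_coend n \<in> mod_hom R (bar_mod C F n) (coend R C (NU n) F)"
  unfolding bar_to_coend_def by (rule bar_lift_hom[OF R C F coend_module[OF R C under_nerve_contra F]]) (rule bar_to_coend_aux)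

lemma bar_to_coend_in:
  "\<lbrakk>\<sigma> \<in> nerve C n; x \<in> elts F (origin C \<sigma>)\<rbrakk> \<Longrightarrow>
    bar_to_coend n (bar_in C F n \<sigma> x) = coend_in R C (NU n) F (origin C \<sigma>) (fgen R (under_lift n \<sigma>)) x"
  unfolding bar_to_coend_def by (rule bar_lift_in[OF R C F coend_module[OF R C under_nerve_contra F]]) (rule bar_to_coend_aux)

text \<open>The inverse direction on tensors: the first structure arrow pushes x from X to the first
  vertex of the chain, and then the structure arrows are forgotten.\<close>

definition under_eval :: "nat \<Rightarrow> ((nat \<times> nat \<Rightarrow> 'a \<times> 'a) \<Rightarrow> 'k) \<Rightarrow> 'm \<Rightarrow> 'a simplex \<Rightarrow> 'm" where
  "under_eval n y x = lin_ext R (bar_mod C F n) (\<lambda>\<sigma>. bar_in C F n (nerve_map n snd \<sigma>) (far F (fst (\<sigma> (0, 0))) x)) y"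

lemma under_gen_hom:
  assumes \<sigma>: "\<sigma> \<in> nerve (under C X) n"
  shows "(\<lambda>x. bar_in C F n (nerve_map n snd \<sigma>) (far F (fst (\<sigma> (0, 0))) x)) \<in> mod_hom R (fob F X) (bar_mod C F n)"
proof (rule mod_hom_comp)
  show "far F (fst (\<sigma> (0, 0))) \<in> mod_hom R (fob F X) (fob F (src C (nerve_map n snd \<sigma> (0, 0))))"
    unfolding under_snd_closed(2)[OF C \<sigma>]
    using is_kfunD(2)[OF F under_nerveD(2)[OF C \<sigma>, of 0 0]] under_nerveD(3)[OF C \<sigma>, of 0 0] by simp
qed (rule bar_in_hom[OF R C F under_snd_closed(1)[OF C \<sigma>]])

lemma under_eval_aux:
  "x \<in> elts F X \<Longrightarrow>
    (\<lambda>\<sigma>. bar_in C F n (nerve_map n snd \<sigma>) (far F (fst (\<sigma> (0, 0))) x)) \<in> nerve (under C X) n \<rightarrow> carrier (bar_mod C F n)"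
  using mod_homD(1)[OF under_gen_hom] by auto

lemma under_eval_gen:
  "\<lbrakk>\<sigma> \<in> nerve (under C X) n; x \<in> elts F X\<rbrakk> \<Longrightarrow>
    under_eval n (fgen R \<sigma>) x = bar_in C F n (nerve_map n snd \<sigma>) (far F (fst (\<sigma> (0, 0))) x)"
  unfolding under_eval_def by (rule lin_ext_fgen[OF bar_module[OF R C F] under_eval_aux])

lemma under_eval_hom_l:
  "x \<in> elts F X \<Longrightarrow> (\<lambda>y. under_eval n y x) \<in> mod_hom R (free_mod R (nerve (under C X) n)) (bar_mod C F n)"
  unfolding under_eval_def by (rule lin_ext_hom[OF bar_module[OF R C F] under_eval_aux])

lemma under_eval_bilinear:
  assumes X: "X \<in> obs C"
  shows "bilinear_map R (fob (NU n) X) (fob F X) (bar_mod C F n) (under_eval n)"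
  unfolding bilinear_map_def under_nerve_fob
proof (intro conjI ballI)
  interpret FX: module R "fob F X" by (rule is_kfunD(1)[OF F X])
  fix y assume y: "y \<in> carrier (free_mod R (nerve (under C X) n))"
  note BM = bar_module[OF R C F] and l = under_eval_hom_l
  show "under_eval n y \<in> mod_hom R (fob F X) (bar_mod C F n)"
  proof (rule mod_homI)
    fix x assume x: "x \<in> elts F X"
    show "under_eval n y x \<in> carrier (bar_mod C F n)" by (rule mod_homD(1)[OF l[OF x] y])
    { fix x' assume x': "x' \<in> elts F X"
      show "under_eval n y (x \<oplus>\<^bsub>fob F X\<^esub> x') = under_eval n y x \<oplus>\<^bsub>bar_mod C F n\<^esub> under_eval n y x'"
        by (rule free_mod_hom_eqI[OF R BM l[OF FX.M.a_closed[OF x x']] mod_hom_add[OF BM l[OF x] l[OF x']] _ y])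
          (simp add: under_eval_gen x x' mod_homD(2)[OF under_gen_hom x x']) }
    { fix r assume r: "r \<in> carrier R"
      show "under_eval n y (r \<odot>\<^bsub>fob F X\<^esub> x) = r \<odot>\<^bsub>bar_mod C F n\<^esub> under_eval n y x"
        by (rule free_mod_hom_eqI[OF R BM l[OF FX.smult_closed[OF r x]] mod_hom_smult[OF BM l[OF x] r] _ y])
          (simp add: under_eval_gen x r mod_homD(3)[OF under_gen_hom r x]) }
  qed
qed (rule under_eval_hom_l)

text \<open>Precomposition with f changes the structure arrows but not the chain, and functoriality
  of F equates pushing x along the composite with pushing it along f first.\<close>

lemma under_eval_compat:
  assumes f: "f \<in> arrs C" and x: "x \<in> elts F (src C f)" and y: "y \<in> elts (NU n) (trg C f)"
  shows "under_eval n y (far F f x) = under_eval n (far (NU n) f y) x"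
proof (rule free_mod_hom_eqI[OF R bar_module[OF R C F] under_eval_hom_l mod_hom_comp[OF under_nerve_far_hom[OF f] under_eval_hom_l[OF x]] _ y[simplified]])
  show fx: "far F f x \<in> elts F (trg C f)" by (rule mod_homD(1)[OF is_kfunD(2)[OF F f] x])
  fix \<sigma> assume \<sigma>: "\<sigma> \<in> nerve (under C (trg C f)) n"
  note u = under_nerveD[OF C \<sigma>, of 0 0, simplified]
  have "nerve_map n snd (under_precomp C n f \<sigma>) = nerve_map n snd \<sigma>"
    by (rule extensionalityI[of _ "order_pairs n"]) (auto simp: nerve_map_def under_precomp_def split: prod.splits)
  moreover have "fst (under_precomp C n f \<sigma> (0, 0)) = cmp C (fst (\<sigma> (0, 0))) f"
    by (simp add: under_precomp_def split: prod.splits)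
  moreover have "far F (cmp C (fst (\<sigma> (0, 0))) f) x = far F (fst (\<sigma> (0, 0))) (far F f x)"
    using is_kfunD(4)[OF F f u(2) u(3) x] .
  ultimately show "under_eval n (fgen R \<sigma>) (far F f x) = under_eval n (far (NU n) f (fgen R \<sigma>)) x"
    by (simp add: under_nerve_far_gen f \<sigma> under_eval_gen[OF \<sigma> fx] under_eval_gen[OF under_precomp_closed[OF C \<sigma> f] x])
qed

definition coend_to_bar :: "nat \<Rightarrow> ('o \<Rightarrow> (((nat \<times> nat \<Rightarrow> 'a \<times> 'a) \<Rightarrow> 'k) \<times> 'm \<Rightarrow> 'k) set) set \<Rightarrow> 'a simplex \<Rightarrow> 'm" where
  "coend_to_bar n = coend_lift R C (NU n) F (bar_mod C F n) (\<lambda>_. under_eval n)"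

lemma coend_to_bar_hom: "coend_to_bar n \<in> mod_hom R (coend R C (NU n) F) (bar_mod C F n)"
  unfolding coend_to_bar_def
  by (rule coend_lift_hom[OF R C under_nerve_contra F bar_module[OF R C F]])
    (rule under_eval_bilinear under_eval_compat; assumption)+

lemma coend_to_bar_in:
  "\<lbrakk>X \<in> obs C; y \<in> elts (NU n) X; x \<in> elts F X\<rbrakk> \<Longrightarrow>
    coend_to_bar n (coend_in R C (NU n) F X y x) = under_eval n y x"
  unfolding coend_to_bar_def
  by (rule coend_lift_in[OF R C under_nerve_contra F bar_module[OF R C F]])
    (rule under_eval_bilinear under_eval_compat; assumption)+

lemma coend_to_bar_inverse:
  assumes z: "z \<in> carrier (bar_mod C F n)"
  shows "coend_to_bar n (bar_to_coend n z) = z"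
proof (rule bar_hom_eqI[OF R C F bar_module[OF R C F] mod_hom_comp[OF bar_to_coend_hom coend_to_bar_hom] mod_hom_id _ z])
  fix \<sigma> x assume s: "\<sigma> \<in> nerve C n" "x \<in> elts F (origin C \<sigma>)"
  have v: "origin C \<sigma> \<in> obs C" by (rule nerve_vertex[OF C s(1)]) simp
  have "far F (fst (under_lift n \<sigma> (0, 0))) x = x"
    using nerve_far_ident[OF R C F s(1) _ s(2)] by (simp add: under_lift_def)
  then show "coend_to_bar n (bar_to_coend n (bar_in C F n \<sigma> x)) = bar_in C F n \<sigma> x"
    using v s by (simp add: bar_to_coend_in coend_to_bar_in fgen_carrier[OF R under_lift_closed[OF C s(1)]]
        under_eval_gen[OF under_lift_closed[OF C s(1)]] under_snd_lift[OF C s(1)])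
qed

text \<open>A generator is a canonical lift pulled back along its first structure arrow; the coend
  relation trades this pull-back for the push-forward that \<open>under_eval\<close>
  performs.\<close>

lemma bar_to_coend_inverse:
  assumes z: "z \<in> carrier (coend R C (NU n) F)"
  shows "bar_to_coend n (coend_to_bar n z) = z"
proof (rule coend_hom_eqI[OF R C under_nerve_contra F coend_module[OF R C under_nerve_contra F]
      mod_hom_comp[OF coend_to_bar_hom bar_to_coend_hom] mod_hom_id _ z])
  fix X y x assume X: "X \<in> obs C" and y: "y \<in> elts (NU n) X" and x: "x \<in> elts F X"
  show "bar_to_coend n (coend_to_bar n (coend_in R C (NU n) F X y x)) = coend_in R C (NU n) F X y x"
    unfolding coend_to_bar_in[OF X y x]
  proof (rule free_mod_hom_eqI[OF R coend_module[OF R C under_nerve_contra F] mod_hom_comp[OF under_eval_hom_l[OF x] bar_to_coend_hom]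
        _ _ y[simplified]])
    show "(\<lambda>y. coend_in R C (NU n) F X y x) \<in> mod_hom R (free_mod R (nerve (under C X) n)) (coend R C (NU n) F)"
      using bilinear_mapD(2)[OF coend_in_bilinear[OF R C under_nerve_contra F X] x] by simp
    fix \<sigma> assume \<sigma>: "\<sigma> \<in> nerve (under C X) n"
    note u = under_nerveD[OF C \<sigma>, of 0 0, simplified] and us = under_snd_closed[OF C \<sigma>]
    have fx: "far F (fst (\<sigma> (0, 0))) x \<in> elts F (src C (nerve_map n snd \<sigma> (0, 0)))"
      unfolding us(2) using mod_homD(1)[OF is_kfunD(2)[OF F u(2)], of x] x u(3) by simp
    have ul: "under_lift n (nerve_map n snd \<sigma>) \<in> nerve (under C (trg C (fst (\<sigma> (0, 0))))) n"
      using under_lift_closed[OF C us(1)] unfolding us(2) .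
    have "bar_to_coend n (under_eval n (fgen R \<sigma>) x) =
        coend_in R C (NU n) F (trg C (fst (\<sigma> (0, 0)))) (fgen R (under_lift n (nerve_map n snd \<sigma>))) (far F (fst (\<sigma> (0, 0))) x)"
      using bar_to_coend_in[OF us(1) fx] under_eval_gen[OF \<sigma> x] unfolding us(2) by simp
    \<comment> \<open>The coend relation for the first structure arrow, read from its target back to
      X.\<close>
    also have "\<dots> = coend_in R C (NU n) F X (far (NU n) (fst (\<sigma> (0, 0))) (fgen R (under_lift n (nerve_map n snd \<sigma>)))) x"
      using coend_in_rel[OF R C under_nerve_contra F u(2), of x] x fgen_carrier[OF R ul] u(3) by simp
    also have "\<dots> = coend_in R C (NU n) F X (fgen R \<sigma>) x"
      using under_nerve_far_gen[OF u(2) ul] under_precomp_lift[OF C \<sigma>] by simp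
    finally show "bar_to_coend n (under_eval n (fgen R \<sigma>) x) = coend_in R C (NU n) F X (fgen R \<sigma>) x" .
  qed
qed

definition coend_diff :: "nat \<Rightarrow> ('o \<Rightarrow> (((nat \<times> nat \<Rightarrow> 'a \<times> 'a) \<Rightarrow> 'k) \<times> 'm \<Rightarrow> 'k) set) set \<Rightarrow>
    ('o \<Rightarrow> (((nat \<times> nat \<Rightarrow> 'a \<times> 'a) \<Rightarrow> 'k) \<times> 'm \<Rightarrow> 'k) set) set" where
  "coend_diff n z = altsum (coend R C (NU n) F) (Suc n) (\<lambda>i. coend_map R C (NU n) F (under_nerve_face R C n i) z)"

text \<open>A face of the nerve leaves the coefficient in place, whereas the bar face moves it to
  the new first vertex. The coend relation along \<open>\<sigma> (0, coface i 0)\<close> reconciles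
  the two.\<close>

lemma bar_to_coend_face:
  assumes i: "i \<le> Suc n" and z: "z \<in> carrier (bar_mod C F (Suc n))"
  shows "bar_to_coend n (bar_face C F n i z) = coend_map R C (NU n) F (under_nerve_face R C n i) (bar_to_coend (Suc n) z)"
proof (rule bar_hom_eqI[OF R C F coend_module[OF R C under_nerve_contra F] mod_hom_comp[OF bar_face_hom[OF R C F i] bar_to_coend_hom]
      mod_hom_comp[OF bar_to_coend_hom coend_face_hom[OF i]] _ z])
  fix \<sigma> x assume s: "\<sigma> \<in> nerve C (Suc n)" "x \<in> elts F (origin C \<sigma>)"
  note m = mono_map_coface[OF i] and D = nerveD[OF s(1)]
  have v: "origin C \<sigma> \<in> obs C" by (rule nerve_vertex[OF C s(1)]) simp
  have c0: "coface i 0 \<le> Suc n" by (simp add: coface_def)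
  let ?h = "\<sigma> (0, coface i 0)"
  have h: "?h \<in> arrs C" "src C ?h = origin C \<sigma>" "trg C ?h = src C (nerve_act n (coface i) \<sigma> (0, 0))"
    using D(1-3)[OF le0 c0] by simp_all
  note ac = nerve_act_closed[OF s(1) m]
  have hx: "far F ?h x \<in> elts F (src C (nerve_act n (coface i) \<sigma> (0, 0)))"
    using mod_homD(1)[OF is_kfunD(2)[OF F h(1)], of x] s(2) unfolding h by simp
  have ul: "under_lift n (nerve_act n (coface i) \<sigma>) \<in> nerve (under C (trg C ?h)) n"
    unfolding h(3) by (rule under_lift_closed[OF C ac])
  have x': "x \<in> elts F (src C ?h)" using s(2) unfolding h .
  have "bar_to_coend n (bar_face C F n i (bar_in C F (Suc n) \<sigma> x)) =
      coend_in R C (NU n) F (trg C ?h) (fgen R (under_lift n (nerve_act n (coface i) \<sigma>))) (far F ?h x)"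
    unfolding bar_act_in[OF R C F m s] bar_to_coend_in[OF ac hx] h(3) ..
  also have "\<dots> = coend_in R C (NU n) F (src C ?h) (far (NU n) ?h (fgen R (under_lift n (nerve_act n (coface i) \<sigma>)))) x"
    by (rule coend_in_rel[OF R C under_nerve_contra F h(1) x']) (simp add: fgen_carrier[OF R ul])
  also have "\<dots> = coend_in R C (NU n) F (origin C \<sigma>) (fgen R (nerve_act n (coface i) (under_lift (Suc n) \<sigma>))) x"
    unfolding under_nerve_far_gen[OF h(1) ul] under_lift_act[OF C s(1) m] h(2) ..
  also have "\<dots> = coend_map R C (NU n) F (under_nerve_face R C n i) (bar_to_coend (Suc n) (bar_in C F (Suc n) \<sigma> x))"
    unfolding bar_to_coend_in[OF s] by (rule coend_face_in[OF i v under_lift_closed[OF C s(1)] s(2), symmetric])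
  finally show "bar_to_coend n (bar_face C F n i (bar_in C F (Suc n) \<sigma> x)) =
      coend_map R C (NU n) F (under_nerve_face R C n i) (bar_to_coend (Suc n) (bar_in C F (Suc n) \<sigma> x))" .
qed

lemma bar_to_coend_diff:
  assumes z: "z \<in> carrier (bar_mod C F (Suc n))"
  shows "bar_to_coend n (bar_diff C F n z) = coend_diff n (bar_to_coend (Suc n) z)"
proof -
  note CM = coend_module[OF R C under_nerve_contra F]
  have "bar_to_coend n (bar_diff C F n z) = altsum (coend R C (NU n) F) (Suc n) (\<lambda>i. bar_to_coend n (bar_face C F n i z))"
    unfolding bar_diff_def
    by (rule altsum_hom[OF bar_module[OF R C F] CM bar_to_coend_hom mod_homD(1)[OF bar_face_hom[OF R C F] z]])
  also have "\<dots> = coend_diff n (bar_to_coend (Suc n) z)"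
    unfolding coend_diff_def
    by (rule altsum_cong[OF CM bar_to_coend_face[OF _ z] mod_homD(1)[OF coend_face_hom mod_homD(1)[OF bar_to_coend_hom z]]])
  finally show ?thesis .
qed

text \<open>That the differential squares to zero is carried over from the bar complex, since
  \<open>bar_to_coend\<close> commutes with the differentials and has a right inverse.\<close>

lemma coend_complex: "is_complex R (\<lambda>n. coend R C (NU n) F) coend_diff"
  unfolding is_complex_def
proof (intro conjI allI ballI)
  fix n
  note CM = coend_module[OF R C under_nerve_contra F]
  show "module R (coend R C (NU n) F)" by (rule CM)
  show "coend_diff n \<in> mod_hom R (coend R C (NU (Suc n)) F) (coend R C (NU n) F)"
    unfolding coend_diff_def[abs_def] by (rule altsum_map_hom[OF CM coend_face_hom CM])
  fix z assume z: "z \<in> carrier (coend R C (NU (Suc (Suc n))) F)"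
  note w = mod_homD(1)[OF coend_to_bar_hom z]
  have "coend_diff n (coend_diff (Suc n) z) = bar_to_coend n (bar_diff C F n (bar_diff C F (Suc n) (coend_to_bar (Suc (Suc n)) z)))"
    using bar_to_coend_diff[OF w] bar_to_coend_diff[OF mod_homD(1)[OF bar_diff_hom[OF R C F] w]] bar_to_coend_inverse[OF z] by simp
  then show "coend_diff n (coend_diff (Suc n) z) = \<zero>\<^bsub>coend R C (NU n) F\<^esub>"
    using is_complexD(3)[OF bar_complex[OF R C F] w] mod_hom_zero[OF bar_module[OF R C F] CM bar_to_coend_hom] by simp
qed

lemma bar_nerve_tensor_homology:
  "mod_isomorphic R (bar_homology C F n) (nerve_tensor_homology R C F n)"
proof -
  have "nerve_tensor_homology R C F = chain_homology (\<lambda>n. coend R C (NU n) F) coend_diff"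
    unfolding nerve_tensor_homology_def simplicial_homology_def coend_diff_def[abs_def] altsum_def ..
  then show ?thesis
    using homology_iso_inverse[where f = bar_to_coend and g = coend_to_bar, OF bar_complex[OF R C F] coend_complex bar_to_coend_hom coend_to_bar_hom
        bar_to_coend_diff coend_to_bar_inverse bar_to_coend_inverse] by simp
qed

end

section \<open>Left Kan extension along a unique factorization system\<close>

section \<open>Extension along a unique factorization\<close>

(* The left Kan extension from the wide subcategory with arrows A to C then has the closed form kan_ext. *)
locale unique_factorization =
  fixes C :: "('o, 'a) category" and A M :: "'a set" and fm fe :: "'a \<Rightarrow> 'a"
  assumes C: "is_category C" and E: "is_category (C\<lparr>arrs := A\<rparr>)" and AC: "A \<subseteq> arrs C" and MC: "M \<subseteq> arrs C"
    and fac: "\<And>g. g \<in> arrs C \<Longrightarrow> fm g \<in> M \<and> fe g \<in> A \<and> src C (fm g) = trg C (fe g) \<and> cmp C (fm g) (fe g) = g"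
    and fac_unique: "\<And>m e. \<lbrakk>m \<in> M; e \<in> A; src C m = trg C e\<rbrakk> \<Longrightarrow> fm (cmp C m e) = m \<and> fe (cmp C m e) = e"
    and ident_M: "\<And>X. X \<in> obs C \<Longrightarrow> ident C X \<in> M"
begin

abbreviation "Esub \<equiv> C\<lparr>arrs := A\<rparr>"

definition over :: "'o \<Rightarrow> 'a set" where
  "over Y = {m \<in> M. trg C m = Y}"

definition kan_in :: "('o, 'a, 'k, 'm) kfun \<Rightarrow> 'o \<Rightarrow> 'a \<Rightarrow> 'm \<Rightarrow> 'a \<Rightarrow> 'm" where
  "kan_in F Y = dsum_in (over Y) (\<lambda>m. fob F (src C m))"

text \<open>The left Kan extension at Y is a colimit over the arrows h : X -> Y, with arrows of A as
  morphisms between them. Such morphisms preserve the M-part, and the arrows with M-part m form a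
  component with terminal object m, the A-part being the only morphism to it. So there is one
  summand F (src m) for every m over Y, and g acts by factoring the composite g m again.\<close>

definition kan_ext :: "('o, 'a, 'k, 'm) kfun \<Rightarrow> ('o, 'a, 'k, 'a \<Rightarrow> 'm) kfun" where
  "kan_ext F =
     \<lparr>fob = (\<lambda>Y. dsum (over Y) (\<lambda>m. fob F (src C m))),
      far = (\<lambda>g. dsum_lift (over (src C g)) (\<lambda>m. fob F (src C m)) (dsum (over (trg C g)) (\<lambda>m. fob F (src C m)))
        (\<lambda>m x. kan_in F (trg C g) (fm (cmp C g m)) (far F (fe (cmp C g m)) x)))\<rparr>"

definition kan_lift ::
  "('o, 'a, 'k, 'm) kfun \<Rightarrow> 'o \<Rightarrow> ('k, 'n) module \<Rightarrow> ('a \<Rightarrow> 'm \<Rightarrow> 'n) \<Rightarrow> ('a \<Rightarrow> 'm) \<Rightarrow> 'n" where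
  "kan_lift F Y = dsum_lift (over Y) (\<lambda>m. fob F (src C m))"

definition kan_map :: "('o \<Rightarrow> 'm \<Rightarrow> 'n) \<Rightarrow> 'o \<Rightarrow> ('a \<Rightarrow> 'm) \<Rightarrow> 'a \<Rightarrow> 'n" where
  "kan_map \<eta> Y = dsum_map (over Y) (\<lambda>m. \<eta> (src C m))"

lemma over_iff: "m \<in> over Y \<longleftrightarrow> m \<in> M \<and> trg C m = Y" by (simp add: over_def)

lemma overD: "m \<in> over Y \<Longrightarrow> m \<in> arrs C" "m \<in> over Y \<Longrightarrow> m \<in> M" "m \<in> over Y \<Longrightarrow> trg C m = Y"
  "m \<in> over Y \<Longrightarrow> src C m \<in> obs C"
  using MC is_categoryD(1)[OF C] by (auto simp: over_iff)

lemma fac_ends: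
  assumes "g \<in> arrs C"
  shows "fm g \<in> arrs C" "fe g \<in> arrs C" "src C (fe g) = src C g" "trg C (fm g) = trg C g"
proof -
  have f: "fm g \<in> M" "fe g \<in> A" "src C (fm g) = trg C (fe g)" "cmp C (fm g) (fe g) = g" using fac[OF assms] by auto
  show c: "fm g \<in> arrs C" "fe g \<in> arrs C" using f MC AC by auto
  show "src C (fe g) = src C g" "trg C (fm g) = trg C g"
    using is_categoryD(7,8)[OF C c(2,1) f(3)] unfolding f(4) by simp_all
qed

text \<open>m is m after an identity, and identities lie in A because the arrows A form a category
  on all objects.\<close>

lemma fac_M:
  assumes "m \<in> M"
  shows "fm m = m" "fe m = ident C (src C m)"
proof -
  have m: "m \<in> arrs C" using assms MC by auto
  have o: "src C m \<in> obs C" by (rule is_categoryD(1)[OF C m])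
  have i: "ident C (src C m) \<in> A" using is_categoryD(3)[OF E, of "src C m"] o by simp
  have "fm (cmp C m (ident C (src C m))) = m \<and> fe (cmp C m (ident C (src C m))) = ident C (src C m)"
    by (rule fac_unique[OF assms i]) (simp add: is_categoryD(5)[OF C o])
  then show "fm m = m" "fe m = ident C (src C m)" unfolding is_categoryD(9)[OF C m] by auto
qed

lemma fac_over:
  assumes "g \<in> arrs C" "m \<in> over (src C g)"
  shows "cmp C g m \<in> arrs C" "fm (cmp C g m) \<in> over (trg C g)" "fe (cmp C g m) \<in> A" "src C (fe (cmp C g m)) = src C m"
    "src C (fm (cmp C g m)) = trg C (fe (cmp C g m))" "cmp C (fm (cmp C g m)) (fe (cmp C g m)) = cmp C g m"
proof -
  note m = overD[OF assms(2)]
  note g = is_categoryD(6-8)[OF C m(1) assms(1) m(3)[symmetric]]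
  show "cmp C g m \<in> arrs C" by (rule g(1))
  show "fm (cmp C g m) \<in> over (trg C g)" "fe (cmp C g m) \<in> A" "src C (fe (cmp C g m)) = src C m"
    "src C (fm (cmp C g m)) = trg C (fe (cmp C g m))" "cmp C (fm (cmp C g m)) (fe (cmp C g m)) = cmp C g m"
    using fac[OF g(1)] fac_ends[OF g(1)] g(2,3) by (simp_all add: over_iff)
qed

text \<open>Factoring g m, then h after its M-part, and collecting the A-parts gives a factorization
  of h g m; by uniqueness it is the chosen one. This is the functoriality of the extension.\<close>

lemma fac_comp:
  assumes g: "g \<in> arrs C" and h: "h \<in> arrs C" and gh: "src C h = trg C g" and m: "m \<in> over (src C g)"
  shows "fm (cmp C (cmp C h g) m) = fm (cmp C h (fm (cmp C g m)))"
    "fe (cmp C (cmp C h g) m) = cmp C (fe (cmp C h (fm (cmp C g m)))) (fe (cmp C g m))"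
proof -
  let ?m = "fm (cmp C g m)" and ?e = "fe (cmp C g m)"
  note a = fac_over[OF g m] and c = is_categoryD[OF C]
  have m': "?m \<in> over (src C h)" using a(2) gh by simp
  note b = fac_over[OF h m']
  let ?m' = "fm (cmp C h ?m)" and ?e' = "fe (cmp C h ?m)"
  have e: "?e \<in> arrs C" "?e' \<in> arrs C" using a(3) b(3) AC by auto
  have "cmp C (cmp C h g) m = cmp C h (cmp C g m)"
    using c(11)[OF overD(1)[OF m] g h _ gh] overD(3)[OF m] by simp
  also have "\<dots> = cmp C h (cmp C ?m ?e)" unfolding a(6) ..
  also have "\<dots> = cmp C (cmp C h ?m) ?e"
    by (rule c(11)[OF e(1) overD(1)[OF m'] h a(5)]) (simp add: overD(3)[OF m'])
  also have "\<dots> = cmp C (cmp C ?m' ?e') ?e" unfolding b(6) ..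
  also have "\<dots> = cmp C ?m' (cmp C ?e' ?e)"
    by (rule c(11)[OF e overD(1)[OF b(2)] _ b(5), symmetric]) (simp add: b(4) a(5))
  finally have eq: "cmp C (cmp C h g) m = cmp C ?m' (cmp C ?e' ?e)" .
  have "cmp C ?e' ?e \<in> A" "trg C (cmp C ?e' ?e) = trg C ?e'"
    using is_categoryD(6,8)[OF E, of ?e ?e'] a(3,5) b(3,4) by simp_all
  then show "fm (cmp C (cmp C h g) m) = ?m'" "fe (cmp C (cmp C h g) m) = cmp C ?e' ?e"
    unfolding eq using fac_unique[OF overD(2)[OF b(2)]] b(5) by auto
qed

context
  fixes R :: "('k, 'r) ring_scheme" and F :: "('o, 'a, 'k, 'm) kfun"
  assumes R: "cring R" and F: "is_kfun R Esub F"
begin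

lemma F_module: "X \<in> obs C \<Longrightarrow> module R (fob F X)" using is_kfunD(1)[OF F] by simp

lemma F_far: "e \<in> A \<Longrightarrow> far F e \<in> mod_hom R (fob F (src C e)) (fob F (trg C e))" using is_kfunD(2)[OF F] by simp

lemma over_module: "m \<in> over Y \<Longrightarrow> module R (fob F (src C m))" by (rule F_module[OF overD(4)])

lemma kan_fob: "fob (kan_ext F) Y = dsum (over Y) (\<lambda>m. fob F (src C m))" by (simp add: kan_ext_def)

lemma kan_module: "module R (fob (kan_ext F) Y)"
  unfolding kan_fob by (rule dsum_module[OF R over_module])

lemma kan_in_hom: "m \<in> over Y \<Longrightarrow> kan_in F Y m \<in> mod_hom R (fob F (src C m)) (fob (kan_ext F) Y)"
  unfolding kan_fob kan_in_def by (rule dsum_in_hom[OF R over_module])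

lemmas kan_in_closed = mod_homD(1)[OF kan_in_hom]

lemma kan_hom_eqI:
  assumes "module R N" "h \<in> mod_hom R (fob (kan_ext F) Y) N" "h' \<in> mod_hom R (fob (kan_ext F) Y) N"
    and "\<And>m x. \<lbrakk>m \<in> over Y; x \<in> elts F (src C m)\<rbrakk> \<Longrightarrow> h (kan_in F Y m x) = h' (kan_in F Y m x)"
    and "z \<in> elts (kan_ext F) Y"
  shows "h z = h' z"
  by (rule dsum_hom_eqI[where I = "over Y" and M = "\<lambda>m. fob F (src C m)" and R = R and N = N])
    (use R over_module assms in \<open>simp_all add: kan_fob kan_in_def\<close>)

lemma kan_lift_hom:
  "\<lbrakk>module R N; \<And>m. m \<in> over Y \<Longrightarrow> h m \<in> mod_hom R (fob F (src C m)) N\<rbrakk> \<Longrightarrow> kan_lift F Y N h \<in> mod_hom R (fob (kan_ext F) Y) N"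
  unfolding kan_fob kan_lift_def by (rule dsum_lift_hom[OF R over_module])

lemma kan_lift_in:
  "\<lbrakk>module R N; \<And>m. m \<in> over Y \<Longrightarrow> h m \<in> mod_hom R (fob F (src C m)) N; m \<in> over Y; x \<in> elts F (src C m)\<rbrakk> \<Longrightarrow>
    kan_lift F Y N h (kan_in F Y m x) = h m x"
  unfolding kan_in_def kan_lift_def by (rule dsum_lift_in[OF R over_module])

lemma kan_far: "far (kan_ext F) g =
    kan_lift F (src C g) (fob (kan_ext F) (trg C g)) (\<lambda>m x. kan_in F (trg C g) (fm (cmp C g m)) (far F (fe (cmp C g m)) x))"
  by (simp add: kan_ext_def kan_lift_def)

lemma kan_far_aux:
  assumes g: "g \<in> arrs C" and m: "m \<in> over (src C g)"
  shows "(\<lambda>x. kan_in F (trg C g) (fm (cmp C g m)) (far F (fe (cmp C g m)) x)) \<in> mod_hom R (fob F (src C m)) (fob (kan_ext F) (trg C g))"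
proof (rule mod_hom_comp)
  note a = fac_over[OF g m]
  show "far F (fe (cmp C g m)) \<in> mod_hom R (fob F (src C m)) (fob F (src C (fm (cmp C g m))))"
    using F_far[OF a(3)] unfolding a(4,5) .
  show "kan_in F (trg C g) (fm (cmp C g m)) \<in> mod_hom R (fob F (src C (fm (cmp C g m)))) (fob (kan_ext F) (trg C g))"
    by (rule kan_in_hom[OF a(2)])
qed

lemma kan_far_hom: "g \<in> arrs C \<Longrightarrow> far (kan_ext F) g \<in> mod_hom R (fob (kan_ext F) (src C g)) (fob (kan_ext F) (trg C g))"
  unfolding kan_far by (rule kan_lift_hom[OF kan_module kan_far_aux])

lemma kan_far_in:
  "\<lbrakk>g \<in> arrs C; m \<in> over (src C g); x \<in> elts F (src C m)\<rbrakk> \<Longrightarrow>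
    far (kan_ext F) g (kan_in F (src C g) m x) = kan_in F (trg C g) (fm (cmp C g m)) (far F (fe (cmp C g m)) x)"
  unfolding kan_far by (rule kan_lift_in[OF kan_module kan_far_aux])

lemma kan_kfun: "is_kfun R C (kan_ext F)"
  unfolding is_kfun_def
proof (intro conjI ballI impI)
  fix X show "module R (fob (kan_ext F) X)" by (rule kan_module)
next
  fix g assume "g \<in> arrs C"
  then show "far (kan_ext F) g \<in> mod_hom R (fob (kan_ext F) (src C g)) (fob (kan_ext F) (trg C g))" by (rule kan_far_hom)
next
  fix X z assume X: "X \<in> obs C" and z: "z \<in> elts (kan_ext F) X"
  note i = is_categoryD(3-5)[OF C X]
  show "far (kan_ext F) (ident C X) z = z"
  proof (rule kan_hom_eqI[OF kan_module _ mod_hom_id _ z])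
    show "far (kan_ext F) (ident C X) \<in> mod_hom R (fob (kan_ext F) X) (fob (kan_ext F) X)"
      using kan_far_hom[OF i(1)] unfolding i(2,3) .
    fix m x assume m: "m \<in> over X" and x: "x \<in> elts F (src C m)"
    have im: "cmp C (ident C X) m = m" using is_categoryD(10)[OF C overD(1)[OF m]] overD(3)[OF m] by simp
    have "far (kan_ext F) (ident C X) (kan_in F X m x) = kan_in F X (fm m) (far F (fe m) x)"
      using kan_far_in[OF i(1) _ x] m unfolding i(2,3) im by simp
    then show "far (kan_ext F) (ident C X) (kan_in F X m x) = kan_in F X m x"
      unfolding fac_M[OF overD(2)[OF m]] using is_kfunD(3)[OF F _ x] overD(4)[OF m] by simp
  qed
next
  fix g h z assume g: "g \<in> arrs C" and h: "h \<in> arrs C" and gh: "src C h = trg C g"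
    and z: "z \<in> elts (kan_ext F) (src C g)"
  note hg = is_categoryD(6-8)[OF C g h gh]
  show "far (kan_ext F) (cmp C h g) z = far (kan_ext F) h (far (kan_ext F) g z)"
  proof (rule kan_hom_eqI[OF kan_module _ mod_hom_comp[OF kan_far_hom[OF g]] _ z])
    show "far (kan_ext F) (cmp C h g) \<in> mod_hom R (fob (kan_ext F) (src C g)) (fob (kan_ext F) (trg C h))"
      using kan_far_hom[OF hg(1)] unfolding hg(2,3) .
    show "far (kan_ext F) h \<in> mod_hom R (fob (kan_ext F) (trg C g)) (fob (kan_ext F) (trg C h))"
      using kan_far_hom[OF h] unfolding gh .
    fix m x assume m: "m \<in> over (src C g)" and x: "x \<in> elts F (src C m)"
    note a = fac_over[OF g m]
    have m': "fm (cmp C g m) \<in> over (src C h)" using a(2) gh by simp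
    note b = fac_over[OF h m']
    have y: "far F (fe (cmp C g m)) x \<in> elts F (src C (fm (cmp C g m)))"
      using mod_homD(1)[OF F_far[OF a(3)], of x] x unfolding a(4,5) .
    have "far (kan_ext F) (cmp C h g) (kan_in F (src C g) m x) =
        kan_in F (trg C h) (fm (cmp C (cmp C h g) m)) (far F (fe (cmp C (cmp C h g) m)) x)"
      using kan_far_in[OF hg(1) _ x] m unfolding hg(2,3) by blast
    also have "\<dots> = kan_in F (trg C h) (fm (cmp C h (fm (cmp C g m)))) (far F (fe (cmp C h (fm (cmp C g m)))) (far F (fe (cmp C g m)) x))"
      unfolding fac_comp[OF g h gh m]
      using is_kfunD(4)[OF F, of "fe (cmp C g m)" "fe (cmp C h (fm (cmp C g m)))" x] a(3-5) b(3,4) x by simp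
    also have "\<dots> = far (kan_ext F) h (kan_in F (src C h) (fm (cmp C g m)) (far F (fe (cmp C g m)) x))"
      by (rule kan_far_in[OF h m' y, symmetric])
    also have "\<dots> = far (kan_ext F) h (far (kan_ext F) g (kan_in F (src C g) m x))"
      unfolding kan_far_in[OF g m x] gh ..
    finally show "far (kan_ext F) (cmp C h g) (kan_in F (src C g) m x) = far (kan_ext F) h (far (kan_ext F) g (kan_in F (src C g) m x))" .
  qed
qed

lemma ident_over: "X \<in> obs C \<Longrightarrow> ident C X \<in> over X"
  by (simp add: over_iff ident_M is_categoryD(5)[OF C])

lemma ident_over_src: "X \<in> obs C \<Longrightarrow> x \<in> elts F X \<Longrightarrow> x \<in> elts F (src C (ident C X))"
  by (simp add: is_categoryD(4)[OF C])

text \<open>Every summand is reached from an identity summand: m carries the copy of F at its source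
  into the summand m. Calculations in the extension are reduced to identity summands in this
  way.\<close>

lemma kan_far_ident:
  assumes m: "m \<in> M" and e: "e \<in> A" and me: "src C m = trg C e" and x: "x \<in> elts F (src C e)"
  shows "far (kan_ext F) (cmp C m e) (kan_in F (src C e) (ident C (src C e)) x) = kan_in F (trg C m) m (far F e x)"
proof -
  have c: "m \<in> arrs C" "e \<in> arrs C" using m e MC AC by auto
  note o = is_categoryD(1)[OF C c(2)] and g = is_categoryD(6-8)[OF C c(2,1) me]
  have "cmp C (cmp C m e) (ident C (src C e)) = cmp C m e" using is_categoryD(9)[OF C g(1)] unfolding g(2) .
  then show ?thesis
    using kan_far_in[OF g(1), of "ident C (src C e)" x] ident_over[OF o] ident_over_src[OF o x] fac_unique[OF m e me]
    unfolding g(2,3) by simp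
qed

end

lemma kan_map_hom:
  assumes R: "cring R" and F: "is_kfun R Esub F" and G: "is_kfun R Esub G" and \<eta>: "is_nat_trans R Esub F G \<eta>"
  shows "kan_map \<eta> Y \<in> mod_hom R (fob (kan_ext F) Y) (fob (kan_ext G) Y)"
  unfolding kan_fob[OF R F] kan_fob[OF R G] kan_map_def
  by (rule dsum_map_hom[OF R over_module[OF R F] over_module[OF R G]]) (use is_nat_transD(1)[OF \<eta>] overD(4) in auto)

lemma kan_map_in:
  assumes R: "cring R" and F: "is_kfun R Esub F" and G: "is_kfun R Esub G" and \<eta>: "is_nat_trans R Esub F G \<eta>"
    and m: "m \<in> over Y" "x \<in> elts F (src C m)"
  shows "kan_map \<eta> Y (kan_in F Y m x) = kan_in G Y m (\<eta> (src C m) x)"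
  unfolding kan_map_def kan_in_def
  by (rule dsum_map_in[where h = "\<lambda>m. \<eta> (src C m)" and M = "\<lambda>m. fob F (src C m)" and N = "\<lambda>m. fob G (src C m)" and R = R])
    (use R over_module[OF R F] over_module[OF R G] is_nat_transD(1)[OF \<eta>] overD(4) m in auto)

lemma kan_map_nat:
  assumes R: "cring R" and F: "is_kfun R Esub F" and G: "is_kfun R Esub G" and \<eta>: "is_nat_trans R Esub F G \<eta>"
  shows "is_nat_trans R C (kan_ext F) (kan_ext G) (kan_map \<eta>)"
  unfolding is_nat_trans_def
proof (intro conjI ballI)
  fix X show "kan_map \<eta> X \<in> mod_hom R (fob (kan_ext F) X) (fob (kan_ext G) X)" by (rule kan_map_hom[OF assms])
next
  fix g z assume g: "g \<in> arrs C" and z: "z \<in> elts (kan_ext F) (src C g)"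
  show "kan_map \<eta> (trg C g) (far (kan_ext F) g z) = far (kan_ext G) g (kan_map \<eta> (src C g) z)"
  proof (rule kan_hom_eqI[OF R F kan_module[OF R G] mod_hom_comp[OF kan_far_hom[OF R F g] kan_map_hom[OF assms]]
        mod_hom_comp[OF kan_map_hom[OF assms] kan_far_hom[OF R G g]] _ z])
    fix m x assume m: "m \<in> over (src C g)" and x: "x \<in> elts F (src C m)"
    note a = fac_over[OF g m]
    have y: "far F (fe (cmp C g m)) x \<in> elts F (src C (fm (cmp C g m)))"
      using mod_homD(1)[OF F_far[OF R F a(3)], of x] x unfolding a(4,5) .
    have "\<eta> (src C (fm (cmp C g m))) (far F (fe (cmp C g m)) x) = far G (fe (cmp C g m)) (\<eta> (src C m) x)"
      using is_nat_transD(2)[OF \<eta>, of "fe (cmp C g m)" x] a(3-5) x by simp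
    moreover have "\<eta> (src C m) x \<in> elts G (src C m)"
      using mod_homD(1)[OF is_nat_transD(1)[OF \<eta>] x] overD(4)[OF m] by simp
    ultimately show "kan_map \<eta> (trg C g) (far (kan_ext F) g (kan_in F (src C g) m x)) =
        far (kan_ext G) g (kan_map \<eta> (src C g) (kan_in F (src C g) m x))"
      using kan_far_in[OF R F g m x] kan_map_in[OF assms a(2) y] kan_map_in[OF assms m x] kan_far_in[OF R G g m] by simp
  qed
qed

text \<open>Values of the extension are direct sums of values of F, so exactness at every object
  passes to the extension.\<close>

lemma kan_map_exact:
  assumes R: "cring R" and F: "is_kfun R Esub F" and G: "is_kfun R Esub G" and \<eta>: "is_nat_trans R Esub F G \<eta>"
    and ex: "\<And>X x. \<lbrakk>X \<in> obs C; x \<in> elts G X; Q X x\<rbrakk> \<Longrightarrow> \<exists>y\<in>elts F X. \<eta> X y = x"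
    and z: "z \<in> elts (kan_ext G) Y" "\<And>m. m \<in> over Y \<Longrightarrow> Q (src C m) (z m)"
  shows "\<exists>y\<in>elts (kan_ext F) Y. kan_map \<eta> Y y = z"
  unfolding kan_fob[OF R F] kan_map_def
proof (rule dsum_map_kernel[where Q = "\<lambda>m. Q (src C m)" and M = "\<lambda>m. fob G (src C m)" and R = R])
  show "\<And>m. m \<in> over Y \<Longrightarrow> \<eta> (src C m) \<in> mod_hom R (fob F (src C m)) (fob G (src C m))"
    using is_nat_transD(1)[OF \<eta>] overD(4) by simp
  show "\<And>m x. \<lbrakk>m \<in> over Y; x \<in> elts G (src C m); Q (src C m) x\<rbrakk> \<Longrightarrow> \<exists>y\<in>elts F (src C m). \<eta> (src C m) y = x"
    by (rule ex[OF overD(4)])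
  show "z \<in> carrier (dsum (over Y) (\<lambda>m. fob G (src C m)))" using z(1) unfolding kan_fob[OF R G] .
qed (use R z(2) over_module[OF R F] over_module[OF R G] in auto)

lemma kan_map_zeroD:
  assumes "cring R" "is_kfun R Esub G" "kan_map \<eta> Y z = \<zero>\<^bsub>fob (kan_ext G) Y\<^esub>" "m \<in> over Y"
  shows "\<eta> (src C m) (z m) = \<zero>\<^bsub>fob G (src C m)\<^esub>"
proof -
  have "kan_map \<eta> Y z m = \<zero>\<^bsub>fob (kan_ext G) Y\<^esub> m" using assms(3) by simp
  then show ?thesis
    using assms(4) unfolding kan_map_def kan_fob[OF assms(1,2)] by (simp add: dsum_map_def) (simp add: dsum_def)
qed

lemma kan_map_comp_zero:
  assumes R: "cring R" and F: "is_kfun R Esub F" and G: "is_kfun R Esub G" and H: "is_kfun R Esub H"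
    and \<eta>: "is_nat_trans R Esub F G \<eta>" and \<zeta>: "is_nat_trans R Esub G H \<zeta>"
    and z: "\<And>X x. \<lbrakk>X \<in> obs C; x \<in> elts F X\<rbrakk> \<Longrightarrow> \<zeta> X (\<eta> X x) = \<zero>\<^bsub>fob H X\<^esub>"
    and x: "x \<in> elts (kan_ext F) Y"
  shows "kan_map \<zeta> Y (kan_map \<eta> Y x) = \<zero>\<^bsub>fob (kan_ext H) Y\<^esub>"
proof (rule kan_hom_eqI[OF R F kan_module[OF R H] mod_hom_comp[OF kan_map_hom[OF R F G \<eta>] kan_map_hom[OF R G H \<zeta>]]
      mod_hom_zero_map[OF kan_module[OF R H]] _ x])
  fix m x assume m: "m \<in> over Y" "x \<in> elts F (src C m)"
  have v: "src C m \<in> obs C" by (rule overD(4)[OF m(1)])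
  have y: "\<eta> (src C m) x \<in> elts G (src C m)" using mod_homD(1)[OF is_nat_transD(1)[OF \<eta>] m(2)] v by simp
  show "kan_map \<zeta> Y (kan_map \<eta> Y (kan_in F Y m x)) = \<zero>\<^bsub>fob (kan_ext H) Y\<^esub>"
    using kan_map_in[OF R F G \<eta> m] kan_map_in[OF R G H \<zeta> m(1) y] z[OF v m(2)]
      mod_hom_zero[OF over_module[OF R H m(1)] kan_module[OF R H] kan_in_hom[OF R H m(1)]] by simp
qed

section \<open>The extension preserves retracts of free functors\<close>

subsection \<open>Extensions of retracts of free functors\<close>

context
  fixes R :: "('k, 'r) ring_scheme" and P :: "('o, 'a, 'k, 'm) kfun" and \<rho>
  assumes R: "cring R" and P: "is_kfun R Esub P"
    and \<rho>: "is_nat_trans R Esub P (cover_fun R Esub (elts P) (\<lambda>p. p)) \<rho>"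
    and sect: "\<And>X x. \<lbrakk>X \<in> obs C; x \<in> elts P X\<rbrakk> \<Longrightarrow>
      cover_map R Esub (elts P) (\<lambda>p. p) P (\<lambda>_ s. s) X (\<rho> X x) = x"
begin

abbreviation (input) "Egens \<equiv> cover_gens Esub (elts P) (\<lambda>p. p)"
abbreviation (input) "Cgens \<equiv> cover_gens C (elts (kan_ext P)) (\<lambda>p. p)"
abbreviation (input) "Cfree \<equiv> cover_fun R C (elts (kan_ext P)) (\<lambda>p. p)"

lemma Egens_iff: "(f, s) \<in> Egens Y \<longleftrightarrow> f \<in> A \<and> s \<in> elts P (src C f) \<and> trg C f = Y"
  by (auto simp: cover_gens_def cover_pairs_def)

lemma Cgens_iff: "(f, s) \<in> Cgens Y \<longleftrightarrow> f \<in> arrs C \<and> s \<in> elts (kan_ext P) (src C f) \<and> trg C f = Y"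
  by (auto simp: cover_gens_def cover_pairs_def)

lemma inj_E: "inj_on (\<lambda>p. p) (cover_pairs Esub (elts P))"
  and inj_C: "inj_on (\<lambda>p. p) (cover_pairs C (elts (kan_ext P)))" by simp_all

lemma Cfree_fob: "fob Cfree Y = free_mod R (Cgens Y)" by (simp add: cover_fun_def)

text \<open>An extended free functor is free on the old generators, placed in identity summands. A
  generator (f, s) occurring in the summand m therefore corresponds to the composite arrow m f with
  s in the identity summand at the source of f.\<close>

definition push :: "'o \<Rightarrow> 'a \<Rightarrow> ('a \<times> 'm \<Rightarrow> 'k) \<Rightarrow> ('a \<times> ('a \<Rightarrow> 'm) \<Rightarrow> 'k)" where
  "push Y m = lin_ext R (free_mod R (Cgens Y)) (\<lambda>(f, s). fgen R (cmp C m f, kan_in P (src C f) (ident C (src C f)) s))"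

lemma push_gen_closed:
  assumes m: "m \<in> over Y" and f: "(f, s) \<in> Egens (src C m)"
  shows "(cmp C m f, kan_in P (src C f) (ident C (src C f)) s) \<in> Cgens Y"
proof -
  have f': "f \<in> A" "f \<in> arrs C" "s \<in> elts P (src C f)" "trg C f = src C m" using f AC by (auto simp: Egens_iff)
  note o = is_categoryD(1)[OF C f'(2)]
  have "kan_in P (src C f) (ident C (src C f)) s \<in> elts (kan_ext P) (src C f)"
    by (rule kan_in_closed[OF R P ident_over[OF R P o] ident_over_src[OF R P o f'(3)]])
  then show ?thesis
    unfolding Cgens_iff using is_categoryD(6-8)[OF C f'(2) overD(1)[OF m] f'(4)[symmetric]] overD(3)[OF m] by simp
qed

lemma push_aux:
  "m \<in> over Y \<Longrightarrow> (\<lambda>(f, s). fgen R (cmp C m f, kan_in P (src C f) (ident C (src C f)) s)) \<in> Egens (src C m) \<rightarrow> carrier (free_mod R (Cgens Y))"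
  using fgen_carrier[OF R push_gen_closed] by auto

lemma push_hom: "m \<in> over Y \<Longrightarrow> push Y m \<in> mod_hom R (free_mod R (Egens (src C m))) (free_mod R (Cgens Y))"
  unfolding push_def by (rule lin_ext_hom[OF free_mod_module[OF R] push_aux])

lemma push_gen:
  "\<lbrakk>m \<in> over Y; (f, s) \<in> Egens (src C m)\<rbrakk> \<Longrightarrow>
    push Y m (fgen R (f, s)) = fgen R (cmp C m f, kan_in P (src C f) (ident C (src C f)) s)"
  unfolding push_def using lin_ext_fgen[OF free_mod_module[OF R] push_aux] by fastforce

lemma rho_hom': "m \<in> over Y \<Longrightarrow> \<rho> (src C m) \<in> mod_hom R (fob P (src C m)) (free_mod R (Egens (src C m)))"
  using is_nat_transD(1)[OF \<rho>, of "src C m"] overD(4) by (simp add: cover_fun_def)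

definition kan_section :: "'o \<Rightarrow> ('a \<Rightarrow> 'm) \<Rightarrow> ('a \<times> ('a \<Rightarrow> 'm) \<Rightarrow> 'k)" where
  "kan_section Y = kan_lift P Y (free_mod R (Cgens Y)) (\<lambda>m x. push Y m (\<rho> (src C m) x))"

lemma kan_section_aux: "m \<in> over Y \<Longrightarrow> (\<lambda>x. push Y m (\<rho> (src C m) x)) \<in> mod_hom R (fob P (src C m)) (free_mod R (Cgens Y))"
  by (rule mod_hom_comp[OF rho_hom' push_hom])

lemma kan_section_hom: "kan_section Y \<in> mod_hom R (fob (kan_ext P) Y) (free_mod R (Cgens Y))"
  unfolding kan_section_def by (rule kan_lift_hom[OF R P free_mod_module[OF R] kan_section_aux])

lemma kan_section_in:
  "\<lbrakk>m \<in> over Y; x \<in> elts P (src C m)\<rbrakk> \<Longrightarrow> kan_section Y (kan_in P Y m x) = push Y m (\<rho> (src C m) x)"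
  unfolding kan_section_def by (rule kan_lift_in[OF R P free_mod_module[OF R] kan_section_aux])

text \<open>Both sides carry the composite g m f: by associativity g (m f) equals the M-part of g m
  after its A-part composed with f. With naturality of \<rho>, this makes \<open>kan_section\<close>
  natural.\<close>

lemma push_far:
  assumes g: "g \<in> arrs C" and m: "m \<in> over (src C g)" and u: "u \<in> carrier (free_mod R (Egens (src C m)))"
  shows "far Cfree g (push (src C g) m u) = push (trg C g) (fm (cmp C g m))
    (far (cover_fun R Esub (elts P) (\<lambda>p. p)) (fe (cmp C g m)) u)"
proof (rule free_mod_hom_eqI[OF R free_mod_module[OF R] mod_hom_comp[OF push_hom[OF m] cover_far_hom[OF R C inj_C g]] _ _ u])
  note a = fac_over[OF g m] and c = is_categoryD[OF C]
  let ?m = "fm (cmp C g m)" and ?e = "fe (cmp C g m)"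
  have e: "?e \<in> arrs Esub" "?e \<in> arrs C" using a(3) AC by auto
  have "far (cover_fun R Esub (elts P) (\<lambda>p. p)) ?e \<in> mod_hom R (free_mod R (Egens (src C m))) (free_mod R (Egens (src C ?m)))"
    using cover_far_hom[OF R E inj_E e(1)] a(4,5) by simp
  from mod_hom_comp[OF this push_hom[OF a(2)]]
  show "(\<lambda>u. push (trg C g) ?m (far (cover_fun R Esub (elts P) (\<lambda>p. p)) ?e u))
      \<in> mod_hom R (free_mod R (Egens (src C m))) (free_mod R (Cgens (trg C g)))" .
  fix b assume "b \<in> Egens (src C m)"
  then obtain f s where b: "b = (f, s)" "(f, s) \<in> Egens (src C m)" by (cases b) auto
  then have f: "f \<in> A" "f \<in> arrs C" "s \<in> elts P (src C f)" "trg C f = src C m" using AC by (auto simp: Egens_iff)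
  have ef: "cmp C ?e f \<in> A" "src C (cmp C ?e f) = src C f" "trg C (cmp C ?e f) = trg C ?e"
    using is_categoryD(6-8)[OF E, of f ?e] f a(3,4) by simp_all
  have g1: "(cmp C ?e f, s) \<in> Egens (src C ?m)" using ef f a(5) by (simp add: Egens_iff)
  have g2: "(cmp C m f, kan_in P (src C f) (ident C (src C f)) s) \<in> Cgens (src C g)" by (rule push_gen_closed[OF m b(2)])
  have "cmp C ?m (cmp C ?e f) = cmp C (cmp C ?m ?e) f"
    by (rule c(11)[OF f(2) e(2) overD(1)[OF a(2)]]) (use a(4,5) f(4) in auto)
  also have "\<dots> = cmp C (cmp C g m) f" unfolding a(6) ..
  also have "\<dots> = cmp C g (cmp C m f)"
    by (rule c(11)[OF f(2) overD(1)[OF m] g, symmetric]) (use overD(3)[OF m] f(4) in auto)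
  finally have eq: "cmp C ?m (cmp C ?e f) = cmp C g (cmp C m f)" .
  have "far Cfree g (push (src C g) m (fgen R b)) = fgen R (cmp C g (cmp C m f), kan_in P (src C f) (ident C (src C f)) s)"
    unfolding b(1) push_gen[OF m b(2)]
    using cover_far_gen[OF R C inj_C g] g2 unfolding Cgens_iff by blast
  also have "\<dots> = push (trg C g) ?m (fgen R (cmp C ?e f, s))"
    unfolding push_gen[OF a(2) g1] eq ef(2) ..
  also have "fgen R (cmp C ?e f, s) = far (cover_fun R Esub (elts P) (\<lambda>p. p)) ?e (fgen R b)"
    unfolding b(1) using cover_far_gen[OF R E inj_E e(1), of f s] f a(4) by simp
  finally show "far Cfree g (push (src C g) m (fgen R b)) =
      push (trg C g) ?m (far (cover_fun R Esub (elts P) (\<lambda>p. p)) ?e (fgen R b))" .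
qed

lemma kan_section_nat: "is_nat_trans R C (kan_ext P) Cfree kan_section"
  unfolding is_nat_trans_def
proof (intro conjI ballI)
  fix X show "kan_section X \<in> mod_hom R (fob (kan_ext P) X) (fob Cfree X)" unfolding Cfree_fob by (rule kan_section_hom)
next
  fix g z assume g: "g \<in> arrs C" and z: "z \<in> elts (kan_ext P) (src C g)"
  show "kan_section (trg C g) (far (kan_ext P) g z) = far Cfree g (kan_section (src C g) z)"
  proof (rule kan_hom_eqI[OF R P free_mod_module[OF R] mod_hom_comp[OF kan_far_hom[OF R P g] kan_section_hom]
        mod_hom_comp[OF kan_section_hom cover_far_hom[OF R C inj_C g]] _ z])
    fix m x assume m: "m \<in> over (src C g)" and x: "x \<in> elts P (src C m)"
    note a = fac_over[OF g m]
    have y: "far P (fe (cmp C g m)) x \<in> elts P (src C (fm (cmp C g m)))"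
      using mod_homD(1)[OF F_far[OF R P a(3)], of x] x unfolding a(4,5) .
    have "\<rho> (src C (fm (cmp C g m))) (far P (fe (cmp C g m)) x) =
        far (cover_fun R Esub (elts P) (\<lambda>p. p)) (fe (cmp C g m)) (\<rho> (src C m) x)"
      using is_nat_transD(2)[OF \<rho>, of "fe (cmp C g m)" x] a(3-5) x by simp
    then show "kan_section (trg C g) (far (kan_ext P) g (kan_in P (src C g) m x)) =
        far Cfree g (kan_section (src C g) (kan_in P (src C g) m x))"
      unfolding kan_far_in[OF R P g m x] kan_section_in[OF a(2) y] kan_section_in[OF m x]
        push_far[OF g m mod_homD(1)[OF rho_hom'[OF m] x]] by simp
  qed
qed

text \<open>Evaluating the generator with arrow m f carries s from the identity summand into the
  summand m, where it becomes the image of s under f. This is the evaluation of (f, s) in P, which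
  \<rho> splits.\<close>

lemma kan_section_section:
  assumes Y: "Y \<in> obs C" and z: "z \<in> elts (kan_ext P) Y"
  shows "cover_map R C (elts (kan_ext P)) (\<lambda>p. p) (kan_ext P) (\<lambda>_ s. s) Y (kan_section Y z) = z"
proof -
  note KP = kan_kfun[OF R P]
  have cm: "cover_map R C (elts (kan_ext P)) (\<lambda>p. p) (kan_ext P) (\<lambda>_ s. s) Y
      \<in> mod_hom R (free_mod R (Cgens Y)) (fob (kan_ext P) Y)"
    by (rule cover_map_hom[OF R C inj_C KP _ Y])
  show ?thesis
  proof (rule kan_hom_eqI[OF R P kan_module[OF R P] mod_hom_comp[OF kan_section_hom cm] mod_hom_id _ z])
    fix m x assume m: "m \<in> over Y" and x: "x \<in> elts P (src C m)"
    have v: "src C m \<in> obs C" by (rule overD(4)[OF m])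
    have em: "cover_map R Esub (elts P) (\<lambda>p. p) P (\<lambda>_ s. s) (src C m)
        \<in> mod_hom R (free_mod R (Egens (src C m))) (fob P (src C m))"
      by (rule cover_map_hom[OF R E inj_E P]) (use v in auto)
    have "cover_map R C (elts (kan_ext P)) (\<lambda>p. p) (kan_ext P) (\<lambda>_ s. s) Y (push Y m u) =
        kan_in P Y m (cover_map R Esub (elts P) (\<lambda>p. p) P (\<lambda>_ s. s) (src C m) u)"
      if u: "u \<in> carrier (free_mod R (Egens (src C m)))" for u
    proof (rule free_mod_hom_eqI[OF R kan_module[OF R P] mod_hom_comp[OF push_hom[OF m] cm]
          mod_hom_comp[OF em kan_in_hom[OF R P m]] _ u])
      fix b assume "b \<in> Egens (src C m)"
      then obtain f s where b: "b = (f, s)" "(f, s) \<in> Egens (src C m)" by (cases b) auto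
      then have f: "f \<in> A" "f \<in> arrs C" "s \<in> elts P (src C f)" "trg C f = src C m" using AC by (auto simp: Egens_iff)
      have g: "cmp C m f \<in> arrs C" "src C (cmp C m f) = src C f"
        "kan_in P (src C f) (ident C (src C f)) s \<in> elts (kan_ext P) (src C (cmp C m f))" "trg C (cmp C m f) = Y"
        using push_gen_closed[OF m b(2)] is_categoryD(7)[OF C f(2) overD(1)[OF m] f(4)[symmetric]] unfolding Cgens_iff by auto
      have "cover_map R C (elts (kan_ext P)) (\<lambda>p. p) (kan_ext P) (\<lambda>_ s. s) Y (push Y m (fgen R b)) =
          far (kan_ext P) (cmp C m f) (kan_in P (src C f) (ident C (src C f)) s)"
        unfolding b(1) push_gen[OF m b(2)] by (rule cover_map_gen[OF R C inj_C KP _ g(1,3,4)])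
      also have "\<dots> = kan_in P Y m (far P f s)"
        using kan_far_ident[OF R P overD(2)[OF m] f(1) f(4)[symmetric] f(3)] overD(3)[OF m] by simp
      also have "far P f s = cover_map R Esub (elts P) (\<lambda>p. p) P (\<lambda>_ s. s) (src C m) (fgen R b)"
        unfolding b(1) by (rule cover_map_gen[OF R E inj_E P, symmetric]) (use f in auto)
      finally show "cover_map R C (elts (kan_ext P)) (\<lambda>p. p) (kan_ext P) (\<lambda>_ s. s) Y (push Y m (fgen R b)) =
          kan_in P Y m (cover_map R Esub (elts P) (\<lambda>p. p) P (\<lambda>_ s. s) (src C m) (fgen R b))" .
    qed
    then show "cover_map R C (elts (kan_ext P)) (\<lambda>p. p) (kan_ext P) (\<lambda>_ s. s) Y (kan_section Y (kan_in P Y m x)) = kan_in P Y m x"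
      unfolding kan_section_in[OF m x] using mod_homD(1)[OF rho_hom'[OF m] x] sect[OF v x] by simp
  qed
qed

lemma kan_split': "split_kfun R C (kan_ext P)"
  unfolding split_kfun_def using kan_kfun[OF R P] kan_section_nat kan_section_section by blast

end

lemma kan_split:
  assumes "cring R" "split_kfun R Esub P"
  shows "split_kfun R C (kan_ext P)"
proof -
  obtain \<rho> where "is_kfun R Esub P" "is_nat_trans R Esub P (cover_fun R Esub (elts P) (\<lambda>p. p)) \<rho>"
    "\<forall>X\<in>obs Esub. \<forall>x\<in>elts P X. cover_map R Esub (elts P) (\<lambda>p. p) P (\<lambda>_ s. s) X (\<rho> X x) = x"
    using assms(2) unfolding split_kfun_def by blast
  then show ?thesis by (intro kan_split'[OF assms(1)]) auto
qed

section \<open>The extension preserves colimits, resolutions and derived functors\<close>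

subsection \<open>Colimits and homology of extensions\<close>

text \<open>Together with \<open>colim_kan\<close> this realises the isomorphism between the colimit
  of a left Kan extension and the original colimit: one direction forgets the index m of a summand,
  the other enters through the identity summands.\<close>

definition kan_colim ::
  "('k, 'r) ring_scheme \<Rightarrow> ('o, 'a, 'k, 'm) kfun \<Rightarrow> ('o \<Rightarrow> 'a \<Rightarrow> 'm) set \<Rightarrow> ('o \<Rightarrow> 'm) set" where
  "kan_colim R P =
     colim_lift C (kan_ext P) (colim R Esub P) (\<lambda>Y. kan_lift P Y (colim R Esub P) (\<lambda>m. colim_in R Esub P (src C m)))"

definition colim_kan ::
  "('k, 'r) ring_scheme \<Rightarrow> ('o, 'a, 'k, 'm) kfun \<Rightarrow> ('o \<Rightarrow> 'm) set \<Rightarrow> ('o \<Rightarrow> 'a \<Rightarrow> 'm) set" where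
  "colim_kan R P =
     colim_lift Esub P (colim R C (kan_ext P)) (\<lambda>X x. colim_in R C (kan_ext P) X (kan_in P X (ident C X) x))"

context
  fixes R :: "('k, 'r) ring_scheme" and P :: "('o, 'a, 'k, 'm) kfun"
  assumes R: "cring R" and P: "is_kfun R Esub P"
begin

lemma kan_colim_aux1: "m \<in> over Y \<Longrightarrow> colim_in R Esub P (src C m) \<in> mod_hom R (fob P (src C m)) (colim R Esub P)"
  by (rule colim_in_hom[OF R E P]) (simp add: overD(4))

lemma kan_colim_aux2: "kan_lift P Y (colim R Esub P) (\<lambda>m. colim_in R Esub P (src C m)) \<in> mod_hom R (fob (kan_ext P) Y) (colim R Esub P)"
  by (rule kan_lift_hom[OF R P colim_module[OF R E P]]) (rule kan_colim_aux1)

lemma kan_colim_aux3: "\<lbrakk>m \<in> over Y; x \<in> elts P (src C m)\<rbrakk> \<Longrightarrow>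
    kan_lift P Y (colim R Esub P) (\<lambda>m. colim_in R Esub P (src C m)) (kan_in P Y m x) = colim_in R Esub P (src C m) x"
  by (rule kan_lift_in[OF R P colim_module[OF R E P]]) (rule kan_colim_aux1)

text \<open>The action of g changes the index m and moves the element along an arrow of A; the
  colimit over \<open>Esub\<close> identifies an element with its image under such an arrow.\<close>

lemma kan_colim_compat:
  assumes g: "g \<in> arrs C" and z: "z \<in> elts (kan_ext P) (src C g)"
  shows "kan_lift P (trg C g) (colim R Esub P) (\<lambda>m. colim_in R Esub P (src C m)) (far (kan_ext P) g z) =
    kan_lift P (src C g) (colim R Esub P) (\<lambda>m. colim_in R Esub P (src C m)) z"
proof (rule kan_hom_eqI[OF R P colim_module[OF R E P] mod_hom_comp[OF kan_far_hom[OF R P g] kan_colim_aux2] kan_colim_aux2 _ z])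
  fix m x assume m: "m \<in> over (src C g)" and x: "x \<in> elts P (src C m)"
  note a = fac_over[OF g m]
  have y: "far P (fe (cmp C g m)) x \<in> elts P (src C (fm (cmp C g m)))"
    using mod_homD(1)[OF F_far[OF R P a(3)], of x] x unfolding a(4,5) .
  show "kan_lift P (trg C g) (colim R Esub P) (\<lambda>m. colim_in R Esub P (src C m)) (far (kan_ext P) g (kan_in P (src C g) m x)) =
    kan_lift P (src C g) (colim R Esub P) (\<lambda>m. colim_in R Esub P (src C m)) (kan_in P (src C g) m x)"
    unfolding kan_far_in[OF R P g m x] kan_colim_aux3[OF a(2) y] kan_colim_aux3[OF m x]
    using colim_in_far[OF R E P, of "fe (cmp C g m)" x] a(3-5) x by simp
qed

lemma kan_colim_hom: "kan_colim R P \<in> mod_hom R (colim R C (kan_ext P)) (colim R Esub P)"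
  unfolding kan_colim_def
  by (rule colim_lift_hom[OF R C kan_kfun[OF R P] colim_module[OF R E P]]) (rule kan_colim_aux2, erule (1) kan_colim_compat)

lemma kan_colim_in:
  assumes "Y \<in> obs C" "m \<in> over Y" "x \<in> elts P (src C m)"
  shows "kan_colim R P (colim_in R C (kan_ext P) Y (kan_in P Y m x)) = colim_in R Esub P (src C m) x"
proof -
  have "kan_colim R P (colim_in R C (kan_ext P) Y (kan_in P Y m x)) =
      kan_lift P Y (colim R Esub P) (\<lambda>m. colim_in R Esub P (src C m)) (kan_in P Y m x)"
    unfolding kan_colim_def
    by (rule colim_lift_in[OF R C kan_kfun[OF R P] colim_module[OF R E P] _ _ assms(1) kan_in_closed[OF R P assms(2,3)]])
      (rule kan_colim_aux2, erule (1) kan_colim_compat)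
  then show ?thesis unfolding kan_colim_aux3[OF assms(2,3)] .
qed

lemma colim_kan_aux:
  "X \<in> obs C \<Longrightarrow> (\<lambda>x. colim_in R C (kan_ext P) X (kan_in P X (ident C X) x)) \<in> mod_hom R (fob P X) (colim R C (kan_ext P))"
  using mod_hom_comp[OF kan_in_hom[OF R P ident_over[OF R P]] colim_in_hom[OF R C kan_kfun[OF R P]]]
  by (simp add: is_categoryD(4)[OF C])

text \<open>An arrow e of A has the factorization identity after e, so it carries the identity
  summand at its source to the identity summand at its target.\<close>

lemma colim_kan_compat:
  assumes e: "e \<in> A" and x: "x \<in> elts P (src C e)"
  shows "colim_in R C (kan_ext P) (trg C e) (kan_in P (trg C e) (ident C (trg C e)) (far P e x)) =
    colim_in R C (kan_ext P) (src C e) (kan_in P (src C e) (ident C (src C e)) x)"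
proof -
  have e': "e \<in> arrs C" using e AC by auto
  note o = is_categoryD(1,2)[OF C e']
  have "far (kan_ext P) (cmp C (ident C (trg C e)) e) (kan_in P (src C e) (ident C (src C e)) x) =
      kan_in P (trg C e) (ident C (trg C e)) (far P e x)"
    using kan_far_ident[OF R P ident_M[OF o(2)] e _ x] by (simp add: is_categoryD(4,5)[OF C o(2)])
  then have "kan_in P (trg C e) (ident C (trg C e)) (far P e x) = far (kan_ext P) e (kan_in P (src C e) (ident C (src C e)) x)"
    unfolding is_categoryD(10)[OF C e'] by simp
  then show ?thesis
    using colim_in_far[OF R C kan_kfun[OF R P] e' kan_in_closed[OF R P ident_over[OF R P o(1)] ident_over_src[OF R P o(1) x]]] by simp
qed

lemma colim_kan_hom: "colim_kan R P \<in> mod_hom R (colim R Esub P) (colim R C (kan_ext P))"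
  unfolding colim_kan_def
  by (rule colim_lift_hom[OF R E P colim_module[OF R C kan_kfun[OF R P]]]) (simp_all add: colim_kan_aux colim_kan_compat)

lemma colim_kan_in: "\<lbrakk>X \<in> obs C; x \<in> elts P X\<rbrakk> \<Longrightarrow>
    colim_kan R P (colim_in R Esub P X x) = colim_in R C (kan_ext P) X (kan_in P X (ident C X) x)"
  unfolding colim_kan_def
  by (rule colim_lift_in[OF R E P colim_module[OF R C kan_kfun[OF R P]]]) (simp_all add: colim_kan_aux colim_kan_compat)

lemma colim_kan_inverse: "z \<in> carrier (colim R Esub P) \<Longrightarrow> kan_colim R P (colim_kan R P z) = z"
proof (rule colim_hom_eqI[OF R E P colim_module[OF R E P] mod_hom_comp[OF colim_kan_hom kan_colim_hom] mod_hom_id])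
  fix X x assume X: "X \<in> obs Esub" and x: "x \<in> elts P X"
  then have o: "X \<in> obs C" by simp
  show "kan_colim R P (colim_kan R P (colim_in R Esub P X x)) = colim_in R Esub P X x"
    using kan_colim_in[OF o ident_over[OF R P o] ident_over_src[OF R P o x]] colim_kan_in[OF o x]
    by (simp add: is_categoryD(4)[OF C o])
qed

text \<open>The summand m at Y is the image under the arrow m of the identity summand at the source
  of m, and the colimit over C identifies an element with its image.\<close>

lemma kan_colim_inverse:
  assumes z: "z \<in> carrier (colim R C (kan_ext P))"
  shows "colim_kan R P (kan_colim R P z) = z"
proof (rule colim_hom_eqI[OF R C kan_kfun[OF R P] colim_module[OF R C kan_kfun[OF R P]] mod_hom_comp[OF kan_colim_hom colim_kan_hom] mod_hom_id _ z])
  fix Y z assume Y: "Y \<in> obs C" and z: "z \<in> elts (kan_ext P) Y"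
  note ci = colim_in_hom[OF R C kan_kfun[OF R P] Y]
  show "colim_kan R P (kan_colim R P (colim_in R C (kan_ext P) Y z)) = colim_in R C (kan_ext P) Y z"
  proof (rule kan_hom_eqI[OF R P colim_module[OF R C kan_kfun[OF R P]] mod_hom_comp[OF mod_hom_comp[OF ci kan_colim_hom] colim_kan_hom] ci _ z])
    fix m x assume m: "m \<in> over Y" and x: "x \<in> elts P (src C m)"
    note D = overD[OF m]
    have "far (kan_ext P) m (kan_in P (src C m) (ident C (src C m)) x) = kan_in P Y m x"
      using kan_far_ident[OF R P D(2), of "ident C (src C m)" x] is_categoryD(3)[OF E, of "src C m"] is_categoryD(4,5)[OF C D(4)] x
        is_categoryD(9)[OF C D(1)] is_kfunD(3)[OF P, of "src C m" x] D(3,4) by simp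
    then show "colim_kan R P (kan_colim R P (colim_in R C (kan_ext P) Y (kan_in P Y m x))) = colim_in R C (kan_ext P) Y (kan_in P Y m x)"
      unfolding kan_colim_in[OF Y m x] colim_kan_in[OF D(4) x]
      using colim_in_far[OF R C kan_kfun[OF R P] D(1) kan_in_closed[OF R P ident_over[OF R P D(4)] ident_over_src[OF R P D(4) x]]] D(3) by simp
  qed
qed

end

lemma kan_colim_nat:
  assumes R: "cring R" and F: "is_kfun R Esub F" and G: "is_kfun R Esub G" and \<eta>: "is_nat_trans R Esub F G \<eta>"
    and z: "z \<in> carrier (colim R C (kan_ext F))"
  shows "kan_colim R G (colim_map R C (kan_ext G) (kan_map \<eta>) z) = colim_map R Esub G \<eta> (kan_colim R F z)"
proof (rule colim_hom_eqI[OF R C kan_kfun[OF R F] colim_module[OF R E G]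
      mod_hom_comp[OF colim_map_hom[OF R C kan_kfun[OF R F] kan_kfun[OF R G] kan_map_nat[OF R F G \<eta>]] kan_colim_hom[OF R G]]
      mod_hom_comp[OF kan_colim_hom[OF R F] colim_map_hom[OF R E F G \<eta>]] _ z])
  fix Y z assume Y: "Y \<in> obs C" and z: "z \<in> elts (kan_ext F) Y"
  note cm = colim_map_hom[OF R C kan_kfun[OF R F] kan_kfun[OF R G] kan_map_nat[OF R F G \<eta>]]
  note ci = colim_in_hom[OF R C kan_kfun[OF R F] Y]
  show "kan_colim R G (colim_map R C (kan_ext G) (kan_map \<eta>) (colim_in R C (kan_ext F) Y z)) =
      colim_map R Esub G \<eta> (kan_colim R F (colim_in R C (kan_ext F) Y z))"
  proof (rule kan_hom_eqI[OF R F colim_module[OF R E G] mod_hom_comp[OF mod_hom_comp[OF ci cm] kan_colim_hom[OF R G]]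
        mod_hom_comp[OF mod_hom_comp[OF ci kan_colim_hom[OF R F]] colim_map_hom[OF R E F G \<eta>]] _ z])
    fix m x assume m: "m \<in> over Y" and x: "x \<in> elts F (src C m)"
    have y: "\<eta> (src C m) x \<in> elts G (src C m)" using mod_homD(1)[OF is_nat_transD(1)[OF \<eta>] x] overD(4)[OF m] by simp
    show "kan_colim R G (colim_map R C (kan_ext G) (kan_map \<eta>) (colim_in R C (kan_ext F) Y (kan_in F Y m x))) =
        colim_map R Esub G \<eta> (kan_colim R F (colim_in R C (kan_ext F) Y (kan_in F Y m x)))"
      using colim_map_in[OF R C kan_kfun[OF R F] kan_kfun[OF R G] kan_map_nat[OF R F G \<eta>] Y kan_in_closed[OF R F m x]]
        kan_map_in[OF R F G \<eta> m x] kan_colim_in[OF R G Y m y] kan_colim_in[OF R F Y m x]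
        colim_map_in[OF R E F G \<eta> _ x] overD(4)[OF m] by simp
  qed
qed

text \<open>Exactness and splitting pass to the extension termwise. The augmentation is composed
  with \<Theta>, so that the resolution ends in G instead of the extension of F.\<close>

lemma kan_resolution:
  assumes R: "cring R" and F: "is_kfun R Esub F" and G: "is_kfun R C G" and res: "split_resolution R Esub F P d e"
    and \<Theta>: "is_nat_trans R C (kan_ext F) G \<Theta>"
    and bij: "\<And>X. X \<in> obs C \<Longrightarrow> bij_betw (\<Theta> X) (elts (kan_ext F) X) (elts G X)"
  shows "split_resolution R C G (\<lambda>n. kan_ext (P n)) (\<lambda>n. kan_map (d n)) (\<lambda>X x. \<Theta> X (kan_map e X x))"
proof -
  note r = split_resolution_facts[OF R E F res]
  note Pf = r(2) and dn = r(4) and en = r(3)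
  have rex: "\<And>X x. X \<in> obs C \<Longrightarrow> x \<in> elts F X \<Longrightarrow> \<exists>y\<in>elts (P 0) X. e X y = x" using r(5) by simp
  \<comment> \<open>Injectivity of \<Theta> keeps the kernel of the augmentation unchanged under
    this composition.\<close>
  have \<Theta>0: "\<Theta> X x = \<zero>\<^bsub>fob G X\<^esub> \<longleftrightarrow> x = \<zero>\<^bsub>fob (kan_ext F) X\<^esub>" if X: "X \<in> obs C" and x: "x \<in> elts (kan_ext F) X" for X x
  proof -
    have z: "\<Theta> X \<zero>\<^bsub>fob (kan_ext F) X\<^esub> = \<zero>\<^bsub>fob G X\<^esub>"
      by (rule mod_hom_zero[OF kan_module[OF R F] is_kfunD(1)[OF G X] is_nat_transD(1)[OF \<Theta> X]])
    interpret K: module R "fob (kan_ext F) X" by (rule kan_module[OF R F])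
    show ?thesis using z inj_onD[OF bij_betw_imp_inj_on[OF bij[OF X]], of x "\<zero>\<^bsub>fob (kan_ext F) X\<^esub>"] x K.M.zero_closed by auto
  qed
  have eh: "kan_map e X x \<in> elts (kan_ext F) X" if "x \<in> elts (kan_ext (P 0)) X" for X x
    using mod_homD(1)[OF kan_map_hom[OF R Pf F en] that] .
  have d0: "is_nat_trans R Esub (P 1) (P 0) (d 0)" using dn[of 0] by simp
  show ?thesis
    unfolding split_resolution_def
  proof (intro conjI allI ballI)
    fix n show "split_kfun R C (kan_ext (P n))" by (rule kan_split[OF R r(1)])
    show "is_nat_trans R C (kan_ext (P (Suc n))) (kan_ext (P n)) (kan_map (d n))" by (rule kan_map_nat[OF R Pf Pf dn])
  next
    note ken = kan_map_nat[OF R Pf F en]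
    show "is_nat_trans R C (kan_ext (P 0)) G (\<lambda>X x. \<Theta> X (kan_map e X x))"
      unfolding is_nat_trans_def
    proof (intro conjI ballI)
      fix X assume X: "X \<in> obs C"
      show "(\<lambda>x. \<Theta> X (kan_map e X x)) \<in> mod_hom R (fob (kan_ext (P 0)) X) (fob G X)"
        by (rule mod_hom_comp[OF is_nat_transD(1)[OF ken X] is_nat_transD(1)[OF \<Theta> X]])
    next
      fix f x assume f: "f \<in> arrs C" and x: "x \<in> elts (kan_ext (P 0)) (src C f)"
      show "\<Theta> (trg C f) (kan_map e (trg C f) (far (kan_ext (P 0)) f x)) = far G f (\<Theta> (src C f) (kan_map e (src C f) x))"
        unfolding is_nat_transD(2)[OF ken f x] is_nat_transD(2)[OF \<Theta> f eh[OF x]] ..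
    qed
  next
    fix X assume X: "X \<in> obs C"
    show "(\<lambda>x. \<Theta> X (kan_map e X x)) ` elts (kan_ext (P 0)) X = elts G X"
    proof (intro equalityI subsetI)
      fix y assume "y \<in> (\<lambda>x. \<Theta> X (kan_map e X x)) ` elts (kan_ext (P 0)) X"
      then show "y \<in> elts G X" using mod_homD(1)[OF is_nat_transD(1)[OF \<Theta> X] eh] by auto
    next
      fix y assume "y \<in> elts G X"
      then obtain z where z: "z \<in> elts (kan_ext F) X" "y = \<Theta> X z" using bij_betw_imp_surj_on[OF bij[OF X]] by auto
      obtain w where "w \<in> elts (kan_ext (P 0)) X" "kan_map e X w = z"
        using kan_map_exact[OF R Pf F en _ z(1), where Q = "\<lambda>_ _. True"] rex by auto
      then show "y \<in> (\<lambda>x. \<Theta> X (kan_map e X x)) ` elts (kan_ext (P 0)) X" using z(2) by auto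
    qed
    show "kan_map (d 0) X ` elts (kan_ext (P 1)) X =
        {x \<in> elts (kan_ext (P 0)) X. \<Theta> X (kan_map e X x) = \<zero>\<^bsub>fob G X\<^esub>}"
    proof (intro equalityI subsetI)
      fix y assume "y \<in> kan_map (d 0) X ` elts (kan_ext (P 1)) X"
      then obtain w where w: "w \<in> elts (kan_ext (P 1)) X" "y = kan_map (d 0) X w" by auto
      have "kan_map e X y = \<zero>\<^bsub>fob (kan_ext F) X\<^esub>"
        unfolding w(2) by (rule kan_map_comp_zero[OF R Pf Pf F d0 en _ w(1)]) (use r(7) in auto)
      moreover have yc: "y \<in> elts (kan_ext (P 0)) X" unfolding w(2) by (rule mod_homD(1)[OF kan_map_hom[OF R Pf Pf d0] w(1)])
      ultimately show "y \<in> {x \<in> elts (kan_ext (P 0)) X. \<Theta> X (kan_map e X x) = \<zero>\<^bsub>fob G X\<^esub>}"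
        using \<Theta>0[OF X eh[OF yc]] by simp
    next
      fix y assume y: "y \<in> {x \<in> elts (kan_ext (P 0)) X. \<Theta> X (kan_map e X x) = \<zero>\<^bsub>fob G X\<^esub>}"
      then have yc: "y \<in> elts (kan_ext (P 0)) X" by simp
      have ky: "kan_map e X y = \<zero>\<^bsub>fob (kan_ext F) X\<^esub>" using y \<Theta>0[OF X eh[OF yc]] by simp
      have "\<exists>w\<in>elts (kan_ext (P 1)) X. kan_map (d 0) X w = y"
        by (rule kan_map_exact[OF R Pf Pf d0 _ yc, where Q = "\<lambda>X x. e X x = \<zero>\<^bsub>fob F X\<^esub>"])
          (use r(6) kan_map_zeroD[OF R F ky] in auto)
      then show "y \<in> kan_map (d 0) X ` elts (kan_ext (P 1)) X" by auto
    qed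
    fix n
    show "kan_map (d (Suc n)) X ` elts (kan_ext (P (Suc (Suc n)))) X =
        {x \<in> elts (kan_ext (P (Suc n))) X. kan_map (d n) X x = \<zero>\<^bsub>fob (kan_ext (P n)) X\<^esub>}"
    proof (intro equalityI subsetI)
      fix y assume "y \<in> kan_map (d (Suc n)) X ` elts (kan_ext (P (Suc (Suc n)))) X"
      then obtain w where w: "w \<in> elts (kan_ext (P (Suc (Suc n)))) X" "y = kan_map (d (Suc n)) X w" by auto
      have "kan_map (d n) X y = \<zero>\<^bsub>fob (kan_ext (P n)) X\<^esub>"
        unfolding w(2) by (rule kan_map_comp_zero[OF R Pf Pf Pf dn dn _ w(1)]) (use r(9) in auto)
      moreover have "y \<in> elts (kan_ext (P (Suc n))) X" unfolding w(2) by (rule mod_homD(1)[OF kan_map_hom[OF R Pf Pf dn] w(1)])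
      ultimately show "y \<in> {x \<in> elts (kan_ext (P (Suc n))) X. kan_map (d n) X x = \<zero>\<^bsub>fob (kan_ext (P n)) X\<^esub>}" by simp
    next
      fix y assume y: "y \<in> {x \<in> elts (kan_ext (P (Suc n))) X. kan_map (d n) X x = \<zero>\<^bsub>fob (kan_ext (P n)) X\<^esub>}"
      then have yc: "y \<in> elts (kan_ext (P (Suc n))) X" and ky: "kan_map (d n) X y = \<zero>\<^bsub>fob (kan_ext (P n)) X\<^esub>" by auto
      have "\<exists>w\<in>elts (kan_ext (P (Suc (Suc n)))) X. kan_map (d (Suc n)) X w = y"
        by (rule kan_map_exact[OF R Pf Pf dn _ yc, where Q = "\<lambda>X x. d n X x = \<zero>\<^bsub>fob (P n) X\<^esub>"])
          (use r(8) kan_map_zeroD[OF R Pf ky] in auto)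
      then show "y \<in> kan_map (d (Suc n)) X ` elts (kan_ext (P (Suc (Suc n)))) X" by auto
    qed
  qed
qed

text \<open>The extended resolution computes the bar homology of G, and its colimit complex is
  isomorphic to that of the original resolution. On the side of C the bar complex is used because it
  depends neither on a resolution nor on the element type of one.\<close>

lemma kan_colim_homology:
  assumes R: "cring R" and F: "is_kfun R Esub F" and G: "is_kfun R C G" and res: "split_resolution R Esub F P d e"
    and \<Theta>: "is_nat_trans R C (kan_ext F) G \<Theta>"
    and bij: "\<And>X. X \<in> obs C \<Longrightarrow> bij_betw (\<Theta> X) (elts (kan_ext F) X) (elts G X)"
  shows "mod_isomorphic R (bar_homology C G n)
    (chain_homology (\<lambda>n. colim R Esub (P n)) (\<lambda>n. colim_map R Esub (P n) (d n)) n)"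
proof -
  note r = split_resolution_facts[OF R E F res]
  note Pf = r(2) and dn = r(4)
  note res' = kan_resolution[OF R F G res \<Theta> bij]
  note r' = split_resolution_facts[OF R C G res']
  have cE: "is_complex R (\<lambda>n. colim R Esub (P n)) (\<lambda>n. colim_map R Esub (P n) (d n))"
    by (rule colim_complex[where P = P and d = d, OF R E]) (rule Pf dn r(9); assumption)+
  have cC: "is_complex R (\<lambda>n. colim R C (kan_ext (P n))) (\<lambda>n. colim_map R C (kan_ext (P n)) (kan_map (d n)))"
    by (rule double_complex.A[OF bar_double_complex[OF R C G res']])
  have "mod_isomorphic R (chain_homology (\<lambda>n. colim R C (kan_ext (P n))) (\<lambda>n. colim_map R C (kan_ext (P n)) (kan_map (d n))) n)
      (chain_homology (\<lambda>n. colim R Esub (P n)) (\<lambda>n. colim_map R Esub (P n) (d n)) n)"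
    by (rule homology_iso_inverse[where f = "\<lambda>n. kan_colim R (P n)" and g = "\<lambda>n. colim_kan R (P n)", OF cC cE
          kan_colim_hom[OF R Pf] colim_kan_hom[OF R Pf] kan_colim_nat[OF R Pf Pf dn] kan_colim_inverse[OF R Pf] colim_kan_inverse[OF R Pf]])
  from mod_isomorphic_trans[OF bar_colim_homology[OF R C G res'] this] show ?thesis .
qed

end

section \<open>Bar homology over Delta S and over Delta S_+ agrees\<close>

section \<open>Adding a point to \<open>\<Delta>S\<^sub>+\<close>\<close>

text \<open>The new point is numbered 0 in source and target and is fixed by the map; the old points
  are shifted by one.\<close>

definition add_point :: "nat list list \<Rightarrow> nat list list" where
  "add_point L = [0] # map (map Suc) L"

text \<open>The order-preserving inclusion that misses the new point 0.\<close>

definition skip_point :: "nat \<Rightarrow> nat list list" where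
  "skip_point n = [] # map (\<lambda>i. [i]) [0..<n]"

lemma upt_Suc_map: "[0..<Suc n] = 0 # map Suc [0..<n]"
  by (metis map_Suc_upt upt_conv_Cons zero_less_Suc)

lemma concat_singletons: "concat (map (\<lambda>i. [i]) xs) = xs"
  by (induction xs) auto

lemma concat_add_point: "concat (add_point L) = 0 # map Suc (concat L)"
  by (simp add: add_point_def map_concat)

lemma add_point_fibre_lists:
  assumes "L \<in> fibre_lists"
  shows "add_point L \<in> fibre_lists"
proof -
  have shift: "mset (0 # map Suc xs) = mset [0..<length (0 # map Suc xs)]" if "mset xs = mset [0..<length xs]" for xs
  proof -
    have "mset (0 # map Suc xs) = add_mset 0 (image_mset Suc (mset xs))" by simp
    also have "\<dots> = mset (0 # map Suc [0..<length xs])" unfolding that by simp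
    finally show ?thesis unfolding upt_Suc_map[symmetric] by simp
  qed
  show ?thesis using assms unfolding fibre_lists_mset concat_add_point by (rule shift)
qed

lemma skip_point_fibre_lists: "skip_point n \<in> fibre_lists"
  by (simp add: fibre_lists_mset skip_point_def concat_singletons del: mset_concat length_concat)

lemma add_point_cmp:
  assumes L: "L \<in> fibre_lists" and K: "K \<in> fibre_lists" and len: "length (concat K) = length L"
  shows "add_point (cmp DeltaS_plus K L) = cmp DeltaS_plus (add_point K) (add_point L)"
proof -
  have "map Suc (concat (map ((!) L) fibre)) = concat (map ((!) (add_point L)) (map Suc fibre))" if "fibre \<in> set K" for fibre
  proof -
    have "map (map Suc) (map ((!) L) fibre) = map ((!) (add_point L)) (map Suc fibre)"
      using fibre_less[OF K that] unfolding len by (auto simp: add_point_def)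
    then show ?thesis by (simp only: map_concat)
  qed
  then show ?thesis by (simp add: add_point_def)
qed

text \<open>Both composites are L with an empty fibre put in front.\<close>

lemma skip_point_natural:
  "cmp DeltaS_plus (skip_point (length L)) L = cmp DeltaS_plus (add_point L) (skip_point (length (concat L)))"
  if L: "L \<in> fibre_lists"
proof -
  have a: "cmp DeltaS_plus (skip_point (length L)) L = [] # L"
    by (simp add: skip_point_def o_def map_nth)
  have "concat (map ((!) (skip_point (length (concat L)))) (map Suc fibre)) = fibre" if "fibre \<in> set L" for fibre
  proof -
    have "map ((!) (skip_point (length (concat L)))) (map Suc fibre) = map (\<lambda>i. [i]) fibre"
      using fibre_less[OF L that] by (auto simp: skip_point_def simp del: length_concat)
    then show ?thesis by (simp only: concat_singletons)
  qed
  then have "map (\<lambda>fibre. concat (map ((!) (skip_point (length (concat L)))) fibre)) (map (map Suc) L) = L"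
    by (simp add: o_def map_idI)
  then have "cmp DeltaS_plus (add_point L) (skip_point (length (concat L))) = [] # L"
    by (simp add: add_point_def skip_point_def del: length_concat)
  then show ?thesis using a by simp
qed

lemma add_point_functor: "is_functor DeltaS_plus DeltaS_plus Suc add_point"
proof -
  have i: "add_point (map (\<lambda>i. [i]) [0..<n]) = map (\<lambda>i. [i]) [0..<Suc n]" for n
    unfolding upt_Suc_map by (simp add: add_point_def)
  have s: "length (concat (add_point L)) = Suc (length (concat L))" for L
    unfolding concat_add_point by simp
  show ?thesis
    unfolding is_functor_def
  proof (intro conjI ballI impI)
    fix f g assume "f \<in> arrs DeltaS_plus" "g \<in> arrs DeltaS_plus" "src DeltaS_plus g = trg DeltaS_plus f"
    then show "add_point (cmp DeltaS_plus g f) = cmp DeltaS_plus (add_point g) (add_point f)"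
      using add_point_cmp[of f g] by (simp only: DeltaS_plus_simps)
  qed (simp_all only: DeltaS_plus_simps UNIV_I add_point_fibre_lists i s, simp_all add: add_point_def)
qed

lemma DeltaS_simps [simp]:
  "obs DeltaS = {n. n \<ge> 1}" "arrs DeltaS = {L \<in> fibre_lists. length (concat L) \<ge> 1}"
  "src DeltaS = src DeltaS_plus" "trg DeltaS = trg DeltaS_plus" "ident DeltaS = ident DeltaS_plus" "cmp DeltaS = cmp DeltaS_plus"
  by (simp_all add: DeltaS_def del: length_concat)

lemma DeltaS_inclusion: "is_functor DeltaS DeltaS_plus (\<lambda>X. X) (\<lambda>f. f)"
  by (simp add: is_functor_def)

lemma functor_into_subcategory:
  assumes "is_functor C D \<phi> \<Phi>" "src D' = src D" "trg D' = trg D" "ident D' = ident D" "cmp D' = cmp D"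
    and "\<And>X. X \<in> obs C \<Longrightarrow> \<phi> X \<in> obs D'" "\<And>f. f \<in> arrs C \<Longrightarrow> \<Phi> f \<in> arrs D'"
  shows "is_functor C D' \<phi> \<Phi>"
  using is_functorD[OF assms(1)] assms(2-) unfolding is_functor_def by simp

lemma functor_from_subcategory:
  assumes "is_functor C D \<phi> \<Phi>" "src C' = src C" "trg C' = trg C" "ident C' = ident C" "cmp C' = cmp C"
    and "obs C' \<subseteq> obs C" "arrs C' \<subseteq> arrs C"
  shows "is_functor C' D \<phi> \<Phi>"
  using is_functorD[OF assms(1)] assms(2-) unfolding is_functor_def by (simp add: subset_iff)

lemma add_point_arrs_DeltaS: "f \<in> fibre_lists \<Longrightarrow> add_point f \<in> arrs DeltaS"
  using add_point_fibre_lists[of f] concat_add_point[of f] by (simp del: length_concat)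

text \<open>The new point makes the source non-empty, even for arrows out of the added object
  0.\<close>

lemma add_point_into_DeltaS: "is_functor DeltaS_plus DeltaS Suc add_point"
  by (rule functor_into_subcategory[OF add_point_functor]) (simp_all add: add_point_arrs_DeltaS del: length_concat DeltaS_simps(2))

lemma add_point_DeltaS: "is_functor DeltaS DeltaS Suc add_point"
  by (rule functor_from_subcategory[OF add_point_into_DeltaS]) (simp_all add: subset_iff)

lemma kfun_restrict:
  assumes "is_kfun R D F" "src C = src D" "trg C = trg D" "ident C = ident D" "cmp C = cmp D" "obs C \<subseteq> obs D" "arrs C \<subseteq> arrs D"
  shows "is_kfun R C F"
  using is_kfunD[OF assms(1)] assms(2-) unfolding is_kfun_def by (simp add: subset_iff)

lemma skip_point_arrow: "skip_point n \<in> fibre_lists \<and> length (concat (skip_point n)) = n \<and> length (skip_point n) = Suc n"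
  by (simp add: skip_point_fibre_lists, simp add: skip_point_def)

text \<open>One map is the inclusion, the other adds a point and moves the coefficients along
  \<open>skip_point\<close>. Both composites have the form required by
  \<open>bar_map_endofunctor\<close>, each over its own category, and so act as the identity on
  homology.\<close>

theorem DeltaS_bar_homology:
  fixes F :: "(nat, nat list list, 'k, 'm) kfun"
  assumes R: "cring R" and F: "is_kfun R DeltaS_plus F"
  shows "mod_isomorphic R (bar_homology DeltaS F n)
    (bar_homology DeltaS_plus F n)"
proof -
  let ?D = DeltaS and ?P = DeltaS_plus
  note D = is_category_DeltaS and P = is_category_DeltaS_plus
  have FD: "is_kfun R ?D F" by (rule kfun_restrict[OF F]) auto
  let ?\<alpha> = "\<lambda>X. far F (skip_point X)"
  have aP: "skip_point X \<in> arrs ?P \<and> src ?P (skip_point X) = X \<and> trg ?P (skip_point X) = Suc X" for X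
    using skip_point_arrow by (simp only: DeltaS_plus_simps simp_thms)
  have aD: "skip_point X \<in> arrs ?D \<and> src ?D (skip_point X) = X \<and> trg ?D (skip_point X) = Suc X" if "X \<in> obs ?D" for X
    using skip_point_arrow[of X] that by (simp del: length_concat)
  have \<alpha>: "?\<alpha> X \<in> mod_hom R (fob F X) (fob F (Suc X))" for X
    using is_kfunD(2)[OF F, of "skip_point X"] aP[of X] by metis
  have natP: "cmp ?P (skip_point (trg ?P f)) f = cmp ?P (add_point f) (skip_point (src ?P f))" if "f \<in> arrs ?P" for f
    using skip_point_natural[of f] that by (simp only: DeltaS_plus_simps)
  have natF: "?\<alpha> (trg ?P f) (far F f x) = far F (add_point f) (?\<alpha> (src ?P f) x)"
    if f: "f \<in> arrs ?P" and x: "x \<in> elts F (src ?P f)" for f x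
  proof -
    have "?\<alpha> (trg ?P f) (far F f x) = far F (cmp ?P (skip_point (trg ?P f)) f) x"
      using is_kfunD(4)[OF F f _ _ x, of "skip_point (trg ?P f)"] aP by simp
    also have "\<dots> = far F (add_point f) (?\<alpha> (src ?P f) x)"
      unfolding natP[OF f]
      using is_kfunD(4)[OF F, of "skip_point (src ?P f)" "add_point f" x] aP is_functorD(3,4)[OF add_point_functor f] x by simp
    finally show ?thesis .
  qed
  let ?f = "bar_map ?D F ?P F (\<lambda>f. f) (\<lambda>_ x. x)" and ?g = "bar_map ?P F ?D F add_point ?\<alpha>"
  have natD: "?\<alpha> (trg ?D f) (far F f x) = far F (add_point f) (?\<alpha> (src ?D f) x)"
    if "f \<in> arrs ?D" "x \<in> elts F (src ?D f)" for f x
    using natF[of f x] that by simp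
  note fprops = R D P FD F DeltaS_inclusion mod_hom_id
  have fh: "?f n \<in> mod_hom R (bar_mod ?D F n) (bar_mod ?P F n)" for n
    by (rule bar_map_hom[OF fprops]) simp
  have fi: "?f n (bar_in ?D F n \<sigma> x) = bar_in ?P F n \<sigma> x" if "\<sigma> \<in> nerve ?D n" "x \<in> elts F (origin ?D \<sigma>)" for n \<sigma> x
  proof -
    have "?f n (bar_in ?D F n \<sigma> x) = bar_in ?P F n (nerve_map n (\<lambda>f. f) \<sigma>) x"
      by (rule bar_map_in[OF fprops _ that]) simp
    then show ?thesis unfolding nerve_map_id[OF that(1)] .
  qed
  have fd: "?f n (bar_diff ?D F n z) = bar_diff ?P F n (?f (Suc n) z)" if "z \<in> carrier (bar_mod ?D F (Suc n))" for n z
    by (rule bar_map_diff[OF fprops _ that]) simp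
  note gprops = R P D F FD add_point_into_DeltaS \<alpha> natF
  have gh: "?g n \<in> mod_hom R (bar_mod ?P F n) (bar_mod ?D F n)" for n
    by (rule bar_map_hom[OF gprops])
  have gi: "?g n (bar_in ?P F n \<sigma> x) = bar_in ?D F n (nerve_map n add_point \<sigma>) (?\<alpha> (origin ?P \<sigma>) x)"
    if "\<sigma> \<in> nerve ?P n" "x \<in> elts F (origin ?P \<sigma>)" for n \<sigma> x
    by (rule bar_map_in[OF gprops that])
  have gd: "?g n (bar_diff ?P F n z) = bar_diff ?D F n (?g (Suc n) z)" if "z \<in> carrier (bar_mod ?P F (Suc n))" for n z
    by (rule bar_map_diff[OF gprops that])
  have vtx: "x \<in> elts F (src ?D (nerve_map n add_point \<sigma> (0, 0))) \<longleftrightarrow> x \<in> elts F (Suc (origin ?P \<sigma>))"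
    if "\<sigma> \<in> nerve ?P n" for n \<sigma> x
    using is_functorD(4)[OF add_point_functor nerveD(1)[OF that, of 0 0]] by simp
  have incl: "\<sigma> \<in> nerve ?P n" if "\<sigma> \<in> nerve ?D n" for n \<sigma>
    using nerve_map_closed[OF D DeltaS_inclusion that] unfolding nerve_map_id[OF that] .
  \<comment> \<open>The composite over \<open>DeltaS\<close> is the endomorphism given by
    \<open>add_point\<close> and \<open>skip_point\<close>; \<open>fg\<close> is the same statement
    over \<open>DeltaS_plus\<close>.\<close>
  have gf: "?g n (?f n z) = bar_map ?D F ?D F add_point ?\<alpha> n z" if z: "z \<in> carrier (bar_mod ?D F n)" for z
  proof (rule bar_hom_eqI[OF R D FD bar_module[OF R D FD] mod_hom_comp[OF fh gh] bar_map_hom[OF R D D FD FD add_point_DeltaS \<alpha> natD] _ z])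
    fix \<sigma> x assume s: "\<sigma> \<in> nerve ?D n" "x \<in> elts F (origin ?D \<sigma>)"
    show "?g n (?f n (bar_in ?D F n \<sigma> x)) = bar_map ?D F ?D F add_point ?\<alpha> n (bar_in ?D F n \<sigma> x)"
      using fi[OF s] gi[OF incl[OF s(1)], of x] s(2) bar_map_in[OF R D D FD FD add_point_DeltaS \<alpha> natD s] by simp
  qed
  have fg: "?f n (?g n z) = bar_map ?P F ?P F add_point ?\<alpha> n z" if z: "z \<in> carrier (bar_mod ?P F n)" for z
  proof (rule bar_hom_eqI[OF R P F bar_module[OF R P F] mod_hom_comp[OF gh fh] bar_map_hom[OF R P P F F add_point_functor \<alpha> natF] _ z])
    fix \<sigma> x assume s: "\<sigma> \<in> nerve ?P n" "x \<in> elts F (origin ?P \<sigma>)"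
    have y: "?\<alpha> (origin ?P \<sigma>) x \<in> elts F (src ?D (nerve_map n add_point \<sigma> (0, 0)))"
      unfolding vtx[OF s(1)] by (rule mod_homD(1)[OF \<alpha> s(2)])
    show "?f n (?g n (bar_in ?P F n \<sigma> x)) = bar_map ?P F ?P F add_point ?\<alpha> n (bar_in ?P F n \<sigma> x)"
    proof -
      have "bar_map ?P F ?P F add_point ?\<alpha> n (bar_in ?P F n \<sigma> x) =
          bar_in ?P F n (nerve_map n add_point \<sigma>) (?\<alpha> (origin ?P \<sigma>) x)"
        by (rule bar_map_in[OF R P P F F add_point_functor \<alpha> natF s])
      then show ?thesis unfolding gi[OF s] fi[OF nerve_map_closed[OF P add_point_into_DeltaS s(1)] y] by (rule sym)
    qed
  qed
  show ?thesis
  proof (rule homology_iso_chain_maps[where f = ?f and g = ?g, OF bar_complex[OF R D FD] bar_complex[OF R P F] fh gh fd gd])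
    fix z assume z: "z \<in> cycles (bar_mod ?D F) (bar_diff ?D F) n"
    have "cmp ?D (skip_point (trg ?D f)) f = cmp ?D (add_point f) (skip_point (src ?D f))" if "f \<in> arrs ?D" for f
      using natP[of f] that by simp
    from bar_map_endofunctor[OF R D FD add_point_DeltaS aD this z]
    show "z \<ominus>\<^bsub>bar_mod ?D F n\<^esub> ?g n (?f n z) \<in> boundaries (bar_mod ?D F) (bar_diff ?D F) n"
      using gf z by (simp add: cycles_def)
  next
    fix z assume z: "z \<in> cycles (bar_mod ?P F) (bar_diff ?P F) n"
    from bar_map_endofunctor[OF R P F add_point_functor aP natP z]
    show "z \<ominus>\<^bsub>bar_mod ?P F n\<^esub> ?f n (?g n z) \<in> boundaries (bar_mod ?P F) (bar_diff ?P F) n"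
      using fg z by (simp add: cycles_def)
  qed
qed

section \<open>The epi-mono factorization in terms of fibre lists\<close>

section \<open>Epimorphisms followed by order-preserving injections\<close>

text \<open>Fibres of length at most one make the underlying map injective; the increasing
  concatenation makes it monotone.\<close>

definition order_inclusions :: "nat list list set" where
  "order_inclusions = {m. (\<forall>fibre\<in>set m. length fibre \<le> 1) \<and> concat m = [0..<length (concat m)]}"

(* The order-preserving injection with the same image as g, for k = 0. *)
fun image_inclusion :: "nat \<Rightarrow> nat list list \<Rightarrow> nat list list" where
  "image_inclusion k [] = []"
| "image_inclusion k ([] # g) = [] # image_inclusion k g"
| "image_inclusion k ((x # xs) # g) = [k] # image_inclusion (Suc k) g"

text \<open>The corestriction of a map to its image: the points of the image are renumbered by their
  position among the non-empty fibres.\<close>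

definition drop_empty :: "'a list list \<Rightarrow> 'a list list" where
  "drop_empty g = filter (\<lambda>fibre. fibre \<noteq> []) g"

lemma concat_drop_empty: "concat (drop_empty g) = concat g"
  by (induction g) (auto simp: drop_empty_def)

lemma concat_image_inclusion: "concat (image_inclusion k g) = [k..<k + length (drop_empty g)]"
  by (induction k g rule: image_inclusion.induct) (auto simp: drop_empty_def upt_rec)

lemma image_inclusion_fibres: "fibre \<in> set (image_inclusion k g) \<Longrightarrow> length fibre \<le> 1"
  by (induction k g rule: image_inclusion.induct) auto

lemma length_image_inclusion: "length (image_inclusion k g) = length g"
  by (induction k g rule: image_inclusion.induct) auto

text \<open>Here \<open>pre\<close> collects the non-empty fibres already passed, and its length is
  the counter of \<open>image_inclusion\<close>; this makes the induction along g go
  through.\<close>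

lemma image_inclusion_factor:
  "map (\<lambda>fibre. concat (map ((!) (pre @ drop_empty g)) fibre)) (image_inclusion (length pre) g) = g"
proof (induction g arbitrary: pre)
  case (Cons fibre g)
  show ?case
  proof (cases fibre)
    case Nil
    then show ?thesis using Cons.IH[of pre] by (simp add: drop_empty_def)
  next
    case (Cons x xs)
    then show ?thesis using Cons.IH[of "pre @ [fibre]"] by (simp add: drop_empty_def nth_append)
  qed
qed simp

text \<open>Since e has no empty fibres, the composite is empty exactly at the points missed by m,
  and this pattern determines m. The non-empty fibres of m consume the numbers k, k + 1, ... in
  order, so the non-empty fibres of the composite are those of e from position k on.\<close>

lemma inclusion_epi_unique:
  assumes "\<forall>fibre\<in>set m. length fibre \<le> 1" "concat m = [k..<length e]" "[] \<notin> set e" "k \<le> length e"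
  shows "drop_empty (map (\<lambda>fibre. concat (map ((!) e) fibre)) m) = drop k e \<and>
    image_inclusion k (map (\<lambda>fibre. concat (map ((!) e) fibre)) m) = m"
  using assms
proof (induction m arbitrary: k)
  case Nil
  then have "[k..<length e] = []" by simp
  then have "length e \<le> k" by auto
  then show ?case by (simp add: drop_empty_def)
next
  case (Cons fibre m)
  show ?case
  proof (cases fibre)
    case Nil
    then show ?thesis using Cons by (simp add: drop_empty_def)
  next
    case (Cons i js)
    then have f: "fibre = [i]" using Cons.prems(1) by (cases js) auto
    have c: "i # concat m = [k..<length e]" using Cons.prems(2) f by simp
    then have k: "k < length e" by (cases "k < length e") auto
    then have ik: "i = k" "concat m = [Suc k..<length e]" using c by (simp_all add: upt_conv_Cons)
    have ne: "e ! k \<noteq> []" using Cons.prems(3) nth_mem[OF k] by metis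
    then obtain y ys where y: "e ! k = y # ys" by (cases "e ! k") auto
    have IH: "drop_empty (map (\<lambda>fibre. concat (map ((!) e) fibre)) m) = drop (Suc k) e \<and>
        image_inclusion (Suc k) (map (\<lambda>fibre. concat (map ((!) e) fibre)) m) = m"
      by (rule Cons.IH) (use Cons.prems ik k in auto)
    then show ?thesis using f ik(1) y Cons_nth_drop_Suc[OF k] by (simp add: drop_empty_def)
  qed
qed

lemma order_inclusions_fibre_lists: "order_inclusions \<subseteq> fibre_lists"
proof
  fix m assume "m \<in> order_inclusions"
  then have "concat m = [0..<length (concat m)]" by (simp only: order_inclusions_def mem_Collect_eq)
  then show "m \<in> fibre_lists" unfolding fibre_lists_mset by (rule arg_cong)
qed

lemma DeltaS_factorization:
  "unique_factorization DeltaS_plus {L. epi DeltaS_plus L} order_inclusions (image_inclusion 0) drop_empty"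
proof (rule unique_factorization.intro)
  show "is_category DeltaS_plus" by (rule is_category_DeltaS_plus)
  show "is_category (DeltaS_plus\<lparr>arrs := {L. epi DeltaS_plus L}\<rparr>)"
    using is_category_EpiDeltaS_plus unfolding EpiDeltaS_plus_def .
  show "{L. epi DeltaS_plus L} \<subseteq> arrs DeltaS_plus" by (auto simp: epi_def)
  show "order_inclusions \<subseteq> arrs DeltaS_plus" using order_inclusions_fibre_lists by simp
next
  fix g assume "g \<in> arrs DeltaS_plus"
  then have g: "g \<in> fibre_lists" by simp
  have "image_inclusion 0 g \<in> order_inclusions"
    using image_inclusion_fibres[of _ 0 g] concat_image_inclusion[of 0 g] by (auto simp: order_inclusions_def simp del: length_concat)
  moreover have "epi DeltaS_plus (drop_empty g)"
    unfolding epi_DeltaS_plus_iff using g by (auto simp: fibre_lists_mset concat_drop_empty simp del: length_concat mset_concat) (simp add: drop_empty_def)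
  moreover have "src DeltaS_plus (image_inclusion 0 g) = trg DeltaS_plus (drop_empty g)"
    unfolding DeltaS_plus_simps concat_image_inclusion by simp
  moreover have "cmp DeltaS_plus (image_inclusion 0 g) (drop_empty g) = g"
    using image_inclusion_factor[of "[]" g] by simp
  ultimately show "image_inclusion 0 g \<in> order_inclusions \<and> drop_empty g \<in> {L. epi DeltaS_plus L} \<and>
      src DeltaS_plus (image_inclusion 0 g) = trg DeltaS_plus (drop_empty g) \<and> cmp DeltaS_plus (image_inclusion 0 g) (drop_empty g) = g"
    by blast
next
  fix m e assume m: "m \<in> order_inclusions" and e: "e \<in> {L. epi DeltaS_plus L}" and me: "src DeltaS_plus m = trg DeltaS_plus e"
  have "drop_empty (map (\<lambda>fibre. concat (map ((!) e) fibre)) m) = drop 0 e \<and>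
      image_inclusion 0 (map (\<lambda>fibre. concat (map ((!) e) fibre)) m) = m"
    by (rule inclusion_epi_unique)
      (use m e me in \<open>auto simp: order_inclusions_def epi_DeltaS_plus_iff simp del: length_concat\<close>)
  then show "image_inclusion 0 (cmp DeltaS_plus m e) = m \<and> drop_empty (cmp DeltaS_plus m e) = e" by simp
next
  fix X :: nat
  show "ident DeltaS_plus X \<in> order_inclusions" by (simp add: order_inclusions_def concat_singletons del: length_concat)
qed

section \<open>Tensor powers as targets of universal multilinear maps\<close>

section \<open>Tensor powers\<close>

definition multilinear ::
  "('k, 'r) ring_scheme \<Rightarrow> ('k, 'm) module \<Rightarrow> nat \<Rightarrow> ('k, 'n) module \<Rightarrow> ('m list \<Rightarrow> 'n) \<Rightarrow> bool" where
  "multilinear R M n N \<phi> \<longleftrightarrow> \<phi> \<in> tuples M n \<rightarrow> carrier N \<and>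
     (\<forall>us vs x y. us @ x # vs \<in> tuples M n \<longrightarrow> us @ y # vs \<in> tuples M n \<longrightarrow>
        \<phi> (us @ (x \<oplus>\<^bsub>M\<^esub> y) # vs) = \<phi> (us @ x # vs) \<oplus>\<^bsub>N\<^esub> \<phi> (us @ y # vs)) \<and>
     (\<forall>us vs r x. r \<in> carrier R \<longrightarrow> us @ x # vs \<in> tuples M n \<longrightarrow>
        \<phi> (us @ (r \<odot>\<^bsub>M\<^esub> x) # vs) = r \<odot>\<^bsub>N\<^esub> \<phi> (us @ x # vs))"

lemma multilinearD:
  assumes "multilinear R M n N \<phi>"
  shows "as \<in> tuples M n \<Longrightarrow> \<phi> as \<in> carrier N"
    "\<lbrakk>us @ x # vs \<in> tuples M n; us @ y # vs \<in> tuples M n\<rbrakk> \<Longrightarrow>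
      \<phi> (us @ (x \<oplus>\<^bsub>M\<^esub> y) # vs) = \<phi> (us @ x # vs) \<oplus>\<^bsub>N\<^esub> \<phi> (us @ y # vs)"
    "\<lbrakk>r \<in> carrier R; us @ x # vs \<in> tuples M n\<rbrakk> \<Longrightarrow> \<phi> (us @ (r \<odot>\<^bsub>M\<^esub> x) # vs) = r \<odot>\<^bsub>N\<^esub> \<phi> (us @ x # vs)"
  using assms unfolding multilinear_def by blast+

definition power_gens :: "('k, 'r) ring_scheme \<Rightarrow> ('k, 'm) module \<Rightarrow> nat \<Rightarrow> ('m list \<Rightarrow> 'k) set" where
  "power_gens R M n =
    (let F = free_mod R (tuples M n) in
      {fgen R (us @ (x \<oplus>\<^bsub>M\<^esub> y) # vs) \<ominus>\<^bsub>F\<^esub> (fgen R (us @ x # vs) \<oplus>\<^bsub>F\<^esub> fgen R (us @ y # vs))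
          | us vs x y. us @ x # vs \<in> tuples M n \<and> us @ y # vs \<in> tuples M n} \<union>
       {fgen R (us @ (r \<odot>\<^bsub>M\<^esub> x) # vs) \<ominus>\<^bsub>F\<^esub> r \<odot>\<^bsub>F\<^esub> fgen R (us @ x # vs)
          | us vs r x. r \<in> carrier R \<and> us @ x # vs \<in> tuples M n})"

lemma power_rels_span: "power_rels R M n = span R (free_mod R (tuples M n)) (power_gens R M n)"
  by (simp add: power_rels_def power_gens_def Let_def)

lemma power_gens_cases:
  assumes "g \<in> power_gens R M n"
  obtains (add) us vs x y where "us @ x # vs \<in> tuples M n" "us @ y # vs \<in> tuples M n"
      "g = fgen R (us @ (x \<oplus>\<^bsub>M\<^esub> y) # vs) \<ominus>\<^bsub>free_mod R (tuples M n)\<^esub>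
        (fgen R (us @ x # vs) \<oplus>\<^bsub>free_mod R (tuples M n)\<^esub> fgen R (us @ y # vs))"
  | (smult) us vs r x where "r \<in> carrier R" "us @ x # vs \<in> tuples M n"
      "g = fgen R (us @ (r \<odot>\<^bsub>M\<^esub> x) # vs) \<ominus>\<^bsub>free_mod R (tuples M n)\<^esub> r \<odot>\<^bsub>free_mod R (tuples M n)\<^esub> fgen R (us @ x # vs)"
  using assms unfolding power_gens_def Let_def by blast

lemma power_gensI:
  "\<lbrakk>us @ x # vs \<in> tuples M n; us @ y # vs \<in> tuples M n\<rbrakk> \<Longrightarrow>
    fgen R (us @ (x \<oplus>\<^bsub>M\<^esub> y) # vs) \<ominus>\<^bsub>free_mod R (tuples M n)\<^esub>
        (fgen R (us @ x # vs) \<oplus>\<^bsub>free_mod R (tuples M n)\<^esub> fgen R (us @ y # vs)) \<in> power_gens R M n"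
  "\<lbrakk>r \<in> carrier R; us @ x # vs \<in> tuples M n\<rbrakk> \<Longrightarrow>
    fgen R (us @ (r \<odot>\<^bsub>M\<^esub> x) # vs) \<ominus>\<^bsub>free_mod R (tuples M n)\<^esub> r \<odot>\<^bsub>free_mod R (tuples M n)\<^esub> fgen R (us @ x # vs) \<in> power_gens R M n"
  unfolding power_gens_def Let_def by blast+

definition tensor_tuple :: "('k, 'r) ring_scheme \<Rightarrow> ('k, 'm) module \<Rightarrow> nat \<Rightarrow> 'm list \<Rightarrow> ('m list \<Rightarrow> 'k) set" where
  "tensor_tuple R M n as = power_rels R M n +>\<^bsub>free_mod R (tuples M n)\<^esub> fgen R as"

context
  fixes R :: "('k, 'r) ring_scheme" and M :: "('k, 'm) module" and n :: nat
  assumes M: "module R M"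
begin

interpretation M: module R M by (rule M)
interpretation F: module R "free_mod R (tuples M n)" by (rule free_mod_module[OF M.R.cring_axioms])

lemma tuples_add: "\<lbrakk>us @ x # vs \<in> tuples M n; us @ y # vs \<in> tuples M n\<rbrakk> \<Longrightarrow> us @ (x \<oplus>\<^bsub>M\<^esub> y) # vs \<in> tuples M n"
  and tuples_smult: "\<lbrakk>r \<in> carrier R; us @ x # vs \<in> tuples M n\<rbrakk> \<Longrightarrow> us @ (r \<odot>\<^bsub>M\<^esub> x) # vs \<in> tuples M n"
  by (auto simp: tuples_def)

lemma tuple_fgen: "as \<in> tuples M n \<Longrightarrow> fgen R as \<in> carrier (free_mod R (tuples M n))"
  by (rule fgen_carrier[OF M.R.cring_axioms])

lemma power_gens_carrier: "power_gens R M n \<subseteq> carrier (free_mod R (tuples M n))"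
proof
  fix g assume "g \<in> power_gens R M n"
  then show "g \<in> carrier (free_mod R (tuples M n))"
    by (cases rule: power_gens_cases) (simp_all add: tuple_fgen tuples_add tuples_smult)
qed

lemma power_rels_submodule: "submodule (power_rels R M n) R (free_mod R (tuples M n))"
  unfolding power_rels_span by (rule span_submodule[OF F.module_axioms power_gens_carrier])

lemma tensor_power_module: "module R (tensor_power R M n)"
  unfolding tensor_power_def by (rule quot_module[OF F.module_axioms power_rels_submodule])

lemma power_proj_hom:
  "(\<lambda>u. power_rels R M n +>\<^bsub>free_mod R (tuples M n)\<^esub> u) \<in> mod_hom R (free_mod R (tuples M n)) (tensor_power R M n)"
  unfolding tensor_power_def by (rule quot_proj_hom[OF F.module_axioms power_rels_submodule])

lemma power_coset_eqI:
  assumes "u \<ominus>\<^bsub>free_mod R (tuples M n)\<^esub> v \<in> power_gens R M n"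
    "u \<in> carrier (free_mod R (tuples M n))" "v \<in> carrier (free_mod R (tuples M n))"
  shows "power_rels R M n +>\<^bsub>free_mod R (tuples M n)\<^esub> u = power_rels R M n +>\<^bsub>free_mod R (tuples M n)\<^esub> v"
proof (rule coset_eq_iff[OF F.module_axioms power_rels_submodule assms(2,3), THEN iffD2])
  show "u \<ominus>\<^bsub>free_mod R (tuples M n)\<^esub> v \<in> power_rels R M n"
    unfolding power_rels_span by (rule subsetD[OF span_incl assms(1)])
qed

lemma tensor_tuple_multilinear: "multilinear R M n (tensor_power R M n) (tensor_tuple R M n)"
  unfolding multilinear_def
proof (intro conjI allI impI Pi_I)
  note p = mod_homD[OF power_proj_hom]
  show "tensor_tuple R M n as \<in> carrier (tensor_power R M n)" if "as \<in> tuples M n" for as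
    unfolding tensor_tuple_def by (rule p(1)[OF tuple_fgen[OF that]])
  fix us vs x assume x: "us @ x # vs \<in> tuples M n"
  { fix y assume y: "us @ y # vs \<in> tuples M n"
    show "tensor_tuple R M n (us @ (x \<oplus>\<^bsub>M\<^esub> y) # vs) =
        tensor_tuple R M n (us @ x # vs) \<oplus>\<^bsub>tensor_power R M n\<^esub> tensor_tuple R M n (us @ y # vs)"
      unfolding tensor_tuple_def p(2)[OF tuple_fgen[OF x] tuple_fgen[OF y], symmetric]
      by (rule power_coset_eqI[OF power_gensI(1)[OF x y]]) (simp_all add: tuple_fgen tuples_add x y) }
  { fix r assume r: "r \<in> carrier R"
    show "tensor_tuple R M n (us @ (r \<odot>\<^bsub>M\<^esub> x) # vs) = r \<odot>\<^bsub>tensor_power R M n\<^esub> tensor_tuple R M n (us @ x # vs)"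
      unfolding tensor_tuple_def p(3)[OF r tuple_fgen[OF x], symmetric]
      by (rule power_coset_eqI[OF power_gensI(2)[OF r x]]) (simp_all add: tuple_fgen tuples_smult x r) }
qed

lemmas tensor_tuple_closed = multilinearD(1)[OF tensor_tuple_multilinear]

lemma tensor_tuple_zero:
  assumes "as \<in> tuples M n" "\<zero>\<^bsub>M\<^esub> \<in> set as"
  shows "tensor_tuple R M n as = \<zero>\<^bsub>tensor_power R M n\<^esub>"
proof -
  interpret T: module R "tensor_power R M n" by (rule tensor_power_module)
  obtain us vs where as: "as = us @ \<zero>\<^bsub>M\<^esub> # vs" using split_list[OF assms(2)] by blast
  have "tensor_tuple R M n (us @ (\<zero>\<^bsub>R\<^esub> \<odot>\<^bsub>M\<^esub> \<zero>\<^bsub>M\<^esub>) # vs) = \<zero>\<^bsub>R\<^esub> \<odot>\<^bsub>tensor_power R M n\<^esub> tensor_tuple R M n (us @ \<zero>\<^bsub>M\<^esub> # vs)"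
    by (rule multilinearD(3)[OF tensor_tuple_multilinear]) (use assms(1) as in auto)
  then show ?thesis using as tensor_tuple_closed[OF assms(1)] by simp
qed

lemma power_hom_eqI:
  assumes N: "module R N" and h: "h \<in> mod_hom R (tensor_power R M n) N" and h': "h' \<in> mod_hom R (tensor_power R M n) N"
    and eq: "\<And>as. as \<in> tuples M n \<Longrightarrow> h (tensor_tuple R M n as) = h' (tensor_tuple R M n as)"
    and z: "z \<in> carrier (tensor_power R M n)"
  shows "h z = h' z"
proof -
  obtain u where u: "u \<in> carrier (free_mod R (tuples M n))" "z = power_rels R M n +>\<^bsub>free_mod R (tuples M n)\<^esub> u"
    using z unfolding tensor_power_def by (rule quot_cosetE[OF F.module_axioms power_rels_submodule])
  show ?thesis unfolding u(2)
    by (rule free_mod_hom_eqI[OF M.R.cring_axioms N mod_hom_comp[OF power_proj_hom h] mod_hom_comp[OF power_proj_hom h'] _ u(1)])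
      (use eq in \<open>simp add: tensor_tuple_def\<close>)
qed

text \<open>Formulated for any linear map with multilinear values on generators: it serves the
  universal property and also shows, in \<open>sym_bar_far\<close>, that the multiplication maps
  preserve the relations.\<close>

lemma multilinear_kills_rels:
  assumes N: "module R N" and h: "h \<in> mod_hom R (free_mod R (tuples M n)) N"
    and v: "\<And>as. as \<in> tuples M n \<Longrightarrow> h (fgen R as) = \<phi> as" and \<phi>: "multilinear R M n N \<phi>"
    and u: "u \<in> power_rels R M n"
  shows "h u = \<zero>\<^bsub>N\<^esub>"
proof (rule span_hom_zero[OF F.module_axioms N h power_gens_carrier _ u[unfolded power_rels_span]])
  interpret N: module R N by (rule N)
  fix g assume "g \<in> power_gens R M n"
  note hm = mod_hom_minus[OF F.module_axioms N h] and hD = mod_homD[OF h] and \<phi>D = multilinearD[OF \<phi>]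
  from \<open>g \<in> power_gens R M n\<close> show "h g = \<zero>\<^bsub>N\<^esub>"
  proof (cases rule: power_gens_cases)
    case (add us vs x y)
    then show ?thesis by (simp add: hm hD v tuple_fgen tuples_add \<phi>D minus_eq_zero_iff[OF N])
  next
    case (smult us vs r x)
    then show ?thesis by (simp add: hm hD v tuple_fgen tuples_smult \<phi>D minus_eq_zero_iff[OF N])
  qed
qed

definition power_lift :: "('k, 'n) module \<Rightarrow> ('m list \<Rightarrow> 'n) \<Rightarrow> ('m list \<Rightarrow> 'k) set \<Rightarrow> 'n" where
  "power_lift N \<phi> = quot_lift (lin_ext R N \<phi>)"

context
  fixes N :: "('k, 'n) module" and \<phi>
  assumes N: "module R N" and \<phi>: "multilinear R M n N \<phi>"
begin

lemma multilinear_lin_ext: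
  "lin_ext R N \<phi> \<in> mod_hom R (free_mod R (tuples M n)) N" "as \<in> tuples M n \<Longrightarrow> lin_ext R N \<phi> (fgen R as) = \<phi> as"
proof -
  have a: "\<phi> \<in> tuples M n \<rightarrow> carrier N" using multilinearD(1)[OF \<phi>] by auto
  show "lin_ext R N \<phi> \<in> mod_hom R (free_mod R (tuples M n)) N" by (rule lin_ext_hom[OF N a])
  show "as \<in> tuples M n \<Longrightarrow> lin_ext R N \<phi> (fgen R as) = \<phi> as" by (rule lin_ext_fgen[OF N a])
qed

lemmas multilinear_lin_ext_rels = multilinear_kills_rels[OF N multilinear_lin_ext(1) multilinear_lin_ext(2) \<phi>]

lemma power_lift_hom: "power_lift N \<phi> \<in> mod_hom R (tensor_power R M n) N"
  unfolding power_lift_def tensor_power_def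
  by (rule quot_lift_hom[OF F.module_axioms power_rels_submodule N multilinear_lin_ext(1) multilinear_lin_ext_rels])

lemma power_lift_tuple: "as \<in> tuples M n \<Longrightarrow> power_lift N \<phi> (tensor_tuple R M n as) = \<phi> as"
  unfolding power_lift_def tensor_tuple_def
  using quot_lift_coset[OF F.module_axioms power_rels_submodule N multilinear_lin_ext(1) multilinear_lin_ext_rels tuple_fgen]
    multilinear_lin_ext(2) by simp

end

end

section \<open>Products over ordered fibres and their functoriality\<close>

section \<open>The symmetric bar construction as a functor\<close>

context augmented_algebra
begin

definition fibre_prod :: "'a list \<Rightarrow> nat list \<Rightarrow> 'a" where
  "fibre_prod as fibre = foldr (\<lambda>i b. as ! i \<otimes>\<^bsub>A\<^esub> b) fibre \<one>\<^bsub>A\<^esub>"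

lemma fibre_prod_simps [simp]:
  "fibre_prod as [] = \<one>\<^bsub>A\<^esub>" "fibre_prod as (i # fibre) = as ! i \<otimes>\<^bsub>A\<^esub> fibre_prod as fibre"
  by (simp_all add: fibre_prod_def)

lemma nth_carrier: "\<lbrakk>set as \<subseteq> carrier A; i < length as\<rbrakk> \<Longrightarrow> as ! i \<in> carrier A"
  by (meson nth_mem subsetD)

lemma fibre_prod_closed:
  "\<lbrakk>set as \<subseteq> carrier A; \<forall>i\<in>set fibre. i < length as\<rbrakk> \<Longrightarrow> fibre_prod as fibre \<in> carrier A"
  by (induction fibre) (auto simp: nth_carrier)

lemma fibre_prod_append:
  "\<lbrakk>set as \<subseteq> carrier A; \<forall>i\<in>set (f @ g). i < length as\<rbrakk> \<Longrightarrow>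
    fibre_prod as (f @ g) = fibre_prod as f \<otimes>\<^bsub>A\<^esub> fibre_prod as g"
  by (induction f) (auto simp: nth_carrier fibre_prod_closed A.m_assoc)

text \<open>Fibres of a composite are concatenations of fibres, and by associativity the product
  over a concatenation is the product of the products. This is the composition law of the bar
  construction.\<close>

lemma fibre_prod_concat:
  assumes "set as \<subseteq> carrier A" "\<And>fibre i. \<lbrakk>fibre \<in> set L; i \<in> set fibre\<rbrakk> \<Longrightarrow> i < length as" "\<forall>j\<in>set f. j < length L"
  shows "fibre_prod as (concat (map ((!) L) f)) = fibre_prod (map (fibre_prod as) L) f"
  using assms(3)
proof (induction f)
  case (Cons j f)
  have b: "i < length as" if "i \<in> set (L ! j)" "j < length L" for i j using assms(2)[OF nth_mem[OF that(2)] that(1)] .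
  have "fibre_prod as (concat (map ((!) L) (j # f))) = fibre_prod as (L ! j) \<otimes>\<^bsub>A\<^esub> fibre_prod as (concat (map ((!) L) f))"
    unfolding list.map concat.simps by (rule fibre_prod_append[OF assms(1)]) (use Cons.prems b in auto)
  then show ?case using Cons by simp
qed simp

lemma fibre_prod_indep:
  assumes "length us \<notin> set fibre"
  shows "fibre_prod (us @ x # vs) fibre = fibre_prod (us @ y # vs) fibre"
  using assms by (induction fibre) (auto simp: nth_append nth_Cons split: nat.splits)

text \<open>In a distinct fibre the varied position occurs exactly once. The factors before it
  distribute from the left, and the product of the factors after it does not depend on the varied
  entry. Both laws are proved in one induction over sublists through the position.\<close>

lemma fibre_prod_linear:
  assumes "distinct fibre" "length us \<in> set fibre" "set us \<subseteq> carrier A" "set vs \<subseteq> carrier A"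
    "\<forall>i\<in>set fibre. i < length (us @ x # vs)" "x \<in> carrier A"
  shows "y \<in> carrier A \<Longrightarrow> fibre_prod (us @ (x \<oplus>\<^bsub>A\<^esub> y) # vs) fibre =
      fibre_prod (us @ x # vs) fibre \<oplus>\<^bsub>A\<^esub> fibre_prod (us @ y # vs) fibre"
    and "r \<in> carrier k \<Longrightarrow> fibre_prod (us @ (r \<odot>\<^bsub>A\<^esub> x) # vs) fibre = r \<odot>\<^bsub>A\<^esub> fibre_prod (us @ x # vs) fibre"
proof -
  have cl: "fibre_prod (us @ z # vs) f \<in> carrier A" if "z \<in> carrier A" "set f \<subseteq> set fibre" for z f
    using that assms(3-5) by (intro fibre_prod_closed) auto
  have "(y \<in> carrier A \<longrightarrow> fibre_prod (us @ (x \<oplus>\<^bsub>A\<^esub> y) # vs) f =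
        fibre_prod (us @ x # vs) f \<oplus>\<^bsub>A\<^esub> fibre_prod (us @ y # vs) f) \<and>
      (r \<in> carrier k \<longrightarrow> fibre_prod (us @ (r \<odot>\<^bsub>A\<^esub> x) # vs) f = r \<odot>\<^bsub>A\<^esub> fibre_prod (us @ x # vs) f)"
    if "set f \<subseteq> set fibre" "distinct f" "length us \<in> set f" for f
    using that
  proof (induction f)
    case (Cons i f)
    show ?case
    proof (cases "i = length us")
      case True
      then have n: "length us \<notin> set f" using Cons.prems by auto
      have ind: "fibre_prod (us @ z # vs) f = fibre_prod (us @ x # vs) f" for z by (rule fibre_prod_indep[OF n])
      have c: "fibre_prod (us @ x # vs) f \<in> carrier A" by (rule cl[OF assms(6)]) (use Cons.prems in auto)
      show ?thesis
        using True c assms(6) ind[of "x \<oplus>\<^bsub>A\<^esub> y"] ind[of y] ind[of "r \<odot>\<^bsub>A\<^esub> x"] by (simp add: A.l_distr smult_mult_left)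
    next
      case False
      have i: "(us @ z # vs) ! i = (us @ x # vs) ! i" for z using False by (auto simp: nth_append nth_Cons split: nat.splits)
      have "i < length (us @ x # vs)" using assms(5) Cons.prems by auto
      then have ic: "(us @ x # vs) ! i \<in> carrier A" using assms(3,4,6) by (intro nth_carrier) auto
      have IH: "(y \<in> carrier A \<longrightarrow> fibre_prod (us @ (x \<oplus>\<^bsub>A\<^esub> y) # vs) f =
          fibre_prod (us @ x # vs) f \<oplus>\<^bsub>A\<^esub> fibre_prod (us @ y # vs) f) \<and>
        (r \<in> carrier k \<longrightarrow> fibre_prod (us @ (r \<odot>\<^bsub>A\<^esub> x) # vs) f = r \<odot>\<^bsub>A\<^esub> fibre_prod (us @ x # vs) f)"
        by (rule Cons.IH) (use Cons.prems False in auto)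
      have sf: "set f \<subseteq> set fibre" using Cons.prems by auto
      show ?thesis
        unfolding fibre_prod_simps i[of "x \<oplus>\<^bsub>A\<^esub> y"] i[of y] i[of "r \<odot>\<^bsub>A\<^esub> x"] using IH ic cl[OF assms(6) sf] cl[OF _ sf, of y]
        by (simp add: A.r_distr smult_mult_right)
    qed
  qed simp
  from this[OF subset_refl assms(1,2)]
  show "y \<in> carrier A \<Longrightarrow> fibre_prod (us @ (x \<oplus>\<^bsub>A\<^esub> y) # vs) fibre =
      fibre_prod (us @ x # vs) fibre \<oplus>\<^bsub>A\<^esub> fibre_prod (us @ y # vs) fibre"
    "r \<in> carrier k \<Longrightarrow> fibre_prod (us @ (r \<odot>\<^bsub>A\<^esub> x) # vs) fibre = r \<odot>\<^bsub>A\<^esub> fibre_prod (us @ x # vs) fibre" by auto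
qed

lemma module_A: "module k A" by (rule module_axioms)

section \<open>The bar construction of a submodule H closed under the relevant products, covering A
  and I at once\<close>

context
  fixes H and C :: "(nat, nat list list) category"
  assumes H: "submodule H k A" and C: "is_category C"
    and Cops: "src C = src DeltaS_plus" "trg C = trg DeltaS_plus" "ident C = ident DeltaS_plus" "cmp C = cmp DeltaS_plus"
    and CL: "arrs C \<subseteq> fibre_lists"
    and adm: "\<And>L as fibre. \<lbrakk>L \<in> arrs C; length as = length (concat L); set as \<subseteq> H; fibre \<in> set L\<rbrakk> \<Longrightarrow> fibre_prod as fibre \<in> H"
begin

abbreviation (input) "HM \<equiv> A\<lparr>carrier := H\<rparr>"

lemma HM: "module k HM" by (rule submodule.submodule_is_module[OF H module_A])

lemma H_carrier: "H \<subseteq> carrier A" by (rule submoduleE(1)[OF H])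

lemma HM_tuples: "as \<in> tuples HM n \<longleftrightarrow> length as = n \<and> set as \<subseteq> H" by (simp add: tuples_def)

lemma sym_bar_fob: "fob (sym_bar k HM) n = tensor_power k HM n" by (simp add: sym_bar_def)

lemma fibre_bound: "\<lbrakk>L \<in> arrs C; fibre \<in> set L; i \<in> set fibre\<rbrakk> \<Longrightarrow> i < length (concat L)"
  using fibre_less CL by blast

lemma prods_tuples:
  assumes "L \<in> arrs C" "as \<in> tuples HM (length (concat L))"
  shows "map (fibre_prod as) L \<in> tuples HM (length L)"
  using adm[OF assms(1)] assms(2) unfolding HM_tuples by auto

text \<open>Every position of the tuple belongs to exactly one fibre, so changing one entry changes
  exactly one factor of the resulting tensor, and that factor depends linearly on it.\<close>

lemma prods_multilinear:
  assumes L: "L \<in> arrs C"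
  shows "multilinear k HM (length (concat L)) (tensor_power k HM (length L)) (\<lambda>as. tensor_tuple k HM (length L) (map (fibre_prod as) L))"
proof -
  let ?t = "tensor_tuple k HM (length L)"
  \<comment> \<open>L is cut at the single fibre containing the position i; distinctness of the
    concatenation excludes i from all other fibres.\<close>
  have split: "\<exists>L1 f L2. L = L1 @ f # L2 \<and> i \<in> set f \<and> distinct f \<and> (\<forall>g\<in>set L1 \<union> set L2. i \<notin> set g)"
    if i: "i < length (concat L)" for i
  proof -
    have d: "distinct (concat L)" "i \<in> set (concat L)" using L CL i by (auto simp: fibre_lists_def simp del: set_concat length_concat)
    then obtain f where f: "f \<in> set L" "i \<in> set f" by auto
    then obtain L1 L2 where L12: "L = L1 @ f # L2" by (meson split_list)
    have "distinct f" "i \<notin> set (concat L1)" "i \<notin> set (concat L2)"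
      using d(1) f(2) unfolding L12 concat_append concat.simps distinct_append set_append by blast+
    then have "\<forall>g\<in>set L1 \<union> set L2. i \<notin> set g" by auto
    then show ?thesis using L12 f(2) \<open>distinct f\<close> by blast
  qed
  have bound: "\<forall>i\<in>set f. i < length as" if "f \<in> set L" "length as = length (concat L)" for f as
    using fibre_bound[OF L that(1)] that(2) by simp
  note tm = multilinearD[OF tensor_tuple_multilinear[OF HM]]
  show ?thesis
    unfolding multilinear_def
  proof (intro conjI allI impI Pi_I)
    fix as assume "as \<in> tuples HM (length (concat L))"
    then show "?t (map (fibre_prod as) L) \<in> carrier (tensor_power k HM (length L))" by (intro tm(1) prods_tuples L)
  next
    fix us vs x y assume x: "us @ x # vs \<in> tuples HM (length (concat L))" and y: "us @ y # vs \<in> tuples HM (length (concat L))"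
    have "length us < length (concat L)" using x unfolding HM_tuples by auto
    from split[OF this] obtain L1 f L2 where L12: "L = L1 @ f # L2" "length us \<in> set f" "distinct f"
      "\<forall>g\<in>set L1 \<union> set L2. length us \<notin> set g" by blast
    have ind: "map (fibre_prod (us @ z # vs)) L = map (fibre_prod (us @ x # vs)) L1 @ fibre_prod (us @ z # vs) f # map (fibre_prod (us @ x # vs)) L2" for z
      unfolding L12(1) using L12(4) fibre_prod_indep by auto
    have fl: "fibre_prod (us @ (x \<oplus>\<^bsub>A\<^esub> y) # vs) f = fibre_prod (us @ x # vs) f \<oplus>\<^bsub>A\<^esub> fibre_prod (us @ y # vs) f"
      by (rule fibre_prod_linear(1)[OF L12(3,2)]) (use x y H_carrier bound[of f "us @ x # vs"] L12(1) in \<open>auto simp: HM_tuples\<close>)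
    have "?t (map (fibre_prod (us @ x # vs)) L1 @ (fibre_prod (us @ x # vs) f \<oplus>\<^bsub>HM\<^esub> fibre_prod (us @ y # vs) f) # map (fibre_prod (us @ x # vs)) L2)
      = ?t (map (fibre_prod (us @ x # vs)) L) \<oplus>\<^bsub>tensor_power k HM (length L)\<^esub> ?t (map (fibre_prod (us @ y # vs)) L)"
      unfolding ind[of x] ind[of y]
      by (rule tm(2)) (use prods_tuples[OF L x] prods_tuples[OF L y] ind[of x] ind[of y] in simp_all)
    then show "?t (map (fibre_prod (us @ (x \<oplus>\<^bsub>HM\<^esub> y) # vs)) L) =
        ?t (map (fibre_prod (us @ x # vs)) L) \<oplus>\<^bsub>tensor_power k HM (length L)\<^esub> ?t (map (fibre_prod (us @ y # vs)) L)"
      using ind[of "x \<oplus>\<^bsub>A\<^esub> y"] fl by simp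
  next
    fix us vs r x assume r: "r \<in> carrier k" and x: "us @ x # vs \<in> tuples HM (length (concat L))"
    have "length us < length (concat L)" using x unfolding HM_tuples by auto
    from split[OF this] obtain L1 f L2 where L12: "L = L1 @ f # L2" "length us \<in> set f" "distinct f"
      "\<forall>g\<in>set L1 \<union> set L2. length us \<notin> set g" by blast
    have ind: "map (fibre_prod (us @ z # vs)) L = map (fibre_prod (us @ x # vs)) L1 @ fibre_prod (us @ z # vs) f # map (fibre_prod (us @ x # vs)) L2" for z
      unfolding L12(1) using L12(4) fibre_prod_indep by auto
    have fl: "fibre_prod (us @ (r \<odot>\<^bsub>A\<^esub> x) # vs) f = r \<odot>\<^bsub>A\<^esub> fibre_prod (us @ x # vs) f"
      by (rule fibre_prod_linear(2)[OF L12(3,2)]) (use x r H_carrier bound[of f "us @ x # vs"] L12(1) in \<open>auto simp: HM_tuples\<close>)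
    have "?t (map (fibre_prod (us @ x # vs)) L1 @ (r \<odot>\<^bsub>HM\<^esub> fibre_prod (us @ x # vs) f) # map (fibre_prod (us @ x # vs)) L2)
      = r \<odot>\<^bsub>tensor_power k HM (length L)\<^esub> ?t (map (fibre_prod (us @ x # vs)) L)"
      unfolding ind[of x] by (rule tm(3)[OF r]) (use prods_tuples[OF L x] ind[of x] in simp)
    then show "?t (map (fibre_prod (us @ (r \<odot>\<^bsub>HM\<^esub> x) # vs)) L) = r \<odot>\<^bsub>tensor_power k HM (length L)\<^esub> ?t (map (fibre_prod (us @ x # vs)) L)"
      using ind[of "r \<odot>\<^bsub>A\<^esub> x"] fl by simp
  qed
qed

lemma sym_bar_far:
  assumes L: "L \<in> arrs C"
  shows "far (sym_bar k HM) L \<in> mod_hom k (tensor_power k HM (length (concat L))) (tensor_power k HM (length L))" (is ?hom)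
    and "as \<in> tuples HM (length (concat L)) \<Longrightarrow>
      far (sym_bar k HM) L (tensor_tuple k HM (length (concat L)) as) = tensor_tuple k HM (length L) (map (fibre_prod as) L)"
      (is "_ \<Longrightarrow> ?val")
proof -
  let ?F = "free_mod k (tuples HM (length (concat L)))" and ?F' = "free_mod k (tuples HM (length L))"
  let ?l = "lin_ext k ?F' (\<lambda>as. fgen k (map (fibre_prod as) L))"
  have far: "far (sym_bar k HM) L = quot_map ?F' (power_rels k HM (length L)) ?l"
    by (simp add: sym_bar_def Let_def fibre_prod_def[abs_def])
  note FM = free_mod_module[OF R.cring_axioms]
  have a: "(\<lambda>as. fgen k (map (fibre_prod as) L)) \<in> tuples HM (length (concat L)) \<rightarrow> carrier ?F'"
    using prods_tuples[OF L] tuple_fgen[OF HM] by blast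
  have l: "?l \<in> mod_hom k ?F ?F'" by (rule lin_ext_hom[OF FM a])
  have lv: "?l (fgen k as) = fgen k (map (fibre_prod as) L)" if "as \<in> tuples HM (length (concat L))" for as
    by (rule lin_ext_fgen[OF FM a that])
  have sub: "?l u \<in> power_rels k HM (length L)" if u: "u \<in> power_rels k HM (length (concat L))" for u
  proof -
    have uc: "u \<in> carrier ?F" using u module.submoduleE(1)[OF FM power_rels_submodule[OF HM]] by blast
    \<comment> \<open>Followed by the projection to the tensor power, the linear extension has
      multilinear values, so it kills the relations; vanishing in the quotient means lying in the
      relations of the target.\<close>
    have "power_rels k HM (length L) +>\<^bsub>?F'\<^esub> ?l u = \<zero>\<^bsub>tensor_power k HM (length L)\<^esub>"
      by (rule multilinear_kills_rels[OF HM tensor_power_module[OF HM] mod_hom_comp[OF l power_proj_hom[OF HM]] _ prods_multilinear[OF L] u])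
        (simp add: lv tensor_tuple_def)
    then show ?thesis
      using quot_proj_eq_zero_iff[OF FM power_rels_submodule[OF HM] mod_homD(1)[OF l uc]] unfolding tensor_power_def by simp
  qed
  note U = FM power_rels_submodule[OF HM] FM power_rels_submodule[OF HM]
  show ?hom unfolding far tensor_power_def by (rule quot_map_hom[OF U l sub])
  assume as: "as \<in> tuples HM (length (concat L))"
  have "quot_map ?F' (power_rels k HM (length L)) ?l (power_rels k HM (length (concat L)) +>\<^bsub>?F\<^esub> fgen k as) =
      power_rels k HM (length L) +>\<^bsub>?F'\<^esub> ?l (fgen k as)"
    by (rule quot_map_coset[OF U l sub tuple_fgen[OF HM as]])
  then show ?val unfolding far tensor_tuple_def lv[OF as] .
qed

lemma singleton_prods: "as \<in> tuples HM n \<Longrightarrow> map (fibre_prod as) (map (\<lambda>i. [i]) [0..<n]) = as"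
  using H_carrier by (intro nth_equalityI) (auto simp: HM_tuples nth_carrier)

lemma sym_bar_kfun: "is_kfun k C (sym_bar k HM)"
  unfolding is_kfun_def
proof (intro conjI ballI impI)
  fix X show "module k (fob (sym_bar k HM) X)" unfolding sym_bar_fob by (rule tensor_power_module[OF HM])
next
  fix L assume "L \<in> arrs C"
  from sym_bar_far(1)[OF this] show "far (sym_bar k HM) L \<in> mod_hom k (fob (sym_bar k HM) (src C L)) (fob (sym_bar k HM) (trg C L))"
    unfolding sym_bar_fob Cops DeltaS_plus_simps .
next
  fix X z assume X: "X \<in> obs C" and z: "z \<in> elts (sym_bar k HM) X"
  have i: "ident C X \<in> arrs C" "length (concat (ident C X)) = X" "length (ident C X) = X"
    using is_categoryD(3-5)[OF C X] unfolding Cops(1,2) DeltaS_plus_simps by auto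
  note far = sym_bar_far[OF i(1), unfolded i(2,3)]
  show "far (sym_bar k HM) (ident C X) z = z"
  proof (rule power_hom_eqI[OF HM tensor_power_module[OF HM] far(1) mod_hom_id _ z[unfolded sym_bar_fob]])
    fix as assume as: "as \<in> tuples HM X"
    have "map (fibre_prod as) (ident C X) = as" using singleton_prods[OF as] unfolding Cops by simp
    then show "far (sym_bar k HM) (ident C X) (tensor_tuple k HM X as) = tensor_tuple k HM X as" using far(2)[OF as] by simp
  qed
next
  fix L K z assume L: "L \<in> arrs C" and K: "K \<in> arrs C" and KL: "src C K = trg C L"
    and z: "z \<in> elts (sym_bar k HM) (src C L)"
  have kl: "cmp C K L \<in> arrs C" "length (concat (cmp C K L)) = length (concat L)" "length (cmp C K L) = length K"
    "length (concat K) = length L"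
    using is_categoryD(6-8)[OF C L K KL] KL unfolding Cops(1,2) DeltaS_plus_simps by auto
  note farKL = sym_bar_far[OF kl(1), unfolded kl(2,3)] and farK = sym_bar_far[OF K, unfolded kl(4)] and farL = sym_bar_far[OF L]
  show "far (sym_bar k HM) (cmp C K L) z = far (sym_bar k HM) K (far (sym_bar k HM) L z)"
  proof (rule power_hom_eqI[OF HM tensor_power_module[OF HM] farKL(1) mod_hom_comp[OF farL(1) farK(1)]])
    show "z \<in> carrier (tensor_power k HM (length (concat L)))" using z unfolding sym_bar_fob Cops DeltaS_plus_simps .
    fix as assume as: "as \<in> tuples HM (length (concat L))"
    have "map (fibre_prod as) (cmp C K L) = map (fibre_prod (map (fibre_prod as) L)) K"
    proof -
      have "fibre_prod as (concat (map ((!) L) f)) = fibre_prod (map (fibre_prod as) L) f" if "f \<in> set K" for f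
        by (rule fibre_prod_concat)
          (use as H_carrier fibre_bound[OF L] fibre_bound[OF K that] kl(4) in \<open>auto simp: HM_tuples simp del: length_concat\<close>)
      then show ?thesis unfolding Cops by simp
    qed
    then show "far (sym_bar k HM) (cmp C K L) (tensor_tuple k HM (length (concat L)) as) =
        far (sym_bar k HM) K (far (sym_bar k HM) L (tensor_tuple k HM (length (concat L)) as))"
      unfolding farKL(2)[OF as] farL(2)[OF as] farK(2)[OF prods_tuples[OF L as]] by simp
  qed
qed

end

end

section \<open>Comparing the extension of the bar construction of I with that of A\<close>

section \<open>The symmetric bar construction as a Kan extension\<close>

declare length_concat [simp del]

lemma multilinear_restrict:
  assumes "multilinear R M n N \<phi>" "H \<subseteq> carrier M"
  shows "multilinear R (M\<lparr>carrier := H\<rparr>) n N \<phi>"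
proof -
  have sub: "as \<in> tuples M n" if "as \<in> tuples (M\<lparr>carrier := H\<rparr>) n" for as
    using that assms(2) by (auto simp: tuples_def)
  show ?thesis
    unfolding multilinear_def
  proof (intro conjI allI impI Pi_I)
    fix as assume "as \<in> tuples (M\<lparr>carrier := H\<rparr>) n"
    then show "\<phi> as \<in> carrier N" by (rule multilinearD(1)[OF assms(1) sub])
  next
    fix us vs x y assume "us @ x # vs \<in> tuples (M\<lparr>carrier := H\<rparr>) n" "us @ y # vs \<in> tuples (M\<lparr>carrier := H\<rparr>) n"
    from multilinearD(2)[OF assms(1) sub[OF this(1)] sub[OF this(2)]]
    show "\<phi> (us @ (x \<oplus>\<^bsub>M\<lparr>carrier := H\<rparr>\<^esub> y) # vs) = \<phi> (us @ x # vs) \<oplus>\<^bsub>N\<^esub> \<phi> (us @ y # vs)" by simp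
  next
    fix us vs r x assume "r \<in> carrier R" "us @ x # vs \<in> tuples (M\<lparr>carrier := H\<rparr>) n"
    from multilinearD(3)[OF assms(1) this(1) sub[OF this(2)]]
    show "\<phi> (us @ (r \<odot>\<^bsub>M\<lparr>carrier := H\<rparr>\<^esub> x) # vs) = r \<odot>\<^bsub>N\<^esub> \<phi> (us @ x # vs)" by simp
  qed
qed

text \<open>Modulo \<open>S\<close> the projection and the zero map agree on all tensors of tuples,
  hence everywhere.\<close>

lemma tensor_tuples_generate:
  assumes M: "module R M" and S: "submodule S R (tensor_power R M n)"
    and gen: "\<And>as. as \<in> tuples M n \<Longrightarrow> tensor_tuple R M n as \<in> S"
    and z: "z \<in> carrier (tensor_power R M n)"
  shows "z \<in> S"
proof -
  let ?T = "tensor_power R M n"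
  note T = tensor_power_module[OF M, of n] and zero = quot_proj_eq_zero_iff[OF tensor_power_module[OF M] S]
  have "S +>\<^bsub>?T\<^esub> z = \<zero>\<^bsub>quot_mod ?T S\<^esub>"
    by (rule power_hom_eqI[OF M quot_module[OF T S] quot_proj_hom[OF T S] mod_hom_zero_map[OF quot_module[OF T S]] _ z])
      (simp add: zero gen tensor_tuple_closed[OF M])
  then show ?thesis using zero[OF z] by simp
qed

interpretation epi_incl: unique_factorization DeltaS_plus "{L. epi DeltaS_plus L}" order_inclusions "image_inclusion 0" drop_empty
  by (rule DeltaS_factorization)

context augmented_algebra
begin

abbreviation (input) "IA \<equiv> a_kernel A k \<epsilon>"
abbreviation (input) "IM \<equiv> A\<lparr>carrier := IA\<rparr>"
abbreviation (input) "BA \<equiv> sym_bar k A"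
abbreviation (input) "BI \<equiv> sym_bar k IM"

lemma aug_closed: "x \<in> carrier A \<Longrightarrow> \<epsilon> x \<in> carrier k" by (rule ring_hom_closed[OF aug_hom])

lemma aug_zero: "\<epsilon> \<zero>\<^bsub>A\<^esub> = \<zero>\<^bsub>k\<^esub>" by (rule ring_hom_zero[OF aug_hom A.ring_axioms R.ring_axioms])

lemma aug_neg:
  assumes "x \<in> carrier A"
  shows "\<epsilon> (\<ominus>\<^bsub>A\<^esub> x) = \<ominus>\<^bsub>k\<^esub> \<epsilon> x"
proof -
  have "\<epsilon> (\<ominus>\<^bsub>A\<^esub> x) \<oplus>\<^bsub>k\<^esub> \<epsilon> x = \<epsilon> (\<ominus>\<^bsub>A\<^esub> x \<oplus>\<^bsub>A\<^esub> x)"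
    by (rule ring_hom_add[OF aug_hom, symmetric]) (simp_all add: assms)
  also have "\<dots> = \<zero>\<^bsub>k\<^esub>" using assms aug_zero by (simp add: M.l_neg)
  finally show ?thesis using assms by (intro R.minus_equality[symmetric]) (simp_all add: aug_closed)
qed

lemma aug_ideal_iff: "x \<in> IA \<longleftrightarrow> x \<in> carrier A \<and> \<epsilon> x = \<zero>\<^bsub>k\<^esub>" by (simp add: a_kernel_def')

lemma aug_ideal_submodule: "submodule IA k A"
  by (rule submoduleI)
    (auto simp: aug_ideal_iff aug_zero aug_neg aug_linear ring_hom_add[OF aug_hom])

lemma aug_ideal_carrier: "IA \<subseteq> carrier A" by (auto simp: aug_ideal_iff)

lemma IM_module: "module k IM" by (rule submodule.submodule_is_module[OF aug_ideal_submodule module_A])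

lemma IM_tuples: "as \<in> tuples IM n \<longleftrightarrow> length as = n \<and> set as \<subseteq> IA" by (simp add: tuples_def)

lemma A_tuples: "as \<in> tuples A n \<longleftrightarrow> length as = n \<and> set as \<subseteq> carrier A" by (simp add: tuples_def)

lemma IM_tuples_A: "as \<in> tuples IM n \<Longrightarrow> as \<in> tuples A n"
  using aug_ideal_carrier by (auto simp: tuples_def)

text \<open>One factor in the kernel of the multiplicative map \<epsilon> suffices, and a non-empty
  fibre has a first factor. An empty fibre would give the unit, which is why I carries an action of
  the epimorphisms.\<close>

lemma fibre_prod_aug_ideal:
  assumes "fibre \<noteq> []" "\<forall>i\<in>set fibre. i < length as" "set as \<subseteq> IA"
  shows "fibre_prod as fibre \<in> IA"
proof -
  obtain i f where f: "fibre = i # f" using assms(1) by (cases fibre) auto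
  have "as ! i \<in> IA" using assms(2,3) f nth_mem[of i as] by auto
  moreover have "fibre_prod as f \<in> carrier A"
    by (rule fibre_prod_closed) (use assms(2,3) aug_ideal_carrier f in auto)
  ultimately show ?thesis
    unfolding f fibre_prod_simps aug_ideal_iff by (simp add: ring_hom_mult[OF aug_hom] aug_closed)
qed

lemma fibre_bound': "\<lbrakk>L \<in> fibre_lists; length as = length (concat L); fibre \<in> set L\<rbrakk> \<Longrightarrow> \<forall>i\<in>set fibre. i < length as"
  using fibre_less by auto

lemma A_adm: "\<lbrakk>L \<in> arrs DeltaS_plus; length as = length (concat L); set as \<subseteq> carrier A; fibre \<in> set L\<rbrakk> \<Longrightarrow>
    fibre_prod as fibre \<in> carrier A"
  by (rule fibre_prod_closed[OF _ fibre_bound']) simp_all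

lemma IM_adm: "\<lbrakk>L \<in> arrs EpiDeltaS_plus; length as = length (concat L); set as \<subseteq> IA; fibre \<in> set L\<rbrakk> \<Longrightarrow> fibre_prod as fibre \<in> IA"
  by (rule fibre_prod_aug_ideal[OF _ fibre_bound']) (auto simp: EpiDeltaS_plus_def epi_DeltaS_plus_iff)

lemma EpiDeltaS_plus_ops:
  "src EpiDeltaS_plus = src DeltaS_plus" "trg EpiDeltaS_plus = trg DeltaS_plus" "ident EpiDeltaS_plus = ident DeltaS_plus"
  "cmp EpiDeltaS_plus = cmp DeltaS_plus" "arrs EpiDeltaS_plus \<subseteq> fibre_lists"
  by (auto simp: EpiDeltaS_plus_def epi_DeltaS_plus_iff)

lemma A_carrier: "A\<lparr>carrier := carrier A\<rparr> = A" by simp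

lemma sym_bar_A_kfun: "is_kfun k DeltaS_plus BA"
  using sym_bar_kfun[OF carrier_is_submodule is_category_DeltaS_plus refl refl refl refl equalityD1[OF DeltaS_plus_simps(2)] A_adm]
  unfolding A_carrier .

lemma sym_bar_A_far:
  assumes "L \<in> fibre_lists"
  shows "far BA L \<in> mod_hom k (tensor_power k A (length (concat L))) (tensor_power k A (length L))"
    and "as \<in> tuples A (length (concat L)) \<Longrightarrow>
      far BA L (tensor_tuple k A (length (concat L)) as) = tensor_tuple k A (length L) (map (fibre_prod as) L)"
proof -
  have L: "L \<in> arrs DeltaS_plus" using assms by simp
  note far = sym_bar_far[OF carrier_is_submodule is_category_DeltaS_plus refl refl refl refl equalityD1[OF DeltaS_plus_simps(2)] A_adm L,
      unfolded A_carrier]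
  show "far BA L \<in> mod_hom k (tensor_power k A (length (concat L))) (tensor_power k A (length L))"
    by (rule far(1))
  show "as \<in> tuples A (length (concat L)) \<Longrightarrow>
      far BA L (tensor_tuple k A (length (concat L)) as) = tensor_tuple k A (length L) (map (fibre_prod as) L)"
    by (rule far(2))
qed

lemma sym_bar_I_kfun: "is_kfun k epi_incl.Esub BI"
  using sym_bar_kfun[OF aug_ideal_submodule is_category_EpiDeltaS_plus EpiDeltaS_plus_ops IM_adm] unfolding EpiDeltaS_plus_def .

lemma sym_bar_I_far:
  assumes "epi DeltaS_plus L"
  shows "far BI L \<in> mod_hom k (tensor_power k IM (length (concat L))) (tensor_power k IM (length L))"
    and "as \<in> tuples IM (length (concat L)) \<Longrightarrow>
      far BI L (tensor_tuple k IM (length (concat L)) as) = tensor_tuple k IM (length L) (map (fibre_prod as) L)"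
    and "as \<in> tuples IM (length (concat L)) \<Longrightarrow> map (fibre_prod as) L \<in> tuples IM (length L)"
proof -
  have L: "L \<in> arrs EpiDeltaS_plus" using assms by (simp add: EpiDeltaS_plus_def)
  show "far BI L \<in> mod_hom k (tensor_power k IM (length (concat L))) (tensor_power k IM (length L))"
    by (rule sym_bar_far(1)[OF aug_ideal_submodule is_category_EpiDeltaS_plus EpiDeltaS_plus_ops IM_adm L])
  assume as: "as \<in> tuples IM (length (concat L))"
  show "far BI L (tensor_tuple k IM (length (concat L)) as) = tensor_tuple k IM (length L) (map (fibre_prod as) L)"
    by (rule sym_bar_far(2)[OF aug_ideal_submodule is_category_EpiDeltaS_plus EpiDeltaS_plus_ops IM_adm L as])
  show "map (fibre_prod as) L \<in> tuples IM (length L)"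
    by (rule prods_tuples[OF aug_ideal_submodule is_category_EpiDeltaS_plus EpiDeltaS_plus_ops IM_adm L as])
qed

subsection \<open>The comparison map\<close>

text \<open>Over a general ring, tensor powers of an injection need not be injective; the tensor
  power of I is therefore mapped to that of A and not regarded as a subset.\<close>

definition power_incl :: "nat \<Rightarrow> ('a list \<Rightarrow> 'k) set \<Rightarrow> ('a list \<Rightarrow> 'k) set" where
  "power_incl n = power_lift k (tensor_power k A n) (tensor_tuple k A n)"

lemmas A_tuple_multilinear = tensor_tuple_multilinear[OF module_A]
lemmas A_power_module = tensor_power_module[OF module_A]
lemmas power_incl_aux = multilinear_restrict[OF A_tuple_multilinear aug_ideal_carrier]

lemma power_incl_hom: "power_incl n \<in> mod_hom k (tensor_power k IM n) (tensor_power k A n)"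
  unfolding power_incl_def by (rule power_lift_hom[OF IM_module A_power_module power_incl_aux])

lemma power_incl_tuple: "as \<in> tuples IM n \<Longrightarrow> power_incl n (tensor_tuple k IM n as) = tensor_tuple k A n as"
  unfolding power_incl_def by (rule power_lift_tuple[OF IM_module A_power_module power_incl_aux])

lemma power_incl_natural:
  assumes L: "epi DeltaS_plus L" and t: "t \<in> carrier (tensor_power k IM (length (concat L)))"
  shows "far BA L (power_incl (length (concat L)) t) = power_incl (length L) (far BI L t)"
proof -
  have L': "L \<in> fibre_lists" using L by (simp add: epi_def)
  note I = sym_bar_I_far[OF L] and A = sym_bar_A_far[OF L']
  show ?thesis
    by (rule power_hom_eqI[OF IM_module A_power_module mod_hom_comp[OF power_incl_hom A(1)] mod_hom_comp[OF I(1) power_incl_hom] _ t])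
      (simp add: power_incl_tuple I A IM_tuples_A)
qed

text \<open>On the summand m the entries from I are placed at the points hit by m, and the action of
  m on the bar construction of A inserts units at the missed points.\<close>

definition kan_compare :: "nat \<Rightarrow> (nat list list \<Rightarrow> ('a list \<Rightarrow> 'k) set) \<Rightarrow> ('a list \<Rightarrow> 'k) set" where
  "kan_compare Y = epi_incl.kan_lift BI Y (tensor_power k A Y) (\<lambda>m t. far BA m (power_incl (length (concat m)) t))"

lemma fobs: "fob BA n = tensor_power k A n" "fob BI n = tensor_power k IM n" by (simp_all add: sym_bar_def)

lemma overs: 
  assumes "m \<in> epi_incl.over Y"
  shows "m \<in> order_inclusions" "m \<in> fibre_lists" "length m = Y"
  using assms order_inclusions_fibre_lists by (auto simp: epi_incl.over_iff)

lemma kan_compare_aux: "m \<in> epi_incl.over Y \<Longrightarrow>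
    (\<lambda>t. far BA m (power_incl (length (concat m)) t)) \<in> mod_hom k (fob BI (src DeltaS_plus m)) (tensor_power k A Y)"
  unfolding fobs DeltaS_plus_simps using mod_hom_comp[OF power_incl_hom sym_bar_A_far(1)] overs by blast

lemma kan_compare_hom: "kan_compare Y \<in> mod_hom k (fob (epi_incl.kan_ext BI) Y) (tensor_power k A Y)"
  unfolding kan_compare_def
  by (rule epi_incl.kan_lift_hom[OF R.cring_axioms sym_bar_I_kfun A_power_module kan_compare_aux])

lemma kan_compare_in:
  assumes "m \<in> epi_incl.over Y" "t \<in> carrier (tensor_power k IM (length (concat m)))"
  shows "kan_compare Y (epi_incl.kan_in BI Y m t) = far BA m (power_incl (length (concat m)) t)"
  unfolding kan_compare_def
  by (rule epi_incl.kan_lift_in[OF R.cring_axioms sym_bar_I_kfun A_power_module kan_compare_aux assms(1)])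
    (simp_all add: fobs assms(2))

lemma kan_compare_tuple:
  assumes "m \<in> epi_incl.over Y" "as \<in> tuples IM (length (concat m))"
  shows "kan_compare Y (epi_incl.kan_in BI Y m (tensor_tuple k IM (length (concat m)) as)) = tensor_tuple k A Y (map (fibre_prod as) m)"
  using kan_compare_in[OF assms(1) tensor_tuple_closed[OF IM_module assms(2)]]
    sym_bar_A_far(2)[OF overs(2)[OF assms(1)] IM_tuples_A[OF assms(2)]] overs(3)[OF assms(1)]
  by (simp add: power_incl_tuple[OF assms(2)])

text \<open>With g m factored as m' e, both sides are the action of g m = m' e on the included
  tensor. The extension uses the action of e on the powers of I, and
  \<open>power_incl_natural\<close> carries it over to A.\<close>

lemma kan_compare_natural: "is_nat_trans k DeltaS_plus (epi_incl.kan_ext BI) BA kan_compare"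
  unfolding is_nat_trans_def fobs
proof (intro conjI ballI)
  fix X show "kan_compare X \<in> mod_hom k (fob (epi_incl.kan_ext BI) X) (tensor_power k A X)" by (rule kan_compare_hom)
next
  let ?D = DeltaS_plus
  fix g z assume g: "g \<in> arrs ?D" and z: "z \<in> elts (epi_incl.kan_ext BI) (src ?D g)"
  have gh: "far BA g \<in> mod_hom k (tensor_power k A (src ?D g)) (tensor_power k A (trg ?D g))"
    using is_kfunD(2)[OF sym_bar_A_kfun g] unfolding fobs .
  note rf = R.cring_axioms sym_bar_I_kfun
  show "kan_compare (trg ?D g) (far (epi_incl.kan_ext BI) g z) = far BA g (kan_compare (src ?D g) z)"
  proof (rule epi_incl.kan_hom_eqI[OF rf A_power_module mod_hom_comp[OF epi_incl.kan_far_hom[OF rf g] kan_compare_hom]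
        mod_hom_comp[OF kan_compare_hom gh] _ z])
    fix m t assume m: "m \<in> epi_incl.over (src ?D g)" and t: "t \<in> elts BI (src ?D m)"
    let ?m = "image_inclusion 0 (cmp ?D g m)" and ?e = "drop_empty (cmp ?D g m)"
    note a = epi_incl.fac_over[OF g m]
    have e: "epi ?D ?e" "?e \<in> arrs ?D" "?m \<in> arrs ?D" using a(3) epi_incl.overD(1)[OF a(2)] by (auto simp: epi_def simp del: DeltaS_plus_simps)
    have se: "length (concat ?e) = length (concat m)" "length (concat ?m) = length ?e" using a(4,5) unfolding DeltaS_plus_simps(3,4) .
    have t': "t \<in> carrier (tensor_power k IM (length (concat m)))" using t unfolding fobs DeltaS_plus_simps .
    have t'': "t \<in> carrier (tensor_power k IM (length (concat ?e)))" using t' unfolding se .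
    have et: "far BI ?e t \<in> carrier (tensor_power k IM (length (concat ?m)))"
      using mod_homD(1)[OF sym_bar_I_far(1)[OF e(1)] t''] unfolding se(2) .
    have it: "power_incl (length (concat m)) t \<in> carrier (tensor_power k A (length (concat m)))"
      by (rule mod_homD(1)[OF power_incl_hom t'])
    have "kan_compare (trg ?D g) (far (epi_incl.kan_ext BI) g (epi_incl.kan_in BI (src ?D g) m t)) =
        kan_compare (trg ?D g) (epi_incl.kan_in BI (trg ?D g) ?m (far BI ?e t))"
      unfolding epi_incl.kan_far_in[OF rf g m t] ..
    also have "\<dots> = far BA ?m (power_incl (length (concat ?m)) (far BI ?e t))" by (rule kan_compare_in[OF a(2) et])
    also have "\<dots> = far BA ?m (far BA ?e (power_incl (length (concat ?e)) t))"
      unfolding power_incl_natural[OF e(1) t''] se(2) ..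
    also have "\<dots> = far BA (cmp ?D ?m ?e) (power_incl (length (concat m)) t)"
      unfolding se(1) by (rule is_kfunD(4)[OF sym_bar_A_kfun e(2,3) a(5), symmetric]) (use it se in \<open>simp add: fobs\<close>)
    also have "\<dots> = far BA g (far BA m (power_incl (length (concat m)) t))"
      unfolding a(6)
      by (rule is_kfunD(4)[OF sym_bar_A_kfun epi_incl.overD(1)[OF m] g epi_incl.overD(3)[OF m, symmetric]])
        (use it in \<open>simp add: fobs\<close>)
    also have "\<dots> = far BA g (kan_compare (src ?D g) (epi_incl.kan_in BI (src ?D g) m t))"
      unfolding kan_compare_in[OF m t'] ..
    finally show "kan_compare (trg ?D g) (far (epi_incl.kan_ext BI) g (epi_incl.kan_in BI (src ?D g) m t)) =
        far BA g (kan_compare (src ?D g) (epi_incl.kan_in BI (src ?D g) m t))" .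
  qed
qed

end

lemma image_inclusion_order: "image_inclusion 0 g \<in> order_inclusions"
  using image_inclusion_fibres[of _ 0 g] concat_image_inclusion[of 0 g] by (auto simp: order_inclusions_def)

text \<open>The recursion tests fibres for emptiness and never looks at their entries.
  Order-preserving injections are therefore determined by their images, and any list with the right
  empty places can be used to build one.\<close>

lemma image_inclusion_pattern:
  "map (\<lambda>fibre. fibre = []) g = map (\<lambda>fibre. fibre = []) h \<Longrightarrow> image_inclusion j g = image_inclusion j h"
proof (induction g arbitrary: h j)
  case (Cons f g)
  then obtain f' h' where h: "h = f' # h'" "(f = []) = (f' = [])" "map (\<lambda>fibre. fibre = []) g = map (\<lambda>fibre. fibre = []) h'"
    by (cases h) auto
  then show ?case using Cons.IH[OF h(3)] by (cases f; cases f') simp_all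
qed simp

lemma order_inclusion_drop_empty:
  assumes "m \<in> order_inclusions"
  shows "drop_empty m = map (\<lambda>i. [i]) [0..<length (concat m)]"
  using epi_incl.fac_M(2)[OF assms] by simp

lemma order_inclusion_eqI:
  assumes m: "m \<in> order_inclusions" "m' \<in> order_inclusions" and len: "length m = length m'"
    and pat: "\<And>j. j < length m \<Longrightarrow> m ! j = [] \<longleftrightarrow> m' ! j = []"
  shows "m = m'"
proof -
  have "map (\<lambda>fibre. fibre = []) m = map (\<lambda>fibre. fibre = []) m'"
    by (rule nth_equalityI) (use len pat in simp_all)
  from image_inclusion_pattern[OF this, of 0] show ?thesis
    unfolding epi_incl.fac_M(1)[OF m(1)] epi_incl.fac_M(1)[OF m(2)] .
qed

context augmented_algebra
begin

lemma zip_snd_subset: "set ys \<subseteq> S \<Longrightarrow> snd ` set (zip xs ys) \<subseteq> S"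
  by (auto dest: set_zip_rightD)

text \<open>The projection of A onto I along the multiples of the unit, from the splitting of A by
  the augmentation.\<close>

definition reduce :: "'a \<Rightarrow> 'a" where
  "reduce x = x \<ominus>\<^bsub>A\<^esub> \<epsilon> x \<odot>\<^bsub>A\<^esub> \<one>\<^bsub>A\<^esub>"

lemma reduce_closed:
  assumes "x \<in> carrier A"
  shows "reduce x \<in> IA"
proof -
  have e: "\<epsilon> x \<odot>\<^bsub>A\<^esub> \<one>\<^bsub>A\<^esub> \<in> carrier A" "\<epsilon> x \<in> carrier k" using assms aug_closed by simp_all
  have "\<epsilon> (reduce x) = \<epsilon> x \<oplus>\<^bsub>k\<^esub> \<ominus>\<^bsub>k\<^esub> (\<epsilon> x \<otimes>\<^bsub>k\<^esub> \<epsilon> \<one>\<^bsub>A\<^esub>)"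
    unfolding reduce_def a_minus_def using assms e by (simp add: ring_hom_add[OF aug_hom] aug_neg aug_linear)
  also have "\<dots> = \<zero>\<^bsub>k\<^esub>" using e by (simp add: ring_hom_one[OF aug_hom] R.r_neg)
  finally show ?thesis using assms e by (simp add: aug_ideal_iff reduce_def)
qed

lemma reduce_id: "x \<in> IA \<Longrightarrow> reduce x = x"
  by (simp add: reduce_def aug_ideal_iff a_minus_def)

lemma reduce_one: "reduce \<one>\<^bsub>A\<^esub> = \<zero>\<^bsub>A\<^esub>"
  by (simp add: reduce_def ring_hom_one[OF aug_hom] a_minus_def M.r_neg)

lemma reduce_hom: "reduce \<in> mod_hom k A IM"
proof (rule mod_homI)
  fix x y assume x: "x \<in> carrier A" and y: "y \<in> carrier A"
  have e: "\<epsilon> x \<odot>\<^bsub>A\<^esub> \<one>\<^bsub>A\<^esub> \<in> carrier A" "\<epsilon> y \<odot>\<^bsub>A\<^esub> \<one>\<^bsub>A\<^esub> \<in> carrier A" using x y aug_closed by simp_all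
  show "reduce (x \<oplus>\<^bsub>A\<^esub> y) = reduce x \<oplus>\<^bsub>IM\<^esub> reduce y"
    using x y e by (simp add: reduce_def a_minus_def ring_hom_add[OF aug_hom] aug_closed smult_l_distr M.minus_add M.a_ac)
next
  fix r x assume r: "r \<in> carrier k" and x: "x \<in> carrier A"
  have e: "\<epsilon> x \<odot>\<^bsub>A\<^esub> \<one>\<^bsub>A\<^esub> \<in> carrier A" using x aug_closed by simp
  show "reduce (r \<odot>\<^bsub>A\<^esub> x) = r \<odot>\<^bsub>IM\<^esub> reduce x"
    using r x e by (simp add: reduce_def a_minus_def aug_linear aug_closed smult_assoc1 smult_r_distr smult_r_minus)
qed (simp add: reduce_closed)

lemma reduce_split: 
  assumes "x \<in> carrier A"
  shows "x = \<epsilon> x \<odot>\<^bsub>A\<^esub> \<one>\<^bsub>A\<^esub> \<oplus>\<^bsub>A\<^esub> reduce x"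
proof -
  have e: "\<epsilon> x \<odot>\<^bsub>A\<^esub> \<one>\<^bsub>A\<^esub> \<in> carrier A" using assms aug_closed by simp
  have "\<epsilon> x \<odot>\<^bsub>A\<^esub> \<one>\<^bsub>A\<^esub> \<oplus>\<^bsub>A\<^esub> (x \<oplus>\<^bsub>A\<^esub> \<ominus>\<^bsub>A\<^esub> (\<epsilon> x \<odot>\<^bsub>A\<^esub> \<one>\<^bsub>A\<^esub>)) = x \<oplus>\<^bsub>A\<^esub> (\<epsilon> x \<odot>\<^bsub>A\<^esub> \<one>\<^bsub>A\<^esub> \<oplus>\<^bsub>A\<^esub> \<ominus>\<^bsub>A\<^esub> (\<epsilon> x \<odot>\<^bsub>A\<^esub> \<one>\<^bsub>A\<^esub>))"
    using assms e by (intro M.a_lcomm) simp_all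
  then show ?thesis using assms e by (simp add: reduce_def a_minus_def M.r_neg)
qed

section \<open>Expanding tensors into tensors whose entries are 1 or lie in I\<close>

subsection \<open>Surjectivity\<close>

text \<open>A tuple of units and elements of I arises from the subtuple of its entries in I by
  inserting units. The entry 0 in the pattern list is a placeholder for a non-empty fibre. Entries
  are sorted by membership in I, which also decides the case of a unit lying in I, over the zero
  ring.\<close>

lemma map_fibre_prod_pattern:
  assumes "set as \<subseteq> insert \<one>\<^bsub>A\<^esub> IA"
  shows "map (fibre_prod (pre @ filter (\<lambda>a. a \<in> IA) as)) (image_inclusion (length pre) (map (\<lambda>a. if a \<in> IA then [0] else []) as)) = as"
  using assms
proof (induction as arbitrary: pre)
  case (Cons a as)
  show ?case
  proof (cases "a \<in> IA")
    case True
    then have "a \<in> carrier A" using aug_ideal_carrier by auto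
    then show ?thesis using True Cons.IH[of "pre @ [a]"] Cons.prems by (simp add: nth_append)
  next
    case False
    then show ?thesis using Cons.IH[of pre] Cons.prems by simp
  qed
qed simp

lemma kan_compare_reduced:
  assumes "as \<in> tuples A Y" "set as \<subseteq> insert \<one>\<^bsub>A\<^esub> IA"
  shows "tensor_tuple k A Y as \<in> kan_compare Y ` elts (epi_incl.kan_ext BI) Y"
proof -
  let ?g = "map (\<lambda>a. if a \<in> IA then [0] else []) as" and ?bs = "filter (\<lambda>a. a \<in> IA) as"
  let ?m = "image_inclusion 0 ?g"
  have m: "?m \<in> epi_incl.over Y"
    using assms(1) image_inclusion_order by (simp add: epi_incl.over_iff length_image_inclusion tuples_def)
  have "length (concat ?m) = length ?bs"
    unfolding concat_image_inclusion by (induction as) (simp_all add: drop_empty_def)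
  then have bs: "?bs \<in> tuples IM (length (concat ?m))" by (auto simp: IM_tuples)
  have "map (fibre_prod ?bs) ?m = as" using map_fibre_prod_pattern[OF assms(2), of "[]"] by simp
  then have "tensor_tuple k A Y as = kan_compare Y (epi_incl.kan_in BI Y ?m (tensor_tuple k IM (length (concat ?m)) ?bs))"
    using kan_compare_tuple[OF m bs] by simp
  moreover have "epi_incl.kan_in BI Y ?m (tensor_tuple k IM (length (concat ?m)) ?bs) \<in> elts (epi_incl.kan_ext BI) Y"
    by (rule epi_incl.kan_in_closed[OF R.cring_axioms sym_bar_I_kfun m])
      (use tensor_tuple_closed[OF IM_module bs] in \<open>simp add: fobs\<close>)
  ultimately show ?thesis by (rule image_eqI)
qed

text \<open>Induction on the number of entries that are neither 1 nor in I: one such entry a is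
  written as \<epsilon>(a) 1 plus its projection to I, and multilinearity expresses the tensor
  through two tensors with fewer such entries. When none is left, \<open>kan_compare_reduced\<close>
  applies.\<close>

lemma kan_compare_surj:
  assumes "z \<in> carrier (tensor_power k A Y)"
  shows "z \<in> kan_compare Y ` elts (epi_incl.kan_ext BI) Y"
proof (rule tensor_tuples_generate[OF module_A _ _ assms])
  let ?S = "kan_compare Y ` elts (epi_incl.kan_ext BI) Y"
  show S: "submodule ?S k (tensor_power k A Y)"
    by (rule submodule_image[OF epi_incl.kan_module[OF R.cring_axioms sym_bar_I_kfun] A_power_module kan_compare_hom])
  interpret T: module k "tensor_power k A Y" by (rule A_power_module)
  note Sc = T.submoduleE(4,5)[OF S]
  note tm = multilinearD[OF A_tuple_multilinear]
  show "tensor_tuple k A Y as \<in> ?S" if "as \<in> tuples A Y" for as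
    using that
  proof (induction "length (filter (\<lambda>a. a \<notin> insert \<one>\<^bsub>A\<^esub> IA) as)" arbitrary: as rule: less_induct)
    case less
    show ?case
    proof (cases "set as \<subseteq> insert \<one>\<^bsub>A\<^esub> IA")
      case True
      then show ?thesis by (rule kan_compare_reduced[OF less.prems])
    next
      case False
      then obtain a where a: "a \<in> set as" "a \<notin> insert \<one>\<^bsub>A\<^esub> IA" by blast
      then obtain us vs where as: "as = us @ a # vs" by (meson split_list)
      have ac: "a \<in> carrier A" using less.prems a(1) by (auto simp: A_tuples)
      have ra: "reduce a \<in> IA" "reduce a \<in> carrier A" using reduce_closed[OF ac] aug_ideal_carrier by auto
      have e: "\<epsilon> a \<in> carrier k" by (rule aug_closed[OF ac])
      have t: "us @ \<one>\<^bsub>A\<^esub> # vs \<in> tuples A Y" "us @ (\<epsilon> a \<odot>\<^bsub>A\<^esub> \<one>\<^bsub>A\<^esub>) # vs \<in> tuples A Y" "us @ reduce a # vs \<in> tuples A Y"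
        using less.prems ra(2) e unfolding as A_tuples by auto
      have "tensor_tuple k A Y as = tensor_tuple k A Y (us @ (\<epsilon> a \<odot>\<^bsub>A\<^esub> \<one>\<^bsub>A\<^esub> \<oplus>\<^bsub>A\<^esub> reduce a) # vs)"
        unfolding as reduce_split[OF ac, symmetric] ..
      also have "\<dots> = \<epsilon> a \<odot>\<^bsub>tensor_power k A Y\<^esub> tensor_tuple k A Y (us @ \<one>\<^bsub>A\<^esub> # vs) \<oplus>\<^bsub>tensor_power k A Y\<^esub> tensor_tuple k A Y (us @ reduce a # vs)"
        unfolding tm(2)[OF t(2,3)] tm(3)[OF e t(1)] ..
      also have "\<dots> \<in> ?S"
      proof (rule Sc(2)[OF Sc(1)[OF e]])
        show "tensor_tuple k A Y (us @ \<one>\<^bsub>A\<^esub> # vs) \<in> ?S" by (rule less.hyps[OF _ t(1)]) (use a(2) in \<open>simp add: as\<close>)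
        show "tensor_tuple k A Y (us @ reduce a # vs) \<in> ?S" by (rule less.hyps[OF _ t(3)]) (use a(2) ra in \<open>simp add: as\<close>)
      qed
      finally show ?thesis .
    qed
  qed
qed

section \<open>Recovering each summand by augmenting and reducing entries\<close>

subsection \<open>Injectivity\<close>

fun empty_aug :: "(nat list \<times> 'a) list \<Rightarrow> 'k" where
  "empty_aug [] = \<one>\<^bsub>k\<^esub>"
| "empty_aug ((fibre, a) # zs) = (if fibre = [] then \<epsilon> a \<otimes>\<^bsub>k\<^esub> empty_aug zs else empty_aug zs)"

definition full_reduce :: "(nat list \<times> 'a) list \<Rightarrow> 'a list" where
  "full_reduce zs = map (\<lambda>(fibre, a). reduce a) (filter (\<lambda>(fibre, a). fibre \<noteq> []) zs)"

(* The component at m: augment the factors over the empty fibres of m, reduce the others to I. *)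
definition component :: "nat list list \<Rightarrow> 'a list \<Rightarrow> ('a list \<Rightarrow> 'k) set" where
  "component m as = empty_aug (zip m as) \<odot>\<^bsub>tensor_power k IM (length (drop_empty m))\<^esub>
     tensor_tuple k IM (length (drop_empty m)) (full_reduce (zip m as))"

lemma empty_aug_closed: "snd ` set zs \<subseteq> carrier A \<Longrightarrow> empty_aug zs \<in> carrier k"
  by (induction zs rule: empty_aug.induct) (auto simp: aug_closed)

lemma empty_aug_append:
  "\<lbrakk>snd ` set zs \<subseteq> carrier A; snd ` set zs' \<subseteq> carrier A\<rbrakk> \<Longrightarrow> empty_aug (zs @ zs') = empty_aug zs \<otimes>\<^bsub>k\<^esub> empty_aug zs'"
  by (induction zs rule: empty_aug.induct) (auto simp: aug_closed empty_aug_closed R.m_assoc)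

lemma empty_aug_zero:
  "\<lbrakk>snd ` set zs \<subseteq> carrier A; ([], a) \<in> set zs; \<epsilon> a = \<zero>\<^bsub>k\<^esub>\<rbrakk> \<Longrightarrow> empty_aug zs = \<zero>\<^bsub>k\<^esub>"
  by (induction zs rule: empty_aug.induct) (auto simp: aug_closed empty_aug_closed)

lemma empty_aug_one:
  "\<forall>z\<in>set zs. fst z = [] \<longrightarrow> snd z = \<one>\<^bsub>A\<^esub> \<Longrightarrow> empty_aug zs = \<one>\<^bsub>k\<^esub>"
  by (induction zs rule: empty_aug.induct) (auto simp: ring_hom_one[OF aug_hom])

lemma full_reduce_tuples:
  "\<lbrakk>length m = length as; set as \<subseteq> carrier A\<rbrakk> \<Longrightarrow> full_reduce (zip m as) \<in> tuples IM (length (drop_empty m))"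
  by (induction m as rule: list_induct2) (auto simp: full_reduce_def IM_tuples drop_empty_def reduce_closed)

text \<open>Each entry enters exactly once and linearly: over an empty fibre as the scalar factor
  \<epsilon>, over a non-empty fibre as a tensor factor through \<open>reduce\<close>.\<close>

lemma component_multilinear:
  "multilinear k A (length m) (tensor_power k IM (length (drop_empty m))) (component m)"
proof -
  let ?T = "tensor_power k IM (length (drop_empty m))" and ?t = "tensor_tuple k IM (length (drop_empty m))"
  interpret T: module k ?T by (rule tensor_power_module[OF IM_module])
  note tm = multilinearD[OF tensor_tuple_multilinear[OF IM_module]] and rh = mod_homD[OF reduce_hom]
  have cc: "full_reduce (zip m as) \<in> tuples IM (length (drop_empty m))" "?t (full_reduce (zip m as)) \<in> carrier ?T"
      "empty_aug (zip m as) \<in> carrier k" if "as \<in> tuples A (length m)" for as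
  proof -
    show c: "full_reduce (zip m as) \<in> tuples IM (length (drop_empty m))" using full_reduce_tuples[of m as] that by (simp add: A_tuples)
    show "?t (full_reduce (zip m as)) \<in> carrier ?T" by (rule tm(1)[OF c])
    show "empty_aug (zip m as) \<in> carrier k"
      by (rule empty_aug_closed[OF zip_snd_subset]) (use that in \<open>simp add: A_tuples\<close>)
  qed
  \<comment> \<open>The pairing with the fibres of m is cut at the varied entry; the fibre paired
    with it and the two outer parts are the same for all values of the entry.\<close>
  have split: "\<exists>zs fibre zs'. snd ` set zs \<subseteq> carrier A \<and> snd ` set zs' \<subseteq> carrier A \<and>
      (\<forall>z. zip m (us @ z # vs) = zs @ (fibre, z) # zs')"
    if "us @ x # vs \<in> tuples A (length m)" for us x vs
  proof -
    have l: "length us < length m" "set us \<subseteq> carrier A" "set vs \<subseteq> carrier A" using that by (auto simp: A_tuples)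
    then have m: "m = take (length us) m @ m ! length us # drop (Suc (length us)) m" by (simp add: id_take_nth_drop)
    have "zip m (us @ z # vs) = zip (take (length us) m) us @ (m ! length us, z) # zip (drop (Suc (length us)) m) vs" for z
      using l(1) by (subst m) (simp add: zip_append)
    moreover have "snd ` set (zip (take (length us) m) us) \<subseteq> carrier A" "snd ` set (zip (drop (Suc (length us)) m) vs) \<subseteq> carrier A"
      using l(2,3) by (auto intro!: zip_snd_subset)
    ultimately show ?thesis by blast
  qed
  show ?thesis
    unfolding multilinear_def
  proof (intro conjI allI impI Pi_I)
    fix as assume "as \<in> tuples A (length m)"
    then show "component m as \<in> carrier ?T" unfolding component_def using cc by simp
  next
    fix us vs x y assume x: "us @ x # vs \<in> tuples A (length m)" and y: "us @ y # vs \<in> tuples A (length m)"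
    have xy: "us @ (x \<oplus>\<^bsub>A\<^esub> y) # vs \<in> tuples A (length m)" by (rule tuples_add[OF module_A x y])
    have c: "x \<in> carrier A" "y \<in> carrier A" using x y by (auto simp: A_tuples)
    obtain zs fibre zs' where z: "snd ` set zs \<subseteq> carrier A" "snd ` set zs' \<subseteq> carrier A" "\<And>z. zip m (us @ z # vs) = zs @ (fibre, z) # zs'"
      using split[OF x] by blast
    have s: "empty_aug (zs @ (fibre, z) # zs') = empty_aug zs \<otimes>\<^bsub>k\<^esub> empty_aug ((fibre, z) # zs')" if "z \<in> carrier A" for z
      by (rule empty_aug_append) (use z that in auto)
    have ez: "empty_aug zs \<in> carrier k" "empty_aug zs' \<in> carrier k" using z empty_aug_closed by auto
    show "component m (us @ (x \<oplus>\<^bsub>A\<^esub> y) # vs) = component m (us @ x # vs) \<oplus>\<^bsub>?T\<^esub> component m (us @ y # vs)"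
    proof (cases "fibre = []")
      case True
      have r: "full_reduce (zs @ (fibre, z) # zs') = full_reduce (zs @ zs')" for z using True by (simp add: full_reduce_def)
      have t: "?t (full_reduce (zs @ zs')) \<in> carrier ?T" using cc(2)[OF x] unfolding z(3) r .
      show ?thesis
        unfolding component_def z(3) r s[OF c(1)] s[OF c(2)] s[OF M.a_closed[OF c]] using c ez t True
        by (simp add: ring_hom_add[OF aug_hom] aug_closed R.l_distr R.r_distr T.smult_l_distr)
    next
      case False
      have r: "full_reduce (zs @ (fibre, z) # zs') = full_reduce zs @ reduce z # full_reduce zs'" for z using False by (simp add: full_reduce_def)
      have t: "full_reduce zs @ reduce x # full_reduce zs' \<in> tuples IM (length (drop_empty m))"
        "full_reduce zs @ reduce y # full_reduce zs' \<in> tuples IM (length (drop_empty m))"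
        using cc(1)[OF x] cc(1)[OF y] unfolding z(3) r .
      show ?thesis
        unfolding component_def z(3) r rh(2)[OF c] tm(2)[OF t] s[OF c(1)] s[OF c(2)] s[OF M.a_closed[OF c]]
        using c ez tm(1)[OF t(1)] tm(1)[OF t(2)] False by (simp add: T.smult_r_distr)
    qed
  next
    fix us vs r x assume r: "r \<in> carrier k" and x: "us @ x # vs \<in> tuples A (length m)"
    have c: "x \<in> carrier A" using x by (auto simp: A_tuples)
    obtain zs fibre zs' where z: "snd ` set zs \<subseteq> carrier A" "snd ` set zs' \<subseteq> carrier A" "\<And>z. zip m (us @ z # vs) = zs @ (fibre, z) # zs'"
      using split[OF x] by blast
    have s: "empty_aug (zs @ (fibre, z) # zs') = empty_aug zs \<otimes>\<^bsub>k\<^esub> empty_aug ((fibre, z) # zs')" if "z \<in> carrier A" for z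
      by (rule empty_aug_append) (use z that in auto)
    have ez: "empty_aug zs \<in> carrier k" "empty_aug zs' \<in> carrier k" using z empty_aug_closed by auto
    show "component m (us @ (r \<odot>\<^bsub>A\<^esub> x) # vs) = r \<odot>\<^bsub>?T\<^esub> component m (us @ x # vs)"
    proof (cases "fibre = []")
      case True
      have fr: "full_reduce (zs @ (fibre, z) # zs') = full_reduce (zs @ zs')" for z using True by (simp add: full_reduce_def)
      have t: "?t (full_reduce (zs @ zs')) \<in> carrier ?T" using cc(2)[OF x] unfolding z(3) fr .
      show ?thesis
        unfolding component_def z(3) fr s[OF c] s[OF smult_closed[OF r c]] using c r ez t True
        by (simp add: aug_linear aug_closed R.m_ac T.smult_assoc1[symmetric])
    next
      case False
      have fr: "full_reduce (zs @ (fibre, z) # zs') = full_reduce zs @ reduce z # full_reduce zs'" for z using False by (simp add: full_reduce_def)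
      have t: "full_reduce zs @ reduce x # full_reduce zs' \<in> tuples IM (length (drop_empty m))"
        using cc(1)[OF x] unfolding z(3) fr .
      show ?thesis
        unfolding component_def z(3) fr rh(3)[OF r c] tm(3)[OF r t] s[OF c] s[OF smult_closed[OF r c]]
        using c r ez tm(1)[OF t] False by (simp add: T.smult_assoc1[symmetric] R.m_ac)
    qed
  qed
qed

text \<open>At the points missed by m the entry is a unit and contributes the scalar 1; at the
  others the fibre is a singleton, and its entry lies in I, where \<open>reduce\<close> is the
  identity.\<close>

lemma component_same:
  assumes m: "m \<in> order_inclusions" and as: "as \<in> tuples IM (length (drop_empty m))"
  shows "component m (map (fibre_prod as) m) = tensor_tuple k IM (length (drop_empty m)) as"
proof -
  have zip: "zip m (map (fibre_prod as) m) = map (\<lambda>f. (f, fibre_prod as f)) m"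
    by (rule nth_equalityI) simp_all
  have "length (drop_empty m) = length (concat m)"
    using arg_cong[OF order_inclusion_drop_empty[OF m], of length] by simp
  then have de: "drop_empty m = map (\<lambda>i. [i]) [0..<length (drop_empty m)]"
    using order_inclusion_drop_empty[OF m] by (rule ssubst)
  have fp: "map (fibre_prod as) (drop_empty m) = as"
    by (subst de) (rule singleton_prods[OF aug_ideal_submodule is_category_EpiDeltaS_plus EpiDeltaS_plus_ops IM_adm as])
  have "full_reduce (zip m (map (fibre_prod as) m)) = map (\<lambda>f. reduce (fibre_prod as f)) (drop_empty m)"
    unfolding zip by (simp add: full_reduce_def drop_empty_def filter_map o_def)
  also have "\<dots> = map reduce (map (fibre_prod as) (drop_empty m))" by simp
  also have "\<dots> = map reduce as" unfolding fp ..
  also have "\<dots> = as" using as reduce_id by (intro map_idI) (auto simp: IM_tuples)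
  finally have f: "full_reduce (zip m (map (fibre_prod as) m)) = as" .
  have e: "empty_aug (zip m (map (fibre_prod as) m)) = \<one>\<^bsub>k\<^esub>"
    unfolding zip by (rule empty_aug_one) auto
  show ?thesis
    unfolding component_def f e
    by (rule module.smult_one[OF tensor_power_module[OF IM_module] tensor_tuple_closed[OF IM_module as]])
qed

text \<open>Distinct order-preserving injections into the same target differ in whether some point j
  is hit. If m misses j, the entry there lies in I and is killed by \<epsilon>; if m hits j, the
  entry there is the unit and is killed by \<open>reduce\<close>.\<close>

lemma component_other:
  assumes m: "m \<in> order_inclusions" and m': "m' \<in> order_inclusions" and len: "length m = length m'" and ne: "m \<noteq> m'"
    and as: "as \<in> tuples IM (length (concat m'))"
  shows "component m (map (fibre_prod as) m') = \<zero>\<^bsub>tensor_power k IM (length (drop_empty m))\<^esub>"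
proof -
  let ?T = "tensor_power k IM (length (drop_empty m))" and ?bs = "map (fibre_prod as) m'"
  interpret T: module k ?T by (rule tensor_power_module[OF IM_module])
  obtain j where j: "j < length m" "(m ! j = []) \<noteq> (m' ! j = [])" using order_inclusion_eqI[OF m m' len] ne by blast
  have fl: "m' \<in> fibre_lists" using m' order_inclusions_fibre_lists by auto
  have bound: "\<forall>i\<in>set f. i < length as" if "f \<in> set m'" for f
    by (rule fibre_bound'[OF fl _ that]) (use as in \<open>simp add: IM_tuples\<close>)
  have as': "set as \<subseteq> IA" using as by (simp add: IM_tuples)
  then have asA: "set as \<subseteq> carrier A" using aug_ideal_carrier by auto
  have bs: "?bs \<in> tuples A (length m)" using fibre_prod_closed[OF asA bound] len by (auto simp: A_tuples)
  have "(m ! j, ?bs ! j) \<in> set (zip m ?bs)" using j(1) len by (auto simp: in_set_zip)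
  then have zj: "(m ! j, fibre_prod as (m' ! j)) \<in> set (zip m ?bs)" using j(1) len by simp
  have zs: "snd ` set (zip m ?bs) \<subseteq> carrier A" by (rule zip_snd_subset) (use bs in \<open>simp only: A_tuples\<close>)
  have fr: "full_reduce (zip m ?bs) \<in> tuples IM (length (drop_empty m))" using full_reduce_tuples[of m ?bs] bs by (simp add: A_tuples)
  show ?thesis
  proof (cases "m ! j = []")
    case True
    then have "m' ! j \<noteq> []" using j(2) by simp
    then have "fibre_prod as (m' ! j) \<in> IA"
      by (rule fibre_prod_aug_ideal[OF _ bound as']) (use j(1) len in simp)
    then have "\<epsilon> (fibre_prod as (m' ! j)) = \<zero>\<^bsub>k\<^esub>" by (simp add: aug_ideal_iff)
    then have "empty_aug (zip m ?bs) = \<zero>\<^bsub>k\<^esub>" using empty_aug_zero[OF zs] zj True by simp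
    then show ?thesis unfolding component_def using tensor_tuple_closed[OF IM_module fr] by simp
  next
    case False
    then have "fibre_prod as (m' ! j) = \<one>\<^bsub>A\<^esub>" using j(2) by simp
    then have "\<zero>\<^bsub>IM\<^esub> \<in> set (full_reduce (zip m ?bs))"
      using zj False reduce_one unfolding full_reduce_def by (force simp: image_iff)
    then have "tensor_tuple k IM (length (drop_empty m)) (full_reduce (zip m ?bs)) = \<zero>\<^bsub>?T\<^esub>"
      by (rule tensor_tuple_zero[OF IM_module fr])
    then show ?thesis unfolding component_def using empty_aug_closed[OF zs] by simp
  qed
qed

lemma dsum_eval_hom:
  assumes "i \<in> S"
  shows "(\<lambda>f. f i) \<in> mod_hom R (dsum S N) (N i)"
  using assms by (intro mod_homI) (auto simp: dsum_def)

text \<open>The component maps are dual to the summands: on the summand m' the component at m is the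
  identity or zero according to whether m = m'. So every coordinate of z can be read off from its
  image.\<close>

lemma kan_compare_component:
  assumes m: "m \<in> epi_incl.over Y" and z: "z \<in> elts (epi_incl.kan_ext BI) Y"
  shows "power_lift k (tensor_power k IM (length (drop_empty m))) (component m) (kan_compare Y z) = z m"
proof -
  let ?n = "length (drop_empty m)"
  let ?T = "tensor_power k IM ?n"
  let ?\<pi> = "power_lift k ?T (component m)"
  note rf = R.cring_axioms sym_bar_I_kfun
  have nm: "length (concat m) = ?n" using arg_cong[OF order_inclusion_drop_empty[OF overs(1)[OF m]], of length] by simp
  note T = tensor_power_module[OF IM_module]
  have cm: "multilinear k A Y ?T (component m)" using component_multilinear[of m] overs(3)[OF m] by simp
  have ph: "?\<pi> \<in> mod_hom k (tensor_power k A Y) ?T" by (rule power_lift_hom[OF module_A T cm])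
  have ev: "(\<lambda>z. z m) \<in> mod_hom k (fob (epi_incl.kan_ext BI) Y) ?T"
    using dsum_eval_hom[OF m, of k "\<lambda>m. fob BI (src DeltaS_plus m)"] unfolding epi_incl.kan_fob[OF rf] fobs DeltaS_plus_simps nm .
  show ?thesis
  proof (rule epi_incl.kan_hom_eqI[OF rf T mod_hom_comp[OF kan_compare_hom ph] ev _ z])
    fix m' t assume m': "m' \<in> epi_incl.over Y" and t: "t \<in> elts BI (src DeltaS_plus m')"
    let ?n' = "length (concat m')"
    have kh: "epi_incl.kan_in BI Y m' \<in> mod_hom k (tensor_power k IM ?n') (fob (epi_incl.kan_ext BI) Y)"
      using epi_incl.kan_in_hom[OF rf m'] unfolding fobs DeltaS_plus_simps .
    show "?\<pi> (kan_compare Y (epi_incl.kan_in BI Y m' t)) = epi_incl.kan_in BI Y m' t m"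
    proof (rule power_hom_eqI[OF IM_module T mod_hom_comp[OF mod_hom_comp[OF kh kan_compare_hom] ph] mod_hom_comp[OF kh ev]])
      show "t \<in> carrier (tensor_power k IM ?n')" using t unfolding fobs DeltaS_plus_simps .
      fix as assume as: "as \<in> tuples IM ?n'"
      have "map (fibre_prod as) m' \<in> tuples A Y"
        using A_adm[of m' as] overs(2,3)[OF m'] IM_tuples_A[OF as] by (auto simp: A_tuples)
      then have "?\<pi> (kan_compare Y (epi_incl.kan_in BI Y m' (tensor_tuple k IM ?n' as))) = component m (map (fibre_prod as) m')"
        unfolding kan_compare_tuple[OF m' as] by (rule power_lift_tuple[OF module_A T cm])
      also have "\<dots> = epi_incl.kan_in BI Y m' (tensor_tuple k IM ?n' as) m"
      proof (cases "m = m'")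
        case True
        then show ?thesis
          using component_same[OF overs(1)[OF m], of as] as m nm by (simp add: epi_incl.kan_in_def dsum_in_def)
      next
        case False
        then show ?thesis
          using component_other[OF overs(1)[OF m] overs(1)[OF m'] _ False as] overs(3)[OF m] overs(3)[OF m'] m nm
          by (simp add: epi_incl.kan_in_def dsum_in_def fobs)
      qed
      finally show "?\<pi> (kan_compare Y (epi_incl.kan_in BI Y m' (tensor_tuple k IM ?n' as))) =
          epi_incl.kan_in BI Y m' (tensor_tuple k IM ?n' as) m" .
    qed
  qed
qed

lemma kan_compare_bij: "bij_betw (kan_compare Y) (elts (epi_incl.kan_ext BI) Y) (elts BA Y)"
proof (rule bij_betw_imageI)
  note rf = R.cring_axioms sym_bar_I_kfun
  show "inj_on (kan_compare Y) (elts (epi_incl.kan_ext BI) Y)"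
  proof (rule inj_onI)
    fix z z' assume z: "z \<in> elts (epi_incl.kan_ext BI) Y" and z': "z' \<in> elts (epi_incl.kan_ext BI) Y"
      and eq: "kan_compare Y z = kan_compare Y z'"
    have e: "z \<in> extensional (epi_incl.over Y)" "z' \<in> extensional (epi_incl.over Y)"
      using z z' unfolding epi_incl.kan_fob[OF rf] dsum_def by (auto simp: PiE_def)
    show "z = z'"
      by (rule extensionalityI[OF e]) (metis kan_compare_component z z' eq)
  qed
  show "kan_compare Y ` elts (epi_incl.kan_ext BI) Y = elts BA Y"
    unfolding fobs using kan_compare_surj mod_homD(1)[OF kan_compare_hom] by blast
qed

end

theorem proposition51:
  fixes k :: "'k ring" and A :: "('k, 'a) module" and \<epsilon> :: "'a \<Rightarrow> 'k"
  assumes "augmented_algebra k A \<epsilon>"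
  shows "\<forall>n.
    mod_isomorphic k
      (symmetric_homology k A n)
      (functor_homology k EpiDeltaS_plus (sym_bar k (aug_ideal k A \<epsilon>)) n) \<and>
    mod_isomorphic k
      (functor_homology k EpiDeltaS_plus (sym_bar k (aug_ideal k A \<epsilon>)) n)
      (nerve_tensor_homology k EpiDeltaS_plus (sym_bar k (aug_ideal k A \<epsilon>)) n)"
proof
  fix n
  interpret augmented_algebra k A \<epsilon> by (rule assms)
  let ?BA = "sym_bar k A" and ?BI = "sym_bar k (aug_ideal k A \<epsilon>)"
  note R = R.cring_axioms
  \<comment> \<open>The bar construction of A is a functor on all of \<open>DeltaS_plus\<close>, its
    value at the added object being the empty tensor power; over \<open>DeltaS\<close> it is the
    restriction.\<close>
  have D: "is_kfun k DeltaS ?BA" by (rule kfun_restrict[OF sym_bar_A_kfun]) auto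
  have E: "is_kfun k EpiDeltaS_plus ?BI" using sym_bar_I_kfun unfolding aug_ideal_def EpiDeltaS_plus_def .
  note c = is_category_DeltaS is_category_EpiDeltaS_plus
  obtain P d e where P: "split_resolution k DeltaS ?BA P d e"
    and A_homology: "functor_homology k DeltaS ?BA = chain_homology (\<lambda>n. colim k DeltaS (P n)) (\<lambda>n. colim_map k DeltaS (P n) (d n))"
    by (rule functor_homology_resolved[OF R c(1) D])
  obtain Q d' e' where Q: "split_resolution k EpiDeltaS_plus ?BI Q d' e'"
    and I_homology: "functor_homology k EpiDeltaS_plus ?BI =
      chain_homology (\<lambda>n. colim k EpiDeltaS_plus (Q n)) (\<lambda>n. colim_map k EpiDeltaS_plus (Q n) (d' n))"
    by (rule functor_homology_resolved[OF R c(2) E])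
  have "mod_isomorphic k (symmetric_homology k A n) (bar_homology DeltaS ?BA n)"
    unfolding symmetric_homology_def A_homology by (rule colim_bar_homology[OF R c(1) D P])
  moreover have "mod_isomorphic k (bar_homology DeltaS ?BA n)
      (bar_homology DeltaS_plus ?BA n)"
    by (rule DeltaS_bar_homology[OF R sym_bar_A_kfun])
  \<comment> \<open>The resolution selected by \<open>functor_homology\<close> on the epimorphism
    side is the one that gets extended, so its colimit complex appears literally on the
    right.\<close>
  moreover have "mod_isomorphic k (bar_homology DeltaS_plus ?BA n)
      (functor_homology k EpiDeltaS_plus ?BI n)"
    unfolding I_homology unfolding EpiDeltaS_plus_def
    by (rule epi_incl.kan_colim_homology[OF R sym_bar_I_kfun sym_bar_A_kfun
          Q[unfolded EpiDeltaS_plus_def aug_ideal_def] kan_compare_natural kan_compare_bij])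
  moreover have "mod_isomorphic k (functor_homology k EpiDeltaS_plus ?BI n)
      (bar_homology EpiDeltaS_plus ?BI n)"
    unfolding I_homology by (rule colim_bar_homology[OF R c(2) E Q])
  moreover have "mod_isomorphic k (bar_homology EpiDeltaS_plus ?BI n)
      (nerve_tensor_homology k EpiDeltaS_plus ?BI n)"
    by (rule bar_nerve_tensor_homology[OF R c(2) E])
  ultimately show "mod_isomorphic k (symmetric_homology k A n) (functor_homology k EpiDeltaS_plus ?BI n) \<and>
    mod_isomorphic k (functor_homology k EpiDeltaS_plus ?BI n) (nerve_tensor_homology k EpiDeltaS_plus ?BI n)"
    by (meson mod_isomorphic_trans)
qed

end
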